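(* Let $P$ be a topological operad, $Q$ a reduced operad and $M$ a $(P\text{-}Q)$-bimodule. The canonical map of $(P\text{-}Q)$-bimodules $\eta:M\to M^f$ is a weak equivalence (a weak homotopy equivalence in each arity).
   Context: $Top$ is the category of $k$-spaces. Operads are symmetric topological operads with unit $\ast_1\in O(1)$; $Q$ reduced means $Q(0)=\{\ast_0\}$. A $(P\text{-}Q)$-bimodule is a sequence of right $\Sigma_n$-spaces $M(n)$, $n\ge0$, with right operations $M(n)\times\prod_{i=1}^n Q(m_i)\to M(\sum m_i)$ (equivalently $\circ^i:M(n)\times Q(m)\to M(n+m-1)$) and left operations $\gamma_\ell:P(n)\times\prod_{i=1}^n M(m_i)\to M(\sum m_i)$ satisfying the usual associativity, unit, equivariance and commutation axioms; for $n=0$ this includes $\gamma_0:P(0)\to M(0)$. Construction of $M^f$. Let $\mathbb{P}[n]$ be the set of planar rooted trees $T$ whose root $r$ has exactly $n$ incoming edges (other vertices $v$ have any arity $|v|\ge0$). Let $|T|$ be the number of leaves of $T$, labelled in planar order, and $V(T)$ the set of vertices, partially ordered by $v<v'$ if the path from $v'$ to the root passes through $v$. Put $D(T)=\prod_{v\in V(T)\setminus\{r\}}Q(|v|)$ and $H(T)=\{\{t_v\}\in[0,1]^{V(T)\setminus\{r\}}: t_v\le t_{v'}\text{ whenever } v<v'\}$. For $m\in M(n)$, $T\in\mathbb{P}[n]$ and $\{q_v\}\in D(T)$ let $m\circ\{q_v\}\in M(|T|)$ be the composite obtained by putting $m$ at the root and $q_v$ at the vertices $v$. $M^f(n)\subset\prod_{T\in\mathbb{P}[n]}Map(H(T)\times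 D(T),M(|T|))$ is the subspace of families $\{f_T\}$ such that: 1. if a non-root vertex $v$ of arity one is labelled by $\ast_1$, then $f_T$ takes the same value as $f_{T\setminus\{v\}}$ on the remaining decorations, where $T\setminus\{v\}$ is obtained by removing $v$ and merging its two edges (the number $t_v$ is forgotten); 2. for a non-root vertex $v$ and a permutation $\sigma$ of its incoming edges, let $T\cdot\sigma$ be the tree with these edges permuted, with label of $v$ replaced by $q_v\cdot\sigma$ and other decorations unchanged; then $f_{T\cdot\sigma}$ on the new decorations equals $f_T$ acted on by the induced permutation $\sigma_L[T]\in\Sigma_{|T|}$ of the leaves (conventions as for composites: $m\circ(T\cdot\sigma\text{-decorations})=(m\circ\{q_v\})\cdot\sigma_L[T]$); 3. if an inner edge $e$ not connected to the root joins two vertices with the same number $t$, then $f_T$ takes the same value as $f_{T/e}$, where $e$ is contracted, the new vertex is labelled by the operadic composite in $Q$ of the two labels and by $t$; 4. for an inner edge $e$, write $T=T_e\circ_{i(e)}T'_e$, with $T_e$ containing the root and $T'_e$ the tree above $e$; if all vertices of $T'_e$ carry the number $1$, then $f_T$ equals $f_{T_e}(\text{decorations of }T_e)\circ^{i(e)}q'$, where $q'\in Q(|T'_e|)$ is the operadic composite of the labels of $T'_e$. Structure on $M^f$. Symmetric groups: for $\sigma\in\Sigma_n$, $(f\cdot\sigma)_T(\{t_v\},\{q_v\})=f_{T_\sigma}(\text{corresponding decorations})\cdot\sigma_L[T]$, where $T_\sigma$ is $T$ with the root edges permuted by $\sigma$ and $\sigma_L[T]$ is the induced leaf permutation (so that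 $(m\cdot\sigma)\circ\{q_v\}=(m\circ\{q_v\}_{T_\sigma})\cdot\sigma_L[T]$). Right operations: for $f\in M^f(n)$, $q\in Q(m)$, $T\in\mathbb{P}[n+m-1]$, $(f\circ^i q)_T$ is $f_{\delta_{i,m}(T)}$ evaluated on the decorations of $T$ together with the number $0$ and the label $q$ on the new vertex; here $\delta_{i,m}(T)\in\mathbb{P}[n]$ is obtained by making the root edges $i,\dots,i+m-1$ of $T$ the incoming edges of a new vertex attached to the root in position $i$ (for $m=0$: a new univalent vertex is attached to the root in position $i$). Left operations: for $p\in P(k)$, $f^i\in M^f(n_i)$, $T\in\mathbb{P}[n_1+\dots+n_k]$, $p(f^1,\dots,f^k)_T=\gamma_\ell(p;f^1_{T^1},\dots,f^k_{T^k})$, where $T^i\in\mathbb{P}[n_i]$ is obtained from $T$ by keeping only the root edges numbered $n_1+\dots+n_{i-1}+1,\dots,n_1+\dots+n_i$ and what is above them, with the restricted decorations. One has $M^f(0)=M(0)$, and $\gamma_0:P(0)\to M^f(0)$ is that of $M$. The map $\eta:M\to M^f$ sends $m\in M(n)$ to the family $\eta(m)_T(\{t_v\},\{q_v\})=m\circ\{q_v\}$. *)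

theory Defs
  imports "HOL-Analysis.Analysis" "HOL-Combinatorics.Combinatorics" "HOL-Library.Sublist"
begin

section \<open>The category of k-spaces\<close>

text \<open>
  A k-space is a space in which every compactly open set is open, where a set is compactly open
  if its preimage under every continuous map from a compact Hausdorff space is open.  HOL cannot
  quantify over all types inside a formula, so the compact Hausdorff test spaces are taken on
  subsets of a type \<open>'k\<close>, which is a free type variable of the development.  Every given topology
  has only a set of subsets, so its k-ification in the usual sense is the one below for every
  sufficiently large \<open>'k\<close>.  Statements about k-spaces should assume that \<open>'k\<close> has at least the
  cardinality of the real numbers, so that finite products of \<open>[0,1]\<close> and of test spaces are, up to
  homeomorphism, again test spaces.  (The predicate \<open>k_space\<close> of the library tests with all compact
  subspaces instead, which is a different notion outside the Hausdorff case.)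
\<close>

definition compactly_open :: "'k itself \<Rightarrow> 'a topology \<Rightarrow> 'a set \<Rightarrow> bool" where
  "compactly_open k X U \<longleftrightarrow> U \<subseteq> topspace X \<and>
     (\<forall>(K :: 'k topology) g. compact_space K \<and> Hausdorff_space K \<and> continuous_map K X g
        \<longrightarrow> openin K {x \<in> topspace K. g x \<in> U})"

definition kify :: "'k itself \<Rightarrow> 'a topology \<Rightarrow> 'a topology" where
  "kify k X = topology (compactly_open k X)"

lemma istopology_compactly_open:
  fixes k :: "'k itself"
  shows "istopology (compactly_open k X)"
proof -
  have "compactly_open k X (S \<inter> T)" if S: "compactly_open k X S" and T: "compactly_open k X T" for S T
  proof -
    have "openin K {x \<in> topspace K. g x \<in> S \<inter> T}"
      if "compact_space K" "Hausdorff_space K" "continuous_map K X g" for K :: "'k topology" and g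
    proof -
      have "{x \<in> topspace K. g x \<in> S \<inter> T}
          = {x \<in> topspace K. g x \<in> S} \<inter> {x \<in> topspace K. g x \<in> T}" by auto
      then show ?thesis
        using that S T unfolding compactly_open_def by (metis (no_types, lifting) openin_Int)
    qed
    then show ?thesis using S unfolding compactly_open_def by blast
  qed
  moreover have "compactly_open k X (\<Union>\<U>)" if U: "\<forall>U\<in>\<U>. compactly_open k X U" for \<U>
  proof -
    have "openin K {x \<in> topspace K. g x \<in> \<Union>\<U>}"
      if "compact_space K" "Hausdorff_space K" "continuous_map K X g" for K :: "'k topology" and g
    proof -
      have "{x \<in> topspace K. g x \<in> \<Union>\<U>} = (\<Union>U\<in>\<U>. {x \<in> topspace K. g x \<in> U})" by auto
      moreover have "openin K {x \<in> topspace K. g x \<in> U}" if "U \<in> \<U>" for U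
        using U \<open>U \<in> \<U>\<close> \<open>compact_space K\<close> \<open>Hausdorff_space K\<close> \<open>continuous_map K X g\<close>
        unfolding compactly_open_def by blast
      ultimately show ?thesis by (metis (no_types, lifting) openin_Union imageE)
    qed
    then show ?thesis using U unfolding compactly_open_def by blast
  qed
  ultimately show ?thesis by (simp add: istopology_def)
qed

lemma openin_kify: "openin (kify k X) U \<longleftrightarrow> compactly_open k X U"
  by (simp add: kify_def topology_inverse' istopology_compactly_open)

lemma topspace_kify [simp]:
  fixes k :: "'k itself"
  shows "topspace (kify k X) = topspace X"
proof -
  have "{x \<in> topspace K. g x \<in> topspace X} = topspace K"
    if "continuous_map K X g" for K :: "'k topology" and g
    using that by (auto simp: continuous_map_def)
  then have "compactly_open k X (topspace X)"
    unfolding compactly_open_def by (metis openin_topspace order_refl)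
  then show ?thesis
    by (metis openin_kify compactly_open_def openin_subset openin_topspace subset_antisym)
qed

definition is_kspace :: "'k itself \<Rightarrow> 'a topology \<Rightarrow> bool" where
  "is_kspace k X \<longleftrightarrow> (\<forall>U. compactly_open k X U \<longrightarrow> openin X U)"

text \<open>Limits and function spaces in k-spaces are k-ifications of the usual ones.\<close>

definition kprod :: "'k itself \<Rightarrow> 'a topology \<Rightarrow> 'b topology \<Rightarrow> ('a \<times> 'b) topology" where
  "kprod k X Y = kify k (prod_topology X Y)"

definition kproduct :: "'k itself \<Rightarrow> ('i \<Rightarrow> 'a topology) \<Rightarrow> 'i set \<Rightarrow> ('i \<Rightarrow> 'a) topology" where
  "kproduct k X I = kify k (product_topology X I)"

definition ksubspace :: "'k itself \<Rightarrow> 'a topology \<Rightarrow> 'a set \<Rightarrow> 'a topology" where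
  "ksubspace k X S = kify k (subtopology X S)"

definition maps :: "'a topology \<Rightarrow> 'b topology \<Rightarrow> ('a \<Rightarrow> 'b) set" where
  "maps X Y = {f \<in> extensional (topspace X). continuous_map X Y f}"

text \<open>
  As in the k-space setting the compact-open topology is generated by the sets of maps taking the
  image of a test map into an open set.
\<close>

definition kmap :: "'k itself \<Rightarrow> 'a topology \<Rightarrow> 'b topology \<Rightarrow> ('a \<Rightarrow> 'b) topology" where
  "kmap k X Y = kify k (topology_generated_by (insert (maps X Y)
     {{f \<in> maps X Y. f ` g ` topspace K \<subseteq> U} | (K :: 'k topology) g U.
        compact_space K \<and> Hausdorff_space K \<and> continuous_map K X g \<and> openin Y U}))"

section \<open>Weak homotopy equivalences\<close>

definition cube :: "nat \<Rightarrow> (nat \<Rightarrow> real) topology" where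
  "cube n = product_topology (\<lambda>_. top_of_set {0..1}) {..<n}"

definition cube_bd :: "nat \<Rightarrow> (nat \<Rightarrow> real) set" where
  "cube_bd n = {u \<in> topspace (cube n). \<exists>i<n. u i = 0 \<or> u i = 1}"

definition nloops :: "nat \<Rightarrow> 'a topology \<Rightarrow> 'a \<Rightarrow> ((nat \<Rightarrow> real) \<Rightarrow> 'a) set" where
  "nloops n X x = {f. continuous_map (cube n) X f \<and> (\<forall>u\<in>cube_bd n. f u = x)}"

definition nloop_class ::
    "nat \<Rightarrow> 'a topology \<Rightarrow> 'a \<Rightarrow> ((nat \<Rightarrow> real) \<Rightarrow> 'a) \<Rightarrow> ((nat \<Rightarrow> real) \<Rightarrow> 'a) set" where
  "nloop_class n X x f = {g \<in> nloops n X x.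
     homotopic_with (\<lambda>h. \<forall>u\<in>cube_bd n. h u = x) (cube n) X f g}"

definition homotopy_group :: "nat \<Rightarrow> 'a topology \<Rightarrow> 'a \<Rightarrow> ((nat \<Rightarrow> real) \<Rightarrow> 'a) set set" where
  "homotopy_group n X x = nloop_class n X x ` nloops n X x"

text \<open>
  The map on homotopy groups induced by \<open>\<phi>\<close> is composition of representatives with \<open>\<phi>\<close>.  It is
  always a homomorphism for \<open>n \<ge> 1\<close>, so being an isomorphism means being bijective.
\<close>

definition weak_homotopy_equivalence :: "'a topology \<Rightarrow> 'b topology \<Rightarrow> ('a \<Rightarrow> 'b) \<Rightarrow> bool" where
  "weak_homotopy_equivalence X Y \<phi> \<longleftrightarrow>
     continuous_map X Y \<phi> \<and>
     bij_betw (\<lambda>C. \<Union>x\<in>C. path_component_of_set Y (\<phi> x))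
       (path_components_of X) (path_components_of Y) \<and>
     (\<forall>n\<ge>1. \<forall>x\<in>topspace X.
        bij_betw (\<lambda>c. \<Union>f\<in>c. nloop_class n Y (\<phi> x) (\<phi> \<circ> f))
          (homotopy_group n X x) (homotopy_group n Y (\<phi> x)))"

section \<open>Permutations\<close>

text \<open>
  Inputs are numbered from 0, and \<open>\<Sigma>\<^sub>n\<close> consists of the \<open>\<sigma>\<close> with \<open>\<sigma> permutes {..<n}\<close>.
  Throughout, input \<open>a\<close> of \<open>x \<cdot> \<sigma>\<close> is input \<open>\<sigma> a\<close> of \<open>x\<close>; this is a right action.

  \<open>circ_perm m i \<sigma> \<tau>\<close> is the permutation with
  \<open>(x \<cdot> \<sigma>) \<circ>\<^sub>i (y \<cdot> \<tau>) = (x \<circ>\<^bsub>\<sigma> i\<^esub> y) \<cdot> circ_perm m i \<sigma> \<tau>\<close> for \<open>y\<close> of arity \<open>m\<close>.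
\<close>

definition circ_perm :: "nat \<Rightarrow> nat \<Rightarrow> (nat \<Rightarrow> nat) \<Rightarrow> (nat \<Rightarrow> nat) \<Rightarrow> nat \<Rightarrow> nat" where
  "circ_perm m i \<sigma> \<tau> a =
     (let sh = (\<lambda>b. if b < \<sigma> i then b else b + m - 1) in
      if a < i then sh (\<sigma> a)
      else if a < i + m then \<sigma> i + \<tau> (a - i)
      else sh (\<sigma> (a + 1 - m)))"

text \<open>
  \<open>block_perm \<sigma> ks\<close>: consecutive blocks of sizes \<open>ks\<close> are rearranged to \<open>permute_list \<sigma>\<close> of them,
  and each position of the rearranged sequence is sent to its position in the old one.
\<close>

definition blocks :: "nat list \<Rightarrow> nat list list" where
  "blocks ks = map (\<lambda>i. [sum_list (take i ks)..<sum_list (take (Suc i) ks)]) [0..<length ks]"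

definition block_perm :: "(nat \<Rightarrow> nat) \<Rightarrow> nat list \<Rightarrow> nat \<Rightarrow> nat" where
  "block_perm \<sigma> ks a =
     (let L = concat (permute_list \<sigma> (blocks ks)) in if a < length L then L ! a else a)"

definition shift_perm :: "nat \<Rightarrow> (nat \<Rightarrow> nat) \<Rightarrow> nat \<Rightarrow> nat" where
  "shift_perm s \<tau> a = (if a < s then a else s + \<tau> (a - s))"

section \<open>Operads and bimodules\<close>

definition symmetric_sequence ::
    "'k itself \<Rightarrow> (nat \<Rightarrow> 'a topology) \<Rightarrow> (nat \<Rightarrow> (nat \<Rightarrow> nat) \<Rightarrow> 'a \<Rightarrow> 'a) \<Rightarrow> bool" where
  "symmetric_sequence k X act \<longleftrightarrow>
     (\<forall>n. is_kspace k (X n)) \<and>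
     (\<forall>n \<sigma>. \<sigma> permutes {..<n} \<longrightarrow> continuous_map (X n) (X n) (act n \<sigma>)) \<and>
     (\<forall>n. \<forall>x\<in>topspace (X n). act n id x = x) \<and>
     (\<forall>n \<sigma> \<tau>. \<forall>x\<in>topspace (X n). \<sigma> permutes {..<n} \<and> \<tau> permutes {..<n} \<longrightarrow>
        act n \<tau> (act n \<sigma> x) = act n (\<sigma> \<circ> \<tau>) x)"

text \<open>
  Operads are given by partial compositions: \<open>ocomp O n m i x y\<close> is \<open>x \<circ>\<^sub>i y\<close> for \<open>x\<close> of arity
  \<open>n\<close>, \<open>y\<close> of arity \<open>m\<close> and \<open>i < n\<close>.  The arities are arguments because the spaces of different
  arity are allowed to overlap.
\<close>

record 'a operad =
  ospace :: "nat \<Rightarrow> 'a topology"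
  oact :: "nat \<Rightarrow> (nat \<Rightarrow> nat) \<Rightarrow> 'a \<Rightarrow> 'a"
  ocomp :: "nat \<Rightarrow> nat \<Rightarrow> nat \<Rightarrow> 'a \<Rightarrow> 'a \<Rightarrow> 'a"
  ounit :: 'a

definition is_operad :: "'k itself \<Rightarrow> 'a operad \<Rightarrow> bool" where
  "is_operad k Q \<longleftrightarrow>
     symmetric_sequence k (ospace Q) (oact Q) \<and>
     (\<forall>n m i. i < n \<longrightarrow>
        continuous_map (kprod k (ospace Q n) (ospace Q m)) (ospace Q (n + m - 1))
          (\<lambda>(x, y). ocomp Q n m i x y)) \<and>
     ounit Q \<in> topspace (ospace Q 1) \<and>
     (\<forall>n i. \<forall>x\<in>topspace (ospace Q n). i < n \<longrightarrow> ocomp Q n 1 i x (ounit Q) = x) \<and>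
     (\<forall>n. \<forall>x\<in>topspace (ospace Q n). ocomp Q 1 n 0 (ounit Q) x = x) \<and>
     (\<forall>n m l i j. \<forall>x\<in>topspace (ospace Q n). \<forall>y\<in>topspace (ospace Q m). \<forall>z\<in>topspace (ospace Q l).
        i < n \<and> j < m \<longrightarrow>
        ocomp Q (n + m - 1) l (i + j) (ocomp Q n m i x y) z
          = ocomp Q n (m + l - 1) i x (ocomp Q m l j y z)) \<and>
     (\<forall>n m l i j. \<forall>x\<in>topspace (ospace Q n). \<forall>y\<in>topspace (ospace Q m). \<forall>z\<in>topspace (ospace Q l).
        i < j \<and> j < n \<longrightarrow>
        ocomp Q (n + m - 1) l (j + m - 1) (ocomp Q n m i x y) z
          = ocomp Q (n + l - 1) m i (ocomp Q n l j x z) y) \<and>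
     (\<forall>n m i \<sigma> \<tau>. \<forall>x\<in>topspace (ospace Q n). \<forall>y\<in>topspace (ospace Q m).
        i < n \<and> \<sigma> permutes {..<n} \<and> \<tau> permutes {..<m} \<longrightarrow>
        ocomp Q n m i (oact Q n \<sigma> x) (oact Q m \<tau> y)
          = oact Q (n + m - 1) (circ_perm m i \<sigma> \<tau>) (ocomp Q n m (\<sigma> i) x y))"

definition reduced :: "'a operad \<Rightarrow> bool" where
  "reduced Q \<longleftrightarrow> (\<exists>z. topspace (ospace Q 0) = {z})"

text \<open>
  \<open>rcomp M n m i x q\<close> is the right operation \<open>x \<circ>\<^sup>i q\<close> on \<open>M(n) \<times> Q(m)\<close>, and \<open>lcomp M ns p xs\<close> is
  the left operation \<open>\<gamma>\<^sub>\<ell>(p; xs)\<close> on \<open>P(k) \<times> M(n\<^sub>1) \<times> \<dots> \<times> M(n\<^sub>k)\<close> where \<open>ns = [n\<^sub>1, \<dots>, n\<^sub>k]\<close>.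
\<close>

record ('p, 'q, 'm) bimod =
  mspace :: "nat \<Rightarrow> 'm topology"
  mact :: "nat \<Rightarrow> (nat \<Rightarrow> nat) \<Rightarrow> 'm \<Rightarrow> 'm"
  rcomp :: "nat \<Rightarrow> nat \<Rightarrow> nat \<Rightarrow> 'm \<Rightarrow> 'q \<Rightarrow> 'm"
  lcomp :: "nat list \<Rightarrow> 'p \<Rightarrow> 'm list \<Rightarrow> 'm"

definition right_module_axioms ::
    "'k itself \<Rightarrow> 'q operad \<Rightarrow> ('p, 'q, 'm) bimod \<Rightarrow> bool" where
  "right_module_axioms k Q M \<longleftrightarrow>
     (\<forall>n m i. i < n \<longrightarrow>
        continuous_map (kprod k (mspace M n) (ospace Q m)) (mspace M (n + m - 1))
          (\<lambda>(x, q). rcomp M n m i x q)) \<and>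
     (\<forall>n i. \<forall>x\<in>topspace (mspace M n). i < n \<longrightarrow> rcomp M n 1 i x (ounit Q) = x) \<and>
     (\<forall>n m l i j. \<forall>x\<in>topspace (mspace M n). \<forall>y\<in>topspace (ospace Q m). \<forall>z\<in>topspace (ospace Q l).
        i < n \<and> j < m \<longrightarrow>
        rcomp M (n + m - 1) l (i + j) (rcomp M n m i x y) z
          = rcomp M n (m + l - 1) i x (ocomp Q m l j y z)) \<and>
     (\<forall>n m l i j. \<forall>x\<in>topspace (mspace M n). \<forall>y\<in>topspace (ospace Q m). \<forall>z\<in>topspace (ospace Q l).
        i < j \<and> j < n \<longrightarrow>
        rcomp M (n + m - 1) l (j + m - 1) (rcomp M n m i x y) z
          = rcomp M (n + l - 1) m i (rcomp M n l j x z) y) \<and>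
     (\<forall>n m i \<sigma> \<tau>. \<forall>x\<in>topspace (mspace M n). \<forall>y\<in>topspace (ospace Q m).
        i < n \<and> \<sigma> permutes {..<n} \<and> \<tau> permutes {..<m} \<longrightarrow>
        rcomp M n m i (mact M n \<sigma> x) (oact Q m \<tau> y)
          = mact M (n + m - 1) (circ_perm m i \<sigma> \<tau>) (rcomp M n m (\<sigma> i) x y))"

definition elems :: "('p, 'q, 'm) bimod \<Rightarrow> nat list \<Rightarrow> 'm list \<Rightarrow> bool" where
  "elems M ns xs \<longleftrightarrow> list_all2 (\<lambda>n x. x \<in> topspace (mspace M n)) ns xs"

definition left_module_axioms ::
    "'k itself \<Rightarrow> 'p operad \<Rightarrow> ('p, 'q, 'm) bimod \<Rightarrow> bool" where
  "left_module_axioms k P M \<longleftrightarrow>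
     (\<forall>ns. continuous_map
        (kprod k (ospace P (length ns)) (kproduct k (\<lambda>i. mspace M (ns ! i)) {..<length ns}))
        (mspace M (sum_list ns))
        (\<lambda>(p, x). lcomp M ns p (map x [0..<length ns]))) \<and>
     (\<forall>n. \<forall>x\<in>topspace (mspace M n). lcomp M [n] (ounit P) [x] = x) \<and>
     (\<forall>k l i ns xs. \<forall>p\<in>topspace (ospace P k). \<forall>p'\<in>topspace (ospace P l).
        i < k \<and> length ns = k + l - 1 \<and> elems M ns xs \<longrightarrow>
        lcomp M ns (ocomp P k l i p p') xs
          = lcomp M (take i ns @ [sum_list (take l (drop i ns))] @ drop (i + l) ns) p
              (take i xs @ [lcomp M (take l (drop i ns)) p' (take l (drop i xs))]
                @ drop (i + l) xs)) \<and>
     (\<forall>ns xs \<sigma>. \<forall>p\<in>topspace (ospace P (length ns)).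
        elems M ns xs \<and> \<sigma> permutes {..<length ns} \<longrightarrow>
        lcomp M (permute_list \<sigma> ns) (oact P (length ns) \<sigma> p) (permute_list \<sigma> xs)
          = mact M (sum_list ns) (block_perm \<sigma> ns) (lcomp M ns p xs)) \<and>
     (\<forall>ns xs i \<tau>. \<forall>p\<in>topspace (ospace P (length ns)).
        elems M ns xs \<and> i < length ns \<and> \<tau> permutes {..<ns ! i} \<longrightarrow>
        lcomp M ns p (xs[i := mact M (ns ! i) \<tau> (xs ! i)])
          = mact M (sum_list ns) (shift_perm (sum_list (take i ns)) \<tau>) (lcomp M ns p xs))"

definition is_bimodule ::
    "'k itself \<Rightarrow> 'p operad \<Rightarrow> 'q operad \<Rightarrow> ('p, 'q, 'm) bimod \<Rightarrow> bool" where
  "is_bimodule k P Q M \<longleftrightarrow>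
     symmetric_sequence k (mspace M) (mact M) \<and>
     right_module_axioms k Q M \<and> left_module_axioms k P M \<and>
     (\<forall>ns xs m i j. \<forall>p\<in>topspace (ospace P (length ns)). \<forall>q\<in>topspace (ospace Q m).
        elems M ns xs \<and> i < length ns \<and> j < ns ! i \<longrightarrow>
        rcomp M (sum_list ns) m (sum_list (take i ns) + j) (lcomp M ns p xs) q
          = lcomp M (ns[i := ns ! i + m - 1]) p (xs[i := rcomp M (ns ! i) m j (xs ! i) q]))"

definition bimodule_map ::
    "'p operad \<Rightarrow> 'q operad \<Rightarrow> ('p, 'q, 'm) bimod \<Rightarrow> ('p, 'q, 'n) bimod \<Rightarrow> (nat \<Rightarrow> 'm \<Rightarrow> 'n) \<Rightarrow> bool"
  where
  "bimodule_map P Q M N \<phi> \<longleftrightarrow>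
     (\<forall>n. continuous_map (mspace M n) (mspace N n) (\<phi> n)) \<and>
     (\<forall>n \<sigma>. \<forall>x\<in>topspace (mspace M n). \<sigma> permutes {..<n} \<longrightarrow>
        \<phi> n (mact M n \<sigma> x) = mact N n \<sigma> (\<phi> n x)) \<and>
     (\<forall>n m i. \<forall>x\<in>topspace (mspace M n). \<forall>q\<in>topspace (ospace Q m). i < n \<longrightarrow>
        \<phi> (n + m - 1) (rcomp M n m i x q) = rcomp N n m i (\<phi> n x) q) \<and>
     (\<forall>ns xs. \<forall>p\<in>topspace (ospace P (length ns)). elems M ns xs \<longrightarrow>
        \<phi> (sum_list ns) (lcomp M ns p xs) = lcomp N ns p (map2 \<phi> ns xs))"

section \<open>Planar trees\<close>

text \<open>
  \<open>('l) ptree\<close> describes what lies above an edge: either the edge is a leaf, or it ends in a vertex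
  with a label.  A rooted tree whose (unlabelled) root has \<open>n\<close> incoming edges is a list of length
  \<open>n\<close>; trees without labels have labels in \<open>unit\<close>.  A non-root vertex is addressed by the nonempty
  list of edge numbers on the path from the root, so \<open>v < v'\<close> is \<open>strict_prefix v v'\<close>.
\<close>

datatype 'l ptree = Leaf | Node (label: 'l) (branches: "'l ptree list")
  where "branches Leaf = []"

type_synonym 'l rtree = "'l ptree list"

fun leaves :: "'l ptree \<Rightarrow> nat" where
  "leaves Leaf = 1"
| "leaves (Node _ ts) = sum_list (map leaves ts)"

definition nleaves :: "'l rtree \<Rightarrow> nat" where
  "nleaves ts = sum_list (map leaves ts)"

fun is_vertex :: "'l rtree \<Rightarrow> nat list \<Rightarrow> bool" where
  "is_vertex ts [] = False"
| "is_vertex ts (j # w) =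
     (j < length ts \<and> ts ! j \<noteq> Leaf \<and> (w = [] \<or> is_vertex (branches (ts ! j)) w))"

definition vertices :: "'l rtree \<Rightarrow> nat list set" where
  "vertices ts = {v. is_vertex ts v}"

text \<open>\<open>branch_at ts v\<close> is the vertex \<open>v\<close> with all that is above it; \<open>replace_at\<close> exchanges it.\<close>

fun branch_at :: "'l rtree \<Rightarrow> nat list \<Rightarrow> 'l ptree" where
  "branch_at ts [] = undefined"
| "branch_at ts (j # w) = (if w = [] then ts ! j else branch_at (branches (ts ! j)) w)"

fun replace_at :: "'l rtree \<Rightarrow> nat list \<Rightarrow> 'l ptree \<Rightarrow> 'l rtree" where
  "replace_at ts [] s = ts"
| "replace_at ts (j # w) s = ts[j :=
     (if w = [] then s else Node (label (ts ! j)) (replace_at (branches (ts ! j)) w s))]"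

text \<open>The number of leaves of the whole tree to the left of the branch at \<open>v\<close>.\<close>

fun leaves_before :: "'l rtree \<Rightarrow> nat list \<Rightarrow> nat" where
  "leaves_before ts [] = 0"
| "leaves_before ts (j # w) =
     nleaves (take j ts) + (if w = [] then 0 else leaves_before (branches (ts ! j)) w)"

definition vertex_arity :: "'l rtree \<Rightarrow> nat list \<Rightarrow> nat" where
  "vertex_arity ts v = length (branches (branch_at ts v))"

definition trees :: "nat \<Rightarrow> unit rtree set" where
  "trees n = {T. length T = n}"

section \<open>Decorated trees\<close>

text \<open>\<open>H(T)\<close> is compact Hausdorff, hence needs no k-ification.\<close>

type_synonym 'q decoration = "(nat list \<Rightarrow> real) \<times> (nat list \<Rightarrow> 'q)"

definition H_space :: "unit rtree \<Rightarrow> (nat list \<Rightarrow> real) topology" where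
  "H_space T = subtopology (product_topology (\<lambda>_. top_of_set {0..1}) (vertices T))
     {t. \<forall>v\<in>vertices T. \<forall>v'\<in>vertices T. strict_prefix v v' \<longrightarrow> t v \<le> t v'}"

definition D_space :: "'k itself \<Rightarrow> 'q operad \<Rightarrow> unit rtree \<Rightarrow> (nat list \<Rightarrow> 'q) topology" where
  "D_space k Q T = kproduct k (\<lambda>v. ospace Q (vertex_arity T v)) (vertices T)"

definition dec_space :: "'k itself \<Rightarrow> 'q operad \<Rightarrow> unit rtree \<Rightarrow> 'q decoration topology" where
  "dec_space k Q T = kprod k (H_space T) (D_space k Q T)"

text \<open>
  A tree together with a point of \<open>H(T) \<times> D(T)\<close> is the same as a tree whose non-root vertices are
  labelled by pairs \<open>(t, q)\<close>; \<open>decorate\<close> passes from the first form to the second, and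
  \<open>shape\<close>, \<open>decoration\<close> go back.
\<close>

type_synonym 'q dtree = "(real \<times> 'q) rtree"

definition shape :: "'l rtree \<Rightarrow> unit rtree" where
  "shape ds = map (map_ptree (\<lambda>_. ())) ds"

definition decoration :: "'q dtree \<Rightarrow> 'q decoration" where
  "decoration ds = ((\<lambda>v\<in>vertices ds. fst (label (branch_at ds v))),
                    (\<lambda>v\<in>vertices ds. snd (label (branch_at ds v))))"

function decorate_branch :: "'q decoration \<Rightarrow> nat list \<Rightarrow> unit ptree \<Rightarrow> (real \<times> 'q) ptree" where
  "decorate_branch x v Leaf = Leaf"
| "decorate_branch x v (Node u ts) = Node (fst x v, snd x v)
     (map (\<lambda>(j, s). decorate_branch x (v @ [j]) s) (zip [0..<length ts] ts))"
  by pat_completeness auto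
termination
proof (relation "Wellfounded.measure (\<lambda>(x, v, s). size s)")
  fix x :: "'q decoration" and v u ts and z :: "nat \<times> unit ptree" and j s
  assume "z \<in> set (zip [0..<length ts] ts)" "(j, s) = z"
  then have "s \<in> set ts" by (auto dest: set_zip_rightD)
  then have "size s \<le> size_list size ts" by (simp add: size_list_estimation')
  then show "((x, v @ [j], s), (x, v, Node u ts)) \<in> Wellfounded.measure (\<lambda>(x, v, s). size s)"
    by simp
qed simp

definition decorate :: "unit rtree \<Rightarrow> 'q decoration \<Rightarrow> 'q dtree" where
  "decorate T x = map (\<lambda>(j, s). decorate_branch x [j] s) (zip [0..<length T] T)"

definition dtrees :: "'k itself \<Rightarrow> 'q operad \<Rightarrow> nat \<Rightarrow> 'q dtree set" where
  "dtrees k Q n = {ds. length ds = n \<and> decoration ds \<in> topspace (dec_space k Q (shape ds))}"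

text \<open>
  Composites: \<open>plug c 0 x [(k\<^sub>1, y\<^sub>1), \<dots>, (k\<^sub>n, y\<^sub>n)]\<close> is \<open>x(y\<^sub>1, \<dots>, y\<^sub>n)\<close>, built from the partial
  compositions \<open>c\<close> starting with the last input; \<open>x\<close> has arity \<open>n\<close> and \<open>y\<^sub>j\<close> has arity \<open>k\<^sub>j\<close>.
\<close>

fun plug :: "(nat \<Rightarrow> nat \<Rightarrow> nat \<Rightarrow> 'x \<Rightarrow> 'y \<Rightarrow> 'x) \<Rightarrow> nat \<Rightarrow> 'x \<Rightarrow> (nat \<times> 'y) list \<Rightarrow> 'x" where
  "plug c i x [] = x"
| "plug c i x ((k, y) # ys) =
     c (Suc i + sum_list (map fst ys)) k i (plug c (Suc i) x ys) y"

fun ocomposite :: "'q operad \<Rightarrow> (real \<times> 'q) ptree \<Rightarrow> 'q" where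
  "ocomposite Q Leaf = ounit Q"
| "ocomposite Q (Node a ds) =
     plug (ocomp Q) 0 (snd a) (map (\<lambda>d. (leaves d, ocomposite Q d)) ds)"

definition mcomposite :: "('p, 'q, 'm) bimod \<Rightarrow> 'q operad \<Rightarrow> 'm \<Rightarrow> 'q dtree \<Rightarrow> 'm" where
  "mcomposite M Q x ds = plug (rcomp M) 0 x (map (\<lambda>d. (leaves d, ocomposite Q d)) ds)"

section \<open>The bimodule of families\<close>

type_synonym ('q, 'm) family = "unit rtree \<Rightarrow> 'q decoration \<Rightarrow> 'm"

definition family_value :: "('q, 'm) family \<Rightarrow> 'q dtree \<Rightarrow> 'm" where
  "family_value f ds = f (shape ds) (decoration ds)"

definition make_family ::
    "'k itself \<Rightarrow> 'q operad \<Rightarrow> nat \<Rightarrow> ('q dtree \<Rightarrow> 'm) \<Rightarrow> ('q, 'm) family" where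
  "make_family k Q n F = (\<lambda>T\<in>trees n. \<lambda>x\<in>topspace (dec_space k Q T). F (decorate T x))"

definition unit_condition ::
    "'k itself \<Rightarrow> 'q operad \<Rightarrow> nat \<Rightarrow> ('q, 'm) family \<Rightarrow> bool" where
  "unit_condition k Q n f \<longleftrightarrow> (\<forall>ds\<in>dtrees k Q n. \<forall>v\<in>vertices ds. \<forall>t d.
     branch_at ds v = Node (t, ounit Q) [d] \<longrightarrow>
     family_value f ds = family_value f (replace_at ds v d))"

definition symmetry_condition ::
    "'k itself \<Rightarrow> 'q operad \<Rightarrow> ('p, 'q, 'm) bimod \<Rightarrow> nat \<Rightarrow> ('q, 'm) family \<Rightarrow> bool" where
  "symmetry_condition k Q M n f \<longleftrightarrow> (\<forall>ds\<in>dtrees k Q n. \<forall>v\<in>vertices ds. \<forall>t q es \<sigma>.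
     branch_at ds v = Node (t, q) es \<and> \<sigma> permutes {..<length es} \<longrightarrow>
     family_value f (replace_at ds v (Node (t, oact Q (length es) \<sigma> q) (permute_list \<sigma> es)))
       = mact M (nleaves ds)
           (shift_perm (leaves_before ds v) (block_perm \<sigma> (map leaves es)))
           (family_value f ds))"

definition contraction_condition ::
    "'k itself \<Rightarrow> 'q operad \<Rightarrow> nat \<Rightarrow> ('q, 'm) family \<Rightarrow> bool" where
  "contraction_condition k Q n f \<longleftrightarrow> (\<forall>ds\<in>dtrees k Q n. \<forall>v\<in>vertices ds. \<forall>t q q' es es' j.
     branch_at ds v = Node (t, q) es \<and> j < length es \<and> es ! j = Node (t, q') es' \<longrightarrow>
     family_value f ds = family_value f (replace_at ds v
       (Node (t, ocomp Q (length es) (length es') j q q')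
          (take j es @ es' @ drop (Suc j) es))))"

text \<open>An inner edge is given by the vertex \<open>v\<close> at its upper end.\<close>

definition top_condition ::
    "'k itself \<Rightarrow> 'q operad \<Rightarrow> ('p, 'q, 'm) bimod \<Rightarrow> nat \<Rightarrow> ('q, 'm) family \<Rightarrow> bool" where
  "top_condition k Q M n f \<longleftrightarrow> (\<forall>ds\<in>dtrees k Q n. \<forall>v\<in>vertices ds.
     (\<forall>a\<in>set_ptree (branch_at ds v). fst a = 1) \<longrightarrow>
     family_value f ds =
       rcomp M (nleaves (replace_at ds v Leaf)) (leaves (branch_at ds v)) (leaves_before ds v)
         (family_value f (replace_at ds v Leaf)) (ocomposite Q (branch_at ds v)))"

definition Mf_space ::
    "'k itself \<Rightarrow> 'q operad \<Rightarrow> ('p, 'q, 'm) bimod \<Rightarrow> nat \<Rightarrow> ('q, 'm) family topology" where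
  "Mf_space k Q M n =
     ksubspace k (kproduct k (\<lambda>T. kmap k (dec_space k Q T) (mspace M (nleaves T))) (trees n))
       {f. unit_condition k Q n f \<and> symmetry_condition k Q M n f \<and>
           contraction_condition k Q n f \<and> top_condition k Q M n f}"

definition Mf_act ::
    "'k itself \<Rightarrow> 'q operad \<Rightarrow> ('p, 'q, 'm) bimod \<Rightarrow>
      nat \<Rightarrow> (nat \<Rightarrow> nat) \<Rightarrow> ('q, 'm) family \<Rightarrow> ('q, 'm) family" where
  "Mf_act k Q M n \<sigma> f = make_family k Q n (\<lambda>ds.
     let ds' = permute_list (inv \<sigma>) ds in
     mact M (nleaves ds) (block_perm \<sigma> (map leaves ds')) (family_value f ds'))"

definition Mf_rcomp ::
    "'k itself \<Rightarrow> 'q operad \<Rightarrow>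
      nat \<Rightarrow> nat \<Rightarrow> nat \<Rightarrow> ('q, 'm) family \<Rightarrow> 'q \<Rightarrow> ('q, 'm) family" where
  "Mf_rcomp k Q n m i f q = make_family k Q (n + m - 1) (\<lambda>ds.
     family_value f (take i ds @ [Node (0, q) (take m (drop i ds))] @ drop (i + m) ds))"

fun split_at :: "nat list \<Rightarrow> 'a list \<Rightarrow> 'a list list" where
  "split_at [] ds = []"
| "split_at (n # ns) ds = take n ds # split_at ns (drop n ds)"

definition Mf_lcomp ::
    "'k itself \<Rightarrow> 'q operad \<Rightarrow> ('p, 'q, 'm) bimod \<Rightarrow>
      nat list \<Rightarrow> 'p \<Rightarrow> ('q, 'm) family list \<Rightarrow> ('q, 'm) family" where
  "Mf_lcomp k Q M ns p fs = make_family k Q (sum_list ns) (\<lambda>ds.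
     lcomp M (map nleaves (split_at ns ds)) p (map2 family_value fs (split_at ns ds)))"

definition Mf :: "'k itself \<Rightarrow> 'q operad \<Rightarrow> ('p, 'q, 'm) bimod \<Rightarrow> ('p, 'q, ('q, 'm) family) bimod"
  where
  "Mf k Q M = \<lparr>mspace = Mf_space k Q M, mact = Mf_act k Q M,
               rcomp = Mf_rcomp k Q, lcomp = Mf_lcomp k Q M\<rparr>"

definition eta ::
    "'k itself \<Rightarrow> 'q operad \<Rightarrow> ('p, 'q, 'm) bimod \<Rightarrow> nat \<Rightarrow> 'm \<Rightarrow> ('q, 'm) family" where
  "eta k Q M n x = make_family k Q n (mcomposite M Q x)"

end

theory Submission
  imports Defs
begin

text \<open>
  Raising all numbers of a decorated tree to at least \<open>s\<close> preserves the four conditions, so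
  \<open>f \<mapsto> ((t, q) \<mapsto> f\<^sub>T (max s t, q))\<close> for \<open>0 \<le> s \<le> 1\<close> is a homotopy on \<open>M\<^sup>f(n)\<close>.  It starts at the
  identity.  At \<open>s = 1\<close> the fourth condition, applied to all root edges, shows that it ends at \<open>\<eta>\<close> of
  the value of \<open>f\<close> on the corolla, and it is constant on the image of \<open>\<eta>\<close>.  Hence \<open>\<eta>\<close> is the
  inclusion of a strong deformation retract.

  Continuity is only ever tested on maps from compact Hausdorff spaces carried by \<open>'k\<close>; for those,
  k-products and mapping spaces satisfy the exponential law, and a family of decorated trees of a
  fixed shape is continuous if and only if its labels are.  Identities between permutations are
  proved by letting both sides act on lists.
\<close>

section \<open>Test spaces\<close>

text \<open>Raising works because t \<mapsto> max s t is monotone, keeps equal numbers equal and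
  fixes 1, while composites do not see the numbers at all. The homotopy lives in each arity
  separately: a right operation inserts a vertex with number 0, which raising would move, so the
  deformation is in general not compatible with right operations, and the bimodule statements need
  their own proofs. Each axiom there compares values at trees that differ in one branch, up to a
  permutation of leaves. Addresses of vertices change whenever root edges are permuted, grafted or
  split into groups; a replacement is therefore located by the number of leaves on its left, which
  is what shifted permutations and partial compositions refer to. The cardinality assumption on
  \<open>'k\<close> enters in two places: products of two test spaces must be k-spaces for currying,
  and cubes with their cylinders must be k-spaces so that homotopies can be tested.\<close>

definition test_space :: "'k topology \<Rightarrow> bool" where
  "test_space K \<longleftrightarrow> compact_space K \<and> Hausdorff_space K"

lemma test_space_singleton: "test_space (discrete_topology {c})"
  by (simp add: test_space_def compact_space_discrete_topology)

lemma openin_kify_if_openin: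
  fixes k :: "'k itself"
  shows "openin X U \<Longrightarrow> openin (kify k X) U"
  unfolding openin_kify compactly_open_def
  by (auto simp: openin_subset continuous_map_def)

text \<open>By definition a compactly open set has an open preimage under every map from a test
  space, so passing to the k-ification is invisible to test maps. Statements on k-products,
  k-subspaces and mapping spaces reduce to ordinary topology through this.\<close>

lemma continuous_map_kify_iff:
  fixes K :: "'k topology" and k :: "'k itself"
  assumes "test_space K"
  shows "continuous_map K (kify k X) f \<longleftrightarrow> continuous_map K X f"
proof
  assume "continuous_map K (kify k X) f"
  then show "continuous_map K X f"
    unfolding continuous_map_def by (auto simp: openin_kify_if_openin)
next
  assume f: "continuous_map K X f"
  then show "continuous_map K (kify k X) f"
    unfolding continuous_map_def openin_kify compactly_open_def
    using assms by (auto simp: test_space_def continuous_map_def)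
qed

lemma is_kspace_kify:
  fixes k :: "'k itself"
  shows "is_kspace k (kify k X)"
  unfolding is_kspace_def
proof (intro allI impI)
  fix U assume U: "compactly_open k (kify k X) U"
  then have "compactly_open k X U"
    unfolding compactly_open_def
    using continuous_map_kify_iff[unfolded test_space_def, where k=k] by (metis topspace_kify)
  then show "openin (kify k X) U" by (simp add: openin_kify)
qed

text \<open>The preimage of an open set under \<open>f\<close> is compactly open, because pulling it
  back along a test map \<open>g\<close> gives the preimage under \<open>f \<circ> g\<close>.
  Continuity of the structure maps on families is thereby reduced to test maps.\<close>

lemma continuous_map_from_kspace:
  fixes k :: "'k itself"
  assumes X: "is_kspace k X"
    and f: "\<And>(K :: 'k topology) g. test_space K \<Longrightarrow> continuous_map K X g \<Longrightarrow> continuous_map K Y (f \<circ> g)"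
  shows "continuous_map X Y f"
  unfolding continuous_map_def
proof (intro conjI allI impI funcsetI)
  fix x assume x: "x \<in> topspace X"
  \<comment> \<open>A point of \<open>X\<close> is the image of a one-point test space; this gives
    \<open>f x \<in> topspace Y\<close>, which the hypothesis on test maps does not state
    directly.\<close>
  define K where "K = discrete_topology {undefined :: 'k}"
  have "continuous_map K X (\<lambda>_. x)" using x by simp
  then have "continuous_map K Y (f \<circ> (\<lambda>_. x))" by (intro f) (simp_all add: K_def test_space_singleton)
  moreover have "undefined \<in> topspace K" by (simp add: K_def)
  ultimately show "f x \<in> topspace Y" using continuous_map_funspace by fastforce
next
  fix U assume U: "openin Y U"
  have "compactly_open k X {x \<in> topspace X. f x \<in> U}"
    unfolding compactly_open_def
  proof (intro conjI allI impI)
    fix K :: "'k topology" and g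
    assume K: "compact_space K \<and> Hausdorff_space K \<and> continuous_map K X g"
    then have c: "continuous_map K Y (f \<circ> g)" using f by (auto simp: test_space_def)
    have "{x \<in> topspace K. g x \<in> {x \<in> topspace X. f x \<in> U}} = {x \<in> topspace K. (f \<circ> g) x \<in> U}"
      using K by (auto simp: continuous_map_def)
    then show "openin K {x \<in> topspace K. g x \<in> {x \<in> topspace X. f x \<in> U}}"
      using openin_continuous_map_preimage[OF c U] by simp
  qed auto
  then show "openin X {x \<in> topspace X. f x \<in> U}" using X by (simp add: is_kspace_def)
qed

text \<open>Test spaces are topologies on \<open>'k\<close>, so a copy of \<open>Z\<close> inside
  \<open>'k\<close> is made by pulling its topology back along the inverse of \<open>h\<close>. The
  resulting homeomorphism \<open>r\<close> onto \<open>Z\<close> is itself a test map, and a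
  compactly open set of \<open>Z\<close> has an open preimage under it.\<close>

lemma is_kspace_small_compact_Hausdorff:
  fixes k :: "'k itself" and h :: "'z \<Rightarrow> 'k"
  assumes Z: "compact_space Z" "Hausdorff_space Z" and h: "inj_on h (topspace Z)"
  shows "is_kspace k Z"
  unfolding is_kspace_def
proof (intro allI impI)
  fix U assume U: "compactly_open k Z U"
  define r where "r = inv_into (topspace Z) h"
  define K where "K = pullback_topology (h ` topspace Z) r Z"
  have rh: "r (h z) = z" if "z \<in> topspace Z" for z using that h by (simp add: r_def)
  have tK: "topspace K = h ` topspace Z" using rh by (auto simp: K_def topspace_pullback_topology)
  have hr: "h (r y) = y" if "y \<in> h ` topspace Z" for y using that rh by auto
  have "continuous_map K Z r"
    using continuous_map_pullback[OF continuous_map_id, of "h ` topspace Z" r Z] by (simp add: K_def)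
  moreover have "continuous_map Z K h"
    unfolding K_def
  proof (rule continuous_map_pullback')
    show "continuous_map Z Z (r \<circ> h)" by (rule continuous_map_eq[OF continuous_map_id]) (simp add: rh)
  qed auto
  ultimately have hom: "homeomorphic_maps Z K h r"
    unfolding homeomorphic_maps_def using rh hr tK by auto
  then have "Z homeomorphic_space K" by (auto simp: homeomorphic_space_def)
  then have "compact_space K" "Hausdorff_space K"
    using Z homeomorphic_compact_space homeomorphic_Hausdorff_space by blast+
  then have "openin K {x \<in> topspace K. r x \<in> U}"
    using U \<open>continuous_map K Z r\<close> by (auto simp: compactly_open_def)
  then have "openin Z {z \<in> topspace Z. h z \<in> {x \<in> topspace K. r x \<in> U}}"
    using \<open>continuous_map Z K h\<close> openin_continuous_map_preimage by blast
  moreover have "{z \<in> topspace Z. h z \<in> {x \<in> topspace K. r x \<in> U}} = U"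
  proof -
    have "h z \<in> {x \<in> topspace K. r x \<in> U} \<longleftrightarrow> z \<in> U" if "z \<in> topspace Z" for z
      using that by (simp add: tK rh)
    then show ?thesis using U by (auto simp: compactly_open_def)
  qed
  ultimately show "openin Z U" by simp
qed

text \<open>\<open>'k\<close> is infinite, and an infinite set is equipotent to its square. Products
  of two spaces carried by \<open>'k\<close> can thus be carried by \<open>'k\<close> again.\<close>

lemma inj_pair_if_inj_real:
  fixes e :: "real \<Rightarrow> 'k"
  assumes "inj e"
  shows "\<exists>p :: 'k \<times> 'k \<Rightarrow> 'k. inj p"
proof -
  have "infinite (UNIV :: 'k set)"
    using finite_imageD[OF _ assms] infinite_UNIV_char_0[where 'a = real] finite_subset[OF subset_UNIV] by blast
  from card_of_Times_same_infinite[OF this]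
  have "\<exists>p :: 'k \<times> 'k \<Rightarrow> 'k. bij_betw p (UNIV \<times> UNIV) UNIV" by (simp only: card_of_ordIso)
  then obtain p :: "'k \<times> 'k \<Rightarrow> 'k" where "bij_betw p (UNIV \<times> UNIV) UNIV" ..
  then show ?thesis by (auto simp: bij_betw_def)
qed

lemma is_kspace_prod_test:
  fixes K L :: "'k topology" and k :: "'k itself" and e :: "real \<Rightarrow> 'k"
  assumes "inj e" "test_space K" "test_space L"
  shows "is_kspace k (prod_topology K L)"
proof -
  obtain p :: "'k \<times> 'k \<Rightarrow> 'k" where "inj p" using inj_pair_if_inj_real[OF assms(1)] by blast
  show ?thesis
  proof (rule is_kspace_small_compact_Hausdorff)
    show "compact_space (prod_topology K L)" "Hausdorff_space (prod_topology K L)"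
      using assms(2,3) by (simp_all add: test_space_def compact_space_prod_topology Hausdorff_space_prod_topology)
    show "inj_on p (topspace (prod_topology K L))"
      using \<open>inj p\<close> inj_on_subset by blast
  qed
qed

section \<open>Test maps into products, subspaces and mapping spaces\<close>

lemma continuous_map_kprod:
  fixes K :: "'k topology" and k :: "'k itself"
  assumes "test_space K"
  shows "continuous_map K (kprod k X Y) f \<longleftrightarrow> continuous_map K X (fst \<circ> f) \<and> continuous_map K Y (snd \<circ> f)"
  unfolding kprod_def by (simp add: assms continuous_map_kify_iff continuous_map_pairwise)

lemma continuous_map_kproduct:
  fixes K :: "'k topology" and k :: "'k itself"
  assumes "test_space K"
  shows "continuous_map K (kproduct k X I) f \<longleftrightarrow>
    f ` topspace K \<subseteq> extensional I \<and> (\<forall>i\<in>I. continuous_map K (X i) (\<lambda>x. f x i))"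
  unfolding kproduct_def
  by (simp add: assms continuous_map_kify_iff continuous_map_componentwise)

lemma continuous_map_ksubspace:
  fixes K :: "'k topology" and k :: "'k itself"
  assumes "test_space K"
  shows "continuous_map K (ksubspace k X S) f \<longleftrightarrow> continuous_map K X f \<and> f ` topspace K \<subseteq> S"
  unfolding ksubspace_def
  by (auto simp add: assms continuous_map_kify_iff continuous_map_in_subtopology)

text \<open>This is the evaluation half of the exponential law. Around \<open>x0\<close> there is a
  closed neighbourhood \<open>C\<close> on which \<open>F x0 \<circ> g\<close> stays in
  \<open>U\<close>. Being compact Hausdorff, \<open>C\<close> is a test space, so the maps sending
  the image of \<open>C\<close> into \<open>U\<close> form a subbasic open set. Its preimage under
  \<open>F\<close>, cut down to the open \<open>W\<close> inside \<open>C\<close>, is the required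
  neighbourhood of \<open>x0\<close>.\<close>

lemma continuous_map_kmap_eval:
  fixes K :: "'k topology" and k :: "'k itself"
  assumes K: "test_space K" and F: "continuous_map K (kmap k X Y) F" and g: "continuous_map K X g"
  shows "continuous_map K Y (\<lambda>x. F x (g x))"
proof -
  define \<S> where "\<S> = insert (maps X Y)
     {{f \<in> maps X Y. f ` g ` topspace K \<subseteq> U} | (K :: 'k topology) g U.
        compact_space K \<and> Hausdorff_space K \<and> continuous_map K X g \<and> openin Y U}"
  have F': "continuous_map K (topology_generated_by \<S>) F"
    using F by (simp add: kmap_def \<S>_def continuous_map_kify_iff[OF K])
  have Fm: "continuous_map X Y (F x)" if "x \<in> topspace K" for x
  proof -
    have "F x \<in> \<Union>\<S>" using F' that unfolding continuous_on_generated_topo_iff by blast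
    then have "F x \<in> maps X Y" by (auto simp: \<S>_def)
    then show ?thesis by (simp add: maps_def)
  qed
  show ?thesis
    unfolding continuous_map_def
  proof (intro conjI allI impI funcsetI)
    fix x assume "x \<in> topspace K"
    then show "F x (g x) \<in> topspace Y"
      using Fm g by (auto simp: continuous_map_def Pi_iff)
  next
    fix U assume U: "openin Y U"
    show "openin K {x \<in> topspace K. F x (g x) \<in> U}"
    proof (subst openin_subopen, intro ballI)
      fix x0 assume x0: "x0 \<in> {x \<in> topspace K. F x (g x) \<in> U}"
      define V where "V = {x \<in> topspace K. F x0 (g x) \<in> U}"
      have "continuous_map K Y (F x0 \<circ> g)"
        using Fm x0 g continuous_map_compose by blast
      then have "openin K V"
        using openin_continuous_map_preimage[OF _ U] by (fastforce simp: V_def)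
      moreover have "neighbourhood_base_of (closedin K) K"
        using K by (simp add: test_space_def neighbourhood_base_of_closedin compact_Hausdorff_imp_regular_space)
      ultimately obtain W C where W: "openin K W" "closedin K C" "x0 \<in> W" "W \<subseteq> C" "C \<subseteq> V"
        using x0 unfolding neighbourhood_base_of by (force simp: V_def)
      define A where "A = {f \<in> maps X Y. f ` g ` topspace (subtopology K C) \<subseteq> U}"
      have "A \<in> \<S>"
        unfolding \<S>_def A_def
        using K W(2) g U
        by (intro insertI2 CollectI exI[of _ "subtopology K C"] exI[of _ g] exI[of _ U])
           (simp add: test_space_def Hausdorff_space_subtopology continuous_map_from_subtopology
             closedin_compact_space compact_space_subtopology)
      then have "openin K (F -` A \<inter> topspace K)"
        using F' unfolding continuous_on_generated_topo_iff by blast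
      then have o: "openin K (W \<inter> (F -` A \<inter> topspace K))" using W(1) by blast
      have "F x0 \<in> maps X Y"
        using F' x0 unfolding continuous_on_generated_topo_iff \<S>_def by blast
      then have "x0 \<in> W \<inter> (F -` A \<inter> topspace K)"
        using W x0 unfolding A_def V_def by auto
      moreover have "W \<inter> (F -` A \<inter> topspace K) \<subseteq> {x \<in> topspace K. F x (g x) \<in> U}"
        using W unfolding A_def by (auto simp: image_subset_iff)
      ultimately show "\<exists>T. openin K T \<and> x0 \<in> T \<and> T \<subseteq> {x \<in> topspace K. F x (g x) \<in> U}"
        using o by blast
    qed
  qed
qed

text \<open>This is the currying half of the exponential law. The set of \<open>x\<close> for which
  \<open>F x\<close> sends the image of a test space \<open>L\<close> into an open \<open>U\<close>
  is the complement of the projection to \<open>K\<close> of a closed subset of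
  \<open>K \<times> L\<close>, and projecting along the compact \<open>L\<close> preserves closed
  sets. Joint continuity is known only on test maps, so \<open>K \<times> L\<close> has to be a
  k-space; this is where \<open>e\<close> is used.\<close>

lemma continuous_map_kmap_curry:
  fixes K :: "'k topology" and k :: "'k itself" and e :: "real \<Rightarrow> 'k"
  assumes e: "inj e" and K: "test_space K" and X: "is_kspace k X"
    and ext: "\<And>x. x \<in> topspace K \<Longrightarrow> F x \<in> extensional (topspace X)"
    and F: "\<And>(L :: 'k topology) \<alpha> g. test_space L \<Longrightarrow> continuous_map L K \<alpha> \<Longrightarrow>
      continuous_map L X g \<Longrightarrow> continuous_map L Y (\<lambda>x. F (\<alpha> x) (g x))"
  shows "continuous_map K (kmap k X Y) F"
proof -
  have Fm: "F x \<in> maps X Y" if "x \<in> topspace K" for x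
  proof -
    have "continuous_map X Y (F x)"
    proof (rule continuous_map_from_kspace[OF X])
      fix L :: "'k topology" and g assume L: "test_space L" "continuous_map L X g"
      \<comment> \<open>The parameter is frozen at \<open>x\<close> by taking a constant map for
        \<alpha>.\<close>
      have "continuous_map L Y (\<lambda>y. F ((\<lambda>_. x) y) (g y))"
        using that by (intro F L) simp
      then show "continuous_map L Y (F x \<circ> g)" by (simp add: o_def)
    qed
    then show ?thesis using ext that by (simp add: maps_def)
  qed
  have op: "openin K {x \<in> topspace K. F x ` g ` topspace L \<subseteq> U}"
    if L: "test_space L" and g: "continuous_map L X g" and U: "openin Y U" for L :: "'k topology" and g U
  proof -
    have "continuous_map (prod_topology K L) Y (\<lambda>z. F (fst z) (g (snd z)))"
    proof (rule continuous_map_from_kspace[OF is_kspace_prod_test[OF e K L]])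
      fix N :: "'k topology" and h
      assume N: "test_space N" "continuous_map N (prod_topology K L) h"
      then have "continuous_map N K (fst \<circ> h)" "continuous_map N X (g \<circ> (snd \<circ> h))"
        using g by (auto simp: continuous_map_pairwise intro: continuous_map_compose)
      from F[OF N(1) this] show "continuous_map N Y ((\<lambda>z. F (fst z) (g (snd z))) \<circ> h)"
        by (simp add: o_def)
    qed
    then have "closedin (prod_topology K L) {z \<in> topspace (prod_topology K L). F (fst z) (g (snd z)) \<in> topspace Y - U}"
      using U by (intro closedin_continuous_map_preimage) auto
    moreover have "closed_map (prod_topology K L) K fst"
      using L by (simp add: closed_map_fst test_space_def)
    ultimately have "closedin K (fst ` {z \<in> topspace (prod_topology K L). F (fst z) (g (snd z)) \<in> topspace Y - U})"
      by (simp add: closed_map_def)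
    moreover have "{x \<in> topspace K. F x ` g ` topspace L \<subseteq> U}
        = topspace K - fst ` {z \<in> topspace (prod_topology K L). F (fst z) (g (snd z)) \<in> topspace Y - U}"
    proof -
      have "F x (g y) \<in> topspace Y" if "x \<in> topspace K" "y \<in> topspace L" for x y
        using Fm[OF that(1)] g that(2) by (auto simp: maps_def continuous_map_def Pi_iff)
      then show ?thesis by (force simp: image_iff)
    qed
    ultimately show ?thesis by (simp add: openin_diff)
  qed
  show ?thesis
    unfolding kmap_def continuous_map_kify_iff[OF K] continuous_on_generated_topo_iff
  proof (intro conjI allI impI)
    fix U
    assume "U \<in> insert (maps X Y)
     {{f \<in> maps X Y. f ` g ` topspace K \<subseteq> U} | (K :: 'k topology) g U.
        compact_space K \<and> Hausdorff_space K \<and> continuous_map K X g \<and> openin Y U}"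
    then consider "U = maps X Y" | (b) L :: "'k topology" and g V where
        "U = {f \<in> maps X Y. f ` g ` topspace L \<subseteq> V}" "test_space L" "continuous_map L X g" "openin Y V"
      unfolding test_space_def by blast
    then show "openin K (F -` U \<inter> topspace K)"
    proof cases
      case 1
      then have "F -` U \<inter> topspace K = topspace K" using Fm by auto
      then show ?thesis by simp
    next
      case b
      then have "F -` U \<inter> topspace K = {x \<in> topspace K. F x ` g ` topspace L \<subseteq> V}" using Fm by auto
      then show ?thesis using op b by simp
    qed
  next
    show "F ` topspace K \<subseteq> \<Union> (insert (maps X Y)
     {{f \<in> maps X Y. f ` g ` topspace K \<subseteq> U} | (K :: 'k topology) g U.
        compact_space K \<and> Hausdorff_space K \<and> continuous_map K X g \<and> openin Y U})"
      using Fm by blast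
  qed
qed

section \<open>Cubes and their cylinders as k-spaces\<close>

lemma inj_on_cube:
  fixes e :: "real \<Rightarrow> 'k"
  assumes "inj e"
  shows "\<exists>h :: (nat \<Rightarrow> real) \<Rightarrow> 'k. inj_on h (topspace (cube n))"
proof (induction n)
  case 0
  show ?case
    unfolding cube_def topspace_product_topology lessThan_0 PiE_empty_domain
    by (rule exI[of _ "\<lambda>_. undefined"], rule inj_onI) blast
next
  case (Suc n)
  then obtain h :: "(nat \<Rightarrow> real) \<Rightarrow> 'k" where h: "inj_on h (topspace (cube n))" by blast
  obtain p :: "'k \<times> 'k \<Rightarrow> 'k" where p: "inj p" using inj_pair_if_inj_real[OF assms] by blast
  \<comment> \<open>The last coordinate is encoded by \<open>e\<close> and the others by the
    injection of the smaller cube; \<open>p\<close> joins the two codes.\<close>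
  have "inj_on (\<lambda>u. p (h (restrict u {..<n}), e (u n))) (topspace (cube (Suc n)))"
  proof (rule inj_onI)
    fix u v assume u: "u \<in> topspace (cube (Suc n))" and v: "v \<in> topspace (cube (Suc n))"
      and eq: "p (h (restrict u {..<n}), e (u n)) = p (h (restrict v {..<n}), e (v n))"
    have eq': "h (restrict u {..<n}) = h (restrict v {..<n})" "e (u n) = e (v n)"
      using injD[OF p eq] by auto
    have "restrict u {..<n} \<in> topspace (cube n)" "restrict v {..<n} \<in> topspace (cube n)"
      using u v by (auto simp: cube_def PiE_iff)
    then have r: "restrict u {..<n} = restrict v {..<n}" and l: "u n = v n"
      using inj_onD[OF h] injD[OF assms] eq' by metis+
    have "u i = v i" if "i < Suc n" for i
    proof (cases "i = n")
      case False
      have "restrict u {..<n} i = restrict v {..<n} i" by (simp only: r)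
      then show ?thesis using False that by simp
    qed (simp add: l)
    then show "u = v"
      using u v unfolding cube_def topspace_product_topology
      by (intro PiE_ext) auto
  qed
  then show ?case by blast
qed

lemma compact_Hausdorff_unit_interval:
  "compact_space (top_of_set {0..1::real})" "Hausdorff_space (top_of_set {0..1::real})"
  by (simp_all add: compact_space_subtopology Hausdorff_space_subtopology)

lemma compact_Hausdorff_cube: "compact_space (cube n)" "Hausdorff_space (cube n)"
  unfolding cube_def
  using compact_Hausdorff_unit_interval
  by (auto simp only: compact_space_product_topology Hausdorff_space_product_topology)

text \<open>Paths, loops and their homotopies have these spaces as sources. Once they are k-spaces,
  a deformation only has to be continuous on test maps.\<close>

lemma is_kspace_cube_homotopy:
  fixes e :: "real \<Rightarrow> 'k" and k :: "'k itself"
  assumes "inj e"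
  shows "is_kspace k (cube n)" "is_kspace k (top_of_set {0..1::real})"
    "is_kspace k (prod_topology (top_of_set {0..1::real}) (cube n))"
proof -
  obtain h :: "(nat \<Rightarrow> real) \<Rightarrow> 'k" where h: "inj_on h (topspace (cube n))"
    using inj_on_cube[OF assms] by blast
  obtain p :: "'k \<times> 'k \<Rightarrow> 'k" where p: "inj p" using inj_pair_if_inj_real[OF assms] by blast
  show "is_kspace k (cube n)"
    using is_kspace_small_compact_Hausdorff[OF compact_Hausdorff_cube h] .
  note I = compact_Hausdorff_unit_interval
  show "is_kspace k (top_of_set {0..1::real})"
    using is_kspace_small_compact_Hausdorff[OF I inj_on_subset[OF assms]] by simp
  have "inj_on (\<lambda>z. p (e (fst z), h (snd z))) (topspace (prod_topology (top_of_set {0..1::real}) (cube n)))"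
  proof (rule inj_onI)
    fix y z :: "real \<times> (nat \<Rightarrow> real)"
    assume yz: "y \<in> topspace (prod_topology (top_of_set {0..1}) (cube n))"
      "z \<in> topspace (prod_topology (top_of_set {0..1}) (cube n))"
      and "p (e (fst y), h (snd y)) = p (e (fst z), h (snd z))"
    from injD[OF p this(3)] have "e (fst y) = e (fst z)" "h (snd y) = h (snd z)" by auto
    then show "y = z" using yz injD[OF assms] inj_onD[OF h] by (auto simp: prod_eq_iff)
  qed
  moreover have "compact_space (prod_topology (top_of_set {0..1::real}) (cube n))"
    "Hausdorff_space (prod_topology (top_of_set {0..1::real}) (cube n))"
    by (simp_all add: I compact_Hausdorff_cube compact_space_prod_topology Hausdorff_space_prod_topology)
  ultimately show "is_kspace k (prod_topology (top_of_set {0..1::real}) (cube n))"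
    by (intro is_kspace_small_compact_Hausdorff)
qed

section \<open>Block permutations and shifts\<close>

lemma permutes_lessThanI_mset:
  assumes "\<And>i. i < n \<Longrightarrow> f i < n" "\<And>i. i \<ge> n \<Longrightarrow> f i = i" "mset (map f [0..<n]) = mset [0..<n]"
  shows "f permutes {..<n :: nat}"
proof (rule bij_imp_permutes)
  have "distinct (map f [0..<n])" "set (map f [0..<n]) = set [0..<n]"
    using assms(3) by (metis distinct_upt mset_eq_imp_distinct_iff) (metis assms(3) mset_eq_setD)
  then show "bij_betw f {..<n} {..<n}"
    by (auto simp: bij_betw_def distinct_map atLeast0LessThan)
qed (use assms(2) in auto)

text \<open>Applied to \<open>[0..<n]\<close>, whose entries are their own positions,
  \<open>permute_list\<close> displays the values of the permutation. Users of the lemma cut an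
  arbitrary list into blocks and compare two rearrangements.\<close>

lemma permute_list_eq_imp_eq:
  fixes \<sigma> \<tau> :: "nat \<Rightarrow> nat"
  assumes "\<sigma> permutes {..<n}" "\<tau> permutes {..<n}"
    and "\<And>xs :: nat list. length xs = n \<Longrightarrow> permute_list \<sigma> xs = permute_list \<tau> xs"
  shows "\<sigma> = \<tau>"
proof
  fix i
  show "\<sigma> i = \<tau> i"
  proof (cases "i < n")
    case True
    have "permute_list \<sigma> [0..<n] ! i = permute_list \<tau> [0..<n] ! i" using assms(3) by simp
    then show ?thesis
      using True assms(1,2) permutes_in_image[OF assms(1)] permutes_in_image[OF assms(2)]
      by (simp add: permute_list_nth)
  qed (use assms in \<open>simp add: permutes_def\<close>)
qed

lemma permutes_less:
  "\<sigma> permutes {..<n} \<Longrightarrow> \<sigma> i < n \<longleftrightarrow> i < n"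
  using permutes_in_image[of \<sigma> "{..<n}" i] by simp

lemma permute_list_update:
  assumes "\<sigma> permutes {..<length xs}" "i < length xs"
  shows "(permute_list \<sigma> xs)[i := x] = permute_list \<sigma> (xs[\<sigma> i := x])"
  using assms permutes_inj[OF assms(1)]
  by (intro nth_equalityI)
     (auto simp: permute_list_nth nth_list_update permutes_less inj_eq)

lemma concat_nth_split:
  "i < length xss \<Longrightarrow> concat xss = concat (take i xss) @ xss ! i @ concat (drop (Suc i) xss)"
  by (metis concat.simps(2) concat_append id_take_nth_drop)

lemma length_concat_take:
  "map length xss = ks \<Longrightarrow> length (concat (take i xss)) = sum_list (take i ks)"
  by (auto simp: length_concat take_map)

lemma exists_blocks:
  assumes "length xs = sum_list ks"
  obtains xss where "concat xss = xs" "map length xss = ks"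
  using assms
proof (induction ks arbitrary: xs thesis)
  case (Cons k ks)
  obtain xss where "concat xss = drop k xs" "map length xss = ks"
    by (rule Cons.IH[of "drop k xs"]) (use Cons.prems in simp_all)
  then show ?case using Cons.prems by (intro Cons.prems(1)[of "take k xs # xss"]) simp_all
qed simp

lemma sum_list_concat: "sum_list (concat xss) = sum_list (map sum_list xss)"
  by (induction xss) simp_all

lemma concat_concat: "concat (concat xsss) = concat (map concat xsss)"
  by (induction xsss) simp_all

subsection \<open>Block permutations\<close>

lemma length_blocks [simp]: "length (blocks ks) = length ks"
  by (simp add: blocks_def)

lemma blocks_nth: "i < length ks \<Longrightarrow> blocks ks ! i = [sum_list (take i ks)..<sum_list (take (Suc i) ks)]"
  by (simp add: blocks_def)

text \<open>An index in block \<open>i\<close> is the total length of the earlier lists plus a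
  position inside the \<open>i\<close>-th list.\<close>

lemma map_nth_concat_blocks:
  assumes "map length xss = ks"
  shows "map (map ((!) (concat xss))) (blocks ks) = xss"
proof (rule nth_equalityI)
  show "length (map (map ((!) (concat xss))) (blocks ks)) = length xss" using assms by auto
next
  fix i assume "i < length (map (map ((!) (concat xss))) (blocks ks))"
  then have i: "i < length xss" "i < length ks" using assms by auto
  have ki: "ks ! i = length (xss ! i)" using assms i by auto
  have s: "sum_list (take (Suc i) ks) = sum_list (take i ks) + ks ! i"
    using i by (simp add: take_Suc_conv_app_nth)
  have "map ((!) (concat xss)) (blocks ks ! i) = xss ! i"
    using i assms
    by (intro nth_equalityI)
       (simp_all add: blocks_nth s ki concat_nth_split[OF i(1)] length_concat_take nth_append)
  then show "map (map ((!) (concat xss))) (blocks ks) ! i = xss ! i" using i by simp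
qed

text \<open>Cut \<open>[0..<sum_list ks]\<close> into pieces of sizes \<open>ks\<close>. Reading its
  entries at the indices in \<open>blocks ks\<close> gives these pieces; since every entry is its
  own index, the pieces are the blocks themselves.\<close>

lemma concat_blocks: "concat (blocks ks) = [0..<sum_list ks]"
proof -
  obtain xss where x: "concat xss = [0..<sum_list ks]" "map length xss = ks"
    using exists_blocks[of "[0..<sum_list ks]" ks] by auto
  have "set (blocks ks ! i) \<subseteq> {..<sum_list ks}" if "i < length ks" for i
  proof -
    have "sum_list (take (Suc i) ks) \<le> sum_list (take (Suc i) ks @ drop (Suc i) ks)"
      by (simp only: sum_list_append le_add1)
    then show ?thesis using that by (auto simp: blocks_nth)
  qed
  then have sub: "\<forall>b\<in>set (blocks ks). \<forall>a\<in>set b. a < sum_list ks"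
    by (force simp: in_set_conv_nth)
  have "xss = map (map ((!) [0..<sum_list ks])) (blocks ks)"
    using map_nth_concat_blocks[OF x(2)] x(1) by simp
  also have "\<dots> = blocks ks"
    using sub by (intro map_idI) (auto intro: map_idI)
  finally show ?thesis using x(1) by simp
qed

lemma mset_concat_permute_list:
  assumes "\<sigma> permutes {..<length xss}"
  shows "mset (concat (permute_list \<sigma> xss)) = mset (concat xss)"
proof -
  have "mset (concat yss) = sum_mset (image_mset mset (mset yss))" for yss :: "'a list list"
    by (simp add: mset_concat flip: sum_mset_sum_list)
  then show ?thesis using assms by simp
qed

lemma length_concat_permute_blocks:
  assumes "\<sigma> permutes {..<length ks}"
  shows "length (concat (permute_list \<sigma> (blocks ks))) = sum_list ks"
proof -
  have "mset (concat (permute_list \<sigma> (blocks ks))) = mset [0..<sum_list ks]"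
    using mset_concat_permute_list[of \<sigma> "blocks ks"] assms by (simp add: concat_blocks)
  from mset_eq_length[OF this] show ?thesis by simp
qed

lemma map_block_perm:
  assumes "\<sigma> permutes {..<length ks}"
  shows "map (block_perm \<sigma> ks) [0..<sum_list ks] = concat (permute_list \<sigma> (blocks ks))"
  by (rule nth_equalityI) (simp_all add: length_concat_permute_blocks[OF assms] block_perm_def Let_def)

lemma block_perm_permutes:
  assumes "\<sigma> permutes {..<length ks}"
  shows "block_perm \<sigma> ks permutes {..<sum_list ks}"
proof (rule permutes_lessThanI_mset)
  let ?L = "concat (permute_list \<sigma> (blocks ks))"
  have m: "mset ?L = mset [0..<sum_list ks]"
    using mset_concat_permute_list[of \<sigma> "blocks ks"] assms by (simp add: concat_blocks)
  show "mset (map (block_perm \<sigma> ks) [0..<sum_list ks]) = mset [0..<sum_list ks]"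
    using m by (simp only: map_block_perm[OF assms])
  fix i
  show "block_perm \<sigma> ks i < sum_list ks" if "i < sum_list ks"
  proof -
    have "?L ! i \<in> set ?L" using that by (intro nth_mem) (simp only: length_concat_permute_blocks[OF assms])
    also have "set ?L = set [0..<sum_list ks]" using m by (rule mset_eq_setD)
    finally show ?thesis
      using that by (simp add: block_perm_def Let_def length_concat_permute_blocks[OF assms])
  qed
  show "block_perm \<sigma> ks i = i" if "i \<ge> sum_list ks"
    using that by (simp add: block_perm_def Let_def length_concat_permute_blocks[OF assms])
qed

lemma permute_list_eq_map: "permute_list f xs = map ((!) xs) (map f [0..<length xs])"
  by (simp add: permute_list_def)

text \<open>This is the meaning of \<open>block_perm\<close>: whole blocks are moved and keep their
  inner order. The indices listed by the permuted blocks pick out of \<open>concat xss\<close>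
  exactly the permuted lists.\<close>

lemma permute_list_block_perm:
  assumes "\<sigma> permutes {..<length xss}" "map length xss = ks"
  shows "permute_list (block_perm \<sigma> ks) (concat xss) = concat (permute_list \<sigma> xss)"
proof -
  have l: "length ks = length xss" "length (concat xss) = sum_list ks"
    using assms(2) by (auto simp: length_concat)
  have "permute_list (block_perm \<sigma> ks) (concat xss)
      = map ((!) (concat xss)) (concat (permute_list \<sigma> (blocks ks)))"
    using assms l by (simp only: permute_list_eq_map[of _ "concat xss"] map_block_perm)
  also have "\<dots> = concat (permute_list \<sigma> (map (map ((!) (concat xss))) (blocks ks)))"
    using assms l by (simp add: map_concat permute_list_map)
  finally show ?thesis by (simp only: map_nth_concat_blocks[OF assms(2)])
qed

text \<open>Every list of length \<open>sum_list ks\<close> can be cut into blocks of the given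
  sizes, so a permutation is determined by its effect on concatenated blocks. Most identities for
  \<open>block_perm\<close> are checked through this characterisation.\<close>

lemma block_perm_eqI:
  assumes "\<sigma> permutes {..<length ks}" "\<pi> permutes {..<sum_list ks}"
    and "\<And>xss :: nat list list. map length xss = ks \<Longrightarrow>
      permute_list \<pi> (concat xss) = concat (permute_list \<sigma> xss)"
  shows "\<pi> = block_perm \<sigma> ks"
proof (rule permute_list_eq_imp_eq[OF assms(2) block_perm_permutes[OF assms(1)]])
  fix xs :: "nat list" assume "length xs = sum_list ks"
  then obtain xss where "concat xss = xs" "map length xss = ks" using exists_blocks by blast
  then show "permute_list \<pi> xs = permute_list (block_perm \<sigma> ks) xs"
    using assms(1,3) permute_list_block_perm[of \<sigma> xss ks] by auto
qed

lemma block_perm_id [simp]: "block_perm id ks = id"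
  by (rule block_perm_eqI[symmetric]) (simp_all add: permutes_id)

lemma concat_map_singleton: "concat (map (\<lambda>x. [x]) xs) = xs"
  by (induction xs) auto

lemma block_perm_singletons:
  assumes "\<sigma> permutes {..<n}"
  shows "block_perm \<sigma> (replicate n 1) = \<sigma>"
proof (rule block_perm_eqI[symmetric])
  fix xss :: "nat list list" assume x: "map length xss = replicate n 1"
  then have n: "length xss = n" by (metis length_map length_replicate)
  have "xss ! i = [hd (xss ! i)]" if "i < length xss" for i
  proof -
    have "length (xss ! i) = 1" using arg_cong[OF x, of "\<lambda>l. l ! i"] that n by simp
    then show ?thesis by (cases "xss ! i") auto
  qed
  then have "xss = map (\<lambda>x. [x]) (map hd xss)"
    by (intro nth_equalityI) simp_all
  then obtain xs where xs: "xss = map (\<lambda>x. [x]) xs" by blast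
  then show "permute_list \<sigma> (concat xss) = concat (permute_list \<sigma> xss)"
    using assms n by (simp only: concat_map_singleton) (simp add: permute_list_map concat_map_singleton)
qed (use assms in \<open>simp_all add: sum_list_replicate\<close>)

lemma sum_list_permute_list:
  fixes ks :: "nat list"
  shows "\<sigma> permutes {..<length ks} \<Longrightarrow> sum_list (permute_list \<sigma> ks) = sum_list ks"
  by (simp flip: sum_mset_sum_list)

text \<open>The second rearrangement meets the blocks in the order produced by the first, hence the
  sizes \<open>permute_list \<sigma> ks\<close>.\<close>

lemma block_perm_comp:
  assumes "\<sigma> permutes {..<length ks}" "\<tau> permutes {..<length ks}"
  shows "block_perm \<sigma> ks \<circ> block_perm \<tau> (permute_list \<sigma> ks) = block_perm (\<sigma> \<circ> \<tau>) ks"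
proof -
  have \<tau>: "block_perm \<tau> (permute_list \<sigma> ks) permutes {..<sum_list ks}"
    using block_perm_permutes[of \<tau> "permute_list \<sigma> ks"] assms by (simp add: sum_list_permute_list)
  show ?thesis
  proof (rule block_perm_eqI)
    fix xss :: "nat list list" assume x: "map length xss = ks"
    then have l: "length xss = length ks" "length (concat xss) = sum_list ks" by (auto simp: length_concat)
    have m: "map length (permute_list \<sigma> xss) = permute_list \<sigma> ks"
      using x l assms by (metis permute_list_map)
    show "permute_list (block_perm \<sigma> ks \<circ> block_perm \<tau> (permute_list \<sigma> ks)) (concat xss)
        = concat (permute_list (\<sigma> \<circ> \<tau>) xss)"
      using assms l x m \<tau> by (simp add: permute_list_compose permute_list_block_perm)
  qed (use assms \<tau> block_perm_permutes permutes_compose in blast)+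
qed

text \<open>Blocks are moved together with the smaller blocks inside them. A list is cut on two
  levels, into \<open>ysss\<close>, and flattening the levels in either order gives the same list.
  Read with root edges as the smaller blocks, this computes the leaf permutation induced by
  permuting groups of root edges.\<close>

lemma block_perm_block_perm:
  assumes "\<sigma> permutes {..<length lss}"
  shows "block_perm (block_perm \<sigma> (map length lss)) (concat lss) = block_perm \<sigma> (map sum_list lss)"
proof (rule block_perm_eqI)
  have p: "block_perm \<sigma> (map length lss) permutes {..<length (concat lss)}"
    using block_perm_permutes[of \<sigma> "map length lss"] assms by (simp add: length_concat)
  show "block_perm (block_perm \<sigma> (map length lss)) (concat lss) permutes {..<sum_list (map sum_list lss)}"
    using block_perm_permutes[OF p] by (simp add: sum_list_concat)
  fix xss :: "nat list list" assume x: "map length xss = map sum_list lss"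
  have "\<exists>ysss. map concat ysss = xss \<and> map (map length) ysss = lss"
    using x
  proof (induction lss arbitrary: xss)
    case (Cons ls lss)
    then obtain xs xss' where xs: "xss = xs # xss'" "length xs = sum_list ls" "map length xss' = map sum_list lss"
      by auto
    obtain yss where "concat yss = xs" "map length yss = ls" using exists_blocks[OF xs(2)] by blast
    moreover obtain ysss where "map concat ysss = xss' \<and> map (map length) ysss = lss"
      using Cons.IH[OF xs(3)] by blast
    ultimately show ?case using xs by (intro exI[of _ "yss # ysss"]) simp
  qed simp
  then obtain ysss where y: "map concat ysss = xss" "map (map length) ysss = lss" by blast
  have l: "length ysss = length lss" using y by auto
  have c: "map length (concat ysss) = concat lss" using y by (simp add: map_concat)
  have lc: "length (concat ysss) = length (concat lss)" using c by (metis length_map)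
  have l2: "map length ysss = map length lss" using y(2) by auto
  have "permute_list (block_perm (block_perm \<sigma> (map length lss)) (concat lss)) (concat (concat ysss))
      = concat (permute_list (block_perm \<sigma> (map length lss)) (concat ysss))"
    by (rule permute_list_block_perm[OF _ c]) (simp only: lc p)
  also have "\<dots> = concat (concat (permute_list \<sigma> ysss))"
    using assms l l2 by (simp add: permute_list_block_perm)
  also have "\<dots> = concat (permute_list \<sigma> (map concat ysss))"
    using assms l by (simp add: permute_list_map concat_concat)
  finally show "permute_list (block_perm (block_perm \<sigma> (map length lss)) (concat lss)) (concat xss)
      = concat (permute_list \<sigma> xss)"
    using y by (metis concat_concat)
qed (use assms in simp)

subsection \<open>Shifted permutations\<close>

lemma shift_perm_permutes:
  assumes "\<tau> permutes {..<k}" "s + k \<le> n"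
  shows "shift_perm s \<tau> permutes {..<n}"
proof -
  have "shift_perm s \<tau> permutes {s..<s + k}"
  proof (rule bij_imp_permutes)
    show "bij_betw (shift_perm s \<tau>) {s..<s + k} {s..<s + k}"
      using permutes_inverses[OF assms(1)] permutes_less[OF assms(1)] permutes_less[OF permutes_inv[OF assms(1)]]
      by (intro bij_betw_byWitness[where f' = "\<lambda>a. s + inv \<tau> (a - s)"]) (auto simp: shift_perm_def)
  qed (use assms in \<open>auto simp: shift_perm_def permutes_def\<close>)
  then show ?thesis by (rule permutes_subset) (use assms in auto)
qed

lemma permute_list_shift_perm:
  assumes "\<tau> permutes {..<length ys}"
  shows "permute_list (shift_perm (length xs) \<tau>) (xs @ ys @ zs) = xs @ permute_list \<tau> ys @ zs"
proof (rule nth_equalityI)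
  fix i assume "i < length (permute_list (shift_perm (length xs) \<tau>) (xs @ ys @ zs))"
  then have i: "i < length (xs @ ys @ zs)" by simp
  have p: "shift_perm (length xs) \<tau> permutes {..<length (xs @ ys @ zs)}"
    using assms by (rule shift_perm_permutes) simp
  consider "i < length xs" | "length xs \<le> i" "i < length xs + length ys" | "length xs + length ys \<le> i"
    by linarith
  then show "permute_list (shift_perm (length xs) \<tau>) (xs @ ys @ zs) ! i = (xs @ permute_list \<tau> ys @ zs) ! i"
  proof cases
    case 2
    then have "i - length xs < length ys" by linarith
    then show ?thesis
      using 2 i assms permutes_less[OF assms]
      by (simp add: permute_list_nth[OF p i] shift_perm_def nth_append permute_list_nth)
  next
    case 3
    then have "\<tau> (i - length xs) = i - length xs" "\<not> i - length xs < length ys"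
      using assms by (simp_all add: permutes_def)
    then show ?thesis
      using 3 i assms by (simp add: permute_list_nth[OF p i] shift_perm_def nth_append)
  qed (simp add: permute_list_nth[OF p i] shift_perm_def nth_append)
qed simp

lemma shift_perm_0 [simp]: "shift_perm 0 \<tau> = \<tau>"
  by (auto simp: shift_perm_def)

lemma shift_perm_shift_perm: "shift_perm s (shift_perm r \<tau>) = shift_perm (s + r) \<tau>"
  by (auto simp: shift_perm_def fun_eq_iff diff_diff_add)

lemma sum_list_take_Suc_le:
  fixes ks :: "nat list"
  assumes "j < length ks"
  shows "sum_list (take j ks) + ks ! j \<le> sum_list ks"
proof -
  have "ks = take j ks @ ks ! j # drop (Suc j) ks" using assms by (rule id_take_nth_drop)
  then have "sum_list ks = sum_list (take j ks) + (ks ! j + sum_list (drop (Suc j) ks))"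
    by (metis sum_list.Cons sum_list_append)
  then show ?thesis by simp
qed

lemma permute_list_shift_perm_concat:
  assumes "j < length xss" "\<rho> permutes {..<length (xss ! j)}" "map length xss = ks"
  shows "permute_list (shift_perm (sum_list (take j ks)) \<rho>) (concat xss)
    = concat (xss[j := permute_list \<rho> (xss ! j)])"
proof -
  have "concat (xss[j := permute_list \<rho> (xss ! j)])
      = concat (take j xss) @ permute_list \<rho> (xss ! j) @ concat (drop (Suc j) xss)"
    using assms(1) concat_nth_split[of j "xss[j := permute_list \<rho> (xss ! j)]"] by simp
  then show ?thesis
    using permute_list_shift_perm[OF assms(2), of "concat (take j xss)" "concat (drop (Suc j) xss)"]
      concat_nth_split[OF assms(1)] length_concat_take[OF assms(3)] by simp
qed

text \<open>A permutation inside one block commutes with moving the blocks once its offset is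
  adjusted: after the move, the block in position \<open>j\<close> is the former block
  \<open>\<sigma> j\<close>. It is used where a root permutation meets a permutation of the edges of
  a higher vertex.\<close>

lemma shift_perm_block_perm:
  assumes \<sigma>: "\<sigma> permutes {..<length ks}" and j: "j < length ks" and \<rho>: "\<rho> permutes {..<ks ! \<sigma> j}"
  shows "shift_perm (sum_list (take (\<sigma> j) ks)) \<rho> \<circ> block_perm \<sigma> ks
    = block_perm \<sigma> ks \<circ> shift_perm (sum_list (take j (permute_list \<sigma> ks))) \<rho>"
proof -
  have \<sigma>j: "\<sigma> j < length ks" using \<sigma> j by (simp add: permutes_less)
  have kj: "permute_list \<sigma> ks ! j = ks ! \<sigma> j" using \<sigma> j by (rule permute_list_nth)
  have p1: "shift_perm (sum_list (take (\<sigma> j) ks)) \<rho> permutes {..<sum_list ks}"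
    using \<rho> by (rule shift_perm_permutes) (rule sum_list_take_Suc_le[OF \<sigma>j])
  have p2: "shift_perm (sum_list (take j (permute_list \<sigma> ks))) \<rho> permutes {..<sum_list ks}"
    using \<rho> sum_list_take_Suc_le[of j "permute_list \<sigma> ks"] j \<sigma> kj
    by (intro shift_perm_permutes) (simp_all add: sum_list_permute_list)
  note pb = block_perm_permutes[OF \<sigma>]
  show ?thesis
  proof (rule permute_list_eq_imp_eq[OF permutes_compose[OF pb p1] permutes_compose[OF p2 pb]])
    fix xs :: "nat list" assume "length xs = sum_list ks"
    then obtain xss where x: "concat xss = xs" "map length xss = ks" using exists_blocks by blast
    then have l: "length xss = length ks" "length xs = sum_list ks" by (auto simp: length_concat)
    have lj: "length (xss ! \<sigma> j) = ks ! \<sigma> j" using arg_cong[OF x(2), of "\<lambda>l. l ! \<sigma> j"] \<sigma>j l by simp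
    have m: "map length (permute_list \<sigma> xss) = permute_list \<sigma> ks"
      using x l \<sigma> by (metis permute_list_map)
    have m': "map length (xss[\<sigma> j := permute_list \<rho> (xss ! \<sigma> j)]) = ks"
      using x lj by (metis length_permute_list list_update_id map_update)
    have "permute_list (shift_perm (sum_list (take (\<sigma> j) ks)) \<rho> \<circ> block_perm \<sigma> ks) xs
        = permute_list (block_perm \<sigma> ks) (concat (xss[\<sigma> j := permute_list \<rho> (xss ! \<sigma> j)]))"
      using pb l \<sigma>j \<rho> lj
      by (simp add: permute_list_compose permute_list_shift_perm_concat x flip: x(1))
    also have "\<dots> = concat (permute_list \<sigma> (xss[\<sigma> j := permute_list \<rho> (xss ! \<sigma> j)]))"
      using \<sigma> l m' by (intro permute_list_block_perm) simp_all
    also have "\<dots> = concat ((permute_list \<sigma> xss)[j := permute_list \<rho> (xss ! \<sigma> j)])"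
      using \<sigma> l j by (simp add: permute_list_update)
    also have "\<dots> = permute_list (shift_perm (sum_list (take j (permute_list \<sigma> ks))) \<rho>) (concat (permute_list \<sigma> xss))"
      using \<sigma> l j \<rho> lj m
      by (subst permute_list_shift_perm_concat) (simp_all add: permute_list_nth)
    also have "\<dots> = permute_list (block_perm \<sigma> ks \<circ> shift_perm (sum_list (take j (permute_list \<sigma> ks))) \<rho>) xs"
      using p2 l \<sigma> x by (simp add: permute_list_compose flip: permute_list_block_perm)
    finally show "permute_list (shift_perm (sum_list (take (\<sigma> j) ks)) \<rho> \<circ> block_perm \<sigma> ks) xs
      = permute_list (block_perm \<sigma> ks \<circ> shift_perm (sum_list (take j (permute_list \<sigma> ks))) \<rho>) xs" .
  qed
qed

text \<open>Here \<open>lss ! i\<close> lists the sizes of the blocks in group \<open>i\<close>.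
  Rearranging the blocks of one group moves only the entries of that group, and these start after
  all entries of the earlier groups.\<close>

lemma block_perm_shift_perm:
  assumes i: "i < length lss" and \<tau>: "\<tau> permutes {..<length (lss ! i)}"
  shows "block_perm (shift_perm (sum_list (take i (map length lss))) \<tau>) (concat lss)
    = shift_perm (sum_list (take i (map sum_list lss))) (block_perm \<tau> (lss ! i))"
proof (rule block_perm_eqI[symmetric])
  show "shift_perm (sum_list (take i (map length lss))) \<tau> permutes {..<length (concat lss)}"
    using \<tau> sum_list_take_Suc_le[of i "map length lss"] i
    by (intro shift_perm_permutes) (simp_all add: length_concat)
  show "shift_perm (sum_list (take i (map sum_list lss))) (block_perm \<tau> (lss ! i)) permutes
      {..<sum_list (concat lss)}"
    using block_perm_permutes[OF \<tau>] sum_list_take_Suc_le[of i "map sum_list lss"] i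
    by (intro shift_perm_permutes) (simp_all add: sum_list_concat)
  fix xss :: "nat list list" assume x: "map length xss = concat lss"
  define a where "a = sum_list (take i (map length lss))"
  have a: "a = length (concat (take i lss))" by (simp add: a_def length_concat take_map)
  define A B C where "A = take a xss" and "B = take (length (lss ! i)) (drop a xss)"
    and "C = drop (a + length (lss ! i)) xss"
  have xs: "xss = A @ B @ C" unfolding A_def B_def C_def
    by (metis add.commute append_take_drop_id drop_drop)
  have L: "concat lss = concat (take i lss) @ lss ! i @ concat (drop (Suc i) lss)"
    using i by (rule concat_nth_split)
  have A: "map length A = concat (take i lss)"
    unfolding A_def by (simp add: x L a flip: take_map)
  have B: "map length B = lss ! i"
    unfolding B_def by (simp add: x L a flip: take_map drop_map)
  have lA: "length A = a" and lB: "length B = length (lss ! i)"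
    using A B a by (metis length_map)+
  have cA: "length (concat A) = sum_list (take i (map sum_list lss))"
    by (simp add: length_concat A sum_list_concat take_map)
  have cB: "length (concat B) = sum_list (lss ! i)" by (simp add: length_concat B)
  have "permute_list (shift_perm (length (concat A)) (block_perm \<tau> (lss ! i))) (concat A @ concat B @ concat C)
      = concat A @ concat (permute_list \<tau> B) @ concat C"
    using block_perm_permutes[OF \<tau>] cB B lB \<tau>
    by (simp add: permute_list_shift_perm permute_list_block_perm)
  also have "\<dots> = concat (permute_list (shift_perm (length A) \<tau>) (A @ B @ C))"
    using \<tau> lB by (simp add: permute_list_shift_perm)
  finally show "permute_list (shift_perm (sum_list (take i (map sum_list lss))) (block_perm \<tau> (lss ! i))) (concat xss)
      = concat (permute_list (shift_perm (sum_list (take i (map length lss))) \<tau>) xss)"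
    by (simp add: xs cA lA a_def)
qed

subsection \<open>Permutations of partial compositions\<close>

lemma circ_perm_id: "\<tau> permutes {..<m} \<Longrightarrow> circ_perm m i id \<tau> = shift_perm i \<tau>"
  by (auto simp: circ_perm_def shift_perm_def fun_eq_iff permutes_def)

lemma upt_split3: "i < n \<Longrightarrow> [0..<n + m - 1] = [0..<i] @ [i..<i + m] @ [i + m..<n + m - 1]"
  by (rule nth_equalityI) (auto simp: nth_append)

text \<open>The inputs of a partial composite are seen as \<open>n\<close> blocks, one for each
  input of the first operation: singletons, except that block \<open>\<sigma> i\<close> consists of
  the \<open>m\<close> inputs of the second. The permutation moves the blocks by \<sigma> and
  rearranges the exceptional one, which arrives in position \<open>i\<close>, by \<tau>.\<close>

lemma permute_list_circ_perm:
  assumes \<sigma>: "\<sigma> permutes {..<n}" and i: "i < n" and \<tau>: "\<tau> permutes {..<m}"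
    and z: "length zss = n" "\<And>b. b < n \<Longrightarrow> length (zss ! b) = (if b = \<sigma> i then m else 1)"
  shows "permute_list (circ_perm m i \<sigma> \<tau>) (concat zss)
    = concat ((permute_list \<sigma> zss)[i := permute_list \<tau> (zss ! \<sigma> i)])"
proof -
  \<comment> \<open>For \<open>b \<noteq> \<sigma> i\<close> this is the place of input
    \<open>b\<close> of the first operation in the composite. In the second case then
    \<open>b > \<sigma> i\<close>, so \<open>b + m - 1\<close> is not truncated even for
    \<open>m = 0\<close>.\<close>
  define sh where "sh b = (if b < \<sigma> i then b else b + m - 1)" for b
  define L where "L = concat zss"
  have \<sigma>i: "\<sigma> i < n" using \<sigma> i by (simp add: permutes_less)
  have tk: "length (concat (take b zss)) = sh b" if "b < n" "b \<noteq> \<sigma> i" for b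
  proof -
    have "length (concat (take b zss)) = (\<Sum>c<b. length (zss ! c))"
      using that z(1) by (simp add: length_concat sum_list_sum_nth atLeast0LessThan)
    also have "\<dots> = (\<Sum>c<b. if c = \<sigma> i then m else 1)"
      using that z by (intro sum.cong) auto
    also have "\<dots> = sh b"
    proof (cases "\<sigma> i < b")
      case True
      have "(\<Sum>c<b. if c = \<sigma> i then m else 1) = m + (\<Sum>c\<in>{..<b} - {\<sigma> i}. 1)"
        using True by (subst sum.remove[of _ "\<sigma> i"]) (auto intro!: sum.cong)
      then show ?thesis using True by (simp add: sh_def)
    next
      case False
      then show ?thesis using that by (simp add: sh_def)
    qed
    finally show ?thesis .
  qed
  have tki: "length (concat (take (\<sigma> i) zss)) = \<sigma> i"
  proof -
    have "length (concat (take (\<sigma> i) zss)) = (\<Sum>c<\<sigma> i. length (zss ! c))"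
      using \<sigma>i z(1) by (simp add: length_concat sum_list_sum_nth atLeast0LessThan)
    also have "\<dots> = (\<Sum>c<\<sigma> i. 1)" using \<sigma>i z by (intro sum.cong) auto
    finally show ?thesis by simp
  qed
  have val: "[L ! sh b] = zss ! b" if "b < n" "b \<noteq> \<sigma> i" for b
  proof -
    have "length (zss ! b) = 1" using that z by simp
    then obtain y where y: "zss ! b = [y]" by (metis One_nat_def length_0_conv length_Suc_conv)
    have "L = concat (take b zss) @ zss ! b @ concat (drop (Suc b) zss)"
      unfolding L_def using that z by (intro concat_nth_split) simp
    then have "L ! sh b = y" using tk[OF that] y by (metis append_Cons nth_append_length)
    then show ?thesis using y by simp
  qed
  have val': "L ! (\<sigma> i + c) = zss ! \<sigma> i ! c" if "c < m" for c
  proof -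
    have "L = concat (take (\<sigma> i) zss) @ zss ! \<sigma> i @ concat (drop (Suc (\<sigma> i)) zss)"
      unfolding L_def using \<sigma>i z by (intro concat_nth_split) simp
    moreover have "c < length (zss ! \<sigma> i)" using that z \<sigma>i by simp
    ultimately show ?thesis using tki by (simp add: nth_append)
  qed
  have len: "length L = n + m - 1"
  proof -
    have "length L = (\<Sum>c<n. length (zss ! c))"
      using z(1) by (simp add: L_def length_concat sum_list_sum_nth atLeast0LessThan)
    also have "\<dots> = (\<Sum>c<n. if c = \<sigma> i then m else 1)" using z by (intro sum.cong) auto
    also have "\<dots> = m + (\<Sum>c\<in>{..<n} - {\<sigma> i}. 1)"
      using \<sigma>i by (subst sum.remove[of _ "\<sigma> i"]) (auto intro!: sum.cong)
    finally show ?thesis using \<sigma>i by simp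
  qed
  have inj: "\<sigma> a = \<sigma> i \<longleftrightarrow> a = i" for a using permutes_inj[OF \<sigma>] by (auto simp: inj_eq)
  let ?c = "circ_perm m i \<sigma> \<tau>"
  have 1: "map ((!) L \<circ> ?c) [0..<i] = concat (map (\<lambda>a. zss ! \<sigma> a) [0..<i])"
  proof -
    have "map ((!) L \<circ> ?c) [0..<i] = concat (map (\<lambda>a. [L ! ?c a]) [0..<i])"
      using concat_map_singleton[of "map ((!) L \<circ> ?c) [0..<i]"] by (simp add: o_def)
    also have "\<dots> = concat (map (\<lambda>a. zss ! \<sigma> a) [0..<i])"
      using i val inj permutes_less[OF \<sigma>]
      by (intro arg_cong[of _ _ concat] map_cong) (auto simp: circ_perm_def Let_def sh_def[symmetric])
    finally show ?thesis .
  qed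
  have 2: "map ((!) L \<circ> ?c) [i..<i + m] = permute_list \<tau> (zss ! \<sigma> i)"
    using z \<sigma>i val' \<tau> permutes_less[OF \<tau>]
    by (intro nth_equalityI) (auto simp: circ_perm_def permute_list_nth)
  have 3: "map ((!) L \<circ> ?c) [i + m..<n + m - 1] = concat (map (\<lambda>a. zss ! \<sigma> a) [Suc i..<n])"
  proof -
    \<comment> \<open>A position \<open>a\<close> beyond the exceptional block belongs to input
      \<open>a + 1 - m\<close> of the permuted first operation, which runs through the inputs after
      \<open>i\<close>.\<close>
    have "map ((!) L \<circ> ?c) [i + m..<n + m - 1] = map (\<lambda>a. L ! sh (\<sigma> a)) [Suc i..<n]"
      using i by (intro nth_equalityI) (auto simp: circ_perm_def Let_def sh_def[symmetric])
    also have "\<dots> = concat (map (\<lambda>a. [L ! sh (\<sigma> a)]) [Suc i..<n])"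
      using concat_map_singleton[of "map (\<lambda>a. L ! sh (\<sigma> a)) [Suc i..<n]"] by (simp add: o_def)
    also have "\<dots> = concat (map (\<lambda>a. zss ! \<sigma> a) [Suc i..<n])"
      using i val inj permutes_less[OF \<sigma>]
      by (intro arg_cong[of _ _ concat] map_cong) auto
    finally show ?thesis .
  qed
  have "permute_list ?c L = map ((!) L \<circ> ?c) [0..<n + m - 1]"
    by (simp add: permute_list_def len)
  also have "\<dots> = concat (map (\<lambda>a. zss ! \<sigma> a) [0..<i] @ permute_list \<tau> (zss ! \<sigma> i) # map (\<lambda>a. zss ! \<sigma> a) [Suc i..<n])"
    by (simp only: upt_split3[OF i] map_append 1 2 3 concat_append concat.simps)
  also have "map (\<lambda>a. zss ! \<sigma> a) [0..<i] @ permute_list \<tau> (zss ! \<sigma> i) # map (\<lambda>a. zss ! \<sigma> a) [Suc i..<n]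
      = (permute_list \<sigma> zss)[i := permute_list \<tau> (zss ! \<sigma> i)]"
    using i z(1) by (simp add: upd_conv_take_nth_drop permute_list_def take_map drop_map)
  finally show ?thesis by (simp add: L_def)
qed

lemma sum_list_update_Suc:
  fixes ks :: "nat list"
  assumes "j < length ks" "r < ks ! j"
  shows "sum_list (ks[j := ks ! j + m - 1]) = sum_list ks + m - 1"
  using assms sum_list_take_Suc_le[of j ks] by (simp add: sum_list_update)

lemma circ_perm_less:
  assumes "\<sigma> permutes {..<n}" "i < n" "\<tau> permutes {..<m}" "a < n + m - 1"
  shows "circ_perm m i \<sigma> \<tau> a < n + m - 1"
proof -
  consider "a < i" | "i \<le> a" "a < i + m" | "i + m \<le> a" by linarith
  then show ?thesis
  proof cases
    case 1
    then have "\<sigma> a < n" "\<sigma> i < n" "\<sigma> a \<noteq> \<sigma> i"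
      using assms permutes_inj[OF assms(1)] by (auto simp: permutes_less inj_eq)
    then show ?thesis using 1 by (auto simp: circ_perm_def Let_def)
  next
    case 2
    then have "\<sigma> i < n" "\<tau> (a - i) < m"
      using assms by (auto simp: permutes_less)
    then show ?thesis using 2 by (auto simp: circ_perm_def Let_def)
  next
    case 3
    then have "\<sigma> (a + 1 - m) < n" "\<sigma> i < n" "\<sigma> (a + 1 - m) \<noteq> \<sigma> i"
      using assms permutes_inj[OF assms(1)] by (auto simp: permutes_less inj_eq)
    then show ?thesis using 3 by (auto simp: circ_perm_def Let_def)
  qed
qed

lemma circ_perm_permutes:
  assumes \<sigma>: "\<sigma> permutes {..<n}" and i: "i < n" and \<tau>: "\<tau> permutes {..<m}"
  shows "circ_perm m i \<sigma> \<tau> permutes {..<n + m - 1}"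
proof (rule permutes_lessThanI_mset)
  let ?c = "circ_perm m i \<sigma> \<tau>" and ?N = "n + m - 1"
  show "?c a < ?N" if "a < ?N" for a using circ_perm_less[OF assms that] .
  have \<sigma>i: "\<sigma> i < n" using \<sigma> i by (simp add: permutes_less)
  show "?c a = a" if "a \<ge> ?N" for a
  proof -
    have "\<sigma> (a + 1 - m) = a + 1 - m" using that \<sigma> i by (auto simp: permutes_def)
    then show ?thesis using that \<sigma>i i by (auto simp: circ_perm_def Let_def)
  qed
  \<comment> \<open>Cutting \<open>[0..<n + m - 1]\<close> into blocks of these sizes makes the list
    description applicable, and it shows that every value occurs exactly once.\<close>
  define ks where "ks = (replicate n 1)[\<sigma> i := m]"
  have "sum_list ks = ?N" using \<sigma>i by (simp add: ks_def sum_list_update sum_list_replicate)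
  then obtain zss where z: "concat zss = [0..<?N]" "map length zss = ks"
    using exists_blocks[of "[0..<?N]" ks] by auto
  have n: "length zss = n" using arg_cong[OF z(2), of length] by (simp add: ks_def)
  have "length (zss ! b) = (if b = \<sigma> i then m else 1)" if "b < n" for b
    using arg_cong[OF z(2), of "\<lambda>l. l ! b"] that n by (simp add: ks_def nth_list_update)
  from permute_list_circ_perm[OF \<sigma> i \<tau> n this]
  have "permute_list ?c [0..<?N] = concat ((permute_list \<sigma> zss)[i := permute_list \<tau> (zss ! \<sigma> i)])"
    by (simp add: z(1))
  also have "\<dots> = concat (permute_list \<sigma> (zss[\<sigma> i := permute_list \<tau> (zss ! \<sigma> i)]))"
    using \<sigma> i n by (simp add: permute_list_update)
  finally have "mset (permute_list ?c [0..<?N]) = mset (concat (permute_list \<sigma> (zss[\<sigma> i := permute_list \<tau> (zss ! \<sigma> i)])))"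
    by simp
  also have "\<dots> = mset (concat (zss[\<sigma> i := permute_list \<tau> (zss ! \<sigma> i)]))"
    using \<sigma> n by (intro mset_concat_permute_list) simp
  also have "\<dots> = mset (concat zss)"
  proof -
    have "length (zss ! \<sigma> i) = m" using arg_cong[OF z(2), of "\<lambda>l. l ! \<sigma> i"] \<sigma>i n by (simp add: ks_def)
    then show ?thesis
      using \<tau> \<sigma>i n concat_nth_split[of "\<sigma> i" zss]
        concat_nth_split[of "\<sigma> i" "zss[\<sigma> i := permute_list \<tau> (zss ! \<sigma> i)]"]
      by simp
  qed
  also have "permute_list ?c [0..<?N] = map ?c [0..<?N]"
    using circ_perm_less[OF assms] by (simp add: permute_list_def)
  finally show "mset (map ?c [0..<?N]) = mset [0..<?N]" using z by simp
qed

text \<open>The block description factors \<open>circ_perm\<close> into a permutation inside the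
  block of size \<open>m\<close> and a move of all blocks, so that the rules for
  \<open>shift_perm\<close> and \<open>block_perm\<close> become available for it.\<close>

lemma circ_perm_eq_shift_block:
  assumes \<sigma>: "\<sigma> permutes {..<n}" and i: "i < n" and \<tau>: "\<tau> permutes {..<m}"
    and ks: "length ks = n" "\<And>b. b < n \<Longrightarrow> ks ! b = (if b = \<sigma> i then m else 1)"
  shows "circ_perm m i \<sigma> \<tau> = shift_perm (\<sigma> i) \<tau> \<circ> block_perm \<sigma> ks"
    and "sum_list ks = n + m - 1" and "sum_list (take (\<sigma> i) ks) = \<sigma> i"
proof -
  have \<sigma>i: "\<sigma> i < n" using \<sigma> i by (simp add: permutes_less)
  have "ks = (replicate n 1)[\<sigma> i := m]" using ks by (intro nth_equalityI) (auto simp: nth_list_update)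
  then show sum: "sum_list ks = n + m - 1" and tk: "sum_list (take (\<sigma> i) ks) = \<sigma> i"
    using \<sigma>i by (simp_all add: sum_list_update sum_list_replicate)
  have sp: "shift_perm (\<sigma> i) \<tau> permutes {..<n + m - 1}"
    using \<tau> \<sigma>i by (intro shift_perm_permutes) auto
  have bp: "block_perm \<sigma> ks permutes {..<n + m - 1}"
    using block_perm_permutes[of \<sigma> ks] \<sigma> ks sum by simp
  show "circ_perm m i \<sigma> \<tau> = shift_perm (\<sigma> i) \<tau> \<circ> block_perm \<sigma> ks"
  proof (rule permute_list_eq_imp_eq[OF circ_perm_permutes[OF \<sigma> i \<tau>] permutes_compose[OF bp sp]])
    fix xs :: "nat list" assume xs: "length xs = n + m - 1"
    then obtain zss where z: "concat zss = xs" "map length zss = ks"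
      using exists_blocks[of xs ks] sum by metis
    have n: "length zss = n" using arg_cong[OF z(2), of length] ks by simp
    have lz: "length (zss ! b) = (if b = \<sigma> i then m else 1)" if "b < n" for b
      using arg_cong[OF z(2), of "\<lambda>l. l ! b"] that n ks by simp
    have m': "map length (zss[\<sigma> i := permute_list \<tau> (zss ! \<sigma> i)]) = ks"
      using z(2) \<sigma>i n by (simp add: map_update) (metis length_map list_update_id nth_map)
    have "permute_list (circ_perm m i \<sigma> \<tau>) xs = concat (permute_list \<sigma> (zss[\<sigma> i := permute_list \<tau> (zss ! \<sigma> i)]))"
      using permute_list_circ_perm[OF \<sigma> i \<tau> n lz] \<sigma> i n z(1) by (simp add: permute_list_update)
    also have "\<dots> = permute_list (block_perm \<sigma> ks) (concat (zss[\<sigma> i := permute_list \<tau> (zss ! \<sigma> i)]))"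
      using \<sigma> n m' by (intro permute_list_block_perm[symmetric]) simp_all
    also have "\<dots> = permute_list (block_perm \<sigma> ks) (permute_list (shift_perm (\<sigma> i) \<tau>) xs)"
      using permute_list_shift_perm_concat[of "\<sigma> i" zss \<tau> ks] \<sigma>i n lz[OF \<sigma>i] \<tau> z tk by simp
    also have "\<dots> = permute_list (shift_perm (\<sigma> i) \<tau> \<circ> block_perm \<sigma> ks) xs"
      using bp xs by (simp add: permute_list_compose)
    finally show "permute_list (circ_perm m i \<sigma> \<tau>) xs
        = permute_list (shift_perm (\<sigma> i) \<tau> \<circ> block_perm \<sigma> ks) xs" .
  qed
qed

text \<open>Each input of a partial composite carries a number of leaves, and \<open>lss\<close>
  groups these numbers by the inputs of the first operation. The leaf permutation splits into one
  inside group \<open>\<sigma> i\<close> and a move of the groups as wholes. This is the comparison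
  needed for equivariance of the right operations on families.\<close>

lemma block_perm_circ_perm:
  assumes \<sigma>: "\<sigma> permutes {..<n}" and i: "i < n" and \<tau>: "\<tau> permutes {..<m}"
    and l: "length lss = n" "\<And>b. b < n \<Longrightarrow> length (lss ! b) = (if b = \<sigma> i then m else 1)"
  shows "block_perm (circ_perm m i \<sigma> \<tau>) (concat lss)
    = shift_perm (sum_list (take (\<sigma> i) (map sum_list lss))) (block_perm \<tau> (lss ! \<sigma> i))
      \<circ> block_perm \<sigma> (map sum_list lss)"
proof -
  let ?ks = "map length lss" and ?lss = "lss[\<sigma> i := permute_list \<tau> (lss ! \<sigma> i)]"
  have \<sigma>i: "\<sigma> i < n" using \<sigma> i by (simp add: permutes_less)
  have ks: "length ?ks = n" "\<And>b. b < n \<Longrightarrow> ?ks ! b = (if b = \<sigma> i then m else 1)" using l by simp_all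
  have circ: "circ_perm m i \<sigma> \<tau> = shift_perm (\<sigma> i) \<tau> \<circ> block_perm \<sigma> ?ks"
      "sum_list ?ks = n + m - 1" "sum_list (take (\<sigma> i) ?ks) = \<sigma> i"
    using circ_perm_eq_shift_block[OF \<sigma> i \<tau>, of ?ks] ks by blast+
  have len: "length (concat lss) = n + m - 1" using circ(2) by (simp add: length_concat)
  have m': "map length ?lss = ?ks" using \<sigma>i l(1) by (simp add: map_update) (metis length_map list_update_id nth_map)
  have m'': "map sum_list ?lss = map sum_list lss"
    using \<sigma>i l \<tau> by (simp add: map_update sum_list_permute_list) (metis length_map list_update_id nth_map)
  have sp: "shift_perm (\<sigma> i) \<tau> permutes {..<length (concat lss)}"
    unfolding len using \<tau> \<sigma>i by (intro shift_perm_permutes) auto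
  have bp: "block_perm \<sigma> ?ks permutes {..<length (concat lss)}"
    unfolding len using block_perm_permutes[of \<sigma> ?ks] \<sigma> ks circ(2) by simp
  have "block_perm (circ_perm m i \<sigma> \<tau>) (concat lss)
      = block_perm (shift_perm (\<sigma> i) \<tau>) (concat lss)
        \<circ> block_perm (block_perm \<sigma> ?ks) (permute_list (shift_perm (\<sigma> i) \<tau>) (concat lss))"
    by (subst circ(1)) (rule block_perm_comp[OF sp bp, symmetric])
  also have "permute_list (shift_perm (\<sigma> i) \<tau>) (concat lss) = concat ?lss"
    using permute_list_shift_perm_concat[of "\<sigma> i" lss \<tau> ?ks] \<sigma>i l \<tau> circ(3) by simp
  also have "block_perm (block_perm \<sigma> ?ks) (concat ?lss) = block_perm \<sigma> (map sum_list lss)"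
    using block_perm_block_perm[of \<sigma> ?lss] \<sigma> l m' m'' by simp
  also have "block_perm (shift_perm (\<sigma> i) \<tau>) (concat lss)
      = shift_perm (sum_list (take (\<sigma> i) (map sum_list lss))) (block_perm \<tau> (lss ! \<sigma> i))"
    using block_perm_shift_perm[of "\<sigma> i" lss \<tau>] \<sigma>i l \<tau> circ(3) by simp
  finally show ?thesis .
qed

lemma block_perm_apply:
  assumes \<sigma>: "\<sigma> permutes {..<length ks}" and j: "j < length ks" and r: "r < ks ! \<sigma> j"
  shows "block_perm \<sigma> ks (sum_list (take j (permute_list \<sigma> ks)) + r) = sum_list (take (\<sigma> j) ks) + r"
proof -
  let ?i = "sum_list (take j (permute_list \<sigma> ks)) + r" and ?B = "permute_list \<sigma> (blocks ks)"
  have \<sigma>j: "\<sigma> j < length ks" using \<sigma> j by (simp add: permutes_less)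
  have lb: "map length (blocks ks) = ks"
    by (rule nth_equalityI) (simp_all add: blocks_nth take_Suc_conv_app_nth)
  have m: "map length ?B = permute_list \<sigma> ks" using \<sigma> lb permute_list_map[of \<sigma> "blocks ks" length] by simp
  have Bj: "?B ! j = blocks ks ! \<sigma> j" using \<sigma> j by (simp add: permute_list_nth)
  have "concat ?B = concat (take j ?B) @ ?B ! j @ concat (drop (Suc j) ?B)"
    using j by (intro concat_nth_split) simp
  moreover have "length (concat (take j ?B)) = sum_list (take j (permute_list \<sigma> ks))"
    using m by (rule length_concat_take)
  moreover have "length (?B ! j) = ks ! \<sigma> j"
    using Bj \<sigma>j by (simp add: blocks_nth take_Suc_conv_app_nth)
  ultimately have "concat ?B ! ?i = ?B ! j ! r" using r by (simp add: nth_append)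
  also have "\<dots> = sum_list (take (\<sigma> j) ks) + r"
    using Bj \<sigma>j r by (simp add: blocks_nth take_Suc_conv_app_nth)
  finally have c: "concat ?B ! ?i = sum_list (take (\<sigma> j) ks) + r" .
  have "?i < sum_list ks"
    using sum_list_take_Suc_le[of j "permute_list \<sigma> ks"] j r \<sigma>
    by (simp add: sum_list_permute_list permute_list_nth)
  then show ?thesis
    using c by (simp add: block_perm_def Let_def length_concat_permute_blocks[OF \<sigma>])
qed

text \<open>Composing with an operation of arity \<open>m\<close> at one input of block
  \<open>\<sigma> j\<close> changes only the size of this block, and the blocks are still moved by
  \<sigma>. This carries block permutations through a further partial composition.\<close>

lemma circ_perm_block_perm:
  assumes \<sigma>: "\<sigma> permutes {..<length ks}" and j: "j < length ks" and r: "r < ks ! \<sigma> j"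
  shows "circ_perm m (sum_list (take j (permute_list \<sigma> ks)) + r) (block_perm \<sigma> ks) id
    = block_perm \<sigma> (ks[\<sigma> j := ks ! \<sigma> j + m - 1])"
proof (rule block_perm_eqI)
  let ?i = "sum_list (take j (permute_list \<sigma> ks)) + r" and ?b = "block_perm \<sigma> ks"
  have \<sigma>j: "\<sigma> j < length ks" using \<sigma> j by (simp add: permutes_less)
  have i: "?i < sum_list ks"
    using sum_list_take_Suc_le[of j "permute_list \<sigma> ks"] j r \<sigma>
    by (simp add: sum_list_permute_list permute_list_nth)
  note bp = block_perm_permutes[OF \<sigma>]
  note bi = block_perm_apply[OF \<sigma> j r]
  show "\<sigma> permutes {..<length (ks[\<sigma> j := ks ! \<sigma> j + m - 1])}" using \<sigma> by simp
  show "circ_perm m ?i ?b id permutes {..<sum_list (ks[\<sigma> j := ks ! \<sigma> j + m - 1])}"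
    using circ_perm_permutes[OF bp i permutes_id] by (simp only: sum_list_update_Suc[OF \<sigma>j r])
  fix xss :: "nat list list" assume x: "map length xss = ks[\<sigma> j := ks ! \<sigma> j + m - 1]"
  have lx: "length xss = length ks" using arg_cong[OF x, of length] by simp
  have lxb: "length (xss ! b) = (if b = \<sigma> j then ks ! \<sigma> j + m - 1 else ks ! b)" if "b < length ks" for b
    using arg_cong[OF x, of "\<lambda>l. l ! b"] that lx by (simp add: nth_list_update)
  let ?s = "map (\<lambda>x::nat. [x])" and ?X = "xss ! \<sigma> j"
  \<comment> \<open>Every block is cut into single entries, except that the \<open>m\<close> entries
    inserted at position \<open>r\<close> of block \<open>\<sigma> j\<close> stay together. Thus
    \<open>yss\<close> has the old sizes \<open>ks\<close>, while its concatenation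
    \<open>zss\<close> has the form required by \<open>permute_list_circ_perm\<close>.\<close>
  define yss where "yss = (map ?s xss)[\<sigma> j := ?s (take r ?X) @ [take m (drop r ?X)] @ ?s (drop (r + m) ?X)]"
  define zss where "zss = concat yss"
  have ly: "map length yss = ks"
  proof (rule nth_equalityI)
    fix b assume "b < length (map length yss)"
    then show "map length yss ! b = ks ! b"
      using lx lxb[of b] \<sigma>j r by (auto simp: yss_def nth_list_update min_def)
  qed (simp add: yss_def lx)
  have cy: "map concat yss = xss"
  proof (rule nth_equalityI)
    fix b assume "b < length (map concat yss)"
    moreover have "take r ?X @ take m (drop r ?X) @ drop (r + m) ?X = ?X"
      by (metis append_take_drop_id drop_drop add.commute)
    ultimately show "map concat yss ! b = xss ! b"
      using \<sigma>j lx by (auto simp: yss_def nth_list_update concat_map_singleton)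
  qed (simp add: yss_def)
  have lyy: "length yss = length ks" using lx by (simp add: yss_def)
  define A where "A = concat (take (\<sigma> j) xss) @ take r ?X"
  define C where "C = drop (r + m) ?X @ concat (drop (Suc (\<sigma> j)) xss)"
  have z: "zss = ?s A @ [take m (drop r ?X)] @ ?s C"
    unfolding zss_def yss_def A_def C_def
    using \<sigma>j lx
    by (subst concat_nth_split[of "\<sigma> j"])
       (simp_all add: map_concat take_map drop_map)
  have lA: "length A = ?b ?i"
  proof -
    have "take (\<sigma> j) (map length xss) = take (\<sigma> j) ks" by (simp add: x)
    then have "length (concat (take (\<sigma> j) xss)) = sum_list (take (\<sigma> j) ks)"
      by (simp add: length_concat take_map)
    then show ?thesis using lxb[OF \<sigma>j] r by (auto simp: A_def bi min_def)
  qed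
  have lz: "length zss = sum_list ks" using ly by (simp add: zss_def length_concat)
  have lzb: "length (zss ! b) = (if b = ?b ?i then m else 1)" if "b < sum_list ks" for b
  proof -
    have "length (take m (drop r ?X)) = m" using lxb[OF \<sigma>j] r by simp
    then show ?thesis using that lz lA by (auto simp: z nth_append nth_Cons')
  qed
  have bi': "permute_list ?b zss ! ?i = zss ! ?b ?i" using bp i lz by (simp add: permute_list_nth)
  have "permute_list (circ_perm m ?i ?b id) (concat zss)
      = concat ((permute_list ?b zss)[?i := permute_list id (zss ! ?b ?i)])"
    by (rule permute_list_circ_perm[OF bp i permutes_id lz lzb])
  also have "\<dots> = concat (permute_list ?b zss)" using bi' by (metis list_update_id permute_list_id)
  also have "\<dots> = concat (concat (permute_list \<sigma> yss))"
    using \<sigma> ly lyy by (simp add: zss_def permute_list_block_perm)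
  also have "\<dots> = concat (permute_list \<sigma> xss)"
    using \<sigma> lyy cy by (simp add: concat_concat permute_list_map[symmetric])
  finally show "permute_list (circ_perm m ?i ?b id) (concat xss) = concat (permute_list \<sigma> xss)"
    using cy by (simp add: zss_def concat_concat)
qed

section \<open>Composites in right modules\<close>

lemma topspace_kprod [simp]:
  fixes k :: "'k itself"
  shows "topspace (kprod k X Y) = topspace X \<times> topspace Y"
  by (simp add: kprod_def)

lemma topspace_kproduct [simp]:
  fixes k :: "'k itself"
  shows "topspace (kproduct k X I) = (\<Pi>\<^sub>E i\<in>I. topspace (X i))"
  by (simp add: kproduct_def)

text \<open>An operad is a right module over itself, so that facts on composites in modules also cover
  composites in the operad.\<close>

definition operad_module :: "'q operad \<Rightarrow> (unit, 'q, 'q) bimod" where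
  "operad_module Q = \<lparr>mspace = ospace Q, mact = oact Q, rcomp = ocomp Q, lcomp = \<lambda>_ _ _. undefined\<rparr>"

lemma operad_module_simps [simp]:
  "mspace (operad_module Q) = ospace Q" "mact (operad_module Q) = oact Q"
  "rcomp (operad_module Q) = ocomp Q"
  by (simp_all add: operad_module_def)

locale right_module =
  fixes k :: "'k itself" and Q :: "'q operad" and M :: "('p, 'q, 'm) bimod"
  assumes operad: "is_operad k Q"
    and symmetric: "symmetric_sequence k (mspace M) (mact M)"
    and right_module: "right_module_axioms k Q M"

lemma right_module_operad_module:
  fixes k :: "'k itself"
  assumes "is_operad k Q"
  shows "right_module k Q (operad_module Q)"
proof
  show "right_module_axioms k Q (operad_module Q)"
    using assms unfolding is_operad_def right_module_axioms_def operad_module_simps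
    by (elim conjE) (intro conjI; assumption)
qed (use assms in \<open>simp_all add: is_operad_def\<close>)

context right_module
begin

abbreviation "Qt n \<equiv> topspace (ospace Q n)"
abbreviation "Mt n \<equiv> topspace (mspace M n)"
abbreviation "circ \<equiv> rcomp M"

lemma kspace: "is_kspace k (mspace M n)"
  using symmetric[unfolded symmetric_sequence_def, THEN conjunct1] by blast

lemma continuous_circ:
  "i < n \<Longrightarrow> continuous_map (kprod k (mspace M n) (ospace Q m)) (mspace M (n + m - 1)) (\<lambda>(x, q). circ n m i x q)"
  using right_module[unfolded right_module_axioms_def, THEN conjunct1] by blast

lemma continuous_act: "\<sigma> permutes {..<n} \<Longrightarrow> continuous_map (mspace M n) (mspace M n) (mact M n \<sigma>)"
  using symmetric[unfolded symmetric_sequence_def, THEN conjunct2, THEN conjunct1] by blast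

lemma circ_closed: "x \<in> Mt n \<Longrightarrow> q \<in> Qt m \<Longrightarrow> i < n \<Longrightarrow> circ n m i x q \<in> Mt (n + m - 1)"
  using continuous_map_funspace[OF continuous_circ[of i n m]] by (auto simp: Pi_iff)

lemma act_closed: "x \<in> Mt n \<Longrightarrow> \<sigma> permutes {..<n} \<Longrightarrow> mact M n \<sigma> x \<in> Mt n"
  using continuous_map_funspace[OF continuous_act[of \<sigma> n]] by (auto simp: Pi_iff)

lemma act_id: "x \<in> Mt n \<Longrightarrow> mact M n id x = x"
  using symmetric[unfolded symmetric_sequence_def, THEN conjunct2, THEN conjunct2, THEN conjunct1] by blast

lemma act_comp:
  "x \<in> Mt n \<Longrightarrow> \<sigma> permutes {..<n} \<Longrightarrow> \<tau> permutes {..<n} \<Longrightarrow> mact M n \<tau> (mact M n \<sigma> x) = mact M n (\<sigma> \<circ> \<tau>) x"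
  using symmetric[unfolded symmetric_sequence_def, THEN conjunct2, THEN conjunct2, THEN conjunct2] by blast

lemma circ_unit: "x \<in> Mt n \<Longrightarrow> i < n \<Longrightarrow> circ n 1 i x (ounit Q) = x"
  using right_module[unfolded right_module_axioms_def, THEN conjunct2, THEN conjunct1] by blast

lemma circ_assoc:
  "x \<in> Mt n \<Longrightarrow> y \<in> Qt m \<Longrightarrow> z \<in> Qt l \<Longrightarrow> i < n \<Longrightarrow> j < m \<Longrightarrow>
    circ (n + m - 1) l (i + j) (circ n m i x y) z = circ n (m + l - 1) i x (ocomp Q m l j y z)"
  using right_module[unfolded right_module_axioms_def, THEN conjunct2, THEN conjunct2, THEN conjunct1] by blast

lemma circ_commute:
  "x \<in> Mt n \<Longrightarrow> y \<in> Qt m \<Longrightarrow> z \<in> Qt l \<Longrightarrow> i < j \<Longrightarrow> j < n \<Longrightarrow>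
    circ (n + m - 1) l (j + m - 1) (circ n m i x y) z = circ (n + l - 1) m i (circ n l j x z) y"
  using right_module[unfolded right_module_axioms_def, THEN conjunct2, THEN conjunct2, THEN conjunct2, THEN conjunct1] by blast

lemma circ_act:
  "x \<in> Mt n \<Longrightarrow> y \<in> Qt m \<Longrightarrow> i < n \<Longrightarrow> \<sigma> permutes {..<n} \<Longrightarrow> \<tau> permutes {..<m} \<Longrightarrow>
    circ n m i (mact M n \<sigma> x) (oact Q m \<tau> y) = mact M (n + m - 1) (circ_perm m i \<sigma> \<tau>) (circ n m (\<sigma> i) x y)"
  using right_module[unfolded right_module_axioms_def, THEN conjunct2, THEN conjunct2, THEN conjunct2, THEN conjunct2] by blast

lemma unit_in: "ounit Q \<in> Qt 1"
  using operad by (simp add: is_operad_def)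

lemma unit_ocomp: "y \<in> Qt m \<Longrightarrow> ocomp Q 1 m 0 (ounit Q) y = y"
  using operad by (simp add: is_operad_def)

lemma oact_id: "y \<in> Qt m \<Longrightarrow> oact Q m id y = y"
  using operad by (simp add: is_operad_def symmetric_sequence_def)

section \<open>Composites with all inputs filled\<close>

definition fits :: "(nat \<times> 'q) list \<Rightarrow> bool" where
  "fits ys \<longleftrightarrow> (\<forall>p\<in>set ys. snd p \<in> Qt (fst p))"

lemma fits_simps [simp]:
  "fits []" "fits (p # ys) \<longleftrightarrow> snd p \<in> Qt (fst p) \<and> fits ys"
  "fits (ys @ zs) \<longleftrightarrow> fits ys \<and> fits zs"
  by (auto simp: fits_def)

lemma fits_nth: "fits ys \<Longrightarrow> j < length ys \<Longrightarrow> ys ! j = (l, y) \<Longrightarrow> y \<in> Qt l"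
  unfolding fits_def by (metis fst_conv nth_mem snd_conv)

lemma fits_update: "fits ys \<Longrightarrow> snd p \<in> Qt (fst p) \<Longrightarrow> fits (ys[j := p])"
  unfolding fits_def using set_update_subset_insert[of ys j p] by blast

lemma fits_units: "fits (replicate n (1, ounit Q))"
  using unit_in by (auto simp: fits_def)

lemma plug_closed:
  "fits ys \<Longrightarrow> x \<in> Mt (i + length ys) \<Longrightarrow> plug circ i x ys \<in> Mt (i + sum_list (map fst ys))"
proof (induction ys arbitrary: i)
  case (Cons p ys)
  obtain l y where p: "p = (l, y)" by force
  have "plug circ (Suc i) x ys \<in> Mt (Suc i + sum_list (map fst ys))"
    using Cons.prems by (intro Cons.IH) auto
  from circ_closed[OF this, of y l i] Cons.prems p show ?case by (simp add: ac_simps)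
qed simp

text \<open>Composing at an input that belongs to the \<open>j\<close>-th plugged operation changes
  only that operation. In \<open>plug\<close> the composition at the first input is outermost: for
  \<open>j = 0\<close> sequential associativity applies, and for later \<open>j\<close> the
  commutation law moves the new composition past the outermost one.\<close>

lemma plug_update:
  assumes "fits ys" "x \<in> Mt (i + length ys)" "j < length ys" "ys ! j = (l, z)" "y \<in> Qt m" "r < l"
  shows "plug circ i x (ys[j := (l + m - 1, ocomp Q l m r z y)])
    = circ (i + sum_list (map fst ys)) m (i + sum_list (map fst (take j ys)) + r) (plug circ i x ys) y"
  using assms
proof (induction ys arbitrary: i j)
  case (Cons p ys)
  obtain l0 y0 where p: "p = (l0, y0)" by force
  define S where "S = sum_list (map fst ys)"
  define X where "X = plug circ (Suc i) x ys"
  have X: "X \<in> Mt (Suc i + S)" unfolding X_def S_def using Cons.prems by (intro plug_closed) auto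
  show ?case
  proof (cases j)
    case 0
    then have [simp]: "l0 = l" "y0 = z" using Cons.prems p by auto
    have "circ (Suc i + S + l - 1) m (i + r) (circ (Suc i + S) l i X z) y
        = circ (Suc i + S) (l + m - 1) i X (ocomp Q l m r z y)"
      using Cons.prems p by (intro circ_assoc X) auto
    then show ?thesis using 0 p by (simp add: S_def X_def ac_simps)
  next
    case (Suc j')
    have j': "j' < length ys" "ys ! j' = (l, z)" using Cons.prems Suc by auto
    let ?ys = "ys[j' := (l + m - 1, ocomp Q l m r z y)]"
    define s where "s = sum_list (map fst (take j' ys))"
    have IH: "plug circ (Suc i) x ?ys = circ (Suc i + S) m (Suc i + s + r) X y"
      unfolding S_def X_def s_def using Cons.prems j' by (intro Cons.IH) auto
    have sl: "s + l \<le> S"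
      using sum_list_take_Suc_le[of j' "map fst ys"] j' by (simp add: s_def S_def take_map)
    have S': "sum_list (map fst ?ys) = S + m - 1"
      using sum_list_update_Suc[of j' "map fst ys" r m] j' Cons.prems(6) by (simp add: map_update S_def)
    have "circ (Suc i + S + l0 - 1) m (Suc i + s + r + l0 - 1) (circ (Suc i + S) l0 i X y0) y
        = circ (Suc i + S + m - 1) l0 i (circ (Suc i + S) m (Suc i + s + r) X y) y0"
      using Cons.prems p sl by (intro circ_commute X) auto
    moreover have "Suc i + (S + m - 1) = Suc i + S + m - 1" using sl Cons.prems(6) by simp
    moreover have "plug circ i x ((p # ys)[j := (l + m - 1, ocomp Q l m r z y)])
        = circ (Suc i + (S + m - 1)) l0 i (circ (Suc i + S) m (Suc i + s + r) X y) y0"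
      using Suc p IH S' by simp
    moreover have "circ (i + sum_list (map fst (p # ys))) m (i + sum_list (map fst (take j (p # ys))) + r)
          (plug circ i x (p # ys)) y
        = circ (Suc i + S + l0 - 1) m (Suc i + s + r + l0 - 1) (circ (Suc i + S) l0 i X y0) y"
      using Suc p by (simp add: S_def X_def s_def ac_simps)
    ultimately show ?thesis by (simp only:)
  qed
qed simp

text \<open>An empty input is represented by the unit, so filling it amounts to composing the unit
  with \<open>y\<close>.\<close>

lemma plug_fill:
  assumes "fits ys" "x \<in> Mt (i + length ys)" "j < length ys" "ys ! j = (1, ounit Q)" "y \<in> Qt m"
  shows "plug circ i x (ys[j := (m, y)])
    = circ (i + sum_list (map fst ys)) m (i + sum_list (map fst (take j ys))) (plug circ i x ys) y"
  using plug_update[OF assms, of 0] unit_ocomp[OF assms(5)] by simp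

lemma plug_units: "x \<in> Mt (i + n) \<Longrightarrow> plug circ i x (replicate n (1, ounit Q)) = x"
proof (induction n arbitrary: i)
  case (Suc n)
  have "plug circ (Suc i) x (replicate n (1, ounit Q)) = x" using Suc by simp
  then show ?case using circ_unit[of x "Suc (i + n)" i] Suc.prems
    by (simp add: sum_list_replicate)
qed simp

end

text \<open>Induction principle for composites: starting with units everywhere, the inputs are
  filled one at a time from the left, so each step needs an axiom for a single partial composition
  only. The inclusion for \<open>set zs\<close> keeps the partly filled lists well typed.\<close>

lemma fill_induct [case_names base fill]:
  assumes base: "P (replicate (length ys) (1, u))"
    and fill: "\<And>zs j l y. length zs = length ys \<Longrightarrow> j < length ys \<Longrightarrow> zs ! j = (1, u) \<Longrightarrow> ys ! j = (l, y) \<Longrightarrow>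
      set zs \<subseteq> insert (1, u) (set ys) \<Longrightarrow> P zs \<Longrightarrow> P (zs[j := (l, y)])"
  shows "P ys"
proof -
  have "P (take j ys @ replicate (length ys - j) (1, u))" if "j \<le> length ys" for j
    using that
  proof (induction j)
    case 0
    then show ?case using base by simp
  next
    case (Suc j)
    let ?zs = "take j ys @ replicate (length ys - j) (1, u)"
    obtain l y where y: "ys ! j = (l, y)" by force
    have "P (?zs[j := (l, y)])"
    proof (rule fill[OF _ _ _ y])
      show "set ?zs \<subseteq> insert (1, u) (set ys)" by (auto dest: in_set_takeD)
    qed (use Suc in \<open>auto simp: nth_append\<close>)
    moreover have "length ys - j = Suc (length ys - Suc j)" using Suc.prems by simp
    then have "?zs[j := (l, y)] = take (Suc j) ys @ replicate (length ys - Suc j) (1, u)"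
      using Suc.prems y by (simp add: take_Suc_conv_app_nth list_update_append)
    ultimately show ?case by simp
  qed
  from this[of "length ys"] show ?thesis by simp
qed

context right_module
begin

lemma fits_filled:
  "fits ys \<Longrightarrow> set zs \<subseteq> insert (1, ounit Q) (set ys) \<Longrightarrow> fits zs"
  using unit_in by (fastforce simp: fits_def)

text \<open>With the unit put back into input \<open>j\<close>, both sides become one partial
  composition at that input, and equivariance is applied with the identity on the module
  side.\<close>

lemma plug_act:
  assumes "fits ys" "x \<in> Mt (length ys)" "j < length ys" "ys ! j = (l, y)" "\<tau> permutes {..<l}"
  shows "plug circ 0 x (ys[j := (l, oact Q l \<tau> y)])
    = mact M (sum_list (map fst ys)) (shift_perm (sum_list (map fst (take j ys))) \<tau>) (plug circ 0 x ys)"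
proof -
  interpret Q: right_module k Q "operad_module Q" using right_module_operad_module operad .
  define zs where "zs = ys[j := (1, ounit Q)]"
  have y: "y \<in> Qt l" using assms fits_nth by blast
  have zs: "fits zs" "length zs = length ys" "zs ! j = (1, ounit Q)"
    using assms fits_update unit_in by (auto simp: zs_def)
  define N i where "N = sum_list (map fst zs)" and "i = sum_list (map fst (take j zs))"
  define X where "X = plug circ 0 x zs"
  have X: "X \<in> Mt N" using plug_closed[of zs x 0] zs assms by (simp add: X_def N_def)
  have iN: "i < N"
    using sum_list_take_Suc_le[of j "map fst zs"] zs assms(3) by (simp add: i_def N_def take_map)
  have 1: "plug circ 0 x (ys[j := (l, q)]) = circ N l i X q" if "q \<in> Qt l" for q
    using plug_fill[of zs x 0 j q l] zs assms that by (simp add: zs_def N_def i_def X_def)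
  have ys: "ys = ys[j := (l, y)]" using assms by (metis list_update_id)
  have i: "i = sum_list (map fst (take j ys))" by (simp add: i_def zs_def)
  have "ys = zs[j := (l, y)]" using ys by (simp add: zs_def)
  then have "map fst ys = (map fst zs)[j := l]" by (metis fst_conv map_update)
  then have N: "N + l - 1 = sum_list (map fst ys)"
    using sum_list_update_Suc[of j "map fst zs" 0 l] zs assms by (simp add: N_def)
  have "circ N l i X (oact Q l \<tau> y) = mact M (N + l - 1) (circ_perm l i id \<tau>) (circ N l i X y)"
    using circ_act[OF X y iN permutes_id assms(5)] act_id[OF X] by simp
  moreover have "oact Q l \<tau> y \<in> Qt l" using Q.act_closed[of y l \<tau>] y assms(5) by simp
  ultimately show ?thesis
    unfolding N[symmetric] i[symmetric]
    using 1[of y] 1[of "oact Q l \<tau> y"] y assms(5) ys by (simp add: circ_perm_id)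
qed

text \<open>With units everywhere all block sizes are 1 and the block permutation is \<sigma>
  itself. Each filling then uses the equivariance of one partial composition, and
  \<open>circ_perm_block_perm\<close> shows that the permutation produced is the block permutation
  for the new sizes.\<close>

lemma plug_permute:
  assumes "fits ys" "x \<in> Mt (length ys)" "\<sigma> permutes {..<length ys}"
  shows "plug circ 0 (mact M (length ys) \<sigma> x) (permute_list \<sigma> ys)
    = mact M (sum_list (map fst ys)) (block_perm \<sigma> (map fst ys)) (plug circ 0 x ys)"
proof (induction ys rule: fill_induct[where u = "ounit Q"])
  case base
  have "permute_list \<sigma> (replicate (length ys) (1 :: nat, ounit Q)) = replicate (length ys) (1, ounit Q)"
    using assms(3) by (intro nth_equalityI) (auto simp: permute_list_nth permutes_less)
  then show ?case
    using assms block_perm_singletons[OF assms(3)]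
    by (simp add: plug_units act_closed sum_list_replicate del: One_nat_def)
next
  case (fill zs j l y)
  have f: "fits zs" using fits_filled[OF assms(1) fill(5)] .
  have y: "y \<in> Qt l" using fits_nth[OF assms(1)] fill by blast
  \<comment> \<open>Entry \<open>j\<close> of \<open>zs\<close> is found at this position of the
    permuted list.\<close>
  define i where "i = inv \<sigma> j"
  have ij: "\<sigma> i = j" by (simp add: i_def permutes_inverses[OF assms(3)])
  have i: "i < length ys" using fill ij assms(3) by (metis permutes_less)
  have p: "\<sigma> permutes {..<length zs}" using assms fill by simp
  let ?x = "mact M (length ys) \<sigma> x" and ?pz = "permute_list \<sigma> zs" and ?ks = "map fst zs"
  have pf: "fits ?pz" using f assms(3) fill by (simp add: fits_def)
  have pzs: "permute_list \<sigma> (zs[j := (l, y)]) = ?pz[i := (l, y)]"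
    using permute_list_update[OF p, of i] i fill ij by simp
  have m: "map fst ?pz = permute_list \<sigma> ?ks" using permute_list_map[OF p, of fst] by simp
  define N where "N = sum_list ?ks"
  have N: "sum_list (map fst ?pz) = N" using p by (simp add: m N_def sum_list_permute_list)
  define a b where "a = sum_list (take i (permute_list \<sigma> ?ks))" and "b = sum_list (take j ?ks)"
  define X where "X = plug circ 0 x zs"
  have X: "X \<in> Mt N" using plug_closed[OF f, of x 0] assms fill by (simp add: X_def N_def)
  have kj: "?ks ! \<sigma> i = 1" using fill ij by simp
  have bp: "block_perm \<sigma> ?ks permutes {..<N}" using block_perm_permutes[of \<sigma> ?ks] p by (simp add: N_def)
  have ba: "block_perm \<sigma> ?ks a = b"
    using block_perm_apply[of \<sigma> ?ks i 0] p i fill kj ij by (simp add: a_def b_def)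
  have bN: "b < N" using sum_list_take_Suc_le[of j ?ks] fill by (simp add: b_def N_def)
  have aN: "a < N" using bN ba bp by (metis permutes_less)
  have cb: "circ_perm l a (block_perm \<sigma> ?ks) id = block_perm \<sigma> (?ks[j := l])"
    using circ_perm_block_perm[of \<sigma> ?ks i 0 l] p i fill kj ij by (simp add: a_def)
  have "plug circ 0 ?x (?pz[i := (l, y)]) = circ N l a (plug circ 0 ?x ?pz) y"
    using plug_fill[OF pf, of ?x 0 i y l] act_closed[OF assms(2,3)] i fill p y ij
    by (simp add: permute_list_nth N m[symmetric] a_def flip: take_map)
  also have "\<dots> = circ N l a (mact M N (block_perm \<sigma> ?ks) X) (oact Q l id y)"
    using fill(1,6) y by (simp add: X_def N_def oact_id)
  also have "\<dots> = mact M (N + l - 1) (block_perm \<sigma> (?ks[j := l])) (circ N l b X y)"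
    using circ_act[OF X y aN bp permutes_id] by (simp only: cb ba)
  also have "circ N l b X y = plug circ 0 x (zs[j := (l, y)])"
    using plug_fill[OF f, of x 0 j y l] assms(2) fill y by (simp add: X_def N_def b_def take_map)
  also have "N + l - 1 = sum_list (map fst (zs[j := (l, y)]))"
    using sum_list_update_Suc[of j ?ks 0 l] fill by (simp add: N_def map_update)
  finally show ?case by (simp add: pzs map_update fill(1))
qed

text \<open>Associativity of full composites, by filling inputs one at a time. The input being
  filled lies to the left of the inputs of \<open>q\<close>, among them or to their right. In the
  middle case it changes the inner composite, and \<open>plug_update\<close> extracts this change;
  in the other two it is an ordinary filling of the outer composite.\<close>

lemma plug_plug:
  assumes "fits zs" "x \<in> Mt n" "q \<in> Qt m" "i < n" "length zs = n + m - 1"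
  shows "plug circ 0 (circ n m i x q) zs
    = plug circ 0 x (take i zs @ (sum_list (map fst (take m (drop i zs))),
        plug (ocomp Q) 0 q (take m (drop i zs))) # drop (i + m) zs)"
  (is "_ = plug circ 0 x (?L zs)")
proof (induction zs rule: fill_induct[where u = "ounit Q"])
  case base
  interpret Q: right_module k Q "operad_module Q" using right_module_operad_module operad .
  let ?u = "(1 :: nat, ounit Q)"
  have l: "length zs - (i + m) = n - Suc i" "min m (length zs - i) = m" "min i (length zs) = i"
    using assms by auto
  have "?L (replicate (length zs) ?u) = (replicate n ?u)[i := (m, q)]"
  proof -
    have "replicate n ?u = replicate i ?u @ ?u # replicate (n - Suc i) ?u"
      using assms(4) by (metis add_diff_inverse_nat less_asym replicate_Suc replicate_add Suc_diff_Suc less_imp_le_nat linorder_not_less)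
    then have "(replicate n ?u)[i := (m, q)] = replicate i ?u @ (m, q) # replicate (n - Suc i) ?u"
      by (simp add: list_update_append del: One_nat_def)
    moreover have "plug (ocomp Q) 0 q (replicate m ?u) = q" using Q.plug_units[of q 0 m] assms(3) by simp
    ultimately show ?thesis using l by (simp add: sum_list_replicate)
  qed
  moreover have "plug circ 0 x ((replicate n ?u)[i := (m, q)]) = circ n m i x q"
    using plug_fill[OF fits_units, of x 0 n i q m] plug_units[of x 0 n] assms
    by (simp add: sum_list_replicate)
  moreover have "plug circ 0 (circ n m i x q) (replicate (length zs) ?u) = circ n m i x q"
    using plug_units[of "circ n m i x q" 0 "length zs"] circ_closed assms by simp
  ultimately show ?case by simp
next
  case (fill ys j l y)
  interpret Q: right_module k Q "operad_module Q" using right_module_operad_module operad .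
  have f: "fits ys" using fits_filled[OF assms(1) fill(5)] .
  have y: "y \<in> Qt l" using fits_nth[OF assms(1)] fill by blast
  define A B C where "A = take i ys" and "B = take m (drop i ys)" and "C = drop (i + m) ys"
  have ABC: "ys = A @ B @ C" unfolding A_def B_def C_def
    by (metis add.commute append_take_drop_id drop_drop)
  have len: "length A = i" "length B = m" "length C = n - Suc i"
    using fill(1) assms by (auto simp: A_def B_def C_def)
  have LABC: "?L (A' @ B' @ C') = A' @ (sum_list (map fst B'), plug (ocomp Q) 0 q B') # C'"
    if "length A' = i" "length B' = m" for A' B' C' using that by simp
  have fABC: "fits A" "fits B" "fits C" using f by (auto simp: ABC)
  define z where "z = plug (ocomp Q) 0 q B"
  have z: "z \<in> Qt (sum_list (map fst B))"
    using Q.plug_closed[of B q 0] fABC len assms(3) by (simp add: z_def)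
  define Y where "Y = ?L ys"
  have LY: "Y = A @ (sum_list (map fst B), z) # C" using LABC[of A B C] len ABC by (simp add: Y_def z_def)
  have fL: "fits (Y)" unfolding LY using fABC z by simp
  have lL: "length (Y) = n" unfolding LY using len assms(4) by simp
  have sL: "sum_list (map fst (Y)) = sum_list (map fst ys)" unfolding LY by (simp add: ABC)
  have left: "plug circ 0 (circ n m i x q) (ys[j := (l, y)])
      = circ (sum_list (map fst ys)) l (sum_list (map fst (take j ys))) (plug circ 0 x (Y)) y"
    using plug_fill[OF f, of "circ n m i x q" 0 j y l] circ_closed[OF assms(2,3,4)] fill y assms by (simp add: Y_def)
  consider "j < i" | "i \<le> j" "j < i + m" | "i + m \<le> j" by linarith
  then show ?case
  proof cases
    case 1
    have "?L (ys[j := (l, y)]) = (Y)[j := (l, y)]"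
      unfolding LY using LABC[of "A[j := (l, y)]" B C] 1 len by (simp add: ABC list_update_append z_def)
    moreover have "take j (Y) = take j ys" "Y ! j = ys ! j"
      unfolding LY using 1 len by (simp_all add: ABC nth_append)
    ultimately show ?thesis
      using left plug_fill[OF fL, of x 0 j y l] 1 assms fill y lL sL by simp
  next
    case 2
    define r where "r = j - i"
    have r: "r < m" "j = i + r" using 2 by (auto simp: r_def)
    have Br: "B ! r = (1, ounit Q)" using fill(3) r len by (simp add: ABC nth_append)
    have "plug (ocomp Q) 0 q (B[r := (l, y)])
        = ocomp Q (sum_list (map fst B)) l (sum_list (map fst (take r B))) z y"
      using Q.plug_fill[of B q 0 r y l] fABC len assms(3) r Br y by (simp add: z_def)
    moreover have "sum_list (map fst (B[r := (l, y)])) = sum_list (map fst B) + l - 1"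
      using sum_list_update_Suc[of r "map fst B" 0 l] r len Br by (simp add: map_update)
    ultimately have "?L (ys[j := (l, y)])
        = (Y)[i := (sum_list (map fst B) + l - 1,
            ocomp Q (sum_list (map fst B)) l (sum_list (map fst (take r B))) z y)]"
      unfolding LY using LABC[of A "B[r := (l, y)]" C] r len by (simp add: ABC list_update_append)
    moreover have "sum_list (map fst (take r B)) < sum_list (map fst B)"
      using sum_list_take_Suc_le[of r "map fst B"] r len Br by (simp add: take_map)
    moreover have "Y ! i = (sum_list (map fst B), z)" "take i (Y) = A"
      unfolding LY using len by (simp_all add: nth_append)
    moreover have "take j ys = A @ take r B" using r len by (simp add: ABC)
    ultimately show ?thesis
      using left plug_update[OF fL, of x 0 i "sum_list (map fst B)" z y l "sum_list (map fst (take r B))"]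
        assms y lL sL by simp
  next
    case 3
    define r where "r = j - (i + m)"
    have r: "j = i + m + r" "r < n - Suc i" using 3 fill(2) assms by (auto simp: r_def)
    have "?L (ys[j := (l, y)]) = (Y)[Suc i + r := (l, y)]"
      unfolding LY using LABC[of A B "C[r := (l, y)]"] r len
      by (simp add: ABC list_update_append z_def)
    moreover have "sum_list (map fst (take (Suc i + r) (Y))) = sum_list (map fst (take j ys))"
      "Y ! (Suc i + r) = ys ! j"
      unfolding LY using r len by (simp_all add: ABC nth_append)
    ultimately show ?thesis
      using left plug_fill[OF fL, of x 0 "Suc i + r" y l] r assms fill y lL sL by simp
  qed
qed

end

section \<open>Replacing branches of decorated trees\<close>

lemma nleaves_simps [simp]:
  "nleaves [] = 0" "nleaves (d # ds) = leaves d + nleaves ds" "nleaves (ds @ es) = nleaves ds + nleaves es"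
  by (simp_all add: nleaves_def)

lemma leaves_Node [simp]: "leaves (Node a ds) = nleaves ds"
  by (simp add: nleaves_def)

declare leaves.simps(2) [simp del]

lemma nleaves_take: "nleaves (take i ds) = sum_list (take i (map leaves ds))"
  by (simp add: nleaves_def take_map)

lemma nleaves_update:
  "i < length ds \<Longrightarrow> nleaves (ds[i := c]) + leaves (ds ! i) = nleaves ds + leaves c"
  by (induction ds arbitrary: i) (auto split: nat.split)

lemma nleaves_take_le: "i < length ds \<Longrightarrow> nleaves (take i ds) + leaves (ds ! i) \<le> nleaves ds"
  using sum_list_take_Suc_le[of i "map leaves ds"] by (simp add: nleaves_def take_map)

lemma nleaves_permute_list: "\<sigma> permutes {..<length ds} \<Longrightarrow> nleaves (permute_list \<sigma> ds) = nleaves ds"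
  unfolding nleaves_def using sum_list_permute_list[of \<sigma> "map leaves ds"] by (simp add: permute_list_map)

text \<open>
  The counterpart of \<open>replace_at\<close> that is suited to induction: the address is replaced by the
  number \<open>s\<close> of leaves to the left of the branch.
\<close>

inductive replaces :: "'l ptree \<Rightarrow> 'l ptree \<Rightarrow> nat \<Rightarrow> 'l rtree \<Rightarrow> 'l rtree \<Rightarrow> bool" for b b' where
  here: "i < length ds \<Longrightarrow> ds ! i = b \<Longrightarrow> replaces b b' (nleaves (take i ds)) ds (ds[i := b'])"
| above: "i < length ds \<Longrightarrow> ds ! i = Node a es \<Longrightarrow> replaces b b' s es es' \<Longrightarrow>
    replaces b b' (nleaves (take i ds) + s) ds (ds[i := Node a es'])"

text \<open>Either rule changes one root branch, as a whole or further up. A relation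
  \<open>R r c c'\<close> on single branches, where \<open>r\<close> counts the leaves of
  \<open>c\<close> left of the change, therefore needs to be checked only for the replaced branch
  itself and for passing down through one vertex.\<close>

lemma replaces_branch:
  assumes "replaces b b' s ds ds'"
    and "R 0 b b'"
    and "\<And>a es i r c'. i < length es \<Longrightarrow> R r (es ! i) c' \<Longrightarrow>
      R (nleaves (take i es) + r) (Node a es) (Node a (es[i := c']))"
  shows "\<exists>i<length ds. \<exists>r c'. ds' = ds[i := c'] \<and> s = nleaves (take i ds) + r \<and> R r (ds ! i) c'"
  using assms(1)
proof (induction rule: replaces.induct)
  case (here i ds)
  then show ?case using assms(2) by (intro exI[of _ i]) force
next
  case (above i ds a es s es')
  then show ?case using assms(3) by (intro exI[of _ i]) fastforce
qed

lemma replaces_singleton_here: "replaces b b' 0 [b] [b']"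
  using replaces.here[of 0 "[b]" b b'] by simp

lemma replaces_singleton_above: "replaces b b' s es es' \<Longrightarrow> replaces b b' s [Node a es] [Node a es']"
  using replaces.above[of 0 "[Node a es]" a es b b' s es'] by simp

lemma replaces_lift:
  assumes "i < length ds" "replaces b b' r [ds ! i] [c']"
  shows "replaces b b' (nleaves (take i ds) + r) ds (ds[i := c'])"
  using assms(2)
proof (cases rule: replaces.cases)
  case (here j)
  then have "ds ! i = b" "c' = b'" "r = 0" by auto
  then show ?thesis using replaces.here[OF assms(1), of b b'] by simp
next
  case (above j a es s es')
  then have "ds ! i = Node a es" "c' = Node a es'" "r = s" by auto
  then show ?thesis using replaces.above[OF assms(1)] above by simp
qed

lemma replaces_iff:
  "replaces b b' s ds ds' \<longleftrightarrow>
    (\<exists>i<length ds. \<exists>r c'. ds' = ds[i := c'] \<and> s = nleaves (take i ds) + r \<and> replaces b b' r [ds ! i] [c'])"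
proof
  assume "replaces b b' s ds ds'"
  then show "\<exists>i<length ds. \<exists>r c'. ds' = ds[i := c'] \<and> s = nleaves (take i ds) + r \<and> replaces b b' r [ds ! i] [c']"
    by (rule replaces_branch[where R = "\<lambda>r c c'. replaces b b' r [c] [c']"])
      (rule replaces_singleton_here replaces_singleton_above[OF replaces_lift] | assumption)+
qed (elim exE conjE, simp add: replaces_lift)

lemma replaces_length: "replaces b b' s ds ds' \<Longrightarrow> length ds' = length ds"
  by (erule replaces.cases) simp_all

lemma replaces_nleaves:
  fixes b b' :: "'l ptree"
  assumes "replaces b b' s ds ds'"
  shows "nleaves ds' + leaves b = nleaves ds + leaves b'" "s + leaves b \<le> nleaves ds"
proof -
  have "\<exists>i<length ds. \<exists>r c'. ds' = ds[i := c'] \<and> s = nleaves (take i ds) + r \<and>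
      leaves c' + leaves b = leaves (ds ! i) + leaves b' \<and> r + leaves b \<le> leaves (ds ! i)"
    using assms
  proof (rule replaces_branch)
    fix a :: 'l and es :: "'l rtree" and i r and c' :: "'l ptree"
    assume "i < length es" "leaves c' + leaves b = leaves (es ! i) + leaves b' \<and> r + leaves b \<le> leaves (es ! i)"
    then show "leaves (Node a (es[i := c'])) + leaves b = leaves (Node a es) + leaves b' \<and>
      nleaves (take i es) + r + leaves b \<le> leaves (Node a es)"
      using nleaves_update[of i es c'] nleaves_take_le[of i es] by simp
  qed simp
  then obtain i r c' where "i < length ds" "ds' = ds[i := c']" "s = nleaves (take i ds) + r"
      "leaves c' + leaves b = leaves (ds ! i) + leaves b'" "r + leaves b \<le> leaves (ds ! i)"
    by blast
  then show "nleaves ds' + leaves b = nleaves ds + leaves b'" "s + leaves b \<le> nleaves ds"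
    using nleaves_update[of i ds c'] nleaves_take_le[of i ds] by simp_all
qed

lemma ptree_exhaust_ne: "d \<noteq> Leaf \<Longrightarrow> \<exists>a es. d = Node a es"
  by (cases d) auto

lemma replaces_replace_at:
  "v \<in> vertices ds \<Longrightarrow> replaces (branch_at ds v) b' (leaves_before ds v) ds (replace_at ds v b')"
proof (induction v arbitrary: ds)
  case Nil
  then show ?case by (simp add: vertices_def)
next
  case (Cons j w)
  then have j: "j < length ds" "ds ! j \<noteq> Leaf" "w = [] \<or> w \<in> vertices (branches (ds ! j))"
    by (auto simp: vertices_def)
  show ?case
  proof (cases "w = []")
    case True
    then show ?thesis using replaces.here[OF j(1) refl, of b'] by simp
  next
    case False
    obtain a es where a: "ds ! j = Node a es" using ptree_exhaust_ne[OF j(2)] by blast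
    then show ?thesis using replaces.above[OF j(1) a Cons.IH[of es]] j False by simp
  qed
qed

text \<open>Together with \<open>replaces_replace_at\<close> this translates between addresses and
  leaf counts. A leaf has no address as a vertex, whence the assumption on \<open>b\<close>.\<close>

lemma replaces_imp_vertex:
  assumes "replaces b b' s ds ds'" "b \<noteq> Leaf"
  shows "\<exists>v\<in>vertices ds. branch_at ds v = b \<and> replace_at ds v b' = ds' \<and> leaves_before ds v = s"
  using assms(1)
proof (induction rule: replaces.induct)
  case (here i ds)
  then show ?case using assms(2) by (intro bexI[of _ "[i]"]) (auto simp: vertices_def)
next
  case (above i ds a es s es')
  then obtain w where w: "w \<in> vertices es" "branch_at es w = b" "replace_at es w b' = es'" "leaves_before es w = s"
    by blast
  then have "w \<noteq> []" by (auto simp: vertices_def)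
  then show ?case using above w by (intro bexI[of _ "i # w"]) (auto simp: vertices_def)
qed

subsection \<open>Well-formed decorations\<close>

text \<open>The parameter \<open>lo\<close> is the number on the vertex below, so monotonicity is
  checked edge by edge on the way up; root branches start with 0.\<close>

fun wf_branch :: "'q operad \<Rightarrow> real \<Rightarrow> (real \<times> 'q) ptree \<Rightarrow> bool" where
  "wf_branch Q lo Leaf \<longleftrightarrow> True"
| "wf_branch Q lo (Node a ds) \<longleftrightarrow> lo \<le> fst a \<and> fst a \<le> 1 \<and> snd a \<in> topspace (ospace Q (length ds)) \<and>
    (\<forall>d\<in>set ds. wf_branch Q (fst a) d)"

lemma wf_branch_mono: "wf_branch Q lo d \<Longrightarrow> lo' \<le> lo \<Longrightarrow> wf_branch Q lo' d"
  by (cases d) auto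

lemma replaces_wf:
  fixes Q :: "'q operad"
  assumes "replaces b b' s ds ds'" "\<And>lo. lo0 \<le> lo \<Longrightarrow> wf_branch Q lo b \<Longrightarrow> wf_branch Q lo b'"
    and "\<forall>d\<in>set ds. wf_branch Q lo0 d"
  shows "\<forall>d\<in>set ds'. wf_branch Q lo0 d"
proof -
  have "\<exists>i<length ds. \<exists>r c'. ds' = ds[i := c'] \<and> s = nleaves (take i ds) + r \<and>
      (\<forall>lo\<ge>lo0. wf_branch Q lo (ds ! i) \<longrightarrow> wf_branch Q lo c')"
    using assms(1)
  proof (rule replaces_branch)
    fix a :: "real \<times> 'q" and es i r c'
    assume "i < length es" "\<forall>lo\<ge>lo0. wf_branch Q lo (es ! i) \<longrightarrow> wf_branch Q lo c'"
    then show "\<forall>lo\<ge>lo0. wf_branch Q lo (Node a es) \<longrightarrow> wf_branch Q lo (Node a (es[i := c']))"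
      using set_update_subset_insert[of es i c'] by fastforce
  qed (use assms(2) in blast)
  then obtain i c' where "i < length ds" "ds' = ds[i := c']"
      "\<forall>lo\<ge>lo0. wf_branch Q lo (ds ! i) \<longrightarrow> wf_branch Q lo c'"
    by blast
  then show ?thesis using assms(3) set_update_subset_insert[of ds i c'] by fastforce
qed

text \<open>What matters later is that the replaced branch is well formed for some bound; the actual
  one is the number on the vertex below it.\<close>

lemma replaces_wf_branch:
  fixes Q :: "'q operad"
  assumes "replaces b b' s ds ds'" "\<forall>d\<in>set ds. wf_branch Q lo d"
  shows "\<exists>lo'\<ge>lo. wf_branch Q lo' b"
proof -
  have "\<exists>i<length ds. \<exists>r c'. ds' = ds[i := c'] \<and> s = nleaves (take i ds) + r \<and>
      (\<forall>lo. wf_branch Q lo (ds ! i) \<longrightarrow> (\<exists>lo'\<ge>lo. wf_branch Q lo' b))"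
    using assms(1)
  proof (rule replaces_branch)
    fix a :: "real \<times> 'q" and es i r c'
    assume i: "i < length es" and IH: "\<forall>lo. wf_branch Q lo (es ! i) \<longrightarrow> (\<exists>lo'\<ge>lo. wf_branch Q lo' b)"
    show "\<forall>lo. wf_branch Q lo (Node a es) \<longrightarrow> (\<exists>lo'\<ge>lo. wf_branch Q lo' b)"
    proof (intro allI impI)
      fix lo assume "wf_branch Q lo (Node a es)"
      then have "lo \<le> fst a" "wf_branch Q (fst a) (es ! i)" using i by auto
      then show "\<exists>lo'\<ge>lo. wf_branch Q lo' b" using IH order_trans by blast
    qed
  qed blast
  then show ?thesis using assms(2) by (metis nth_mem)
qed

section \<open>Labelled trees versus a shape with a decoration\<close>

lemma is_vertex_nonempty: "w \<in> vertices ds \<Longrightarrow> w \<noteq> []"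
  by (auto simp: vertices_def)

lemma vertices_ball_iff:
  "(\<forall>v\<in>vertices ds. P v) \<longleftrightarrow>
    (\<forall>j<length ds. ds ! j \<noteq> Leaf \<longrightarrow> P [j] \<and> (\<forall>w\<in>vertices (branches (ds ! j)). P (j # w)))"
proof -
  have "vertices ds = {j # w | j w. j < length ds \<and> ds ! j \<noteq> Leaf \<and> (w = [] \<or> w \<in> vertices (branches (ds ! j)))}"
    (is "_ = ?R")
  proof (rule set_eqI)
    fix v show "v \<in> vertices ds \<longleftrightarrow> v \<in> ?R" by (cases v) (auto simp: vertices_def)
  qed
  then show ?thesis by auto
qed

lemma vertices_Cons_iff:
  "j # w \<in> vertices ds \<longleftrightarrow> j < length ds \<and> ds ! j \<noteq> Leaf \<and> (w = [] \<or> w \<in> vertices (branches (ds ! j)))"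
  by (auto simp: vertices_def)

lemma shape_nth: "j < length ds \<Longrightarrow> shape ds ! j = map_ptree (\<lambda>_. ()) (ds ! j)"
  by (simp add: shape_def)

lemma branches_map_ptree: "branches (map_ptree f d) = map (map_ptree f) (branches d)"
  by (cases d) auto

lemma length_shape [simp]: "length (shape ds) = length ds"
  by (simp add: shape_def)

lemma vertices_shape: "v \<in> vertices (shape ds) \<longleftrightarrow> v \<in> vertices ds"
proof (induction v arbitrary: ds)
  case (Cons j w)
  have "map_ptree (\<lambda>_. ()) d = Leaf \<longleftrightarrow> d = Leaf" for d :: "'a ptree" by (cases d) auto
  moreover have "branches (shape ds ! j) = shape (branches (ds ! j))" if "j < length ds"
    using that by (simp add: shape_nth branches_map_ptree) (simp add: shape_def)
  ultimately show ?case using Cons[of "branches (ds ! j)"] by (auto simp: vertices_Cons_iff shape_nth)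
qed (simp add: vertices_def)

lemma branch_at_shape: "v \<in> vertices ds \<Longrightarrow> branch_at (shape ds) v = map_ptree (\<lambda>_. ()) (branch_at ds v)"
proof (induction v arbitrary: ds)
  case (Cons j w)
  have "branches (shape ds ! j) = shape (branches (ds ! j))" if "j < length ds"
    using that by (simp add: shape_nth branches_map_ptree) (simp add: shape_def)
  then show ?case using Cons by (auto simp: vertices_Cons_iff shape_nth)
qed (simp add: vertices_def)

lemma vertex_arity_shape: "v \<in> vertices ds \<Longrightarrow> vertex_arity (shape ds) v = length (branches (branch_at ds v))"
  by (simp add: vertex_arity_def branch_at_shape branches_map_ptree)

lemma size_branches_less:
  assumes "d \<in> set ds" "d = Node a es"
  shows "size_list size es < size_list size ds"
proof -
  have "size d \<le> size_list size ds" using assms(1) by (simp add: size_list_estimation')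
  then show ?thesis using assms(2) by simp
qed

text \<open>Monotonicity along edges is compared with monotonicity for all pairs of vertices on a
  path. For pairs that start at the bottom vertex of a root branch, the latter says that its number
  bounds all numbers above it; the other pairs lie in the subtrees, where the induction hypothesis
  applies.\<close>

lemma wf_branch_vertices:
  "(\<forall>d\<in>set ds. wf_branch Q lo d) \<longleftrightarrow>
    (\<forall>v\<in>vertices ds. lo \<le> fst (label (branch_at ds v)) \<and> fst (label (branch_at ds v)) \<le> 1 \<and>
      snd (label (branch_at ds v)) \<in> topspace (ospace Q (length (branches (branch_at ds v))))) \<and>
    (\<forall>v\<in>vertices ds. \<forall>v'\<in>vertices ds. strict_prefix v v' \<longrightarrow>
      fst (label (branch_at ds v)) \<le> fst (label (branch_at ds v')))"
  (is "_ \<longleftrightarrow> ?A lo ds \<and> ?B ds")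
proof (induction "size_list size ds" arbitrary: ds lo rule: less_induct)
  case less
  have wf: "wf_branch Q lo (ds ! j) \<longleftrightarrow> lo \<le> fst a \<and> fst a \<le> 1 \<and> snd a \<in> topspace (ospace Q (length es)) \<and>
      ?A (fst a) es \<and> ?B es" if "j < length ds" "ds ! j = Node a es" for j a es
    using less[OF size_branches_less[OF nth_mem[OF that(1)] that(2)], of "fst a"] that(2) by simp
  have A: "?A lo ds \<longleftrightarrow> (\<forall>j<length ds. \<forall>a es. ds ! j = Node a es \<longrightarrow>
      lo \<le> fst a \<and> fst a \<le> 1 \<and> snd a \<in> topspace (ospace Q (length es)) \<and> ?A lo es)"
    unfolding vertices_ball_iff[of ds]
    by (rule all_cong, rename_tac j, case_tac "ds ! j")
       (auto simp: is_vertex_nonempty)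
  have B: "?B ds \<longleftrightarrow> (\<forall>j<length ds. \<forall>a es. ds ! j = Node a es \<longrightarrow>
      (\<forall>w\<in>vertices es. fst a \<le> fst (label (branch_at es w))) \<and> ?B es)" (is "_ \<longleftrightarrow> ?R")
  proof
    assume B: "?B ds"
    show ?R
    proof (intro allI impI conjI ballI)
      fix j a es w assume j: "j < length ds" "ds ! j = Node a es" and w: "w \<in> vertices es"
      have "[j] \<in> vertices ds" "j # w \<in> vertices ds" "strict_prefix [j] (j # w)"
        using j w is_vertex_nonempty[OF w] by (auto simp: vertices_Cons_iff strict_prefix_def)
      from B[rule_format, OF this] show "fst a \<le> fst (label (branch_at es w))"
        using j is_vertex_nonempty[OF w] by simp
    next
      fix j a es w w' assume j: "j < length ds" "ds ! j = Node a es"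
        and w: "w \<in> vertices es" "w' \<in> vertices es" "strict_prefix w w'"
      have "j # w \<in> vertices ds" "j # w' \<in> vertices ds" "strict_prefix (j # w) (j # w')"
        using j w by (auto simp: vertices_Cons_iff)
      from B[rule_format, OF this] show "fst (label (branch_at es w)) \<le> fst (label (branch_at es w'))"
        using j is_vertex_nonempty[OF w(1)] is_vertex_nonempty[OF w(2)] by simp
    qed
  next
    assume R: ?R
    show "?B ds"
    proof (intro ballI impI)
      fix v v' assume v: "v \<in> vertices ds" "v' \<in> vertices ds" "strict_prefix v v'"
      obtain j w where vj: "v = j # w" using is_vertex_nonempty[OF v(1)] by (cases v) auto
      obtain w' where vj': "v' = j # w'" and ww: "strict_prefix w w'"
        using v(3) vj by (cases v') auto
      have j: "j < length ds" "ds ! j \<noteq> Leaf" using v(1) vj by (auto simp: vertices_Cons_iff)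
      obtain a es where a: "ds ! j = Node a es" using ptree_exhaust_ne[OF j(2)] by blast
      have w'0: "w' \<noteq> []" using ww by auto
      then have w': "w' \<in> vertices es" using v(2) vj' a by (auto simp: vertices_Cons_iff)
      have Rj: "\<forall>w\<in>vertices es. fst a \<le> fst (label (branch_at es w))" "?B es"
        using R j(1) a by blast+
      show "fst (label (branch_at ds v)) \<le> fst (label (branch_at ds v'))"
      proof (cases "w = []")
        case True
        then show ?thesis using Rj(1) a w' w'0 vj vj' by simp
      next
        case False
        then have "w \<in> vertices es" using v(1) vj a by (auto simp: vertices_Cons_iff)
        then show ?thesis using Rj(2) a w' w'0 vj vj' False ww by simp
      qed
    qed
  qed
  have "(\<forall>d\<in>set ds. wf_branch Q lo d) \<longleftrightarrow> (\<forall>j<length ds. \<forall>a es. ds ! j = Node a es \<longrightarrow> wf_branch Q lo (ds ! j))"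
    unfolding all_set_conv_all_nth by (metis ptree.exhaust wf_branch.simps(1))
  also have "\<dots> \<longleftrightarrow> (\<forall>j<length ds. \<forall>a es. ds ! j = Node a es \<longrightarrow>
      lo \<le> fst a \<and> fst a \<le> 1 \<and> snd a \<in> topspace (ospace Q (length es)) \<and> ?A (fst a) es \<and> ?B es)"
    using wf by blast
  \<comment> \<open>The bound \<open>fst a\<close> on the subtree becomes a clause of its own, and
    the bound \<open>lo\<close> that replaces it follows from \<open>lo \<le> fst a\<close> by
    transitivity.\<close>
  also have "\<dots> \<longleftrightarrow> (\<forall>j<length ds. \<forall>a es. ds ! j = Node a es \<longrightarrow>
      lo \<le> fst a \<and> fst a \<le> 1 \<and> snd a \<in> topspace (ospace Q (length es)) \<and> ?A lo es \<and>
      (\<forall>w\<in>vertices es. fst a \<le> fst (label (branch_at es w))) \<and> ?B es)"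
    by (meson order_trans)
  also have "\<dots> \<longleftrightarrow> ?A lo ds \<and> ?B ds" unfolding A B by blast
  finally show ?case .
qed

lemma topspace_dec_space:
  fixes k :: "'k itself"
  shows "topspace (dec_space k Q T) =
    {t \<in> \<Pi>\<^sub>E v\<in>vertices T. {0..1}. \<forall>v\<in>vertices T. \<forall>v'\<in>vertices T. strict_prefix v v' \<longrightarrow> t v \<le> t v'} \<times>
    (\<Pi>\<^sub>E v\<in>vertices T. topspace (ospace Q (vertex_arity T v)))"
  by (auto simp: dec_space_def D_space_def H_space_def)

lemma dtrees_iff:
  fixes k :: "'k itself"
  shows "ds \<in> dtrees k Q n \<longleftrightarrow> length ds = n \<and> (\<forall>d\<in>set ds. wf_branch Q 0 d)"
proof -
  have v: "vertices (shape ds) = vertices ds" using vertices_shape by blast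
  have "decoration ds \<in> topspace (dec_space k Q (shape ds)) \<longleftrightarrow>
    (\<forall>v\<in>vertices ds. 0 \<le> fst (label (branch_at ds v)) \<and> fst (label (branch_at ds v)) \<le> 1 \<and>
      snd (label (branch_at ds v)) \<in> topspace (ospace Q (length (branches (branch_at ds v))))) \<and>
    (\<forall>v\<in>vertices ds. \<forall>v'\<in>vertices ds. strict_prefix v v' \<longrightarrow>
      fst (label (branch_at ds v)) \<le> fst (label (branch_at ds v')))"
    unfolding topspace_dec_space decoration_def v
    by (auto simp: PiE_iff vertex_arity_shape)
  then show ?thesis unfolding dtrees_def wf_branch_vertices by auto
qed

lemma decorate_branch_Node:
  "decorate_branch x v (Node u ts) = Node (fst x v, snd x v)
    (map (\<lambda>j. decorate_branch x (v @ [j]) (ts ! j)) [0..<length ts])"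
  by (auto simp: zip_map1 intro!: nth_equalityI)

declare decorate_branch.simps(2) [simp del]

lemma decorate_eq: "decorate T x = map (\<lambda>j. decorate_branch x [j] (T ! j)) [0..<length T]"
  by (auto simp: decorate_def intro!: nth_equalityI)

text \<open>A branch is treated as the tree \<open>[d]\<close> with one root edge, whose addresses
  all begin with 0. Dropping this entry gives the address relative to the absolute position
  \<open>v\<close>, hence \<open>v @ tl w\<close>.\<close>

lemma decorate_branch_shape:
  assumes "\<And>w. w \<in> vertices [d] \<Longrightarrow> (fst x (v @ tl w), snd x (v @ tl w)) = label (branch_at [d] w)"
  shows "decorate_branch x v (map_ptree (\<lambda>_. ()) d) = d"
  using assms
proof (induction d arbitrary: v)
  case (Node a ds)
  have "decorate_branch x (v @ [j]) (map_ptree (\<lambda>_. ()) (ds ! j)) = ds ! j" if j: "j < length ds" for j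
  proof (rule Node.IH)
    fix w assume w: "w \<in> vertices [ds ! j]"
    then obtain u where u: "w = 0 # u" using is_vertex_nonempty[OF w] by (cases w) (auto simp: vertices_Cons_iff)
    then have "0 # j # u \<in> vertices [Node a ds]" using w j by (auto simp: vertices_Cons_iff)
    from Node.prems[OF this] show "(fst x ((v @ [j]) @ tl w), snd x ((v @ [j]) @ tl w)) = label (branch_at [ds ! j] w)"
      using u by auto
  qed (use j in simp)
  moreover have "(fst x v, snd x v) = a"
    using Node.prems[of "[0]"] by (simp add: vertices_Cons_iff)
  ultimately show ?case
    by (simp add: decorate_branch_Node) (auto intro!: nth_equalityI)
qed simp

lemma decorate_shape_decoration: "decorate (shape ds) (decoration ds) = ds"
proof (rule nth_equalityI)
  fix j assume "j < length (decorate (shape ds) (decoration ds))"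
  then have j: "j < length ds" by (simp add: decorate_eq)
  have "decorate_branch (decoration ds) [j] (map_ptree (\<lambda>_. ()) (ds ! j)) = ds ! j"
  proof (rule decorate_branch_shape)
    fix w assume w: "w \<in> vertices [ds ! j]"
    then obtain u where u: "w = 0 # u" using is_vertex_nonempty[OF w] by (cases w) (auto simp: vertices_Cons_iff)
    then have "j # u \<in> vertices ds" using w j by (auto simp: vertices_Cons_iff)
    then show "(fst (decoration ds) ([j] @ tl w), snd (decoration ds) ([j] @ tl w)) = label (branch_at [ds ! j] w)"
      using u by (auto simp: decoration_def)
  qed
  then show "decorate (shape ds) (decoration ds) ! j = ds ! j" using j by (simp add: decorate_eq shape_nth)
qed (simp add: decorate_eq)

lemma shape_decorate_branch: "map_ptree (\<lambda>_. ()) (decorate_branch x v s) = s"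
proof (induction s arbitrary: v)
  case (Node u ts)
  then show ?case by (auto simp: decorate_branch_Node intro!: nth_equalityI)
qed simp

lemma shape_decorate: "shape (decorate T x) = T"
  by (auto simp: shape_def decorate_eq shape_decorate_branch intro!: nth_equalityI)

lemma label_decorate_branch:
  "w \<in> vertices [s] \<Longrightarrow> label (branch_at [decorate_branch x v s] w) = (fst x (v @ tl w), snd x (v @ tl w))"
proof (induction s arbitrary: v w)
  case Leaf
  then show ?case by (cases w) (auto simp: vertices_def)
next
  case (Node u ts)
  obtain w' where w: "w = 0 # w'" using is_vertex_nonempty[OF Node.prems] Node.prems by (cases w) (auto simp: vertices_Cons_iff)
  show ?case
  proof (cases w')
    case Nil
    then show ?thesis using w by (simp add: decorate_branch_Node)
  next
    case (Cons j z)
    then have j: "j < length ts" "0 # z \<in> vertices [ts ! j]"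
      using Node.prems w by (auto simp: vertices_Cons_iff)
    from Node.IH[OF nth_mem[OF j(1)] j(2), of "v @ [j]"] show ?thesis
      using w Cons j by (cases "z = []") (simp_all add: decorate_branch_Node)
  qed
qed

lemma decoration_decorate:
  fixes k :: "'k itself"
  assumes "x \<in> topspace (dec_space k Q T)"
  shows "decoration (decorate T x) = x"
proof -
  have v: "vertices (decorate T x) = vertices T"
    using vertices_shape[of _ "decorate T x"] by (auto simp: shape_decorate)
  have l: "label (branch_at (decorate T x) w) = (fst x w, snd x w)" if w: "w \<in> vertices T" for w
  proof -
    obtain j z where jz: "w = j # z" using is_vertex_nonempty[OF w] by (cases w) auto
    then have j: "j < length T" "0 # z \<in> vertices [T ! j]" using w by (auto simp: vertices_Cons_iff)
    from label_decorate_branch[OF j(2), of x "[j]"] show ?thesis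
      using j jz by (cases "z = []") (simp_all add: decorate_eq)
  qed
  have "fst x \<in> extensional (vertices T)" "snd x \<in> extensional (vertices T)"
    using assms unfolding topspace_dec_space by (auto simp: PiE_iff)
  then show ?thesis
    unfolding decoration_def v using l
    by (intro prod_eqI) (auto intro!: extensionalityI[of _ "vertices T"])
qed

lemma decorate_in_dtrees:
  fixes k :: "'k itself"
  assumes "x \<in> topspace (dec_space k Q T)" "length T = n"
  shows "decorate T x \<in> dtrees k Q n"
  using assms by (simp add: dtrees_def shape_decorate decoration_decorate) (simp add: decorate_eq)

lemma nleaves_shape: "nleaves (shape ds) = nleaves ds"
proof -
  have "leaves (map_ptree f d) = leaves d" for f :: "'a \<Rightarrow> unit" and d
    by (induction d) (simp_all add: nleaves_def o_def cong: map_cong)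
  then show ?thesis by (simp add: nleaves_def shape_def o_def)
qed

lemma family_value_make_family:
  fixes k :: "'k itself"
  assumes "ds \<in> dtrees k Q n"
  shows "family_value (make_family k Q n F) ds = F ds"
  using assms unfolding family_value_def make_family_def
  by (simp add: dtrees_def trees_def decorate_shape_decoration)

lemma make_family_family_value:
  fixes k :: "'k itself"
  assumes "f \<in> extensional (trees n)" "\<And>T. T \<in> trees n \<Longrightarrow> f T \<in> extensional (topspace (dec_space k Q T))"
  shows "make_family k Q n (family_value f) = f"
proof (rule extensionalityI[of _ "trees n"])
  fix T assume T: "T \<in> trees n"
  show "make_family k Q n (family_value f) T = f T"
    unfolding make_family_def family_value_def using T assms(2)[OF T]
    by (intro extensionalityI[of _ "topspace (dec_space k Q T)"])
       (simp_all add: shape_decorate decoration_decorate)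
qed (use assms in \<open>auto simp: make_family_def\<close>)

lemma make_family_cong:
  fixes k :: "'k itself"
  assumes "\<And>ds. ds \<in> dtrees k Q n \<Longrightarrow> F ds = G ds"
  shows "make_family k Q n F = make_family k Q n G"
  unfolding make_family_def
  using assms decorate_in_dtrees[where n = n and k = k and Q = Q] by (auto simp: trees_def intro!: restrict_ext)

section \<open>Composites along decorated trees\<close>

abbreviation wf_tree :: "'q operad \<Rightarrow> real \<Rightarrow> 'q dtree \<Rightarrow> bool" where
  "wf_tree Q lo ds \<equiv> \<forall>d\<in>set ds. wf_branch Q lo d"

abbreviation comps :: "'q operad \<Rightarrow> 'q dtree \<Rightarrow> (nat \<times> 'q) list" where
  "comps Q ds \<equiv> map (\<lambda>d. (leaves d, ocomposite Q d)) ds"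

lemma sum_list_comps: "sum_list (map fst (comps Q ds)) = nleaves ds"
  by (simp add: nleaves_def o_def)

lemma ocomposite_Node: "ocomposite Q (Node a ds) = mcomposite (operad_module Q) Q (snd a) ds"
  by (simp add: mcomposite_def)

declare ocomposite.simps(2) [simp del]

lemma mcomposite_cong_replaces:
  assumes "replaces b b' s ds ds'" "leaves b = leaves b'" "ocomposite Q b = ocomposite Q b'"
  shows "mcomposite M Q x ds = mcomposite M Q x ds'"
proof -
  have upd: "comps Q (es[i := c]) = comps Q es"
    if "i < length es" "leaves (es ! i) = leaves c" "ocomposite Q (es ! i) = ocomposite Q c" for es i c
    using that by (simp add: map_update) (metis (no_types, lifting) list_update_id nth_map)
  have "\<exists>i<length ds. \<exists>r c'. ds' = ds[i := c'] \<and> s = nleaves (take i ds) + r \<and>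
      leaves (ds ! i) = leaves c' \<and> ocomposite Q (ds ! i) = ocomposite Q c'"
    using assms(1)
  proof (rule replaces_branch)
    fix a :: "real \<times> 'a" and es i r c'
    assume i: "i < length es" and "leaves (es ! i) = leaves c' \<and> ocomposite Q (es ! i) = ocomposite Q c'"
    then show "leaves (Node a es) = leaves (Node a (es[i := c'])) \<and>
        ocomposite Q (Node a es) = ocomposite Q (Node a (es[i := c']))"
      using upd[OF i, of c'] nleaves_update[OF i, of c'] by (simp add: ocomposite_Node mcomposite_def)
  qed (use assms(2,3) in simp)
  then obtain i c' where "i < length ds" "ds' = ds[i := c']"
    "leaves (ds ! i) = leaves c'" "ocomposite Q (ds ! i) = ocomposite Q c'" by blast
  then show ?thesis using upd by (simp only: mcomposite_def)
qed

context right_module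
begin

lemma ocomposite_closed: "wf_branch Q lo d \<Longrightarrow> ocomposite Q d \<in> Qt (leaves d)"
proof (induction d arbitrary: lo)
  case Leaf
  then show ?case using unit_in by simp
next
  case (Node a ds)
  interpret Q: right_module k Q "operad_module Q" using right_module_operad_module operad .
  have "fits (comps Q ds)" using Node by (auto simp: fits_def)
  then show ?case
    using Q.plug_closed[of "comps Q ds" "snd a" 0] Node.prems
    by (simp only: sum_list_comps operad_module_simps) (simp add: ocomposite.simps)
qed

lemma fits_comps: "wf_tree Q lo ds \<Longrightarrow> fits (comps Q ds)"
  using ocomposite_closed by (auto simp: fits_def)

lemma mcomposite_closed: "wf_tree Q lo ds \<Longrightarrow> x \<in> Mt (length ds) \<Longrightarrow> mcomposite M Q x ds \<in> Mt (nleaves ds)"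
  using plug_closed[OF fits_comps, of ds lo x 0] by (simp add: mcomposite_def nleaves_def o_def)

lemma mcomposite_act_update:
  assumes "wf_tree Q lo ds" "x \<in> Mt (length ds)" "i < length ds" "leaves c' = leaves (ds ! i)"
    "ocomposite Q c' = oact Q (leaves (ds ! i)) \<tau> (ocomposite Q (ds ! i))" "\<tau> permutes {..<leaves (ds ! i)}"
  shows "mcomposite M Q x (ds[i := c']) = mact M (nleaves ds) (shift_perm (nleaves (take i ds)) \<tau>) (mcomposite M Q x ds)"
  using plug_act[OF fits_comps[OF assms(1)], of x i "leaves (ds ! i)" "ocomposite Q (ds ! i)" \<tau>] assms(2-)
  unfolding mcomposite_def by (simp add: map_update nleaves_def o_def take_map)

lemma mcomposite_circ_update:
  assumes "wf_tree Q lo ds" "x \<in> Mt (length ds)" "i < length ds" "q \<in> Qt l" "r < leaves (ds ! i)"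
    "leaves c + 1 = leaves (ds ! i) + l" "ocomposite Q c = ocomp Q (leaves (ds ! i)) l r (ocomposite Q (ds ! i)) q"
  shows "mcomposite M Q x (ds[i := c]) = circ (nleaves ds) l (nleaves (take i ds) + r) (mcomposite M Q x ds) q"
proof -
  have c: "leaves c = leaves (ds ! i) + l - 1" using assms(6) by simp
  show ?thesis
    using plug_update[OF fits_comps[OF assms(1)], of x 0 i "leaves (ds ! i)" "ocomposite Q (ds ! i)" q l r] assms(2-5,7)
    unfolding mcomposite_def map_update c
    by (simp add: nleaves_def o_def take_map)
qed

lemma mcomposite_permute:
  assumes "wf_tree Q lo ds" "x \<in> Mt (length ds)" "\<sigma> permutes {..<length ds}"
  shows "mcomposite M Q (mact M (length ds) \<sigma> x) (permute_list \<sigma> ds)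
    = mact M (nleaves ds) (block_perm \<sigma> (map leaves ds)) (mcomposite M Q x ds)"
  using plug_permute[OF fits_comps[OF assms(1)], of x \<sigma>] assms
  by (simp add: mcomposite_def permute_list_map nleaves_def o_def)

text \<open>The number \<open>t\<close> on the new vertex may be arbitrary, since composites read
  only the operad labels.\<close>

lemma mcomposite_circ:
  assumes "wf_tree Q lo ds" "x \<in> Mt n" "q \<in> Qt m" "i < n" "length ds = n + m - 1"
  shows "mcomposite M Q (circ n m i x q) ds
    = mcomposite M Q x (take i ds @ Node (t, q) (take m (drop i ds)) # drop (i + m) ds)"
  using plug_plug[OF fits_comps[OF assms(1)] assms(2-4)] assms(5)
  by (simp add: mcomposite_def nleaves_def o_def take_map drop_map ocomposite.simps)

lemma ocomposite_unit:
  assumes "wf_branch Q lo d"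
  shows "ocomposite Q (Node (t, ounit Q) [d]) = ocomposite Q d"
  using unit_ocomp[OF ocomposite_closed[OF assms]] by (simp add: ocomposite.simps)

lemma ocomposite_permute:
  assumes "wf_branch Q lo (Node (t, q) ds)" "\<sigma> permutes {..<length ds}"
  shows "ocomposite Q (Node (t, oact Q (length ds) \<sigma> q) (permute_list \<sigma> ds))
    = oact Q (nleaves ds) (block_perm \<sigma> (map leaves ds)) (ocomposite Q (Node (t, q) ds))"
proof -
  interpret Q: right_module k Q "operad_module Q" using right_module_operad_module operad .
  show ?thesis using Q.mcomposite_permute[of ds t q \<sigma>] assms by (simp add: ocomposite_Node)
qed

text \<open>Associativity of the operad as a module over itself: the branches \<open>es\<close> are
  the ones that \<open>mcomposite_circ\<close> collects at a new vertex in position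
  \<open>j\<close>, which restores the tree before contraction.\<close>

lemma ocomposite_contract:
  assumes wf: "wf_branch Q lo (Node (t, q) ds)" and j: "j < length ds" "ds ! j = Node (t, q') es"
  shows "ocomposite Q (Node (t, q) ds)
    = ocomposite Q (Node (t, ocomp Q (length ds) (length es) j q q') (take j ds @ es @ drop (Suc j) ds))"
proof -
  interpret Q: right_module k Q "operad_module Q" using right_module_operad_module operad .
  let ?ds = "take j ds @ es @ drop (Suc j) ds"
  have wfj: "wf_branch Q t (Node (t, q') es)" using wf j by (metis nth_mem wf_branch.simps(2) fst_conv)
  have ds: "take j ds @ Node (t, q') es # drop (Suc j) ds = ds" using j by (metis id_take_nth_drop)
  have "wf_tree Q t ?ds" using wf wfj by (auto dest: in_set_takeD in_set_dropD)
  moreover have "length ?ds = length ds + length es - 1" using j by simp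
  ultimately have "mcomposite (operad_module Q) Q (rcomp (operad_module Q) (length ds) (length es) j q q') ?ds
      = mcomposite (operad_module Q) Q q
        (take j ?ds @ Node (t, q') (take (length es) (drop j ?ds)) # drop (j + length es) ?ds)"
    using wf wfj j by (intro Q.mcomposite_circ) auto
  moreover have "take j ?ds @ Node (t, q') (take (length es) (drop j ?ds)) # drop (j + length es) ?ds = ds"
    using j ds by simp
  ultimately show ?thesis by (simp add: ocomposite_Node )
qed

text \<open>On the way from the replaced branch down to the root, each vertex shifts the leaf
  permutation past the leaves of the branches on the left; these shifts add up to
  \<open>s\<close>.\<close>

lemma replaces_ocomposite_act:
  assumes "replaces b b' s ds ds'" "wf_tree Q lo ds" "leaves b' = leaves b" "\<tau> permutes {..<leaves b}"
    and b': "\<And>lo. wf_branch Q lo b \<Longrightarrow> ocomposite Q b' = oact Q (leaves b) \<tau> (ocomposite Q b)"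
    and x: "x \<in> Mt (length ds)"
  shows "mcomposite M Q x ds' = mact M (nleaves ds) (shift_perm s \<tau>) (mcomposite M Q x ds)"
proof -
  interpret Q: right_module k Q "operad_module Q" using right_module_operad_module operad .
  define R where "R r c c' \<longleftrightarrow> leaves c' = leaves c \<and> shift_perm r \<tau> permutes {..<leaves c} \<and>
     (\<forall>lo. wf_branch Q lo c \<longrightarrow> ocomposite Q c' = oact Q (leaves c) (shift_perm r \<tau>) (ocomposite Q c))" for r c c'
  have "\<exists>i<length ds. \<exists>r c'. ds' = ds[i := c'] \<and> s = nleaves (take i ds) + r \<and> R r (ds ! i) c'"
    using assms(1)
  proof (rule replaces_branch)
    show "R 0 b b'" using assms by (auto simp: R_def)
  next
    fix a :: "real \<times> 'q" and es i r c'
    assume i: "i < length es" and R: "R r (es ! i) c'"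
    have "shift_perm (nleaves (take i es) + r) \<tau> permutes {..<nleaves es}"
      using R nleaves_take_le[OF i] unfolding R_def
      by (auto simp flip: shift_perm_shift_perm intro: shift_perm_permutes)
    moreover have "nleaves (es[i := c']) = nleaves es" using nleaves_update[OF i, of c'] R by (simp add: R_def)
    moreover have "ocomposite Q (Node a (es[i := c']))
        = oact Q (nleaves es) (shift_perm (nleaves (take i es) + r) \<tau>) (ocomposite Q (Node a es))"
      if "wf_branch Q lo (Node a es)" for lo
      using Q.mcomposite_act_update[of es "fst a" "snd a" i c' "shift_perm r \<tau>"] that i R
      by (auto simp: R_def ocomposite_Node shift_perm_shift_perm)
    ultimately show "R (nleaves (take i es) + r) (Node a es) (Node a (es[i := c']))"
      using R unfolding R_def leaves_Node by blast
  qed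
  then obtain i r c' where i: "i < length ds" "ds' = ds[i := c']" "s = nleaves (take i ds) + r" "R r (ds ! i) c'"
    by blast
  then show ?thesis
    using mcomposite_act_update[OF assms(2) x, of i c' "shift_perm r \<tau>"] assms(2)
    by (auto simp: R_def shift_perm_shift_perm)
qed

text \<open>The composite of a tree is that of the tree with \<open>b\<close> cut off, composed with
  the composite of \<open>b\<close> at the leaf left by the cut. At the cut itself this is the left
  unit law, and each vertex on the way down uses \<open>mcomposite_circ_update\<close> once.\<close>

lemma replaces_mcomposite_circ:
  assumes "replaces b Leaf s ds ds'" "wf_tree Q lo ds" "x \<in> Mt (length ds)"
  shows "mcomposite M Q x ds = circ (nleaves ds') (leaves b) s (mcomposite M Q x ds') (ocomposite Q b)"
proof -
  interpret Q: right_module k Q "operad_module Q" using right_module_operad_module operad .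
  define R where "R r c c' \<longleftrightarrow> leaves c + 1 = leaves c' + leaves b \<and> r < leaves c' \<and>
     (\<forall>lo. wf_branch Q lo c \<longrightarrow> wf_branch Q lo c' \<and> ocomposite Q b \<in> Qt (leaves b) \<and>
        ocomposite Q c = ocomp Q (leaves c') (leaves b) r (ocomposite Q c') (ocomposite Q b))" for r c c'
  have "\<exists>i<length ds. \<exists>r c'. ds' = ds[i := c'] \<and> s = nleaves (take i ds) + r \<and> R r (ds ! i) c'"
    using assms(1)
  proof (rule replaces_branch)
    show "R 0 b Leaf" using ocomposite_closed unit_ocomp by (auto simp: R_def)
  next
    fix a :: "real \<times> 'q" and es i r c'
    assume i: "i < length es" and R: "R r (es ! i) c'"
    let ?es = "es[i := c']"
    have "nleaves es + 1 = nleaves ?es + leaves b" "nleaves (take i es) + r < nleaves ?es"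
      using nleaves_update[OF i, of c'] nleaves_take_le[of i ?es] i R by (simp_all add: R_def)
    moreover have "wf_branch Q lo (Node a ?es) \<and> ocomposite Q b \<in> Qt (leaves b) \<and>
        ocomposite Q (Node a es)
          = ocomp Q (nleaves ?es) (leaves b) (nleaves (take i es) + r) (ocomposite Q (Node a ?es)) (ocomposite Q b)"
      if wf: "wf_branch Q lo (Node a es)" for lo
    proof -
      have "wf_branch Q (fst a) (es ! i)" using wf i by simp
      then have c': "wf_branch Q (fst a) c'" "ocomposite Q b \<in> Qt (leaves b)"
          "ocomposite Q (es ! i) = ocomp Q (leaves c') (leaves b) r (ocomposite Q c') (ocomposite Q b)"
        using R by (auto simp: R_def)
      have wf': "wf_branch Q lo (Node a ?es)"
        using wf c'(1) set_update_subset_insert[of es i c'] by auto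
      then show ?thesis
        using Q.mcomposite_circ_update[of ?es "fst a" "snd a" i "ocomposite Q b" "leaves b" r "es ! i"] i c' R
        by (simp add: R_def ocomposite_Node)
    qed
    ultimately show "R (nleaves (take i es) + r) (Node a es) (Node a ?es)"
      unfolding R_def leaves_Node by blast
  qed
  then obtain i r c' where i: "i < length ds" "ds' = ds[i := c']" "s = nleaves (take i ds) + r" and R: "R r (ds ! i) c'"
    by blast
  have "wf_branch Q lo (ds ! i)" using assms(2) i by simp
  then have c': "wf_branch Q lo c'" "ocomposite Q b \<in> Qt (leaves b)"
      "ocomposite Q (ds ! i) = ocomp Q (leaves c') (leaves b) r (ocomposite Q c') (ocomposite Q b)"
    using R by (auto simp: R_def)
  have "wf_tree Q lo ds'" using assms(2) c'(1) i set_update_subset_insert[of ds i c'] by auto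
  then show ?thesis
    using mcomposite_circ_update[of ds' lo x i "ocomposite Q b" "leaves b" r "ds ! i"] i c' R assms(3)
    by (simp add: R_def)
qed

end

subsection \<open>Continuous families of decorated trees\<close>

text \<open>A family of decorated branches over \<open>K\<close> with continuous labels and one
  fixed shape, which is encoded by the derivation and need not be named. The shape is the same at
  all points of \<open>'k\<close>, also outside the space \<open>K\<close>.\<close>

inductive plot_branch :: "'q operad \<Rightarrow> 'k topology \<Rightarrow> ('k \<Rightarrow> (real \<times> 'q) ptree) \<Rightarrow> bool" for Q K where
  Leaf: "plot_branch Q K (\<lambda>_. Leaf)"
| Node: "continuous_map K euclideanreal t \<Longrightarrow> continuous_map K (ospace Q (length es)) q \<Longrightarrow>
    \<forall>e\<in>set es. plot_branch Q K e \<Longrightarrow> plot_branch Q K (\<lambda>z. Node (t z, q z) (map (\<lambda>e. e z) es))"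

lemma plot_branch_shape: "plot_branch Q K e \<Longrightarrow> map_ptree (\<lambda>_. ()) (e z) = map_ptree (\<lambda>_. ()) (e z')"
  by (induction rule: plot_branch.induct) auto

lemma plots_shape: "\<forall>e\<in>set es. plot_branch Q K e \<Longrightarrow> shape (map (\<lambda>e. e z) es) = shape (map (\<lambda>e. e z') es)"
  using plot_branch_shape by (fastforce simp: shape_def)

lemma plots_nleaves: "\<forall>e\<in>set es. plot_branch Q K e \<Longrightarrow> nleaves (map (\<lambda>e. e z) es) = nleaves (map (\<lambda>e. e z') es)"
  using plots_shape by (metis nleaves_shape)

lemma plot_branch_leaves: "plot_branch Q K e \<Longrightarrow> leaves (e z) = leaves (e z')"
  using plots_nleaves[of "[e]"] by simp

context right_module
begin

lemma continuous_circ_test: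
  assumes "test_space (K :: 'k topology)" "continuous_map K (mspace M n) x" "continuous_map K (ospace Q m) q" "i < n"
  shows "continuous_map K (mspace M (n + m - 1)) (\<lambda>z. circ n m i (x z) (q z))"
proof -
  have "continuous_map K (kprod k (mspace M n) (ospace Q m)) (\<lambda>z. (x z, q z))"
    using assms by (simp add: continuous_map_kprod o_def)
  from continuous_map_compose[OF this continuous_circ[OF assms(4)]] show ?thesis by (simp add: o_def)
qed

lemma continuous_plug:
  assumes "test_space (K :: 'k topology)"
    and "\<forall>p\<in>set ys. continuous_map K (ospace Q (fst p)) (snd p)"
    and "continuous_map K (mspace M (i + length ys)) x"
  shows "continuous_map K (mspace M (i + sum_list (map fst ys))) (\<lambda>z. plug circ i (x z) (map (\<lambda>p. (fst p, snd p z)) ys))"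
  using assms(2,3)
proof (induction ys arbitrary: i)
  case (Cons p ys)
  have "continuous_map K (mspace M (Suc i + sum_list (map fst ys))) (\<lambda>z. plug circ (Suc i) (x z) (map (\<lambda>p. (fst p, snd p z)) ys))"
    using Cons by (intro Cons.IH) auto
  from continuous_circ_test[OF assms(1) this, of "fst p" "snd p" i] Cons.prems
  show ?case by (simp add: o_def ac_simps)
qed simp

text \<open>The number of leaves does not vary along a plot, so the arity of the target can be read
  off at any point \<open>z0\<close>.\<close>

lemma continuous_ocomposite:
  assumes K: "test_space (K :: 'k topology)"
  shows "plot_branch Q K e \<Longrightarrow> continuous_map K (ospace Q (leaves (e z0))) (\<lambda>z. ocomposite Q (e z))"
proof (induction rule: plot_branch.induct)
  case Leaf
  then show ?case using unit_in by simp
next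
  case (Node t es q)
  interpret Q: right_module k Q "operad_module Q" using right_module_operad_module operad .
  let ?ys = "map (\<lambda>e. (leaves (e z0), \<lambda>z. ocomposite Q (e z))) es"
  have "continuous_map K (ospace Q (0 + sum_list (map fst ?ys)))
      (\<lambda>z. plug (ocomp Q) 0 (q z) (map (\<lambda>p. (fst p, snd p z)) ?ys))"
    using Node Q.continuous_plug[OF K, of ?ys 0 q] by simp
  moreover have "map (\<lambda>p. (fst p, snd p z)) ?ys = comps Q (map (\<lambda>e. e z) es)" for z
    using Node(3) plot_branch_leaves by fastforce
  ultimately have "continuous_map K (ospace Q (0 + sum_list (map fst ?ys)))
      (\<lambda>z. plug (ocomp Q) 0 (q z) (comps Q (map (\<lambda>e. e z) es)))" by (simp only:)
  then show ?case by (simp add: nleaves_def o_def ocomposite.simps)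
qed

lemma continuous_mcomposite:
  assumes K: "test_space (K :: 'k topology)" and es: "\<forall>e\<in>set es. plot_branch Q K e"
    and x: "continuous_map K (mspace M (length es)) x"
  shows "continuous_map K (mspace M (nleaves (map (\<lambda>e. e z0) es))) (\<lambda>z. mcomposite M Q (x z) (map (\<lambda>e. e z) es))"
proof -
  let ?ys = "map (\<lambda>e. (leaves (e z0), \<lambda>z. ocomposite Q (e z))) es"
  have "continuous_map K (mspace M (0 + sum_list (map fst ?ys)))
      (\<lambda>z. plug circ 0 (x z) (map (\<lambda>p. (fst p, snd p z)) ?ys))"
    using es x continuous_ocomposite[OF K] by (intro continuous_plug[OF K]) auto
  moreover have "map (\<lambda>p. (fst p, snd p z)) ?ys = comps Q (map (\<lambda>e. e z) es)" for z
    using es plot_branch_leaves by fastforce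
  ultimately have "continuous_map K (mspace M (0 + sum_list (map fst ?ys)))
      (\<lambda>z. plug circ 0 (x z) (comps Q (map (\<lambda>e. e z) es)))" by (simp only:)
  then show ?thesis by (simp add: mcomposite_def nleaves_def o_def)
qed

end

section \<open>Test maps into the spaces of decorations\<close>

lemma plot_branch_decorate_branch:
  assumes "\<And>w. w \<in> vertices [s] \<Longrightarrow> continuous_map K euclideanreal (\<lambda>z. fst (g z) (v @ tl w)) \<and>
    continuous_map K (ospace Q (vertex_arity [s] w)) (\<lambda>z. snd (g z) (v @ tl w))"
  shows "plot_branch Q K (\<lambda>z. decorate_branch (g z) v s)"
  using assms
proof (induction s arbitrary: v)
  case Leaf
  then show ?case by (simp add: plot_branch.Leaf)
next
  case (Node u ts)
  let ?es = "map (\<lambda>j z. decorate_branch (g z) (v @ [j]) (ts ! j)) [0..<length ts]"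
  have "plot_branch Q K (\<lambda>z. Node (fst (g z) v, snd (g z) v) (map (\<lambda>e. e z) ?es))"
  proof (rule plot_branch.Node)
    show "continuous_map K euclideanreal (\<lambda>z. fst (g z) v)"
      "continuous_map K (ospace Q (length ?es)) (\<lambda>z. snd (g z) v)"
      using Node.prems[of "[0]"] by (simp_all add: vertices_Cons_iff vertex_arity_def)
    have "plot_branch Q K (\<lambda>z. decorate_branch (g z) (v @ [j]) (ts ! j))" if j: "j < length ts" for j
    proof (rule Node.IH)
      fix w assume w: "w \<in> vertices [ts ! j]"
      then obtain u' where u: "w = 0 # u'" using is_vertex_nonempty[OF w] by (cases w) (auto simp: vertices_Cons_iff)
      then have "0 # j # u' \<in> vertices [Node u ts]" using w j by (auto simp: vertices_Cons_iff)
      from Node.prems[OF this]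
      show "continuous_map K euclideanreal (\<lambda>z. fst (g z) ((v @ [j]) @ tl w)) \<and>
          continuous_map K (ospace Q (vertex_arity [ts ! j] w)) (\<lambda>z. snd (g z) ((v @ [j]) @ tl w))"
        using u j by (cases "u' = []") (simp_all add: vertex_arity_def)
    qed (use j in simp)
    then show "\<forall>e\<in>set ?es. plot_branch Q K e" by auto
  qed
  then show ?case by (simp add: decorate_branch_Node o_def)
qed

lemma continuous_map_dec_space_components:
  fixes K :: "'k topology" and k :: "'k itself"
  assumes K: "test_space K" and g: "continuous_map K (dec_space k Q T) g" and v: "v \<in> vertices T"
  shows "continuous_map K euclideanreal (\<lambda>z. fst (g z) v)"
    "continuous_map K (ospace Q (vertex_arity T v)) (\<lambda>z. snd (g z) v)"
proof -
  have H: "continuous_map K (H_space T) (fst \<circ> g)" and D: "continuous_map K (D_space k Q T) (snd \<circ> g)"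
    using g by (simp_all add: dec_space_def continuous_map_kprod[OF K])
  have "continuous_map K (product_topology (\<lambda>_. top_of_set {0..1}) (vertices T)) (fst \<circ> g)"
    using H unfolding H_space_def continuous_map_in_subtopology by blast
  then show "continuous_map K euclideanreal (\<lambda>z. fst (g z) v)"
    using v by (auto simp: continuous_map_componentwise continuous_map_in_subtopology)
  show "continuous_map K (ospace Q (vertex_arity T v)) (\<lambda>z. snd (g z) v)"
    using D v by (simp add: D_space_def continuous_map_kproduct[OF K])
qed

lemma plots_decorate:
  fixes K :: "'k topology" and k :: "'k itself"
  assumes K: "test_space K" and g: "continuous_map K (dec_space k Q T) g"
  shows "\<exists>es. (\<forall>e\<in>set es. plot_branch Q K e) \<and> (\<forall>z. decorate T (g z) = map (\<lambda>e. e z) es)"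
proof (intro exI conjI allI ballI)
  let ?es = "map (\<lambda>j z. decorate_branch (g z) [j] (T ! j)) [0..<length T]"
  show "decorate T (g z) = map (\<lambda>e. e z) ?es" for z by (simp add: decorate_eq o_def)
  fix e assume "e \<in> set ?es"
  then obtain j where j: "j < length T" and e: "e = (\<lambda>z. decorate_branch (g z) [j] (T ! j))" by auto
  show "plot_branch Q K e" unfolding e
  proof (rule plot_branch_decorate_branch)
    fix w assume w: "w \<in> vertices [T ! j]"
    then obtain u where u: "w = 0 # u" using is_vertex_nonempty[OF w] by (cases w) (auto simp: vertices_Cons_iff)
    then have v: "j # u \<in> vertices T" using w j by (auto simp: vertices_Cons_iff)
    show "continuous_map K euclideanreal (\<lambda>z. fst (g z) ([j] @ tl w)) \<and>
        continuous_map K (ospace Q (vertex_arity [T ! j] w)) (\<lambda>z. snd (g z) ([j] @ tl w))"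
      using continuous_map_dec_space_components[OF K g v] u j by (cases "u = []") (simp_all add: vertex_arity_def)
  qed
qed

lemma plots_label:
  assumes "\<forall>e\<in>set es. plot_branch Q K e" "v \<in> vertices (map (\<lambda>e. e z0) es)"
  shows "continuous_map K euclideanreal (\<lambda>z. fst (label (branch_at (map (\<lambda>e. e z) es) v))) \<and>
    continuous_map K (ospace Q (length (branches (branch_at (map (\<lambda>e. e z0) es) v))))
      (\<lambda>z. snd (label (branch_at (map (\<lambda>e. e z) es) v)))"
  using assms
proof (induction v arbitrary: es)
  case Nil
  then show ?case by (simp add: vertices_def)
next
  case (Cons j w)
  then have j: "j < length es" "(es ! j) z0 \<noteq> Leaf" "w = [] \<or> w \<in> vertices (branches ((es ! j) z0))"
    by (auto simp: vertices_Cons_iff)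
  have "plot_branch Q K (es ! j)" using Cons.prems j by simp
  then obtain t q es' where e: "es ! j = (\<lambda>z. Node (t z, q z) (map (\<lambda>e. e z) es'))"
      and tq: "continuous_map K euclideanreal t" "continuous_map K (ospace Q (length es')) q"
      and es': "\<forall>e\<in>set es'. plot_branch Q K e"
    using j(2) by (cases rule: plot_branch.cases) auto
  show ?case
  proof (cases "w = []")
    case True
    then show ?thesis using j(1) e tq by simp
  next
    case False
    then have "w \<in> vertices (map (\<lambda>e. e z0) es')" using j e by auto
    from Cons.IH[OF es' this] show ?thesis using j(1) e False by simp
  qed
qed

text \<open>Converse of \<open>plots_decorate\<close>. On a test space, continuity into the
  k-products is componentwise, and membership in \<open>dtrees\<close> supplies the bounds and the
  monotonicity that cut out \<open>H_space\<close>.\<close>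

lemma continuous_map_decoration:
  fixes K :: "'k topology" and k :: "'k itself"
  assumes K: "test_space K" and es: "\<forall>e\<in>set es. plot_branch Q K e"
    and d: "\<And>z. z \<in> topspace K \<Longrightarrow> map (\<lambda>e. e z) es \<in> dtrees k Q n"
  shows "continuous_map K (dec_space k Q (shape (map (\<lambda>e. e z0) es))) (\<lambda>z. decoration (map (\<lambda>e. e z) es))"
proof -
  define T where "T = shape (map (\<lambda>e. e z0) es)"
  have T: "shape (map (\<lambda>e. e z) es) = T" for z unfolding T_def by (rule plots_shape[OF es])
  have V: "vertices (map (\<lambda>e. e z) es) = vertices T" for z
    using vertices_shape[of _ "map (\<lambda>e. e z) es"] T by auto
  have dec: "decoration (map (\<lambda>e. e z) es) \<in> topspace (dec_space k Q T)" if "z \<in> topspace K" for z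
    using d[OF that] T unfolding dtrees_def by auto
  have l: "continuous_map K euclideanreal (\<lambda>z. fst (label (branch_at (map (\<lambda>e. e z) es) v)))"
      "continuous_map K (ospace Q (vertex_arity T v)) (\<lambda>z. snd (label (branch_at (map (\<lambda>e. e z) es) v)))"
    if "v \<in> vertices T" for v
    using plots_label[OF es, of v z0] that V vertex_arity_shape[of v "map (\<lambda>e. e z0) es"] by (auto simp: T_def)
  let ?d = "\<lambda>z. decoration (map (\<lambda>e. e z) es)"
  have "continuous_map K (H_space T) (fst \<circ> ?d)"
    unfolding H_space_def
  proof (subst continuous_map_in_subtopology, subst continuous_map_componentwise, intro conjI ballI)
    show "(fst \<circ> ?d) ` topspace K \<subseteq> extensional (vertices T)" by (auto simp: decoration_def V)
    show "fst \<circ> ?d \<in> topspace K \<rightarrow> {t. \<forall>v\<in>vertices T. \<forall>v'\<in>vertices T. strict_prefix v v' \<longrightarrow> t v \<le> t v'}"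
      using dec by (intro funcsetI) (simp add: topspace_dec_space mem_Times_iff)
    fix v assume v: "v \<in> vertices T"
    have "continuous_map K euclideanreal (\<lambda>z. fst (?d z) v)"
      using l(1)[OF v] v by (simp add: decoration_def V)
    moreover have "fst (?d z) v \<in> {0..1}" if "z \<in> topspace K" for z
      using dec[OF that] v by (auto simp: topspace_dec_space mem_Times_iff PiE_iff)
    ultimately have "continuous_map K (top_of_set {0..1}) (\<lambda>z. fst (?d z) v)"
      by (auto simp: continuous_map_in_subtopology)
    then show "continuous_map K (top_of_set {0..1}) (\<lambda>z. (fst \<circ> ?d) z v)" by simp
  qed
  moreover have "continuous_map K (D_space k Q T) (snd \<circ> ?d)"
    unfolding D_space_def continuous_map_kproduct[OF K]
  proof (intro conjI ballI)
    show "(snd \<circ> ?d) ` topspace K \<subseteq> extensional (vertices T)" by (auto simp: decoration_def V)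
    fix v assume v: "v \<in> vertices T"
    show "continuous_map K (ospace Q (vertex_arity T v)) (\<lambda>z. (snd \<circ> ?d) z v)"
      using l(2)[OF v] v by (simp add: decoration_def V)
  qed
  ultimately show ?thesis unfolding dec_space_def continuous_map_kprod[OF K] T_def by simp
qed

section \<open>Families as functions on decorated trees\<close>

lemma topspace_kmap [simp]:
  fixes k :: "'k itself"
  shows "topspace (kmap k X Y) = maps X Y"
  by (auto simp: kmap_def topology_generated_by_topspace)

lemma is_kspace_dec_space:
  fixes k :: "'k itself"
  shows "is_kspace k (dec_space k Q T)"
  by (simp add: dec_space_def kprod_def is_kspace_kify)

lemma is_kspace_Mf_space:
  fixes k :: "'k itself"
  shows "is_kspace k (Mf_space k Q M n)"
  by (simp add: Mf_space_def ksubspace_def is_kspace_kify)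

lemma dtrees_replaces:
  fixes k :: "'k itself"
  assumes "ds \<in> dtrees k Q n" "replaces b b' s ds ds'" "\<And>lo. 0 \<le> lo \<Longrightarrow> wf_branch Q lo b \<Longrightarrow> wf_branch Q lo b'"
  shows "ds' \<in> dtrees k Q n"
  using assms replaces_wf[OF assms(2), of 0 Q] replaces_length[OF assms(2)] by (simp add: dtrees_iff)

lemma wf_branch_unit: "wf_branch Q lo (Node (t, u) [d]) \<Longrightarrow> wf_branch Q lo d"
  by (auto intro: wf_branch_mono)

lemma leaves_contract:
  assumes "j < length es" "es ! j = Node a es'"
  shows "leaves (Node b' (take j es @ es' @ drop (Suc j) es)) = leaves (Node b es)"
proof -
  have "nleaves (take j es @ Node a es' # drop (Suc j) es) = nleaves es"
    using assms by (metis id_take_nth_drop)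
  then show ?thesis by simp
qed

locale family_module = right_module k Q M for k :: "'k itself" and Q :: "'q operad" and M :: "('p, 'q, 'm) bimod" +
  assumes inj: "\<exists>e :: real \<Rightarrow> 'k. inj e"
begin

abbreviation "dt \<equiv> dtrees k Q"

text \<open>This and the next three definitions state the conditions for functions on decorated
  trees, with \<open>replaces\<close> in place of an address. In this form they pass easily through
  permuting, grafting and splitting of trees.\<close>

definition unit_invariant :: "nat \<Rightarrow> ('q dtree \<Rightarrow> 'm) \<Rightarrow> bool" where
  "unit_invariant n F \<longleftrightarrow> (\<forall>ds ds' s t d. ds \<in> dt n \<longrightarrow> replaces (Node (t, ounit Q) [d]) d s ds ds' \<longrightarrow> F ds = F ds')"

definition symmetric_family :: "nat \<Rightarrow> ('q dtree \<Rightarrow> 'm) \<Rightarrow> bool" where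
  "symmetric_family n F \<longleftrightarrow> (\<forall>ds ds' s t q es \<sigma>. ds \<in> dt n \<longrightarrow> \<sigma> permutes {..<length es} \<longrightarrow>
     replaces (Node (t, q) es) (Node (t, oact Q (length es) \<sigma> q) (permute_list \<sigma> es)) s ds ds' \<longrightarrow>
     F ds' = mact M (nleaves ds) (shift_perm s (block_perm \<sigma> (map leaves es))) (F ds))"

definition contraction_invariant :: "nat \<Rightarrow> ('q dtree \<Rightarrow> 'm) \<Rightarrow> bool" where
  "contraction_invariant n F \<longleftrightarrow> (\<forall>ds ds' s t q q' es es' j. ds \<in> dt n \<longrightarrow> j < length es \<longrightarrow> es ! j = Node (t, q') es' \<longrightarrow>
     replaces (Node (t, q) es)
       (Node (t, ocomp Q (length es) (length es') j q q') (take j es @ es' @ drop (Suc j) es)) s ds ds' \<longrightarrow>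
     F ds = F ds')"

definition top_compatible :: "nat \<Rightarrow> ('q dtree \<Rightarrow> 'm) \<Rightarrow> bool" where
  "top_compatible n F \<longleftrightarrow> (\<forall>ds ds' s b. ds \<in> dt n \<longrightarrow> (\<forall>a\<in>set_ptree b. fst a = 1) \<longrightarrow> b \<noteq> Leaf \<longrightarrow>
     replaces b Leaf s ds ds' \<longrightarrow>
     F ds = circ (nleaves ds') (leaves b) s (F ds') (ocomposite Q b))"

definition typed_family :: "nat \<Rightarrow> ('q dtree \<Rightarrow> 'm) \<Rightarrow> bool" where
  "typed_family n F \<longleftrightarrow> (\<forall>ds\<in>dt n. F ds \<in> Mt (nleaves ds))"

definition is_family :: "nat \<Rightarrow> ('q dtree \<Rightarrow> 'm) \<Rightarrow> bool" where
  "is_family n F \<longleftrightarrow> typed_family n F \<and> unit_invariant n F \<and> symmetric_family n F \<and>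
     contraction_invariant n F \<and> top_compatible n F"

text \<open>Joint continuity in the parameter and the decoration, tested on a map into
  \<open>K\<close> together with a plot of trees. It is the uncurried form of a test map into the
  space of families.\<close>

definition continuous_family :: "'k topology \<Rightarrow> nat \<Rightarrow> ('k \<Rightarrow> 'q dtree \<Rightarrow> 'm) \<Rightarrow> bool" where
  "continuous_family K n F \<longleftrightarrow> (\<forall>(L :: 'k topology) \<alpha> es z0. test_space L \<longrightarrow> continuous_map L K \<alpha> \<longrightarrow>
     (\<forall>e\<in>set es. plot_branch Q L e) \<longrightarrow> (\<forall>z\<in>topspace L. map (\<lambda>e. e z) es \<in> dt n) \<longrightarrow>
     continuous_map L (mspace M (nleaves (map (\<lambda>e. e z0) es))) (\<lambda>z. F (\<alpha> z) (map (\<lambda>e. e z) es)))"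

section \<open>Families and their values on decorated trees\<close>

lemma unit_condition_iff: "unit_condition k Q n f \<longleftrightarrow> unit_invariant n (family_value f)"
proof
  assume f: "unit_condition k Q n f"
  show "unit_invariant n (family_value f)"
    unfolding unit_invariant_def
  proof (intro allI impI)
    fix ds ds' s t d assume ds: "ds \<in> dt n" and r: "replaces (Node (t, ounit Q) [d]) d s ds ds'"
    obtain v where "v \<in> vertices ds" "branch_at ds v = Node (t, ounit Q) [d]" "replace_at ds v d = ds'"
      using replaces_imp_vertex[OF r] by auto
    then show "family_value f ds = family_value f ds'" using f ds unfolding unit_condition_def by blast
  qed
next
  assume f: "unit_invariant n (family_value f)"
  show "unit_condition k Q n f"
    unfolding unit_condition_def
  proof (intro ballI allI impI)
    fix ds v t d assume ds: "ds \<in> dt n" and v: "v \<in> vertices ds" "branch_at ds v = Node (t, ounit Q) [d]"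
    show "family_value f ds = family_value f (replace_at ds v d)"
      using f ds replaces_replace_at[OF v(1), of d] unfolding v(2) unit_invariant_def by blast
  qed
qed

lemma symmetry_condition_iff: "symmetry_condition k Q M n f \<longleftrightarrow> symmetric_family n (family_value f)"
proof
  assume f: "symmetry_condition k Q M n f"
  show "symmetric_family n (family_value f)"
    unfolding symmetric_family_def
  proof (intro allI impI)
    fix ds ds' s t q es \<sigma> assume ds: "ds \<in> dt n" "\<sigma> permutes {..<length es}"
      and r: "replaces (Node (t, q) es) (Node (t, oact Q (length es) \<sigma> q) (permute_list \<sigma> es)) s ds ds'"
    obtain v where v: "v \<in> vertices ds" "branch_at ds v = Node (t, q) es"
        "replace_at ds v (Node (t, oact Q (length es) \<sigma> q) (permute_list \<sigma> es)) = ds'" "leaves_before ds v = s"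
      using replaces_imp_vertex[OF r] by auto
    show "family_value f ds' = mact M (nleaves ds) (shift_perm s (block_perm \<sigma> (map leaves es))) (family_value f ds)"
      using f ds v unfolding symmetry_condition_def by blast
  qed
next
  assume f: "symmetric_family n (family_value f)"
  show "symmetry_condition k Q M n f"
    unfolding symmetry_condition_def
  proof (intro ballI allI impI)
    fix ds v t q es \<sigma> assume ds: "ds \<in> dt n" and v: "v \<in> vertices ds"
      and b: "branch_at ds v = Node (t, q) es \<and> \<sigma> permutes {..<length es}"
    show "family_value f (replace_at ds v (Node (t, oact Q (length es) \<sigma> q) (permute_list \<sigma> es)))
       = mact M (nleaves ds) (shift_perm (leaves_before ds v) (block_perm \<sigma> (map leaves es))) (family_value f ds)"
      using f ds replaces_replace_at[OF v, of "Node (t, oact Q (length es) \<sigma> q) (permute_list \<sigma> es)"] b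
      unfolding symmetric_family_def by (simp only: conjunct1[OF b])
  qed
qed

lemma contraction_condition_iff: "contraction_condition k Q n f \<longleftrightarrow> contraction_invariant n (family_value f)"
proof
  assume f: "contraction_condition k Q n f"
  show "contraction_invariant n (family_value f)"
    unfolding contraction_invariant_def
  proof (intro allI impI)
    fix ds ds' s t q q' es es' j assume ds: "ds \<in> dt n" "j < length es" "es ! j = Node (t, q') es'"
      and r: "replaces (Node (t, q) es)
        (Node (t, ocomp Q (length es) (length es') j q q') (take j es @ es' @ drop (Suc j) es)) s ds ds'"
    obtain v where v: "v \<in> vertices ds" "branch_at ds v = Node (t, q) es"
        "replace_at ds v (Node (t, ocomp Q (length es) (length es') j q q') (take j es @ es' @ drop (Suc j) es)) = ds'"
      using replaces_imp_vertex[OF r] by auto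
    show "family_value f ds = family_value f ds'"
      using f ds v unfolding contraction_condition_def by blast
  qed
next
  assume f: "contraction_invariant n (family_value f)"
  show "contraction_condition k Q n f"
    unfolding contraction_condition_def
  proof (intro ballI allI impI)
    fix ds v t q q' es es' j assume ds: "ds \<in> dt n" and v: "v \<in> vertices ds"
      and b: "branch_at ds v = Node (t, q) es \<and> j < length es \<and> es ! j = Node (t, q') es'"
    have "replaces (Node (t, q) es)
        (Node (t, ocomp Q (length es) (length es') j q q') (take j es @ es' @ drop (Suc j) es)) (leaves_before ds v) ds
        (replace_at ds v (Node (t, ocomp Q (length es) (length es') j q q') (take j es @ es' @ drop (Suc j) es)))"
      using replaces_replace_at[OF v] conjunct1[OF b] by metis
    then show "family_value f ds = family_value f (replace_at ds v
        (Node (t, ocomp Q (length es) (length es') j q q') (take j es @ es' @ drop (Suc j) es)))"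
      using f ds b unfolding contraction_invariant_def by blast
  qed
qed

lemma top_condition_iff: "top_condition k Q M n f \<longleftrightarrow> top_compatible n (family_value f)"
proof
  assume f: "top_condition k Q M n f"
  show "top_compatible n (family_value f)"
    unfolding top_compatible_def
  proof (intro allI impI)
    fix ds ds' s b assume ds: "ds \<in> dt n" "\<forall>a\<in>set_ptree b. fst a = 1" "b \<noteq> Leaf" and r: "replaces b Leaf s ds ds'"
    obtain v where v: "v \<in> vertices ds" "branch_at ds v = b" "replace_at ds v Leaf = ds'" "leaves_before ds v = s"
      using replaces_imp_vertex[OF r ds(3)] by blast
    show "family_value f ds = circ (nleaves ds') (leaves b) s (family_value f ds') (ocomposite Q b)"
      using f ds v unfolding top_condition_def by blast
  qed
next
  assume f: "top_compatible n (family_value f)"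
  show "top_condition k Q M n f"
    unfolding top_condition_def
  proof (intro ballI impI)
    fix ds v assume ds: "ds \<in> dt n" and v: "v \<in> vertices ds" and b: "\<forall>a\<in>set_ptree (branch_at ds v). fst a = 1"
    \<comment> \<open>Addresses in \<open>vertices\<close> never lead to a leaf, so the proviso of
      \<open>top_compatible\<close> is met.\<close>
    have "branch_at ds v \<noteq> Leaf"
      using v
    proof (induction v arbitrary: ds)
      case (Cons j w)
      then show ?case by (auto simp: vertices_Cons_iff)
    qed (simp add: vertices_def)
    then show "family_value f ds = circ (nleaves (replace_at ds v Leaf)) (leaves (branch_at ds v)) (leaves_before ds v)
        (family_value f (replace_at ds v Leaf)) (ocomposite Q (branch_at ds v))"
      using f ds b replaces_replace_at[OF v, of Leaf] unfolding top_compatible_def by blast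
  qed
qed

lemma Mf_space_family:
  assumes "f \<in> topspace (Mf_space k Q M n)"
  shows "is_family n (family_value f)" "make_family k Q n (family_value f) = f"
proof -
  have f: "f \<in> (\<Pi>\<^sub>E T\<in>trees n. maps (dec_space k Q T) (mspace M (nleaves T)))"
      "unit_invariant n (family_value f)" "symmetric_family n (family_value f)"
      "contraction_invariant n (family_value f)" "top_compatible n (family_value f)"
    using assms unfolding Mf_space_def ksubspace_def
    by (auto simp: unit_condition_iff symmetry_condition_iff contraction_condition_iff top_condition_iff)
  have "typed_family n (family_value f)"
    unfolding typed_family_def
  proof
    fix ds assume ds: "ds \<in> dt n"
    then have "shape ds \<in> trees n" "decoration ds \<in> topspace (dec_space k Q (shape ds))"
      by (auto simp: dtrees_def trees_def)
    then have "f (shape ds) (decoration ds) \<in> Mt (nleaves (shape ds))"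
      using f(1) by (auto simp: maps_def PiE_iff continuous_map_def Pi_iff)
    then show "family_value f ds \<in> Mt (nleaves ds)" by (simp add: family_value_def nleaves_shape)
  qed
  then show "is_family n (family_value f)" using f by (simp add: is_family_def)
  show "make_family k Q n (family_value f) = f"
    using f(1) by (intro make_family_family_value) (auto simp: PiE_iff maps_def)
qed

text \<open>A plot has one shape, so a single component of \<phi> is evaluated along it, and the
  evaluation half of the exponential law applies.\<close>

lemma continuous_family_Mf_space:
  assumes K: "test_space (K :: 'k topology)" and \<phi>: "continuous_map K (Mf_space k Q M n) \<phi>"
  shows "continuous_family K n (\<lambda>z. family_value (\<phi> z))"
  unfolding continuous_family_def
proof (intro allI impI)
  fix L :: "'k topology" and \<alpha> es z0
  assume L: "test_space L" and \<alpha>: "continuous_map L K \<alpha>" and es: "\<forall>e\<in>set es. plot_branch Q L e"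
    and d: "\<forall>z\<in>topspace L. map (\<lambda>e. e z) es \<in> dt n"
  show "continuous_map L (mspace M (nleaves (map (\<lambda>e. e z0) es))) (\<lambda>z. family_value (\<phi> (\<alpha> z)) (map (\<lambda>e. e z) es))"
  \<comment> \<open>A point of \<open>L\<close> is needed to see that the plot has \<open>n\<close>
    root edges; over the empty space continuity is trivial.\<close>
  proof (cases "topspace L = {}")
    case False
    define T where "T = shape (map (\<lambda>e. e z0) es)"
    have T: "shape (map (\<lambda>e. e z) es) = T" for z unfolding T_def by (rule plots_shape[OF es])
    obtain z where "z \<in> topspace L" using False by blast
    then have "length es = n" using d by (fastforce simp: dtrees_def)
    then have Tn: "T \<in> trees n" by (simp add: trees_def T_def)
    have g: "continuous_map L (dec_space k Q T) (\<lambda>z. decoration (map (\<lambda>e. e z) es))"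
      using continuous_map_decoration[OF L es] d unfolding T_def by blast
    have "continuous_map L (Mf_space k Q M n) (\<phi> \<circ> \<alpha>)" using continuous_map_compose[OF \<alpha> \<phi>] .
    then have "continuous_map L (kmap k (dec_space k Q T) (mspace M (nleaves T))) (\<lambda>z. (\<phi> \<circ> \<alpha>) z T)"
      using Tn unfolding Mf_space_def continuous_map_ksubspace[OF L] continuous_map_kproduct[OF L] by blast
    moreover have "nleaves (map (\<lambda>e. e z0) es) = nleaves T" by (simp add: T_def nleaves_shape)
    ultimately show ?thesis
      using continuous_map_kmap_eval[OF L _ g] by (simp add: family_value_def T)
  qed (auto simp: continuous_map_def)
qed

text \<open>For each shape this is the currying half of the exponential law. The conditions must
  also be transported to \<open>make_family\<close>, which remembers values on well-formed trees
  only; hence each modified tree is first shown to be well formed.\<close>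

lemma continuous_map_make_family:
  assumes K: "test_space (K :: 'k topology)"
    and F: "\<And>z. z \<in> topspace K \<Longrightarrow> is_family n (F z)" and cF: "continuous_family K n F"
  shows "continuous_map K (Mf_space k Q M n) (\<lambda>z. make_family k Q n (F z))"
  unfolding Mf_space_def continuous_map_ksubspace[OF K] continuous_map_kproduct[OF K]
proof (intro conjI ballI)
  obtain e :: "real \<Rightarrow> 'k" where e: "inj e" using inj by blast
  show "(\<lambda>z. make_family k Q n (F z)) ` topspace K \<subseteq> extensional (trees n)"
    by (auto simp: make_family_def)
  fix T assume T: "T \<in> trees n"
  show "continuous_map K (kmap k (dec_space k Q T) (mspace M (nleaves T))) (\<lambda>z. make_family k Q n (F z) T)"
  proof (rule continuous_map_kmap_curry[OF e K is_kspace_dec_space])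
    fix L :: "'k topology" and \<alpha> g
    assume L: "test_space L" and \<alpha>: "continuous_map L K \<alpha>" and g: "continuous_map L (dec_space k Q T) g"
    obtain es where es: "\<forall>e\<in>set es. plot_branch Q L e" and d: "\<And>z. decorate T (g z) = map (\<lambda>e. e z) es"
      using plots_decorate[OF L g] by blast
    have gz: "g z \<in> topspace (dec_space k Q T)" if "z \<in> topspace L" for z
      using g that by (auto simp: continuous_map_def Pi_iff)
    have dz: "map (\<lambda>e. e z) es \<in> dt n" if "z \<in> topspace L" for z
      using decorate_in_dtrees[OF gz[OF that], of n] T by (simp add: d[symmetric] trees_def)
    have nT: "nleaves (map (\<lambda>e. e z) es) = nleaves T" for z
      using nleaves_shape[of "decorate T (g z)"] by (simp add: d shape_decorate[of T "g z", unfolded d])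
    have "continuous_map L (mspace M (nleaves (map (\<lambda>e. e undefined) es))) (\<lambda>z. F (\<alpha> z) (map (\<lambda>e. e z) es))"
      using cF[unfolded continuous_family_def] L \<alpha> es dz by blast
    then have "continuous_map L (mspace M (nleaves T)) (\<lambda>z. F (\<alpha> z) (map (\<lambda>e. e z) es))" by (simp only: nT)
    then show "continuous_map L (mspace M (nleaves T)) (\<lambda>z. make_family k Q n (F (\<alpha> z)) T (g z))"
      by (rule continuous_map_eq) (simp add: make_family_def T gz d)
  qed (use T in \<open>simp add: make_family_def\<close>)
next
  have cong: "family_value (make_family k Q n (F z)) ds = F z ds" if "ds \<in> dt n" for z ds
    using family_value_make_family[OF that] .
  show "(\<lambda>z. make_family k Q n (F z)) ` topspace K \<subseteq> {f. unit_condition k Q n f \<and>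
      symmetry_condition k Q M n f \<and> contraction_condition k Q n f \<and> top_condition k Q M n f}"
  proof (intro image_subsetI CollectI)
    fix z assume z: "z \<in> topspace K"
    let ?f = "make_family k Q n (F z)"
    have fam: "typed_family n (F z)" "unit_invariant n (F z)" "symmetric_family n (F z)"
        "contraction_invariant n (F z)" "top_compatible n (F z)"
      using F[OF z] by (simp_all add: is_family_def)
    have "unit_invariant n (family_value ?f)"
      unfolding unit_invariant_def
    proof (intro allI impI)
      fix ds ds' s t d assume ds: "ds \<in> dt n" and r: "replaces (Node (t, ounit Q) [d]) d s ds ds'"
      have ds': "ds' \<in> dt n" by (rule dtrees_replaces[OF ds r]) (rule wf_branch_unit)
      then show "family_value ?f ds = family_value ?f ds'"
        unfolding cong[OF ds] cong[OF ds'] using fam(2)[unfolded unit_invariant_def] ds r by blast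
    qed
    moreover have "symmetric_family n (family_value ?f)"
      unfolding symmetric_family_def
    proof (intro allI impI)
      fix ds ds' s t q es \<sigma> assume ds: "ds \<in> dt n" and \<sigma>: "\<sigma> permutes {..<length es}"
        and r: "replaces (Node (t, q) es) (Node (t, oact Q (length es) \<sigma> q) (permute_list \<sigma> es)) s ds ds'"
      have ds': "ds' \<in> dt n"
        using \<sigma> right_module.act_closed[OF right_module_operad_module[OF operad], of q "length es" \<sigma>]
        by (intro dtrees_replaces[OF ds r]) simp
      then show "family_value ?f ds'
          = mact M (nleaves ds) (shift_perm s (block_perm \<sigma> (map leaves es))) (family_value ?f ds)"
        unfolding cong[OF ds] cong[OF ds'] using fam(3)[unfolded symmetric_family_def] ds r \<sigma> by blast
    qed
    moreover have "contraction_invariant n (family_value ?f)"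
      unfolding contraction_invariant_def
    proof (intro allI impI)
      fix ds ds' s t q q' es es' j assume ds: "ds \<in> dt n" and j: "j < length es" "es ! j = Node (t, q') es'"
        and r: "replaces (Node (t, q) es)
          (Node (t, ocomp Q (length es) (length es') j q q') (take j es @ es' @ drop (Suc j) es)) s ds ds'"
      have ds': "ds' \<in> dt n"
      proof (rule dtrees_replaces[OF ds r])
        fix lo assume wf: "wf_branch Q lo (Node (t, q) es)"
        then have "wf_branch Q t (Node (t, q') es')" using j by (metis nth_mem wf_branch.simps(2) fst_conv)
        moreover have "length (take j es @ es' @ drop (Suc j) es) = length es + length es' - 1" using j by simp
        ultimately show "wf_branch Q lo (Node (t, ocomp Q (length es) (length es') j q q') (take j es @ es' @ drop (Suc j) es))"
          using wf j right_module.circ_closed[OF right_module_operad_module[OF operad], of q "length es" q' "length es'" j]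
          by (auto dest: in_set_takeD in_set_dropD)
      qed
      then show "family_value ?f ds = family_value ?f ds'"
        unfolding cong[OF ds] cong[OF ds'] using fam(4)[unfolded contraction_invariant_def] ds r j by blast
    qed
    moreover have "top_compatible n (family_value ?f)"
      unfolding top_compatible_def
    proof (intro allI impI)
      fix ds ds' s b assume ds: "ds \<in> dt n" "\<forall>a\<in>set_ptree b. fst a = 1" "b \<noteq> Leaf" and r: "replaces b Leaf s ds ds'"
      have ds': "ds' \<in> dt n" using dtrees_replaces[OF ds(1) r] by simp
      then show "family_value ?f ds = circ (nleaves ds') (leaves b) s (family_value ?f ds') (ocomposite Q b)"
        unfolding cong[OF ds(1)] cong[OF ds'] using fam(5)[unfolded top_compatible_def] ds r by blast
    qed
    ultimately show "unit_condition k Q n ?f \<and> symmetry_condition k Q M n ?f \<and>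
        contraction_condition k Q n ?f \<and> top_condition k Q M n ?f"
      by (simp add: unit_condition_iff symmetry_condition_iff contraction_condition_iff top_condition_iff)
  qed
qed

end

section \<open>Operations on families\<close>

lemma permute_list_inv:
  assumes "\<sigma> permutes {..<length xs}"
  shows "permute_list (inv \<sigma>) (permute_list \<sigma> xs) = xs" "permute_list \<sigma> (permute_list (inv \<sigma>) xs) = xs"
  using permute_list_compose[of "inv \<sigma>" xs \<sigma>] permute_list_compose[of \<sigma> xs "inv \<sigma>"] permutes_inv[OF assms] assms
  by (simp_all add: permutes_inv_o[OF assms])

lemma replaces_permute:
  assumes "replaces b b' s (permute_list \<sigma> ds) ds'" and \<sigma>: "\<sigma> permutes {..<length ds}"
  obtains i r c' where "i < length ds" "ds' = permute_list \<sigma> (ds[\<sigma> i := c'])"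
    "s = nleaves (take i (permute_list \<sigma> ds)) + r" "replaces b b' r [ds ! \<sigma> i] [c']"
    "replaces b b' (nleaves (take (\<sigma> i) ds) + r) ds (ds[\<sigma> i := c'])"
proof -
  obtain i r c' where i: "i < length ds" "ds' = (permute_list \<sigma> ds)[i := c']"
      "s = nleaves (take i (permute_list \<sigma> ds)) + r" "replaces b b' r [permute_list \<sigma> ds ! i] [c']"
    using assms(1) unfolding replaces_iff[of b b' s] by auto
  have "replaces b b' r [ds ! \<sigma> i] [c']" using i \<sigma> by (simp add: permute_list_nth)
  then show ?thesis
    using that[OF i(1) _ i(3)] i \<sigma> replaces_lift[of "\<sigma> i" ds b b' r c']
    by (simp add: permute_list_update permutes_less)
qed

text \<open>The tree \<delta> of the right operation, including the decoration of its new vertex by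
  the number 0 and the label \<open>q\<close>; root edges are counted from 0.\<close>

definition graft :: "nat \<Rightarrow> nat \<Rightarrow> 'q \<Rightarrow> 'q dtree \<Rightarrow> 'q dtree" where
  "graft i m q ds = take i ds @ Node (0, q) (take m (drop i ds)) # drop (i + m) ds"

lemma graft_append: "i = length A \<Longrightarrow> m = length B \<Longrightarrow> graft i m q (A @ B @ C) = A @ Node (0, q) B # C"
  by (simp add: graft_def)

lemma nleaves_graft: "nleaves (graft i m q ds) = nleaves ds"
proof -
  have "take i ds @ take m (drop i ds) @ drop (i + m) ds = ds"
    by (metis add.commute append_take_drop_id drop_drop)
  then have "nleaves ds = nleaves (take i ds @ take m (drop i ds) @ drop (i + m) ds)" by simp
  then show ?thesis by (simp add: graft_def)
qed

lemma length_graft: "length ds = n + m - 1 \<Longrightarrow> i < n \<Longrightarrow> length (graft i m q ds) = n"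
  by (auto simp: graft_def)

text \<open>The new vertex has number 0, the lower bound already imposed on the root branches above
  it, so monotonicity is preserved.\<close>

lemma graft_in_dtrees:
  fixes k :: "'k itself"
  assumes "ds \<in> dtrees k Q (n + m - 1)" "i < n" "q \<in> topspace (ospace Q m)"
  shows "graft i m q ds \<in> dtrees k Q n"
  using assms length_graft[of ds n m i q] unfolding dtrees_iff
  by (auto simp: graft_def dest: in_set_takeD in_set_dropD)

lemma replaces_append:
  assumes "replaces b b' s ds ds'"
  shows "replaces b b' (nleaves xs + s) (xs @ ds @ ys) (xs @ ds' @ ys)"
proof -
  obtain i r c' where i: "i < length ds" "ds' = ds[i := c']" "s = nleaves (take i ds) + r" "replaces b b' r [ds ! i] [c']"
    using assms unfolding replaces_iff[of b b' s] by auto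
  have "replaces b b' r [(xs @ ds @ ys) ! (length xs + i)] [c']" using i by (simp add: nth_append)
  from replaces_lift[OF _ this] i show ?thesis by (simp add: list_update_append add.assoc)
qed

lemma replaces_split3:
  assumes "replaces b b' s (A @ B @ C) ds'"
  obtains (left) A' where "ds' = A' @ B @ C" "replaces b b' s A A'"
  | (middle) B' r where "ds' = A @ B' @ C" "replaces b b' r B B'" "s = nleaves A + r"
  | (right) C' r where "ds' = A @ B @ C'" "replaces b b' r C C'" "s = nleaves A + nleaves B + r"
proof -
  obtain i r c' where i: "i < length (A @ B @ C)" "ds' = (A @ B @ C)[i := c']"
      "s = nleaves (take i (A @ B @ C)) + r" "replaces b b' r [(A @ B @ C) ! i] [c']"
    using assms unfolding replaces_iff[of b b' s] by auto
  consider "i < length A" | "length A \<le> i" "i < length A + length B" | "length A + length B \<le> i" by linarith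
  then show ?thesis
  proof cases
    case 1
    then show ?thesis
      using i left[of "A[i := c']"] replaces_lift[of i A b b' r c'] by (simp add: list_update_append nth_append)
  next
    case 2
    define j where "j = i - length A"
    have j: "i = length A + j" "j < length B" using 2 by (auto simp: j_def)
    show ?thesis
      using i j middle[of "B[j := c']" "nleaves (take j B) + r"] replaces_lift[of j B b b' r c']
      by (simp add: list_update_append nth_append)
  next
    case 3
    define j where "j = i - (length A + length B)"
    have j: "i = length A + length B + j" "j < length C" using 3 i by (auto simp: j_def)
    show ?thesis
      using i j right[of "C[j := c']" "nleaves (take j C) + r"] replaces_lift[of j C b b' r c']
      by (simp add: list_update_append nth_append)
  qed
qed

text \<open>Grafting keeps the planar order of the leaves, so the count \<open>s\<close> is
  unchanged. The branch lies to the left of the grafted edges, above the new vertex, or to the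
  right.\<close>

lemma replaces_graft:
  assumes "replaces b b' s ds ds'" "i + m \<le> length ds"
  shows "replaces b b' s (graft i m q ds) (graft i m q ds')"
proof -
  define A B C where "A = take i ds" and "B = take m (drop i ds)" and "C = drop (i + m) ds"
  have ds: "ds = A @ B @ C" unfolding A_def B_def C_def by (metis add.commute append_take_drop_id drop_drop)
  have len: "i = length A" "m = length B" using assms(2) by (auto simp: A_def B_def)
  have g: "graft i m q ds = A @ [Node (0, q) B] @ C" using len ds by (simp add: graft_append)
  from assms(1)[unfolded ds] show ?thesis
  proof (cases rule: replaces_split3)
    case (left A')
    then have "graft i m q ds' = A' @ [Node (0, q) B] @ C"
      using graft_append[of i A' m B q C] len replaces_length[OF left(2)] by simp
    then show ?thesis using g replaces_append[OF left(2), of "[]" "[Node (0, q) B] @ C"] by simp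
  next
    case (middle B' r)
    then have g': "graft i m q ds' = A @ [Node (0, q) B'] @ C"
      using graft_append[of i A m B' q C] len replaces_length[OF middle(2)] by simp
    show ?thesis
      unfolding g g' middle(3) using replaces_append[OF replaces_singleton_above[OF middle(2)]] .
  next
    case (right C' r)
    then have g': "graft i m q ds' = (A @ [Node (0, q) B]) @ C' @ []"
      using graft_append[of i A m B q C'] len by simp
    have "graft i m q ds = (A @ [Node (0, q) B]) @ C @ []" using g by simp
    then show ?thesis
      unfolding g' right(3) using replaces_append[OF right(2), of "A @ [Node (0, q) B]" "[]"] by simp
  qed
qed

context family_module
begin

definition act_family :: "(nat \<Rightarrow> nat) \<Rightarrow> ('q dtree \<Rightarrow> 'm) \<Rightarrow> 'q dtree \<Rightarrow> 'm" where
  "act_family \<sigma> F ds = mact M (nleaves ds) (block_perm \<sigma> (map leaves (permute_list (inv \<sigma>) ds)))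
     (F (permute_list (inv \<sigma>) ds))"

lemma Mf_act_eq: "Mf_act k Q M n \<sigma> f = make_family k Q n (act_family \<sigma> (family_value f))"
  by (simp add: Mf_act_def act_family_def[abs_def] Let_def)

lemma Mf_rcomp_eq: "Mf_rcomp k Q n m i f q = make_family k Q (n + m - 1) (\<lambda>ds. family_value f (graft i m q ds))"
  by (simp add: Mf_rcomp_def graft_def)

lemma dt_permute: "ds \<in> dt n \<Longrightarrow> \<sigma> permutes {..<n} \<Longrightarrow> permute_list \<sigma> ds \<in> dt n"
  unfolding dtrees_iff by auto

lemma dt_length: "ds \<in> dt n \<Longrightarrow> length ds = n"
  by (simp add: dtrees_iff)

text \<open>Writing the argument as a permuted tree removes the inverse from the definition; by
  \<open>dt_permuteE\<close> every tree in \<open>dt n\<close> has this form.\<close>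

lemma act_family_permute:
  assumes "\<sigma> permutes {..<length ds}"
  shows "act_family \<sigma> F (permute_list \<sigma> ds) = mact M (nleaves ds) (block_perm \<sigma> (map leaves ds)) (F ds)"
  using assms by (simp add: act_family_def permute_list_inv nleaves_permute_list)

lemma dt_permuteE:
  assumes "ds \<in> dt n" "\<sigma> permutes {..<n}"
  obtains ds0 where "ds0 \<in> dt n" "length ds0 = n" "ds = permute_list \<sigma> ds0"
  using that[of "permute_list (inv \<sigma>) ds"] dt_permute[OF assms(1) permutes_inv[OF assms(2)]] assms dt_length
    permute_list_inv(2) by metis

lemma block_perm_leaves: "\<sigma> permutes {..<length ds} \<Longrightarrow> block_perm \<sigma> (map leaves ds) permutes {..<nleaves ds}"
  using block_perm_permutes[of \<sigma> "map leaves ds"] by (simp add: nleaves_def)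

text \<open>Permuting root edges leaves the vertices above them intact. Each tree is written as
  \<open>permute_list \<sigma> ds0\<close>, a replacement in it comes from one in
  \<open>ds0\<close>, and the condition for \<open>F\<close> is used there. What remains is a
  comparison of leaf permutations.\<close>

lemma is_family_act:
  assumes F: "is_family n F" and \<sigma>: "\<sigma> permutes {..<n}"
  shows "is_family n (act_family \<sigma> F)"
proof -
  have fam: "typed_family n F" "unit_invariant n F" "symmetric_family n F" "contraction_invariant n F" "top_compatible n F"
    using F by (simp_all add: is_family_def)
  have typed: "typed_family n (act_family \<sigma> F)"
    unfolding typed_family_def
  proof
    fix ds assume "ds \<in> dt n"
    then obtain ds0 where ds0: "ds0 \<in> dt n" "length ds0 = n" "ds = permute_list \<sigma> ds0" using \<sigma> by (rule dt_permuteE)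
    then show "act_family \<sigma> F ds \<in> Mt (nleaves ds)"
      using fam(1) \<sigma> by (simp add: act_family_permute nleaves_permute_list typed_family_def act_closed block_perm_leaves)
  qed
  \<comment> \<open>Removing a unit and contracting an edge keep the leaf count of every root
    branch, so the same block permutation acts on both values.\<close>
  have invariant: "act_family \<sigma> F ds = act_family \<sigma> F ds'"
    if ds: "ds \<in> dt n" and r: "replaces b b' s ds ds'" and l: "leaves b = leaves b'"
      and inv: "\<And>s ds0 ds0'. ds0 \<in> dt n \<Longrightarrow> replaces b b' s ds0 ds0' \<Longrightarrow> F ds0 = F ds0'" for ds ds' b b' s
  proof -
    obtain ds0 where ds0: "ds0 \<in> dt n" "length ds0 = n" "ds = permute_list \<sigma> ds0" using ds \<sigma> by (rule dt_permuteE)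
    have \<sigma>0: "\<sigma> permutes {..<length ds0}" using \<sigma> ds0 by simp
    obtain i r' c' where i: "i < length ds0" "ds' = permute_list \<sigma> (ds0[\<sigma> i := c'])" "replaces b b' r' [ds0 ! \<sigma> i] [c']"
        "replaces b b' (nleaves (take (\<sigma> i) ds0) + r') ds0 (ds0[\<sigma> i := c'])"
      using replaces_permute[OF r[unfolded ds0(3)] \<sigma>0] by metis
    have "leaves c' = leaves (ds0 ! \<sigma> i)" using replaces_nleaves(1)[OF i(3)] l by simp
    then have "map leaves (ds0[\<sigma> i := c']) = map leaves ds0"
      using i(1) \<sigma>0 by (simp add: map_update) (metis length_map list_update_id nth_map permutes_less)
    then show ?thesis
      using act_family_permute[of \<sigma> "ds0[\<sigma> i := c']" F] act_family_permute[of \<sigma> ds0 F] \<sigma>0 ds0(3) i(2) inv[OF ds0(1) i(4)]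
      by (simp add: nleaves_def)
  qed
  have "unit_invariant n (act_family \<sigma> F)"
    unfolding unit_invariant_def
  proof (intro allI impI)
    fix ds ds' s t d assume ds: "ds \<in> dt n" and r: "replaces (Node (t, ounit Q) [d]) d s ds ds'"
    show "act_family \<sigma> F ds = act_family \<sigma> F ds'"
    proof (rule invariant[OF ds r])
      show "F ds0 = F ds0'" if "ds0 \<in> dt n" "replaces (Node (t, ounit Q) [d]) d s ds0 ds0'" for s ds0 ds0'
        using fam(2)[unfolded unit_invariant_def] that by blast
    qed simp
  qed
  moreover have "contraction_invariant n (act_family \<sigma> F)"
    unfolding contraction_invariant_def
  proof (intro allI impI)
    fix ds ds' s t q q' es es' j assume ds: "ds \<in> dt n" and j: "j < length es" "es ! j = Node (t, q') es'"
      and r: "replaces (Node (t, q) es)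
          (Node (t, ocomp Q (length es) (length es') j q q') (take j es @ es' @ drop (Suc j) es)) s ds ds'"
    show "act_family \<sigma> F ds = act_family \<sigma> F ds'"
    proof (rule invariant[OF ds r leaves_contract[OF j, symmetric]])
      show "F ds0 = F ds0'" if "ds0 \<in> dt n" "replaces (Node (t, q) es)
          (Node (t, ocomp Q (length es) (length es') j q q') (take j es @ es' @ drop (Suc j) es)) s ds0 ds0'" for s ds0 ds0'
        using fam(4)[unfolded contraction_invariant_def] that j by blast
    qed
  qed
  moreover have "symmetric_family n (act_family \<sigma> F)"
    unfolding symmetric_family_def
  proof (intro allI impI)
    fix ds ds' s t q es \<pi> assume ds: "ds \<in> dt n" and \<pi>: "\<pi> permutes {..<length es}"
      and r: "replaces (Node (t, q) es) (Node (t, oact Q (length es) \<pi> q) (permute_list \<pi> es)) s ds ds'"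
    obtain ds0 where ds0: "ds0 \<in> dt n" "length ds0 = n" "ds = permute_list \<sigma> ds0" using ds \<sigma> by (rule dt_permuteE)
    have \<sigma>0: "\<sigma> permutes {..<length ds0}" using \<sigma> ds0 by simp
    let ?b = "Node (t, q) es" and ?b' = "Node (t, oact Q (length es) \<pi> q) (permute_list \<pi> es)"
    obtain i r' c' where i: "i < length ds0" "ds' = permute_list \<sigma> (ds0[\<sigma> i := c'])"
        "s = nleaves (take i (permute_list \<sigma> ds0)) + r'" "replaces ?b ?b' r' [ds0 ! \<sigma> i] [c']"
        "replaces ?b ?b' (nleaves (take (\<sigma> i) ds0) + r') ds0 (ds0[\<sigma> i := c'])"
      using replaces_permute[OF r[unfolded ds0(3)] \<sigma>0] by metis
    have \<sigma>i: "\<sigma> i < length ds0" using i(1) \<sigma>0 by (simp add: permutes_less)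
    have lb: "leaves ?b' = leaves ?b" using \<pi> by (simp add: nleaves_permute_list)
    have lc: "leaves c' = leaves (ds0 ! \<sigma> i)" using replaces_nleaves(1)[OF i(4)] lb by simp
    have mc: "map leaves (ds0[\<sigma> i := c']) = map leaves ds0"
      using lc \<sigma>i by (simp add: map_update) (metis length_map list_update_id nth_map)
    define N where "N = nleaves ds0"
    define \<rho> where "\<rho> = shift_perm r' (block_perm \<pi> (map leaves es))"
    let ?ks = "map leaves ds0" and ?S = "nleaves (take (\<sigma> i) ds0)" and ?S' = "nleaves (take i (permute_list \<sigma> ds0))"
    have pk: "permute_list \<sigma> ?ks = map leaves (permute_list \<sigma> ds0)" using \<sigma>0 by (rule permute_list_map)
    have \<rho>: "\<rho> permutes {..<leaves (ds0 ! \<sigma> i)}"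
      unfolding \<rho>_def using block_perm_leaves[OF \<pi>] replaces_nleaves(2)[OF i(4)]
      by (intro shift_perm_permutes) auto
    \<comment> \<open>The same permutation \<rho> inside a root branch has offset \<open>?S\<close>
      in \<open>ds0\<close> and offset \<open>?S'\<close> after the root edges are permuted.\<close>
    have comm: "shift_perm ?S \<rho> \<circ> block_perm \<sigma> ?ks = block_perm \<sigma> ?ks \<circ> shift_perm ?S' \<rho>"
      using shift_perm_block_perm[of \<sigma> ?ks i \<rho>] \<sigma>0 i(1) \<sigma>i \<rho> by (simp add: nleaves_take pk)
    have pS: "shift_perm ?S \<rho> permutes {..<N}"
      using \<rho> nleaves_take_le[OF \<sigma>i] unfolding N_def by (rule shift_perm_permutes)
    have pS': "shift_perm ?S' \<rho> permutes {..<N}"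
      using \<rho> nleaves_take_le[of i "permute_list \<sigma> ds0"] i(1) \<sigma>0 unfolding N_def
      by (intro shift_perm_permutes) (auto simp: permute_list_nth nleaves_permute_list)
    have pb: "block_perm \<sigma> ?ks permutes {..<N}" unfolding N_def using \<sigma>0 by (rule block_perm_leaves)
    have F0: "F ds0 \<in> Mt N" using fam(1) ds0(1) by (simp add: typed_family_def N_def)
    have F0': "F (ds0[\<sigma> i := c']) = mact M N (shift_perm ?S \<rho>) (F ds0)"
      using fam(3)[unfolded symmetric_family_def, rule_format, OF ds0(1) \<pi> i(5)]
      by (simp add: N_def \<rho>_def shift_perm_shift_perm)
    have N': "nleaves (ds0[\<sigma> i := c']) = N" using arg_cong[OF mc, of sum_list] by (simp add: nleaves_def N_def)
    have "act_family \<sigma> F ds' = mact M N (block_perm \<sigma> ?ks) (mact M N (shift_perm ?S \<rho>) (F ds0))"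
      using act_family_permute[of \<sigma> "ds0[\<sigma> i := c']" F] \<sigma>0 by (simp only: i(2) F0' N' mc length_list_update)
    also have "\<dots> = mact M N (shift_perm ?S' \<rho>) (mact M N (block_perm \<sigma> ?ks) (F ds0))"
      by (simp only: act_comp[OF F0 pS pb] act_comp[OF F0 pb pS'] comm)
    also have "\<dots> = mact M (nleaves ds) (shift_perm s (block_perm \<pi> (map leaves es))) (act_family \<sigma> F ds)"
      using act_family_permute[OF \<sigma>0, of F] \<sigma>0
      by (simp add: ds0(3) nleaves_permute_list N_def i(3) \<rho>_def shift_perm_shift_perm)
    finally show "act_family \<sigma> F ds' = mact M (nleaves ds) (shift_perm s (block_perm \<pi> (map leaves es))) (act_family \<sigma> F ds)" .
  qed
  moreover have "top_compatible n (act_family \<sigma> F)"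
    unfolding top_compatible_def
  proof (intro allI impI)
    fix ds ds' s b assume ds: "ds \<in> dt n" and b: "\<forall>a\<in>set_ptree b. fst a = 1" "b \<noteq> Leaf" and r: "replaces b Leaf s ds ds'"
    obtain ds0 where ds0: "ds0 \<in> dt n" "length ds0 = n" "ds = permute_list \<sigma> ds0" using ds \<sigma> by (rule dt_permuteE)
    have \<sigma>0: "\<sigma> permutes {..<length ds0}" using \<sigma> ds0 by simp
    obtain i r' c' where i: "i < length ds0" "ds' = permute_list \<sigma> (ds0[\<sigma> i := c'])"
        "s = nleaves (take i (permute_list \<sigma> ds0)) + r'" "replaces b Leaf r' [ds0 ! \<sigma> i] [c']"
        "replaces b Leaf (nleaves (take (\<sigma> i) ds0) + r') ds0 (ds0[\<sigma> i := c'])"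
      using replaces_permute[OF r[unfolded ds0(3)] \<sigma>0] by metis
    have \<sigma>i: "\<sigma> i < length ds0" using i(1) \<sigma>0 by (simp add: permutes_less)
    \<comment> \<open>This is \<open>ds0\<close> with \<open>b\<close> cut off. Equivariance is
      applied to the partial composition that glues \<open>b\<close> back onto its value.\<close>
    define ds1 where "ds1 = ds0[\<sigma> i := c']"
    have ds1: "ds1 \<in> dt n" unfolding ds1_def by (rule dtrees_replaces[OF ds0(1) i(5)]) simp
    have l1: "length ds1 = length ds0" by (simp add: ds1_def)
    have \<sigma>1: "\<sigma> permutes {..<length ds1}" using \<sigma>0 l1 by simp
    have lc: "leaves c' + leaves b = leaves (ds0 ! \<sigma> i) + 1" "r' + leaves b \<le> leaves (ds0 ! \<sigma> i)"
      using replaces_nleaves[OF i(4)] by simp_all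
    have c1: "ds1 ! \<sigma> i = c'" using \<sigma>i by (simp add: ds1_def)
    define N where "N = nleaves ds1"
    let ?ks = "map leaves ds1" and ?l = "leaves b" and ?q = "ocomposite Q b"
    have pk: "permute_list \<sigma> ?ks = map leaves (permute_list \<sigma> ds1)" using \<sigma>1 by (rule permute_list_map)
    have s: "s = sum_list (take i (permute_list \<sigma> ?ks)) + r'"
    proof -
      have "take i (permute_list \<sigma> ds1) = take i (permute_list \<sigma> ds0)"
        using \<sigma>0 i(1) permute_list_update[of \<sigma> ds0 i c'] by (simp add: ds1_def flip: permute_list_update)
      then show ?thesis by (simp only: i(3) pk take_map nleaves_def)
    qed
    have r1: "r' < ?ks ! \<sigma> i" using lc c1 \<sigma>i l1 by simp
    have ks0: "?ks[\<sigma> i := ?ks ! \<sigma> i + ?l - 1] = map leaves ds0"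
    proof -
      have "?ks ! \<sigma> i + ?l - 1 = leaves (ds0 ! \<sigma> i)" using lc c1 \<sigma>i l1 by simp
      then have "?ks[\<sigma> i := ?ks ! \<sigma> i + ?l - 1] = (map leaves ds1)[\<sigma> i := leaves (ds0 ! \<sigma> i)]" by simp
      also have "\<dots> = map leaves (ds1[\<sigma> i := ds0 ! \<sigma> i])" by (simp add: map_update)
      finally show ?thesis by (simp add: ds1_def)
    qed
    have wfq: "?q \<in> Qt ?l"
      using replaces_wf_branch[OF i(5), of Q 0] ds0(1) ocomposite_closed unfolding dtrees_iff by blast
    have circ: "circ_perm ?l s (block_perm \<sigma> ?ks) id = block_perm \<sigma> (map leaves ds0)"
      using circ_perm_block_perm[of \<sigma> ?ks i r' ?l] \<sigma>1 i(1) l1 r1 ks0 s by simp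
    have bs: "block_perm \<sigma> ?ks s = nleaves (take (\<sigma> i) ds0) + r'"
    proof -
      have "take (\<sigma> i) ds1 = take (\<sigma> i) ds0" by (simp add: ds1_def)
      then have "nleaves (take (\<sigma> i) ds0) = sum_list (take (\<sigma> i) ?ks)" by (simp add: nleaves_def take_map)
      then show ?thesis
        using block_perm_apply[of \<sigma> ?ks i r'] \<sigma>1 i(1) l1 r1 s by simp
    qed
    have pb: "block_perm \<sigma> ?ks permutes {..<N}" unfolding N_def using \<sigma>1 by (rule block_perm_leaves)
    have sN: "s < N"
      using sum_list_take_Suc_le[of i "permute_list \<sigma> ?ks"] i(1) l1 r1 s \<sigma>1 sum_list_permute_list[of \<sigma> ?ks]
      by (simp add: permute_list_nth N_def nleaves_def)
    have F1: "F ds1 \<in> Mt N" using fam(1) ds1 by (simp add: typed_family_def N_def)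
    have F0: "F ds0 = circ N ?l (nleaves (take (\<sigma> i) ds0) + r') (F ds1) ?q"
      using fam(5)[unfolded top_compatible_def, rule_format, OF ds0(1) _ b(2) i(5)] b(1) by (simp add: N_def ds1_def)
    have N0: "nleaves ds0 = N + ?l - 1"
      using replaces_nleaves(1)[OF i(5)] by (simp add: N_def ds1_def)
    have "circ (nleaves ds') ?l s (act_family \<sigma> F ds') ?q = circ N ?l s (mact M N (block_perm \<sigma> ?ks) (F ds1)) (oact Q ?l id ?q)"
      using act_family_permute[OF \<sigma>1, of F] \<sigma>1 wfq
      by (simp add: i(2) ds1_def[symmetric] nleaves_permute_list N_def oact_id)
    also have "\<dots> = mact M (N + ?l - 1) (block_perm \<sigma> (map leaves ds0)) (circ N ?l (nleaves (take (\<sigma> i) ds0) + r') (F ds1) ?q)"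
      using circ_act[OF F1 wfq sN pb permutes_id] by (simp only: circ bs)
    also have "\<dots> = act_family \<sigma> F ds"
      using act_family_permute[OF \<sigma>0, of F] by (simp only: ds0(3) F0 N0)
    finally show "act_family \<sigma> F ds = circ (nleaves ds') ?l s (act_family \<sigma> F ds') ?q" by simp
  qed
  ultimately show ?thesis using typed by (simp add: is_family_def)
qed

lemma continuous_familyI:
  assumes "\<And>(L :: 'k topology) \<alpha> es z0. test_space L \<Longrightarrow> continuous_map L K \<alpha> \<Longrightarrow> \<forall>e\<in>set es. plot_branch Q L e \<Longrightarrow>
     \<forall>z\<in>topspace L. map (\<lambda>e. e z) es \<in> dt n \<Longrightarrow> length es = n \<Longrightarrow>
     continuous_map L (mspace M (nleaves (map (\<lambda>e. e z0) es))) (\<lambda>z. F (\<alpha> z) (map (\<lambda>e. e z) es))"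
  shows "continuous_family K n F"
  unfolding continuous_family_def
proof (intro allI impI)
  fix L :: "'k topology" and \<alpha> es z0
  assume *: "test_space L" "continuous_map L K \<alpha>" "\<forall>e\<in>set es. plot_branch Q L e"
     "\<forall>z\<in>topspace L. map (\<lambda>e. e z) es \<in> dt n"
  show "continuous_map L (mspace M (nleaves (map (\<lambda>e. e z0) es))) (\<lambda>z. F (\<alpha> z) (map (\<lambda>e. e z) es))"
  proof (cases "topspace L = {}")
    case False
    then obtain z where "z \<in> topspace L" by blast
    then have "length es = n" using *(4) dt_length by fastforce
    then show ?thesis using assms * by blast
  qed (auto simp: continuous_map_def)
qed

lemma continuous_familyD:
  assumes "continuous_family K n F" "test_space (L :: 'k topology)" "continuous_map L K \<alpha>"
    "\<forall>e\<in>set es. plot_branch Q L e" "\<forall>z\<in>topspace L. map (\<lambda>e. e z) es \<in> dt n"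
  shows "continuous_map L (mspace M (nleaves (map (\<lambda>e. e z0) es))) (\<lambda>z. F (\<alpha> z) (map (\<lambda>e. e z) es))"
  using assms unfolding continuous_family_def by blast

lemma continuous_family_act:
  assumes F: "continuous_family K n F" and \<sigma>: "\<sigma> permutes {..<n}"
  shows "continuous_family K n (\<lambda>z. act_family \<sigma> (F z))"
proof (rule continuous_familyI)
  fix L :: "'k topology" and \<alpha> es z0
  assume L: "test_space L" and \<alpha>: "continuous_map L K \<alpha>" and es: "\<forall>e\<in>set es. plot_branch Q L e"
     and d: "\<forall>z\<in>topspace L. map (\<lambda>e. e z) es \<in> dt n" and len: "length es = n"
  have \<sigma>': "inv \<sigma> permutes {..<length es}" using permutes_inv[OF \<sigma>] len by simp
  define es' where "es' = permute_list (inv \<sigma>) es"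
  have es': "\<forall>e\<in>set es'. plot_branch Q L e" using es \<sigma>' by (simp add: es'_def)
  have m: "map (\<lambda>e. e z) es' = permute_list (inv \<sigma>) (map (\<lambda>e. e z) es)" for z
    unfolding es'_def using permute_list_map[OF \<sigma>', of "\<lambda>e. e z"] by simp
  have d': "\<forall>z\<in>topspace L. map (\<lambda>e. e z) es' \<in> dt n"
    using d dt_permute permutes_inv[OF \<sigma>] by (simp add: m)
  define N where "N = nleaves (map (\<lambda>e. e z0) es)"
  define \<pi> where "\<pi> = block_perm \<sigma> (map leaves (map (\<lambda>e. e z0) es'))"
  have N': "nleaves (map (\<lambda>e. e z0) es') = N" using \<sigma>' by (simp add: m nleaves_permute_list N_def)
  have \<pi>: "\<pi> permutes {..<N}"
    unfolding \<pi>_def N'[symmetric] using \<sigma> len by (intro block_perm_leaves) (simp add: es'_def)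
  have pi_eq: "block_perm \<sigma> (map leaves (map (\<lambda>e. e z) es')) = \<pi>" for z
  proof -
    have "leaves (e z) = leaves (e z0)" if "e \<in> set es'" for e
      by (rule plot_branch_leaves[of Q L]) (use es' that in blast)
    then have "map leaves (map (\<lambda>e. e z) es') = map leaves (map (\<lambda>e. e z0) es')" by simp
    then show ?thesis unfolding \<pi>_def by metis
  qed
  have "continuous_map L (mspace M N) (\<lambda>z. F (\<alpha> z) (map (\<lambda>e. e z) es'))"
    using continuous_familyD[OF F L \<alpha> es' d', of z0] by (simp only: N')
  from continuous_map_compose[OF this continuous_act[OF \<pi>]]
  have "continuous_map L (mspace M N) (\<lambda>z. mact M N \<pi> (F (\<alpha> z) (map (\<lambda>e. e z) es')))" by (simp add: o_def)
  moreover have "act_family \<sigma> (F (\<alpha> z)) (map (\<lambda>e. e z) es) = mact M N \<pi> (F (\<alpha> z) (map (\<lambda>e. e z) es'))" for z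
  proof -
    have "nleaves (map (\<lambda>e. e z) es) = N" unfolding N_def by (rule plots_nleaves[OF es])
    then show ?thesis using pi_eq[of z] by (simp only: act_family_def m)
  qed
  ultimately show "continuous_map L (mspace M (nleaves (map (\<lambda>e. e z0) es))) (\<lambda>z. act_family \<sigma> (F (\<alpha> z)) (map (\<lambda>e. e z) es))"
    by (simp add: N_def)
qed

text \<open>Replacements commute with grafting, and grafting changes neither the number of leaves
  nor their order, so each condition at \<open>ds\<close> is the corresponding condition for
  \<open>F\<close> at the grafted tree.\<close>

lemma is_family_graft:
  assumes F: "is_family n F" and q: "q \<in> Qt m" and i: "i < n"
  shows "is_family (n + m - 1) (\<lambda>ds. F (graft i m q ds))"
proof -
  have fam: "typed_family n F" "unit_invariant n F" "symmetric_family n F" "contraction_invariant n F" "top_compatible n F"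
    using F by (simp_all add: is_family_def)
  have g: "graft i m q ds \<in> dt n" if "ds \<in> dt (n + m - 1)" for ds using graft_in_dtrees[OF that i q] .
  have r: "replaces b b' s (graft i m q ds) (graft i m q ds')"
    if "ds \<in> dt (n + m - 1)" "replaces b b' s ds ds'" for ds ds' b b' s
    using replaces_graft[OF that(2)] dt_length[OF that(1)] i by simp
  have "typed_family (n + m - 1) (\<lambda>ds. F (graft i m q ds))"
    using fam(1) g nleaves_graft unfolding typed_family_def by metis
  moreover have "unit_invariant (n + m - 1) (\<lambda>ds. F (graft i m q ds))"
    using fam(2) g r unfolding unit_invariant_def by blast
  moreover have "contraction_invariant (n + m - 1) (\<lambda>ds. F (graft i m q ds))"
    using fam(4) g r unfolding contraction_invariant_def by blast
  moreover have "symmetric_family (n + m - 1) (\<lambda>ds. F (graft i m q ds))"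
    unfolding symmetric_family_def
  proof (intro allI impI)
    fix ds ds' s t p es \<sigma> assume ds: "ds \<in> dt (n + m - 1)" and \<sigma>: "\<sigma> permutes {..<length es}"
      and rp: "replaces (Node (t, p) es) (Node (t, oact Q (length es) \<sigma> p) (permute_list \<sigma> es)) s ds ds'"
    show "F (graft i m q ds') = mact M (nleaves ds) (shift_perm s (block_perm \<sigma> (map leaves es))) (F (graft i m q ds))"
      using fam(3)[unfolded symmetric_family_def, rule_format, OF g[OF ds] \<sigma> r[OF ds rp]] by (simp only: nleaves_graft)
  qed
  moreover have "top_compatible (n + m - 1) (\<lambda>ds. F (graft i m q ds))"
    unfolding top_compatible_def
  proof (intro allI impI)
    fix ds ds' s b assume ds: "ds \<in> dt (n + m - 1)" and b: "\<forall>a\<in>set_ptree b. fst a = 1" "b \<noteq> Leaf"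
      and rp: "replaces b Leaf s ds ds'"
    show "F (graft i m q ds) = circ (nleaves ds') (leaves b) s (F (graft i m q ds')) (ocomposite Q b)"
      using fam(5)[unfolded top_compatible_def, rule_format, OF g[OF ds] _ b(2) r[OF ds rp]] b(1)
      by (simp only: nleaves_graft)
  qed
  ultimately show ?thesis by (simp add: is_family_def)
qed

lemma continuous_family_graft:
  assumes F: "continuous_family K n F" and q: "continuous_map K (ospace Q m) q" and i: "i < n"
  shows "continuous_family K (n + m - 1) (\<lambda>z ds. F z (graft i m (q z) ds))"
proof (rule continuous_familyI)
  fix L :: "'k topology" and \<alpha> es z0
  assume L: "test_space L" and \<alpha>: "continuous_map L K \<alpha>" and es: "\<forall>e\<in>set es. plot_branch Q L e"
     and d: "\<forall>z\<in>topspace L. map (\<lambda>e. e z) es \<in> dt (n + m - 1)" and len: "length es = n + m - 1"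
  let ?B = "take m (drop i es)"
  define v where "v = (\<lambda>z. Node (0 :: real, (q \<circ> \<alpha>) z) (map (\<lambda>e. e z) ?B))"
  define es' where "es' = take i es @ v # drop (i + m) es"
  have "plot_branch Q L v"
    unfolding v_def
  proof (rule plot_branch.Node)
    have "length ?B = m" using len i by simp
    then show "continuous_map L (ospace Q (length ?B)) (q \<circ> \<alpha>)"
      using continuous_map_compose[OF \<alpha> q] by simp
    show "\<forall>e\<in>set ?B. plot_branch Q L e" using es by (auto dest: in_set_takeD in_set_dropD)
  qed simp
  then have es': "\<forall>e\<in>set es'. plot_branch Q L e"
    using es by (auto simp: es'_def dest: in_set_takeD in_set_dropD)
  have m: "map (\<lambda>e. e z) es' = graft i m (q (\<alpha> z)) (map (\<lambda>e. e z) es)" for z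
    by (simp add: es'_def v_def graft_def take_map drop_map)
  have "q (\<alpha> z) \<in> Qt m" if "z \<in> topspace L" for z
    using continuous_map_compose[OF \<alpha> q] that by (auto simp: continuous_map_def Pi_iff)
  then have d': "\<forall>z\<in>topspace L. map (\<lambda>e. e z) es' \<in> dt n"
    unfolding m by (intro ballI graft_in_dtrees[OF d[rule_format] i])
  show "continuous_map L (mspace M (nleaves (map (\<lambda>e. e z0) es)))
      (\<lambda>z. F (\<alpha> z) (graft i m (q (\<alpha> z)) (map (\<lambda>e. e z) es)))"
    using continuous_familyD[OF F L \<alpha> es' d', of z0] by (simp only: m nleaves_graft)
qed

end

section \<open>The right module of families\<close>

lemma three_blocks:
  assumes "i + m \<le> length xs"
  obtains A B C where "xs = A @ B @ C" "length A = i" "length B = m"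
proof
  show "xs = take i xs @ take m (drop i xs) @ drop (i + m) xs"
    by (metis add.commute append_take_drop_id drop_drop)
qed (use assms in auto)

context family_module
begin

abbreviation "Mfs n \<equiv> Mf_space k Q M n"

lemma continuous_map_into_Mf_space:
  assumes X: "is_kspace k X"
    and F: "\<And>(K :: 'k topology) g z. test_space K \<Longrightarrow> continuous_map K X g \<Longrightarrow> z \<in> topspace K \<Longrightarrow> is_family n (F (g z))"
    and cF: "\<And>(K :: 'k topology) g. test_space K \<Longrightarrow> continuous_map K X g \<Longrightarrow> continuous_family K n (\<lambda>z. F (g z))"
  shows "continuous_map X (Mfs n) (\<lambda>x. make_family k Q n (F x))"
proof (rule continuous_map_from_kspace[OF X])
  fix K :: "'k topology" and g assume g: "test_space K" "continuous_map K X g"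
  have "continuous_map K (Mfs n) (\<lambda>z. make_family k Q n (F (g z)))"
    by (rule continuous_map_make_family[OF g(1) F[OF g] cF[OF g]])
  then show "continuous_map K (Mfs n) ((\<lambda>x. make_family k Q n (F x)) \<circ> g)" by (simp add: o_def)
qed

lemma family_value_in: "f \<in> topspace (Mfs n) \<Longrightarrow> ds \<in> dt n \<Longrightarrow> family_value f ds \<in> Mt (nleaves ds)"
  using Mf_space_family(1) by (auto simp: is_family_def typed_family_def)

lemma continuous_Mf_act:
  assumes \<sigma>: "\<sigma> permutes {..<n}"
  shows "continuous_map (Mfs n) (Mfs n) (Mf_act k Q M n \<sigma>)"
proof -
  have "continuous_map (Mfs n) (Mfs n) (\<lambda>f. make_family k Q n (act_family \<sigma> (family_value f)))"
  proof (rule continuous_map_into_Mf_space[OF is_kspace_Mf_space])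
    fix K :: "'k topology" and g assume g: "test_space K" "continuous_map K (Mfs n) g"
    show "continuous_family K n (\<lambda>z. act_family \<sigma> (family_value (g z)))"
      using continuous_family_act[OF continuous_family_Mf_space[OF g] \<sigma>] .
    fix z assume "z \<in> topspace K"
    then have "g z \<in> topspace (Mfs n)" using g(2) by (auto simp: continuous_map_def Pi_iff)
    then show "is_family n (act_family \<sigma> (family_value (g z)))"
      using is_family_act[OF Mf_space_family(1) \<sigma>] by blast
  qed
  then show ?thesis by (simp add: Mf_act_eq[abs_def])
qed

lemma continuous_Mf_rcomp:
  assumes i: "i < n"
  shows "continuous_map (kprod k (Mfs n) (ospace Q m)) (Mfs (n + m - 1)) (\<lambda>(f, q). Mf_rcomp k Q n m i f q)"
proof -
  have "continuous_map (kprod k (Mfs n) (ospace Q m)) (Mfs (n + m - 1))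
      (\<lambda>x. make_family k Q (n + m - 1) ((\<lambda>x ds. family_value (fst x) (graft i m (snd x) ds)) x))"
  proof (rule continuous_map_into_Mf_space)
    show "is_kspace k (kprod k (Mfs n) (ospace Q m))" by (simp add: kprod_def is_kspace_kify)
    fix K :: "'k topology" and g assume K: "test_space K" and g: "continuous_map K (kprod k (Mfs n) (ospace Q m)) g"
    have g1: "continuous_map K (Mfs n) (\<lambda>z. fst (g z))" and g2: "continuous_map K (ospace Q m) (\<lambda>z. snd (g z))"
      using g by (simp_all add: continuous_map_kprod[OF K] o_def)
    show "continuous_family K (n + m - 1) (\<lambda>z ds. family_value (fst (g z)) (graft i m (snd (g z)) ds))"
      by (rule continuous_family_graft[OF continuous_family_Mf_space[OF K g1] g2 i])
    fix z assume "z \<in> topspace K"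
    then have "fst (g z) \<in> topspace (Mfs n)" "snd (g z) \<in> Qt m"
      using g1 g2 by (auto simp: continuous_map_def Pi_iff)
    then show "is_family (n + m - 1) (\<lambda>ds. family_value (fst (g z)) (graft i m (snd (g z)) ds))"
      using is_family_graft[OF Mf_space_family(1) _ i] by blast
  qed
  then show ?thesis by (simp add: Mf_rcomp_eq case_prod_unfold)
qed

lemma symmetric_sequence_Mf: "symmetric_sequence k Mfs (Mf_act k Q M)"
  unfolding symmetric_sequence_def
proof (intro conjI allI ballI impI)
  show "is_kspace k (Mfs n)" for n by (rule is_kspace_Mf_space)
  show "continuous_map (Mfs n) (Mfs n) (Mf_act k Q M n \<sigma>)" if "\<sigma> permutes {..<n}" for n \<sigma>
    using continuous_Mf_act[OF that] .
next
  fix n f assume f: "f \<in> topspace (Mfs n)"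
  have "Mf_act k Q M n id f = make_family k Q n (family_value f)"
    unfolding Mf_act_eq
    by (rule make_family_cong) (simp add: act_family_def act_id family_value_in[OF f])
  then show "Mf_act k Q M n id f = f" using Mf_space_family(2)[OF f] by simp
next
  fix n \<sigma> \<tau> f assume f: "f \<in> topspace (Mfs n)" and "\<sigma> permutes {..<n} \<and> \<tau> permutes {..<n}"
  then have \<sigma>: "\<sigma> permutes {..<n}" and \<tau>: "\<tau> permutes {..<n}" by auto
  have \<sigma>\<tau>: "\<sigma> \<circ> \<tau> permutes {..<n}" using permutes_compose[OF \<tau> \<sigma>] .
  show "Mf_act k Q M n \<tau> (Mf_act k Q M n \<sigma> f) = Mf_act k Q M n (\<sigma> \<circ> \<tau>) f"
    unfolding Mf_act_eq[of n \<tau>] Mf_act_eq[of n "\<sigma> \<circ> \<tau>"]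
  proof (rule make_family_cong)
    fix ds assume "ds \<in> dt n"
    then obtain ds1 where ds1: "ds1 \<in> dt n" "length ds1 = n" "ds = permute_list \<tau> ds1" using \<tau> by (rule dt_permuteE)
    from ds1(1) \<sigma> obtain ds0 where ds0: "ds0 \<in> dt n" "length ds0 = n" "ds1 = permute_list \<sigma> ds0" by (rule dt_permuteE)
    let ?N = "nleaves ds0" and ?ks = "map leaves ds0"
    have N: "nleaves ds1 = ?N" using \<sigma> ds0 by (simp add: nleaves_permute_list)
    have ks: "map leaves ds1 = permute_list \<sigma> ?ks" unfolding ds0(3) using \<sigma> ds0(2) by (simp add: permute_list_map)
    have p\<sigma>: "block_perm \<sigma> ?ks permutes {..<?N}" using \<sigma> ds0 by (simp add: block_perm_leaves)
    have p\<tau>: "block_perm \<tau> (permute_list \<sigma> ?ks) permutes {..<?N}"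
      using block_perm_leaves[of \<tau> ds1] \<tau> ds1 by (simp add: N ks)
    have ds: "ds = permute_list (\<sigma> \<circ> \<tau>) ds0" using ds1(3) ds0 \<tau> by (simp add: permute_list_compose)
    have "act_family \<tau> (family_value (Mf_act k Q M n \<sigma> f)) ds
        = mact M ?N (block_perm \<tau> (permute_list \<sigma> ?ks)) (act_family \<sigma> (family_value f) ds1)"
      using act_family_permute[of \<tau> ds1] \<tau> ds1 by (simp add: Mf_act_eq N ks family_value_make_family[OF ds1(1)])
    also have "\<dots> = mact M ?N (block_perm \<tau> (permute_list \<sigma> ?ks)) (mact M ?N (block_perm \<sigma> ?ks) (family_value f ds0))"
      using act_family_permute[of \<sigma> ds0] \<sigma> ds0 by simp
    also have "\<dots> = mact M ?N (block_perm (\<sigma> \<circ> \<tau>) ?ks) (family_value f ds0)"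
      using act_comp[OF family_value_in[OF f ds0(1)] p\<sigma> p\<tau>] \<sigma> \<tau> ds0 by (simp add: block_perm_comp)
    also have "\<dots> = act_family (\<sigma> \<circ> \<tau>) (family_value f) ds"
      unfolding ds using act_family_permute[of "\<sigma> \<circ> \<tau>" ds0] \<sigma>\<tau> ds0 by simp
    finally show "act_family \<tau> (family_value (Mf_act k Q M n \<sigma> f)) ds = act_family (\<sigma> \<circ> \<tau>) (family_value f) ds" .
  qed
qed

lemma family_value_Mf_rcomp:
  "ds \<in> dt (n + m - 1) \<Longrightarrow> family_value (Mf_rcomp k Q n m i f q) ds = family_value f (graft i m q ds)"
  unfolding Mf_rcomp_eq by (rule family_value_make_family)

text \<open>Grafting with the unit inserts a vertex of arity one labelled by the unit, which the
  unit condition removes.\<close>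

lemma Mf_rcomp_unit:
  assumes f: "f \<in> topspace (Mfs n)" and i: "i < n"
  shows "Mf_rcomp k Q n 1 i f (ounit Q) = f"
proof -
  have "Mf_rcomp k Q n 1 i f (ounit Q) = make_family k Q (n + 1 - 1) (family_value f)"
    unfolding Mf_rcomp_eq
  proof (rule make_family_cong)
    fix ds assume ds: "ds \<in> dt (n + 1 - 1)"
    then have "i < length ds" using i dt_length by simp
    then have "i + 1 \<le> length ds" by simp
    then obtain A B C where B: "ds = A @ B @ C" "length A = i" "length B = 1" by (rule three_blocks)
    obtain d where "B = [d]" using B(3) by (cases B) auto
    then have A: "ds = A @ [d] @ C" "length A = i" using B by simp_all
    have g: "graft i 1 (ounit Q) ds = A @ [Node (0, ounit Q) [d]] @ C" using graft_append[of i A 1 "[d]" "ounit Q" C] A by simp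
    have "replaces (Node (0, ounit Q) [d]) d (nleaves A + 0) (graft i 1 (ounit Q) ds) ds"
      unfolding g by (subst A(1)) (rule replaces_append[OF replaces_singleton_here])
    moreover have "graft i 1 (ounit Q) ds \<in> dt n" using graft_in_dtrees[OF ds i unit_in] .
    ultimately show "family_value f (graft i 1 (ounit Q) ds) = family_value f ds"
      using Mf_space_family(1)[OF f] unfolding is_family_def unit_invariant_def by blast
  qed
  then show ?thesis using Mf_space_family(2)[OF f] by simp
qed

text \<open>Grafting twice yields two non-root vertices joined by an edge and both with number 0, so
  the contraction condition merges them.\<close>

lemma Mf_rcomp_assoc:
  assumes f: "f \<in> topspace (Mfs n)" and y: "y \<in> Qt m" and z: "z \<in> Qt l" and i: "i < n" and j: "j < m"
  shows "Mf_rcomp k Q (n + m - 1) l (i + j) (Mf_rcomp k Q n m i f y) z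
    = Mf_rcomp k Q n (m + l - 1) i f (ocomp Q m l j y z)"
proof -
  have eq: "n + m - 1 + l - 1 = n + (m + l - 1) - 1" and ij: "i + j < n + m - 1" using i j by auto
  show ?thesis
    unfolding Mf_rcomp_eq[of "n + m - 1"] Mf_rcomp_eq[of n "m + l - 1"] eq[symmetric]
  proof (rule make_family_cong)
    fix ds assume ds: "ds \<in> dt (n + m - 1 + l - 1)"
    have len: "length ds = n + m - 1 + l - 1" using dt_length[OF ds] .
    have "i + (m + l - 1) \<le> length ds" using len i j by simp
    then obtain A B C where ABC: "ds = A @ B @ C" "length A = i" "length B = m + l - 1" by (rule three_blocks)
    have "j + l \<le> length B" using ABC(3) j by simp
    then obtain B1 B2 B3 where B: "B = B1 @ B2 @ B3" "length B1 = j" "length B2 = l" by (rule three_blocks)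
    let ?es = "B1 @ Node (0, z) B2 # B3"
    have g1: "graft (i + j) l z ds = A @ ?es @ C"
      using graft_append[of "i + j" "A @ B1" l B2 z "B3 @ C"] ABC B by simp
    have les: "length ?es = m" using B ABC(3) j by simp
    have g2: "graft i m y (graft (i + j) l z ds) = A @ [Node (0, y) ?es] @ C"
      unfolding g1 using graft_append[of i A m ?es y C] ABC les by simp
    have g3: "graft i (m + l - 1) (ocomp Q m l j y z) ds = A @ [Node (0, ocomp Q m l j y z) B] @ C"
      unfolding ABC(1) using graft_append[of i A "m + l - 1" B _ C] ABC by simp
    have d1: "graft (i + j) l z ds \<in> dt (n + m - 1)" using graft_in_dtrees[OF ds ij z] .
    have d2: "graft i m y (graft (i + j) l z ds) \<in> dt n" using graft_in_dtrees[OF d1 i y] .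
    have "replaces (Node (0, y) ?es)
        (Node (0, ocomp Q (length ?es) (length B2) j y z) (take j ?es @ B2 @ drop (Suc j) ?es)) (nleaves A + 0)
        (graft i m y (graft (i + j) l z ds)) (graft i (m + l - 1) (ocomp Q m l j y z) ds)"
      unfolding g2 g3 using replaces_append[OF replaces_singleton_here, where xs = A and ys = C] B les by simp
    moreover have "j < length ?es" "?es ! j = Node (0, z) B2" using B by (auto simp: nth_append)
    ultimately have "family_value f (graft i m y (graft (i + j) l z ds))
        = family_value f (graft i (m + l - 1) (ocomp Q m l j y z) ds)"
      using Mf_space_family(1)[OF f] d2 unfolding is_family_def contraction_invariant_def by blast
    then show "family_value (Mf_rcomp k Q n m i f y) (graft (i + j) l z ds)
        = family_value f (graft i (m + l - 1) (ocomp Q m l j y z) ds)"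
      by (simp only: family_value_Mf_rcomp[OF d1])
  qed
qed

text \<open>The two grafts use disjoint groups of root edges and give literally the same tree in
  either order.\<close>

lemma Mf_rcomp_commute:
  assumes f: "f \<in> topspace (Mfs n)" and y: "y \<in> Qt m" and z: "z \<in> Qt l" and ij: "i < j" "j < n"
  shows "Mf_rcomp k Q (n + m - 1) l (j + m - 1) (Mf_rcomp k Q n m i f y) z
    = Mf_rcomp k Q (n + l - 1) m i (Mf_rcomp k Q n l j f z) y"
proof -
  have eq: "n + m - 1 + l - 1 = n + l - 1 + m - 1" using ij by auto
  show ?thesis
    unfolding Mf_rcomp_eq[of "n + m - 1"] Mf_rcomp_eq[of "n + l - 1"] eq[symmetric]
  proof (rule make_family_cong)
    fix ds assume ds: "ds \<in> dt (n + m - 1 + l - 1)"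
    have len: "length ds = n + m - 1 + l - 1" using dt_length[OF ds] .
    have "i + m \<le> length ds" using len ij by simp
    then obtain A B C' where A: "ds = A @ B @ C'" "length A = i" "length B = m" by (rule three_blocks)
    have "j - i - 1 + l \<le> length C'" using len A ij by simp
    then obtain C D E where C: "C' = C @ D @ E" "length C = j - i - 1" "length D = l" by (rule three_blocks)
    have "j + m - 1 = length (A @ B @ C)" using A C ij by simp
    from graft_append[OF this, of l D z E]
    have g1: "graft (j + m - 1) l z ds = A @ B @ C @ Node (0, z) D # E" using A C by simp
    have g2: "graft i m y ds = A @ Node (0, y) B # C @ D @ E"
      using graft_append[of i A m B y "C @ D @ E"] A C by simp
    have g3: "graft i m y (A @ B @ C @ Node (0, z) D # E) = A @ Node (0, y) B # C @ Node (0, z) D # E"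
      using graft_append[of i A m B y "C @ Node (0, z) D # E"] A by simp
    have g4: "graft j l z (A @ Node (0, y) B # C @ D @ E) = A @ Node (0, y) B # C @ Node (0, z) D # E"
      using graft_append[of j "A @ Node (0, y) B # C" l D z E] A C ij by simp
    have d1: "graft (j + m - 1) l z ds \<in> dt (n + m - 1)"
      using ij by (intro graft_in_dtrees[OF ds _ z]) simp
    have d2: "graft i m y ds \<in> dt (n + l - 1)"
      using ij by (intro graft_in_dtrees[OF ds[unfolded eq] _ y]) simp
    show "family_value (Mf_rcomp k Q n m i f y) (graft (j + m - 1) l z ds)
        = family_value (Mf_rcomp k Q n l j f z) (graft i m y ds)"
      unfolding family_value_Mf_rcomp[OF d1] family_value_Mf_rcomp[OF d2] unfolding g1 g2 g3 g4 ..
  qed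
qed

text \<open>The symmetry condition at the grafted vertex accounts for \<tau>, and the action on
  families for \<sigma>. It remains to see that grafting after \<open>circ_perm\<close> is a
  permutation by \<sigma> of the root edges of a grafted tree, and that the induced leaf
  permutations agree.\<close>

lemma Mf_rcomp_act:
  assumes f: "f \<in> topspace (Mfs n)" and y: "y \<in> Qt m" and i: "i < n"
    and \<sigma>: "\<sigma> permutes {..<n}" and \<tau>: "\<tau> permutes {..<m}"
  shows "Mf_rcomp k Q n m i (Mf_act k Q M n \<sigma> f) (oact Q m \<tau> y)
    = Mf_act k Q M (n + m - 1) (circ_perm m i \<sigma> \<tau>) (Mf_rcomp k Q n m (\<sigma> i) f y)"
  unfolding Mf_rcomp_eq[of n m i] Mf_act_eq[of "n + m - 1"]
proof (rule make_family_cong)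
  let ?c = "circ_perm m i \<sigma> \<tau>" and ?y = "oact Q m \<tau> y"
  have pc: "?c permutes {..<n + m - 1}" using circ_perm_permutes[OF \<sigma> i \<tau>] .
  have \<sigma>i: "\<sigma> i < n" using \<sigma> i by (simp add: permutes_less)
  have y': "?y \<in> Qt m" using right_module.act_closed[OF right_module_operad_module[OF operad], of y m \<tau>] y \<tau> by simp
  fix ds assume ds: "ds \<in> dt (n + m - 1)"
  then obtain ds0 where ds0: "ds0 \<in> dt (n + m - 1)" "length ds0 = n + m - 1" "ds = permute_list ?c ds0"
    using pc by (rule dt_permuteE)
  have "\<sigma> i + m \<le> length ds0" using ds0(2) \<sigma>i by simp
  then obtain A B C where A: "ds0 = A @ B @ C" "length A = \<sigma> i" "length B = m" by (rule three_blocks)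
  let ?s = "map (\<lambda>d :: (real \<times> 'q) ptree. [d])"
  \<comment> \<open>The root edges of \<open>ds0\<close> in the form required by
    \<open>permute_list_circ_perm\<close>: the \<open>m\<close> edges to be grafted form one block,
    all others are singletons.\<close>
  define dss where "dss = ?s A @ [B] @ ?s C"
  \<comment> \<open>\<open>W\<close> is the grafted tree, and \<open>W1\<close> is obtained from it
    by letting \<tau> act at the new vertex.\<close>
  define W where "W = A @ Node (0, y) B # C"
  define W1 where "W1 = A @ Node (0, ?y) (permute_list \<tau> B) # C"
  have lC: "length C = n - Suc (\<sigma> i)" using A ds0(2) by simp
  have lW: "length W = n" "length W1 = n" "length dss = n" using A lC \<sigma>i by (simp_all add: W_def W1_def dss_def)
  have dss: "dss ! b = (if b = \<sigma> i then B else [W1 ! b])" if "b < n" for b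
    using that A lC by (auto simp: dss_def W1_def nth_append nth_Cons')
  have "concat dss = ds0" by (simp add: dss_def A concat_map_singleton)
  moreover have "length (dss ! b) = (if b = \<sigma> i then m else 1)" if "b < n" for b
    using dss[OF that] A by simp
  ultimately have dsc: "ds = concat ((permute_list \<sigma> dss)[i := permute_list \<tau> (dss ! \<sigma> i)])"
    using permute_list_circ_perm[OF \<sigma> i \<tau> lW(3)] ds0(3) by simp
  define L where "L = (permute_list \<sigma> dss)[i := permute_list \<tau> B]"
  define V where "V = permute_list \<sigma> W1"
  have La: "L ! a = [V ! a]" if "a < n" "a \<noteq> i" for a
    using that \<sigma> lW dss[of "\<sigma> a"] permutes_inj[OF \<sigma>]
    by (simp add: L_def V_def permute_list_nth permutes_less inj_eq)
  have lL: "length L = n" "length V = n" using lW by (simp_all add: L_def V_def)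
  have t: "take i L = ?s (take i V)" and d: "drop (Suc i) L = ?s (drop (Suc i) V)"
    using La lL i by (auto intro!: nth_equalityI)
  have "ds = concat (take i L) @ L ! i @ concat (drop (Suc i) L)"
    unfolding dsc using concat_nth_split[of i L] lL i dss[OF \<sigma>i] by (simp add: L_def)
  then have "ds = take i V @ permute_list \<tau> B @ drop (Suc i) V"
    using i lW by (simp add: t d concat_map_singleton) (simp add: L_def)
  then have "graft i m ?y ds = take i V @ Node (0, ?y) (permute_list \<tau> B) # drop (Suc i) V"
    using graft_append[of i "take i V" m "permute_list \<tau> B" ?y "drop (Suc i) V"] A(3) lL i by simp
  also have "Node (0, ?y) (permute_list \<tau> B) = V ! i"
    using \<sigma> i lW A by (simp add: V_def permute_list_nth) (simp add: W1_def nth_append)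
  finally have g: "graft i m ?y ds = permute_list \<sigma> W1"
    using lL i by (simp add: V_def[symmetric] id_take_nth_drop[symmetric])
  have gW: "graft (\<sigma> i) m y ds0 = W" unfolding A(1) W_def by (rule graft_append) (simp_all add: A)
  have Wdt: "W \<in> dt n" using graft_in_dtrees[OF ds0(1) \<sigma>i y] by (simp add: gW)
  have r: "replaces (Node (0, y) B) (Node (0, oact Q (length B) \<tau> y) (permute_list \<tau> B)) (nleaves A + 0) W W1"
    unfolding W_def W1_def using replaces_append[OF replaces_singleton_here, where xs = A and ys = C] A(3) by simp
  let ?\<beta> = "shift_perm (nleaves A) (block_perm \<tau> (map leaves B))" and ?N = "nleaves ds0"
  have \<tau>B: "\<tau> permutes {..<length B}" using \<tau> A by simp
  have N: "nleaves W = ?N" by (simp add: W_def A)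
  have F: "family_value f W \<in> Mt ?N" using family_value_in[OF f Wdt] by (simp add: N)
  have FW1: "family_value f W1 = mact M ?N ?\<beta> (family_value f W)"
    using Mf_space_family(1)[OF f] Wdt \<tau>B r unfolding is_family_def symmetric_family_def by (simp only: N add_0_right)
  have lv: "map leaves W1 = map leaves W" using \<tau>B by (simp add: W_def W1_def nleaves_permute_list)
  have lW1: "nleaves W1 = ?N" using arg_cong[OF lv, of sum_list] N by (simp add: nleaves_def)
  have p\<beta>: "?\<beta> permutes {..<?N}"
    using block_perm_leaves[OF \<tau>B] by (rule shift_perm_permutes) (simp add: A)
  have p\<sigma>: "block_perm \<sigma> (map leaves W) permutes {..<?N}"
    using block_perm_leaves[of \<sigma> W] \<sigma> lW N by simp
  have perm: "block_perm ?c (map leaves ds0) = ?\<beta> \<circ> block_perm \<sigma> (map leaves W)"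
  proof -
    let ?lss = "map (map leaves) dss"
    have "concat ?lss = map leaves ds0" using \<open>concat dss = ds0\<close> by (simp flip: map_concat)
    moreover have "map sum_list ?lss = map leaves W"
      by (simp add: dss_def W_def nleaves_def)
    moreover have "?lss ! \<sigma> i = map leaves B" using dss[OF \<sigma>i] \<sigma>i lW by simp
    moreover have "sum_list (take (\<sigma> i) (map leaves W)) = nleaves A" using A by (simp add: W_def nleaves_def)
    moreover have "length (?lss ! b) = (if b = \<sigma> i then m else 1)" if "b < n" for b
      using dss[OF that] that lW A by simp
    ultimately show ?thesis using block_perm_circ_perm[OF \<sigma> i \<tau>, of ?lss] lW by simp
  qed
  have "family_value (Mf_act k Q M n \<sigma> f) (graft i m ?y ds) = act_family \<sigma> (family_value f) (permute_list \<sigma> W1)"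
    unfolding Mf_act_eq using family_value_make_family[OF graft_in_dtrees[OF ds i y']] by (simp only: g)
  also have "\<dots> = mact M ?N (block_perm \<sigma> (map leaves W)) (mact M ?N ?\<beta> (family_value f W))"
    using act_family_permute[of \<sigma> W1] \<sigma> lW by (simp only: lW1 FW1 lv)
  also have "\<dots> = mact M ?N (block_perm ?c (map leaves ds0)) (family_value f W)"
    by (simp only: act_comp[OF F p\<beta> p\<sigma>] perm)
  also have "\<dots> = act_family ?c (family_value (Mf_rcomp k Q n m (\<sigma> i) f y)) ds"
    using act_family_permute[of ?c ds0] pc ds0 by (simp add: gW family_value_Mf_rcomp[OF ds0(1), unfolded One_nat_def])
  finally show "family_value (Mf_act k Q M n \<sigma> f) (graft i m ?y ds)
      = act_family ?c (family_value (Mf_rcomp k Q n m (\<sigma> i) f y)) ds" .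
qed

end

section \<open>Left operations on families\<close>

lemma split_at_concat: "map length xss = ns \<Longrightarrow> split_at ns (concat xss) = xss"
  by (induction xss arbitrary: ns) auto

lemma map2_update:
  assumes "length xs = length ys" "i < length ys"
  shows "map2 f (xs[i := x]) (ys[i := y]) = (map2 f xs ys)[i := f x y]"
  using assms by (auto intro!: nth_equalityI simp: nth_list_update)

lemma replaces_concat:
  assumes "replaces b b' s (concat dss) ds'"
  obtains a r e' where "a < length dss" "ds' = concat (dss[a := e'])" "replaces b b' r (dss ! a) e'"
    "s = sum_list (take a (map nleaves dss)) + r"
  using assms
proof (induction dss arbitrary: s ds' thesis)
  case Nil
  then show ?case by (auto elim: replaces.cases)
next
  case (Cons D dss)
  from Cons.prems(2) have "replaces b b' s ([] @ D @ concat dss) ds'" by simp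
  then show ?case
  proof (cases rule: replaces_split3)
    case (left A')
    then show ?thesis by (auto elim: replaces.cases)
  next
    case (middle B' r)
    then show ?thesis using Cons.prems(1)[of 0 B' r] by simp
  next
    case (right C' r)
    obtain a r' e' where "a < length dss" "C' = concat (dss[a := e'])" "replaces b b' r' (dss ! a) e'"
      "r = sum_list (take a (map nleaves dss)) + r'"
      using Cons.IH[OF _ right(2)] by blast
    then show ?thesis using Cons.prems(1)[of "Suc a" e' r'] right by simp
  qed
qed

lemma nleaves_concat: "nleaves (concat dss) = sum_list (map nleaves dss)"
  by (induction dss) simp_all

lemma permute_list_map2:
  assumes "\<sigma> permutes {..<length xs}" "length xs = length ys"
  shows "permute_list \<sigma> (map2 f xs ys) = map2 f (permute_list \<sigma> xs) (permute_list \<sigma> ys)"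
  using assms by (auto intro!: nth_equalityI simp: permute_list_nth permutes_less)

lemma elems_iff: "elems M ns xs \<longleftrightarrow> length ns = length xs \<and> (\<forall>a<length xs. xs ! a \<in> topspace (mspace M (ns ! a)))"
  by (auto simp: elems_def list_all2_conv_all_nth)

lemma mspace_Mf [simp]:
  fixes k :: "'k itself"
  shows "mspace (Mf k Q M) = Mf_space k Q M" "mact (Mf k Q M) = Mf_act k Q M"
    "rcomp (Mf k Q M) = Mf_rcomp k Q" "lcomp (Mf k Q M) = Mf_lcomp k Q M"
  by (simp_all add: Mf_def)

locale bimodule_families = family_module k Q M
  for k :: "'k itself" and Q :: "'q operad" and M :: "('p, 'q, 'm) bimod" +
  fixes P :: "'p operad"
  assumes bimodule: "is_bimodule k P Q M"
begin

abbreviation "Pt n \<equiv> topspace (ospace P n)"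
abbreviation "lc \<equiv> lcomp M"

lemmas left_axioms = bimodule[unfolded is_bimodule_def, THEN conjunct2, THEN conjunct2, THEN conjunct1,
    unfolded left_module_axioms_def]

lemma continuous_lc:
  "continuous_map (kprod k (ospace P (length ns)) (kproduct k (\<lambda>i. mspace M (ns ! i)) {..<length ns}))
     (mspace M (sum_list ns)) (\<lambda>(p, x). lc ns p (map x [0..<length ns]))"
  using left_axioms[THEN conjunct1] by blast

lemma lc_unit: "x \<in> Mt n \<Longrightarrow> lc [n] (ounit P) [x] = x"
  using left_axioms[THEN conjunct2, THEN conjunct1] by blast

lemma lc_assoc:
  "p \<in> Pt n \<Longrightarrow> p' \<in> Pt l \<Longrightarrow> i < n \<Longrightarrow> length ns = n + l - 1 \<Longrightarrow> elems M ns xs \<Longrightarrow>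
    lc ns (ocomp P n l i p p') xs
      = lc (take i ns @ [sum_list (take l (drop i ns))] @ drop (i + l) ns) p
          (take i xs @ [lc (take l (drop i ns)) p' (take l (drop i xs))] @ drop (i + l) xs)"
  using left_axioms[THEN conjunct2, THEN conjunct2, THEN conjunct1] by blast

lemma lc_permute:
  "p \<in> Pt (length ns) \<Longrightarrow> elems M ns xs \<Longrightarrow> \<sigma> permutes {..<length ns} \<Longrightarrow>
    lc (permute_list \<sigma> ns) (oact P (length ns) \<sigma> p) (permute_list \<sigma> xs)
      = mact M (sum_list ns) (block_perm \<sigma> ns) (lc ns p xs)"
  using left_axioms[THEN conjunct2, THEN conjunct2, THEN conjunct2, THEN conjunct1] by blast

lemma lc_act:
  "p \<in> Pt (length ns) \<Longrightarrow> elems M ns xs \<Longrightarrow> i < length ns \<Longrightarrow> \<tau> permutes {..<ns ! i} \<Longrightarrow>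
    lc ns p (xs[i := mact M (ns ! i) \<tau> (xs ! i)])
      = mact M (sum_list ns) (shift_perm (sum_list (take i ns)) \<tau>) (lc ns p xs)"
  using left_axioms[THEN conjunct2, THEN conjunct2, THEN conjunct2, THEN conjunct2] by blast

lemma circ_lc:
  "p \<in> Pt (length ns) \<Longrightarrow> q \<in> Qt m \<Longrightarrow> elems M ns xs \<Longrightarrow> i < length ns \<Longrightarrow> j < ns ! i \<Longrightarrow>
    circ (sum_list ns) m (sum_list (take i ns) + j) (lc ns p xs) q
      = lc (ns[i := ns ! i + m - 1]) p (xs[i := circ (ns ! i) m j (xs ! i) q])"
  using bimodule[unfolded is_bimodule_def, THEN conjunct2, THEN conjunct2, THEN conjunct2] by blast

lemma lc_closed:
  assumes "p \<in> Pt (length ns)" "elems M ns xs"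
  shows "lc ns p xs \<in> Mt (sum_list ns)"
proof -
  have l: "length xs = length ns" using assms(2) by (simp add: elems_iff)
  let ?x = "\<lambda>i\<in>{..<length ns}. xs ! i"
  have "(p, ?x) \<in> topspace (kprod k (ospace P (length ns)) (kproduct k (\<lambda>i. mspace M (ns ! i)) {..<length ns}))"
    using assms l by (auto simp: elems_iff)
  then have "(\<lambda>(p, x). lc ns p (map x [0..<length ns])) (p, ?x) \<in> Mt (sum_list ns)"
    using continuous_map_funspace[OF continuous_lc[of ns]] by blast
  moreover have "map ?x [0..<length ns] = xs" using l by (auto intro!: nth_equalityI)
  ultimately show ?thesis by simp
qed

definition lcomp_family :: "nat list \<Rightarrow> 'p \<Rightarrow> ('q dtree \<Rightarrow> 'm) list \<Rightarrow> 'q dtree \<Rightarrow> 'm" where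
  "lcomp_family ns p Fs ds = lc (map nleaves (split_at ns ds)) p (map2 (\<lambda>F D. F D) Fs (split_at ns ds))"

lemma lcomp_family_concat:
  "map length dss = ns \<Longrightarrow> lcomp_family ns p Fs (concat dss) = lc (map nleaves dss) p (map2 (\<lambda>F D. F D) Fs dss)"
  by (simp add: lcomp_family_def split_at_concat)

lemma dt_blocksE:
  assumes "ds \<in> dt (sum_list ns)"
  obtains dss where "ds = concat dss" "map length dss = ns" "length dss = length ns"
    "\<And>a. a < length ns \<Longrightarrow> dss ! a \<in> dt (ns ! a)"
proof -
  obtain dss where dss: "concat dss = ds" "map length dss = ns"
    using exists_blocks[of ds ns] dt_length[OF assms] by blast
  have l: "length dss = length ns" using dss(2) by auto
  have "dss ! a \<in> dt (ns ! a)" if "a < length ns" for a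
  proof -
    have "length (dss ! a) = ns ! a" using arg_cong[OF dss(2), of "\<lambda>l. l ! a"] that l by simp
    moreover have "dss ! a \<in> set dss" using that l by simp
    then have "set (dss ! a) \<subseteq> set ds" unfolding dss(1)[symmetric] set_concat by blast
    ultimately show ?thesis using assms unfolding dtrees_iff by blast
  qed
  then show ?thesis using that dss l by blast
qed

lemma elems_values:
  assumes "length Fs = length ns" "\<And>a. a < length ns \<Longrightarrow> typed_family (ns ! a) (Fs ! a)"
    "length dss = length ns" "\<And>a. a < length ns \<Longrightarrow> dss ! a \<in> dt (ns ! a)"
  shows "elems M (map nleaves dss) (map2 (\<lambda>F D. F D) Fs dss)"
  using assms by (simp add: elems_iff typed_family_def)

text \<open>A replacement takes place in one block of root edges and so changes one argument of the
  left operation. For the symmetry condition this argument is acted on by a permutation, for the top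
  condition it becomes a partial composite; the axioms of \<open>M\<close> move either out of the
  left operation.\<close>

lemma is_family_lcomp:
  assumes p: "p \<in> Pt (length ns)" and lF: "length Fs = length ns"
    and F: "\<And>a. a < length ns \<Longrightarrow> is_family (ns ! a) (Fs ! a)"
  shows "is_family (sum_list ns) (lcomp_family ns p Fs)"
proof -
  have fam: "typed_family (ns ! a) (Fs ! a)" "unit_invariant (ns ! a) (Fs ! a)" "symmetric_family (ns ! a) (Fs ! a)"
      "contraction_invariant (ns ! a) (Fs ! a)" "top_compatible (ns ! a) (Fs ! a)" if "a < length ns" for a
    using F[OF that] by (simp_all add: is_family_def)
  let ?V = "\<lambda>dss. map2 (\<lambda>F D. F D) Fs dss"
  have typed: "typed_family (sum_list ns) (lcomp_family ns p Fs)"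
    unfolding typed_family_def
  proof
    fix ds assume "ds \<in> dt (sum_list ns)"
    then obtain dss where dss: "ds = concat dss" "map length dss = ns" "length dss = length ns"
      "\<And>a. a < length ns \<Longrightarrow> dss ! a \<in> dt (ns ! a)" by (rule dt_blocksE) blast
    have "elems M (map nleaves dss) (?V dss)" using lF fam(1) dss(3,4) by (rule elems_values)
    then show "lcomp_family ns p Fs ds \<in> Mt (nleaves ds)"
      using lc_closed[of p "map nleaves dss"] p dss(3)
      by (simp add: dss(1) lcomp_family_concat[OF dss(2)] nleaves_concat)
  qed
  \<comment> \<open>Here \<open>a\<close> is the block that contains the change, and
    \<open>r\<close> counts the leaves of this block to the left of it.\<close>
  have step: "\<exists>a r e' dss. a < length ns \<and> replaces b b' r (dss ! a) e' \<and> length dss = length ns \<and>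
      ds = concat dss \<and> ds' = concat (dss[a := e']) \<and> (\<forall>a<length ns. dss ! a \<in> dt (ns ! a)) \<and>
      s = sum_list (take a (map nleaves dss)) + r \<and>
      lcomp_family ns p Fs ds = lc (map nleaves dss) p (?V dss) \<and>
      lcomp_family ns p Fs ds' = lc ((map nleaves dss)[a := nleaves e']) p ((?V dss)[a := (Fs ! a) e'])"
    if ds: "ds \<in> dt (sum_list ns)" and r: "replaces b b' s ds ds'" for ds ds' b b' s
  proof -
    obtain dss where dss: "ds = concat dss" "map length dss = ns" "length dss = length ns"
      "\<And>a. a < length ns \<Longrightarrow> dss ! a \<in> dt (ns ! a)" using ds by (rule dt_blocksE) blast
    obtain a r' e' where a: "a < length dss" "ds' = concat (dss[a := e'])" "replaces b b' r' (dss ! a) e'"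
        "s = sum_list (take a (map nleaves dss)) + r'"
      using r[unfolded dss(1)] by (rule replaces_concat)
    have "map length (dss[a := e']) = ns"
      using dss(2) replaces_length[OF a(3)] a(1) by (simp add: map_update) (metis list_update_id length_map nth_map)
    then have "lcomp_family ns p Fs ds' = lc ((map nleaves dss)[a := nleaves e']) p ((?V dss)[a := (Fs ! a) e'])"
      using map2_update[of Fs dss a "\<lambda>F D. F D" "Fs ! a" e'] lF dss(3) a(1)
      by (simp add: a(2) lcomp_family_concat map_update)
    then show ?thesis
      using a dss lcomp_family_concat[OF dss(2)] by (intro exI[of _ a] exI[of _ r'] exI[of _ e'] exI[of _ dss]) simp
  qed
  have invariant: "lcomp_family ns p Fs ds = lcomp_family ns p Fs ds'"
    if ds: "ds \<in> dt (sum_list ns)" and r: "replaces b b' s ds ds'" and l: "leaves b = leaves b'"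
      and inv: "\<And>a s ds0 ds0'. a < length ns \<Longrightarrow> ds0 \<in> dt (ns ! a) \<Longrightarrow> replaces b b' s ds0 ds0' \<Longrightarrow> (Fs ! a) ds0 = (Fs ! a) ds0'"
    for ds ds' b b' s
  proof -
    obtain a r' e' dss where a: "a < length ns" "replaces b b' r' (dss ! a) e'" "length dss = length ns"
      "\<forall>a<length ns. dss ! a \<in> dt (ns ! a)"
      "lcomp_family ns p Fs ds = lc (map nleaves dss) p (?V dss)"
      "lcomp_family ns p Fs ds' = lc ((map nleaves dss)[a := nleaves e']) p ((?V dss)[a := (Fs ! a) e'])"
      using step[OF ds r] by blast
    have "nleaves e' = map nleaves dss ! a" using replaces_nleaves(1)[OF a(2)] l a(1,3) by simp
    moreover have "(Fs ! a) e' = ?V dss ! a" using inv[OF a(1) _ a(2)] a lF by simp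
    ultimately show ?thesis using a(5,6) by simp
  qed
  have "unit_invariant (sum_list ns) (lcomp_family ns p Fs)"
    unfolding unit_invariant_def
  proof (intro allI impI)
    fix ds ds' s t d assume ds: "ds \<in> dt (sum_list ns)" and r: "replaces (Node (t, ounit Q) [d]) d s ds ds'"
    show "lcomp_family ns p Fs ds = lcomp_family ns p Fs ds'"
    proof (rule invariant[OF ds r])
      show "(Fs ! a) ds0 = (Fs ! a) ds0'"
        if "a < length ns" "ds0 \<in> dt (ns ! a)" "replaces (Node (t, ounit Q) [d]) d s ds0 ds0'" for a s ds0 ds0'
        using fam(2)[OF that(1), unfolded unit_invariant_def] that by blast
    qed simp
  qed
  moreover have "contraction_invariant (sum_list ns) (lcomp_family ns p Fs)"
    unfolding contraction_invariant_def
  proof (intro allI impI)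
    fix ds ds' s t q q' es es' j assume ds: "ds \<in> dt (sum_list ns)" and j: "j < length es" "es ! j = Node (t, q') es'"
      and r: "replaces (Node (t, q) es)
          (Node (t, ocomp Q (length es) (length es') j q q') (take j es @ es' @ drop (Suc j) es)) s ds ds'"
    show "lcomp_family ns p Fs ds = lcomp_family ns p Fs ds'"
    proof (rule invariant[OF ds r leaves_contract[OF j, symmetric]])
      show "(Fs ! a) ds0 = (Fs ! a) ds0'" if "a < length ns" "ds0 \<in> dt (ns ! a)" "replaces (Node (t, q) es)
          (Node (t, ocomp Q (length es) (length es') j q q') (take j es @ es' @ drop (Suc j) es)) s ds0 ds0'" for a s ds0 ds0'
        using fam(4)[OF that(1), unfolded contraction_invariant_def] that j by blast
    qed
  qed
  moreover have "symmetric_family (sum_list ns) (lcomp_family ns p Fs)"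
    unfolding symmetric_family_def
  proof (intro allI impI)
    fix ds ds' s t q es \<pi> assume ds: "ds \<in> dt (sum_list ns)" and \<pi>: "\<pi> permutes {..<length es}"
      and r: "replaces (Node (t, q) es) (Node (t, oact Q (length es) \<pi> q) (permute_list \<pi> es)) s ds ds'"
    let ?b = "Node (t, q) es" and ?b' = "Node (t, oact Q (length es) \<pi> q) (permute_list \<pi> es)"
    obtain a r' e' dss where a: "a < length ns" "replaces ?b ?b' r' (dss ! a) e'" "length dss = length ns"
      "ds = concat dss" "\<forall>a<length ns. dss ! a \<in> dt (ns ! a)" "s = sum_list (take a (map nleaves dss)) + r'"
      "lcomp_family ns p Fs ds = lc (map nleaves dss) p (?V dss)"
      "lcomp_family ns p Fs ds' = lc ((map nleaves dss)[a := nleaves e']) p ((?V dss)[a := (Fs ! a) e'])"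
      using step[OF ds r] by blast
    let ?N = "map nleaves dss" and ?\<rho> = "shift_perm r' (block_perm \<pi> (map leaves es))"
    have Na: "nleaves e' = ?N ! a"
      using replaces_nleaves(1)[OF a(2)] a(1,3) \<pi> by (simp add: nleaves_permute_list)
    have \<rho>: "?\<rho> permutes {..<?N ! a}"
      using block_perm_leaves[OF \<pi>] replaces_nleaves(2)[OF a(2)] a(1,3)
      by (intro shift_perm_permutes) auto
    have el: "elems M ?N (?V dss)" using lF fam(1) a(3) a(5)[rule_format] by (rule elems_values)
    have Fa: "(Fs ! a) e' = mact M (?N ! a) ?\<rho> (?V dss ! a)"
      using fam(3)[OF a(1), unfolded symmetric_family_def, rule_format, OF a(5)[rule_format, OF a(1)] \<pi> a(2)] a(1,3) lF
      by simp
    have "lcomp_family ns p Fs ds' = lc ?N p ((?V dss)[a := mact M (?N ! a) ?\<rho> (?V dss ! a)])"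
      by (simp only: a(8) Na Fa list_update_id)
    also have "\<dots> = mact M (sum_list ?N) (shift_perm (sum_list (take a ?N)) ?\<rho>) (lc ?N p (?V dss))"
      using p a(1,3) \<rho> by (intro lc_act el) simp_all
    also have "sum_list ?N = nleaves ds" by (simp add: a(4) nleaves_concat)
    finally show "lcomp_family ns p Fs ds'
        = mact M (nleaves ds) (shift_perm s (block_perm \<pi> (map leaves es))) (lcomp_family ns p Fs ds)"
      by (simp only: a(6,7) shift_perm_shift_perm)
  qed
  moreover have "top_compatible (sum_list ns) (lcomp_family ns p Fs)"
    unfolding top_compatible_def
  proof (intro allI impI)
    fix ds ds' s b assume ds: "ds \<in> dt (sum_list ns)" and b: "\<forall>a\<in>set_ptree b. fst a = 1" "b \<noteq> Leaf"
      and r: "replaces b Leaf s ds ds'"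
    obtain a r' e' dss where a: "a < length ns" "replaces b Leaf r' (dss ! a) e'" "length dss = length ns"
      "ds = concat dss" "ds' = concat (dss[a := e'])" "\<forall>a<length ns. dss ! a \<in> dt (ns ! a)"
      "s = sum_list (take a (map nleaves dss)) + r'"
      "lcomp_family ns p Fs ds = lc (map nleaves dss) p (?V dss)"
      "lcomp_family ns p Fs ds' = lc ((map nleaves dss)[a := nleaves e']) p ((?V dss)[a := (Fs ! a) e'])"
      using step[OF ds r] by blast
    let ?N = "map nleaves dss" and ?l = "leaves b" and ?q = "ocomposite Q b"
    let ?N1 = "?N[a := nleaves e']" and ?V1 = "(?V dss)[a := (Fs ! a) e']"
    have da: "dss ! a \<in> dt (ns ! a)" using a(1,6) by blast
    have e': "e' \<in> dt (ns ! a)" by (rule dtrees_replaces[OF da a(2)]) simp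
    have q: "?q \<in> Qt ?l"
      using replaces_wf_branch[OF a(2), of Q 0] da ocomposite_closed unfolding dtrees_iff by blast
    have rl: "nleaves e' + ?l = nleaves (dss ! a) + 1" "r' + ?l \<le> nleaves (dss ! a)"
      using replaces_nleaves[OF a(2)] by simp_all
    have el: "elems M ?N (?V dss)" using lF fam(1) a(3) a(6)[rule_format] by (rule elems_values)
    have el1: "elems M ?N1 ?V1"
      using el fam(1)[OF a(1)] e' lF a(1,3) by (auto simp: elems_iff nth_list_update typed_family_def)
    have Fa: "?V dss ! a = circ (nleaves e') ?l r' ((Fs ! a) e') ?q"
      using fam(5)[OF a(1), unfolded top_compatible_def, rule_format, OF da _ b(2) a(2)] b(1) a(1,3) lF by simp
    have aN: "a < length ?N1" "a < length (?V dss)" using a(1,3) lF by simp_all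
    have "circ (sum_list ?N1) ?l (sum_list (take a ?N1) + r') (lc ?N1 p ?V1) ?q
        = lc (?N1[a := ?N1 ! a + ?l - 1]) p (?V1[a := circ (?N1 ! a) ?l r' (?V1 ! a) ?q])"
      using p a(1,3) rl q by (intro circ_lc el1) simp_all
    also have "?N1[a := ?N1 ! a + ?l - 1] = ?N"
    proof -
      have "?N1 ! a + ?l - 1 = ?N ! a" using rl a(1,3) by simp
      then show ?thesis by (metis list_update_id list_update_overwrite)
    qed
    also have "?V1[a := circ (?N1 ! a) ?l r' (?V1 ! a) ?q] = ?V dss"
    proof -
      have "?V1[a := circ (?N1 ! a) ?l r' (?V1 ! a) ?q] = (?V dss)[a := ?V dss ! a]"
        unfolding Fa using aN by simp
      then show ?thesis by simp
    qed
    finally have "lc ?N p (?V dss) = circ (sum_list ?N1) ?l (sum_list (take a ?N1) + r') (lc ?N1 p ?V1) ?q" by simp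
    moreover have "nleaves ds' = sum_list ?N1" by (simp add: a(5) nleaves_concat map_update)
    moreover have "take a ?N1 = take a ?N" by simp
    ultimately show "lcomp_family ns p Fs ds = circ (nleaves ds') ?l s (lcomp_family ns p Fs ds') ?q"
      by (simp only: a(7,8,9))
  qed
  ultimately show ?thesis using typed by (simp add: is_family_def)
qed

text \<open>The leaf counts \<open>N\<close> of the blocks are constant along a plot, so the values
  on the blocks form a test map into one fixed k-product, on which the left operation of
  \<open>M\<close> is continuous.\<close>

lemma continuous_family_lcomp:
  assumes p: "continuous_map K (ospace P (length ns)) p"
    and H: "\<And>a. a < length ns \<Longrightarrow> continuous_family K (ns ! a) (H a)"
  shows "continuous_family K (sum_list ns) (\<lambda>z. lcomp_family ns (p z) (map (\<lambda>a. H a z) [0..<length ns]))"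
proof (rule continuous_familyI)
  fix L :: "'k topology" and \<alpha> es z0
  assume L: "test_space L" and \<alpha>: "continuous_map L K \<alpha>" and es: "\<forall>e\<in>set es. plot_branch Q L e"
     and d: "\<forall>z\<in>topspace L. map (\<lambda>e. e z) es \<in> dt (sum_list ns)" and len: "length es = sum_list ns"
  obtain ess where ess: "concat ess = es" "map length ess = ns" using exists_blocks[of es ns] len by metis
  have le: "length ess = length ns" using arg_cong[OF ess(2), of length] by simp
  let ?D = "\<lambda>z. map (map (\<lambda>e. e z)) ess"
  have cD: "concat (?D z) = map (\<lambda>e. e z) es" "map length (?D z) = ns" for z
    using ess by (auto simp: map_concat o_def)
  have plots: "\<forall>e\<in>set (ess ! a). plot_branch Q L e" if "a < length ns" for a
    using es that le unfolding ess(1)[symmetric] by (metis (no_types, lifting) UN_I nth_mem set_concat)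
  have dD: "?D z ! a \<in> dt (ns ! a)" if "z \<in> topspace L" "a < length ns" for z a
  proof -
    have "map (\<lambda>e. e z) es \<in> dt (sum_list ns)" using d that(1) by blast
    moreover have "ess ! a \<in> set ess" using that le by simp
    then have "set (ess ! a) \<subseteq> set es" unfolding ess(1)[symmetric] set_concat by blast
    then have "set (?D z ! a) \<subseteq> set (map (\<lambda>e. e z) es)" using that le by auto
    moreover have "length (?D z ! a) = ns ! a" using arg_cong[OF cD(2)[of z], of "\<lambda>l. l ! a"] that le by simp
    ultimately show ?thesis unfolding dtrees_iff by blast
  qed
  define N where "N = map nleaves (?D z0)"
  have lN: "length N = length ns" using le by (simp add: N_def)
  have N: "map nleaves (?D z) = N" for z
  proof -
    have "nleaves (map (\<lambda>e. e z) (ess ! a)) = nleaves (map (\<lambda>e. e z0) (ess ! a))" if "a < length ns" for a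
      by (rule plots_nleaves[OF plots[OF that]])
    then show ?thesis unfolding N_def using le by (intro nth_equalityI) simp_all
  qed
  have "continuous_map L (mspace M (N ! a)) (\<lambda>z. H a (\<alpha> z) (?D z ! a))" if a: "a < length ns" for a
    using continuous_familyD[OF H[OF a] L \<alpha> plots[OF a], of z0] dD a le by (simp add: N_def)
  then have "continuous_map L (kproduct k (\<lambda>a. mspace M (N ! a)) {..<length N})
      (\<lambda>z. \<lambda>a\<in>{..<length N}. H a (\<alpha> z) (?D z ! a))"
    unfolding continuous_map_kproduct[OF L] lN by auto
  moreover have "continuous_map L (ospace P (length N)) (p \<circ> \<alpha>)"
    using continuous_map_compose[OF \<alpha> p] by (simp add: lN)
  ultimately have "continuous_map L (kprod k (ospace P (length N)) (kproduct k (\<lambda>a. mspace M (N ! a)) {..<length N}))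
      (\<lambda>z. ((p \<circ> \<alpha>) z, \<lambda>a\<in>{..<length N}. H a (\<alpha> z) (?D z ! a)))"
    unfolding continuous_map_kprod[OF L] by (simp add: o_def)
  from continuous_map_compose[OF this continuous_lc]
  have c: "continuous_map L (mspace M (sum_list N))
      (\<lambda>z. lc N (p (\<alpha> z)) (map (\<lambda>a\<in>{..<length N}. H a (\<alpha> z) (?D z ! a)) [0..<length N]))"
    by (simp add: o_def)
  have "lcomp_family ns (p (\<alpha> z)) (map (\<lambda>a. H a (\<alpha> z)) [0..<length ns]) (map (\<lambda>e. e z) es)
      = lc N (p (\<alpha> z)) (map (\<lambda>a\<in>{..<length N}. H a (\<alpha> z) (?D z ! a)) [0..<length N])" for z
  proof -
    have "map2 (\<lambda>F D. F D) (map (\<lambda>a. H a (\<alpha> z)) [0..<length ns]) (?D z)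
        = map (\<lambda>a\<in>{..<length N}. H a (\<alpha> z) (?D z ! a)) [0..<length N]"
      using le lN by (intro nth_equalityI) simp_all
    then show ?thesis using lcomp_family_concat[OF cD(2)[of z]] by (simp only: cD(1) N)
  qed
  moreover have "nleaves (map (\<lambda>e. e z0) es) = sum_list N"
    using cD(1)[of z0] nleaves_concat[of "?D z0"] by (simp add: N_def)
  ultimately show "continuous_map L (mspace M (nleaves (map (\<lambda>e. e z0) es)))
      (\<lambda>z. lcomp_family ns (p (\<alpha> z)) (map (\<lambda>a. H a (\<alpha> z)) [0..<length ns]) (map (\<lambda>e. e z) es))"
    using c by simp
qed

end

section \<open>Axioms for the left operations on families\<close>

lemma map2_apply: "map2 (\<lambda>F. F) (map f xs) ys = map2 f xs ys"
  by (simp add: zip_map1 case_prod_unfold o_def)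

lemma concat_take_drop: "concat (take i xss @ [concat (take l (drop i xss))] @ drop (i + l) xss) = concat xss"
proof -
  have "xss = take i xss @ take l (drop i xss) @ drop (i + l) xss"
    by (metis add.commute append_take_drop_id drop_drop)
  then have "concat xss = concat (take i xss @ take l (drop i xss) @ drop (i + l) xss)" by simp
  then show ?thesis by simp
qed

lemma sum_list_take_drop:
  fixes ns :: "nat list"
  shows "sum_list (take i ns @ [sum_list (take l (drop i ns))] @ drop (i + l) ns) = sum_list ns"
proof -
  have "ns = take i ns @ take l (drop i ns) @ drop (i + l) ns"
    by (metis add.commute append_take_drop_id drop_drop)
  then have "sum_list ns = sum_list (take i ns @ take l (drop i ns) @ drop (i + l) ns)" by simp
  then show ?thesis by simp
qed

context bimodule_families
begin

abbreviation "elems_Mf \<equiv> elems (Mf k Q M)"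

lemma Mf_lcomp_eq: "Mf_lcomp k Q M ns p fs = make_family k Q (sum_list ns) (lcomp_family ns p (map family_value fs))"
  by (simp add: Mf_lcomp_def lcomp_family_def[abs_def] map2_apply)

lemma elems_MfD:
  assumes "elems_Mf ns fs"
  shows "length fs = length ns" "\<And>a. a < length ns \<Longrightarrow> fs ! a \<in> topspace (Mfs (ns ! a))"
  using assms by (simp_all add: elems_iff)

lemma elems_Mf_values:
  assumes "elems_Mf ns fs" "length dss = length ns" "\<And>a. a < length ns \<Longrightarrow> dss ! a \<in> dt (ns ! a)"
  shows "elems M (map nleaves dss) (map2 family_value fs dss)"
  unfolding elems_iff
proof (intro conjI allI impI)
  fix a assume "a < length (map2 family_value fs dss)"
  then show "map2 family_value fs dss ! a \<in> Mt (map nleaves dss ! a)"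
    using family_value_in[OF elems_MfD(2)[OF assms(1), of a] assms(3)[of a]] assms(2) elems_MfD(1)[OF assms(1)] by simp
qed (use assms(2) elems_MfD(1)[OF assms(1)] in simp)

lemma family_value_Mf_lcomp:
  assumes "concat dss \<in> dt (sum_list ns)" "map length dss = ns"
  shows "family_value (Mf_lcomp k Q M ns p fs) (concat dss) = lc (map nleaves dss) p (map2 family_value fs dss)"
  unfolding Mf_lcomp_eq
  by (simp add: family_value_make_family[OF assms(1)] lcomp_family_concat[OF assms(2)] map2_apply)

lemma continuous_Mf_lcomp:
  "continuous_map (kprod k (ospace P (length ns)) (kproduct k (\<lambda>i. Mfs (ns ! i)) {..<length ns}))
     (Mfs (sum_list ns)) (\<lambda>(p, x). Mf_lcomp k Q M ns p (map x [0..<length ns]))"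
proof -
  let ?X = "kprod k (ospace P (length ns)) (kproduct k (\<lambda>i. Mfs (ns ! i)) {..<length ns})"
  let ?F = "\<lambda>x. lcomp_family ns (fst x) (map (\<lambda>a. family_value (snd x a)) [0..<length ns])"
  have "continuous_map ?X (Mfs (sum_list ns)) (\<lambda>x. make_family k Q (sum_list ns) (?F x))"
  proof (rule continuous_map_into_Mf_space)
    show "is_kspace k ?X" by (simp add: kprod_def is_kspace_kify)
    fix K :: "'k topology" and g assume K: "test_space K" and g: "continuous_map K ?X g"
    have g2: "continuous_map K (Mfs (ns ! a)) (\<lambda>z. snd (g z) a)" if "a < length ns" for a
      using g that by (simp add: continuous_map_kprod[OF K] continuous_map_kproduct[OF K] o_def)
    have g1: "continuous_map K (ospace P (length ns)) (\<lambda>z. fst (g z))"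
      using g by (simp add: continuous_map_kprod[OF K] o_def)
    show "continuous_family K (sum_list ns) (\<lambda>z. ?F (g z))"
      using continuous_family_lcomp[OF g1, of "\<lambda>a z. family_value (snd (g z) a)"]
        continuous_family_Mf_space[OF K g2] by blast
    fix z assume z: "z \<in> topspace K"
    show "is_family (sum_list ns) (?F (g z))"
    proof (rule is_family_lcomp)
      show "fst (g z) \<in> Pt (length ns)" using g1 z by (auto simp: continuous_map_def Pi_iff)
      fix a assume a: "a < length ns"
      then have "snd (g z) a \<in> topspace (Mfs (ns ! a))" using g2[OF a] z by (auto simp: continuous_map_def Pi_iff)
      then show "is_family (ns ! a) (map (\<lambda>a. family_value (snd (g z) a)) [0..<length ns] ! a)"
        using a Mf_space_family(1) by simp
    qed simp
  qed
  then show ?thesis by (simp add: Mf_lcomp_eq case_prod_unfold o_def)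
qed

lemma Mf_lcomp_unit:
  assumes f: "f \<in> topspace (Mfs n)"
  shows "Mf_lcomp k Q M [n] (ounit P) [f] = f"
proof -
  have "Mf_lcomp k Q M [n] (ounit P) [f] = make_family k Q n (family_value f)"
    unfolding Mf_lcomp_eq sum_list.Cons sum_list.Nil add_0_right
  proof (rule make_family_cong)
    fix ds assume ds: "ds \<in> dt n"
    have "lcomp_family [n] (ounit P) (map family_value [f]) (concat [ds]) = lc [nleaves ds] (ounit P) [family_value f ds]"
      using dt_length[OF ds] by (subst lcomp_family_concat) simp_all
    then show "lcomp_family [n] (ounit P) (map family_value [f]) ds = family_value f ds"
      using lc_unit[OF family_value_in[OF f ds]] by simp
  qed
  then show ?thesis using Mf_space_family(2)[OF f] by simp
qed

text \<open>Left operations are computed blockwise at each tree, so this is the axiom of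
  \<open>M\<close> with the leaf counts of the blocks as arities. On the right-hand side the middle
  \<open>l\<close> blocks are joined for the outer operation and split again by the inner
  one.\<close>

lemma Mf_lcomp_assoc:
  assumes p: "p \<in> Pt n" and p': "p' \<in> Pt l" and i: "i < n" and len: "length ns = n + l - 1" and fs: "elems_Mf ns fs"
  shows "Mf_lcomp k Q M ns (ocomp P n l i p p') fs
    = Mf_lcomp k Q M (take i ns @ [sum_list (take l (drop i ns))] @ drop (i + l) ns) p
        (take i fs @ [Mf_lcomp k Q M (take l (drop i ns)) p' (take l (drop i fs))] @ drop (i + l) fs)"
  unfolding Mf_lcomp_eq[of ns] Mf_lcomp_eq[of "take i ns @ _"] sum_list_take_drop
proof (rule make_family_cong)
  note lf = elems_MfD(1)[OF fs]
  fix ds assume ds: "ds \<in> dt (sum_list ns)"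
  then obtain dss where dss: "ds = concat dss" "map length dss = ns" "length dss = length ns"
    "\<And>a. a < length ns \<Longrightarrow> dss ! a \<in> dt (ns ! a)" by (rule dt_blocksE) blast
  let ?N = "map nleaves dss" and ?V = "map2 family_value fs dss"
  let ?dM = "take l (drop i dss)" and ?nM = "take l (drop i ns)"
  let ?dss = "take i dss @ [concat ?dM] @ drop (i + l) dss" and ?ns = "take i ns @ [sum_list ?nM] @ drop (i + l) ns"
  let ?g = "Mf_lcomp k Q M ?nM p' (take l (drop i fs))"
  let ?fs = "take i fs @ [?g] @ drop (i + l) fs"
  have el: "elems M ?N ?V" using fs dss(3,4) by (rule elems_Mf_values)
  have mM: "map length ?dM = ?nM" unfolding dss(2)[symmetric] by (simp add: take_map drop_map)
  have m: "map length ?dss = ?ns" unfolding dss(2)[symmetric] by (simp add: length_concat take_map drop_map)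
  have "set (concat ?dM) \<subseteq> set ds" unfolding dss(1) by (auto dest: in_set_takeD in_set_dropD)
  then have dM: "concat ?dM \<in> dt (sum_list ?nM)"
    using ds mM unfolding dtrees_iff length_concat by auto
  have "lcomp_family ?ns p (map family_value ?fs) ds
      = lc (map nleaves ?dss) p (map2 (\<lambda>F D. F D) (map family_value ?fs) ?dss)"
    using lcomp_family_concat[OF m] by (simp only: concat_take_drop dss(1))
  also have "map nleaves ?dss = take i ?N @ [sum_list (take l (drop i ?N))] @ drop (i + l) ?N"
    by (simp add: nleaves_concat take_map drop_map)
  also have "map2 (\<lambda>F D. F D) (map family_value ?fs) ?dss
      = take i ?V @ [lc (take l (drop i ?N)) p' (take l (drop i ?V))] @ drop (i + l) ?V"
  proof -
    have "family_value ?g (concat ?dM) = lc (take l (drop i ?N)) p' (take l (drop i ?V))"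
      using family_value_Mf_lcomp[OF dM mM] by (simp add: take_map drop_map take_zip drop_zip)
    moreover have "map2 (\<lambda>F D. F D) (map family_value ?fs) ?dss = map2 family_value ?fs ?dss"
      by (rule map2_apply)
    moreover have "length (take i fs) = length (take i dss)" using lf dss(3) by simp
    ultimately show ?thesis by (simp add: take_map drop_map take_zip drop_zip)
  qed
  also have "lc (take i ?N @ [sum_list (take l (drop i ?N))] @ drop (i + l) ?N) p
      (take i ?V @ [lc (take l (drop i ?N)) p' (take l (drop i ?V))] @ drop (i + l) ?V) = lc ?N (ocomp P n l i p p') ?V"
    using lc_assoc[OF p p' i _ el] len dss(3) by simp
  also have "\<dots> = lcomp_family ns (ocomp P n l i p p') (map family_value fs) ds"
    by (simp add: dss(1) lcomp_family_concat[OF dss(2)] map2_apply)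
  finally show "lcomp_family ns (ocomp P n l i p p') (map family_value fs) ds
      = lcomp_family ?ns p (map family_value ?fs) ds" ..
qed

text \<open>Permuting the arguments permutes groups of root edges, and
  \<open>block_perm_block_perm\<close> identifies the induced leaf permutation with the one that the
  axiom of \<open>M\<close> produces.\<close>

lemma Mf_lcomp_permute:
  assumes p: "p \<in> Pt (length ns)" and fs: "elems_Mf ns fs" and \<sigma>: "\<sigma> permutes {..<length ns}"
  shows "Mf_lcomp k Q M (permute_list \<sigma> ns) (oact P (length ns) \<sigma> p) (permute_list \<sigma> fs)
    = Mf_act k Q M (sum_list ns) (block_perm \<sigma> ns) (Mf_lcomp k Q M ns p fs)"
  unfolding Mf_lcomp_eq[of "permute_list \<sigma> ns"] Mf_act_eq sum_list_permute_list[OF \<sigma>]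
proof (rule make_family_cong)
  note lf = elems_MfD(1)[OF fs]
  let ?b = "block_perm \<sigma> ns"
  have pb: "?b permutes {..<sum_list ns}" using \<sigma> by (rule block_perm_permutes)
  fix ds assume "ds \<in> dt (sum_list ns)"
  then obtain ds0 where ds0: "ds0 \<in> dt (sum_list ns)" "length ds0 = sum_list ns" "ds = permute_list ?b ds0"
    using pb by (rule dt_permuteE)
  obtain dss where dss: "ds0 = concat dss" "map length dss = ns" "length dss = length ns"
    "\<And>a. a < length ns \<Longrightarrow> dss ! a \<in> dt (ns ! a)" using ds0(1) by (rule dt_blocksE) blast
  let ?N = "map nleaves dss" and ?V = "map2 family_value fs dss"
  have el: "elems M ?N ?V" using fs dss(3,4) by (rule elems_Mf_values)
  have \<sigma>d: "\<sigma> permutes {..<length dss}" "\<sigma> permutes {..<length fs}" "\<sigma> permutes {..<length ?N}"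
    using \<sigma> dss(3) lf by simp_all
  have ds: "ds = concat (permute_list \<sigma> dss)"
    using permute_list_block_perm[OF \<sigma>d(1) dss(2)] by (simp add: ds0(3) dss(1))
  have m: "map length (permute_list \<sigma> dss) = permute_list \<sigma> ns"
    using permute_list_map[OF \<sigma>d(1), of length] dss(2) by simp
  have "lcomp_family (permute_list \<sigma> ns) (oact P (length ns) \<sigma> p) (map family_value (permute_list \<sigma> fs)) ds
      = lc (map nleaves (permute_list \<sigma> dss)) (oact P (length ns) \<sigma> p)
          (map2 family_value (permute_list \<sigma> fs) (permute_list \<sigma> dss))"
    by (simp add: ds lcomp_family_concat[OF m] map2_apply)
  also have "map nleaves (permute_list \<sigma> dss) = permute_list \<sigma> ?N"
    using permute_list_map[OF \<sigma>d(1), of nleaves] by simp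
  also have "map2 family_value (permute_list \<sigma> fs) (permute_list \<sigma> dss) = permute_list \<sigma> ?V"
    using permute_list_map2[OF \<sigma>d(2), of dss family_value] lf dss(3) by simp
  also have "lc (permute_list \<sigma> ?N) (oact P (length ns) \<sigma> p) (permute_list \<sigma> ?V)
      = mact M (sum_list ?N) (block_perm \<sigma> ?N) (lc ?N p ?V)"
    using lc_permute[OF _ el \<sigma>d(3)] p dss(3) by simp
  also have "block_perm \<sigma> ?N = block_perm ?b (map leaves ds0)"
  proof -
    let ?lss = "map (map leaves) dss"
    have L: "map length ?lss = ns" "concat ?lss = map leaves ds0" "map sum_list ?lss = ?N"
      using dss by (simp_all add: map_concat nleaves_def o_def)
    then show ?thesis using block_perm_block_perm[of \<sigma> ?lss, unfolded L] \<sigma>d(1) by simp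
  qed
  also have "sum_list ?N = nleaves ds0" by (simp add: dss(1) nleaves_concat)
  also have "lc ?N p ?V = family_value (Mf_lcomp k Q M ns p fs) ds0"
    using family_value_Mf_lcomp[OF ds0(1)[unfolded dss(1)] dss(2)] by (simp add: dss(1))
  also have "mact M (nleaves ds0) (block_perm ?b (map leaves ds0)) (family_value (Mf_lcomp k Q M ns p fs) ds0)
      = act_family ?b (family_value (Mf_lcomp k Q M ns p fs)) ds"
    using act_family_permute[of ?b ds0] pb ds0(2) by (simp add: ds0(3))
  finally show "lcomp_family (permute_list \<sigma> ns) (oact P (length ns) \<sigma> p) (map family_value (permute_list \<sigma> fs)) ds
      = act_family ?b (family_value (Mf_lcomp k Q M ns p fs)) ds" .
qed

text \<open>Permuting the root edges of block \<open>i\<close> moves only the leaves above this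
  block; \<open>block_perm_shift_perm\<close> puts the leaf permutation into the form given by the
  axiom of \<open>M\<close>.\<close>

lemma Mf_lcomp_act:
  assumes p: "p \<in> Pt (length ns)" and fs: "elems_Mf ns fs" and i: "i < length ns" and \<tau>: "\<tau> permutes {..<ns ! i}"
  shows "Mf_lcomp k Q M ns p (fs[i := Mf_act k Q M (ns ! i) \<tau> (fs ! i)])
    = Mf_act k Q M (sum_list ns) (shift_perm (sum_list (take i ns)) \<tau>) (Mf_lcomp k Q M ns p fs)"
  unfolding Mf_lcomp_eq[of ns p "fs[i := _]"] Mf_act_eq[of "sum_list ns"]
proof (rule make_family_cong)
  note lf = elems_MfD(1)[OF fs]
  let ?s = "shift_perm (sum_list (take i ns)) \<tau>" and ?f = "Mf_act k Q M (ns ! i) \<tau> (fs ! i)"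
  have ps: "?s permutes {..<sum_list ns}" using \<tau> sum_list_take_Suc_le[OF i] by (rule shift_perm_permutes)
  fix ds assume "ds \<in> dt (sum_list ns)"
  then obtain ds0 where ds0: "ds0 \<in> dt (sum_list ns)" "length ds0 = sum_list ns" "ds = permute_list ?s ds0"
    using ps by (rule dt_permuteE)
  obtain dss where dss: "ds0 = concat dss" "map length dss = ns" "length dss = length ns"
    "\<And>a. a < length ns \<Longrightarrow> dss ! a \<in> dt (ns ! a)" using ds0(1) by (rule dt_blocksE) blast
  let ?N = "map nleaves dss" and ?V = "map2 family_value fs dss"
  let ?D = "permute_list \<tau> (dss ! i)"
  have el: "elems M ?N ?V" using fs dss(3,4) by (rule elems_Mf_values)
  have li: "length (dss ! i) = ns ! i" using dt_length[OF dss(4)[OF i]] .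
  have \<tau>i: "\<tau> permutes {..<length (dss ! i)}" using \<tau> li by simp
  have id: "i < length dss" using i dss(3) by simp
  have ds: "ds = concat (dss[i := ?D])"
    using permute_list_shift_perm_concat[OF id \<tau>i dss(2)] by (simp add: ds0(3) dss(1))
  have m: "map length (dss[i := ?D]) = ns"
    using dss(2) li i by (simp add: map_update)
  have N: "map nleaves (dss[i := ?D]) = ?N"
    using \<tau>i id by (simp add: map_update nleaves_permute_list) (metis list_update_id length_map nth_map)
  let ?\<rho> = "block_perm \<tau> (map leaves (dss ! i))"
  have fD: "family_value ?f ?D = mact M (?N ! i) ?\<rho> (?V ! i)"
  proof -
    have "?D \<in> dt (ns ! i)" using dt_permute[OF dss(4)[OF i] \<tau>] .
    then have "family_value ?f ?D = act_family \<tau> (family_value (fs ! i)) ?D"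
      unfolding Mf_act_eq by (rule family_value_make_family)
    then show ?thesis using act_family_permute[OF \<tau>i] id i lf by simp
  qed
  have "lcomp_family ns p (map family_value (fs[i := ?f])) ds
      = lc (map nleaves (dss[i := ?D])) p (map2 family_value (fs[i := ?f]) (dss[i := ?D]))"
    by (simp add: ds lcomp_family_concat[OF m] map2_apply)
  also have "map2 family_value (fs[i := ?f]) (dss[i := ?D]) = ?V[i := mact M (?N ! i) ?\<rho> (?V ! i)]"
    using map2_update[of fs dss i family_value ?f ?D] lf dss(3) id fD by simp
  also have "lc (map nleaves (dss[i := ?D])) p (?V[i := mact M (?N ! i) ?\<rho> (?V ! i)])
      = mact M (sum_list ?N) (shift_perm (sum_list (take i ?N)) ?\<rho>) (lc ?N p ?V)"
    unfolding N using p id block_perm_leaves[OF \<tau>i] dss(3) by (intro lc_act el) simp_all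
  also have "shift_perm (sum_list (take i ?N)) ?\<rho> = block_perm ?s (map leaves ds0)"
  proof -
    let ?lss = "map (map leaves) dss"
    have L: "map length ?lss = ns" "concat ?lss = map leaves ds0" "map sum_list ?lss = ?N"
      using dss by (simp_all add: map_concat nleaves_def o_def)
    then show ?thesis using block_perm_shift_perm[of i ?lss \<tau>, unfolded L] id \<tau>i by simp
  qed
  also have "sum_list ?N = nleaves ds0" by (simp add: dss(1) nleaves_concat)
  also have "lc ?N p ?V = family_value (Mf_lcomp k Q M ns p fs) ds0"
    using family_value_Mf_lcomp[OF ds0(1)[unfolded dss(1)] dss(2)] by (simp add: dss(1))
  also have "mact M (nleaves ds0) (block_perm ?s (map leaves ds0)) (family_value (Mf_lcomp k Q M ns p fs) ds0)
      = act_family ?s (family_value (Mf_lcomp k Q M ns p fs)) ds"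
    using act_family_permute[of ?s ds0] ps ds0(2) by (simp add: ds0(3))
  finally show "lcomp_family ns p (map family_value (fs[i := ?f])) ds
      = act_family ?s (family_value (Mf_lcomp k Q M ns p fs)) ds" .
qed

text \<open>Grafting at an edge of block \<open>i\<close> happens inside this block and keeps all
  leaf counts, so both sides evaluate the same left operation of \<open>M\<close> on the same
  values.\<close>

lemma Mf_rcomp_lcomp:
  assumes p: "p \<in> Pt (length ns)" and q: "q \<in> Qt m" and fs: "elems_Mf ns fs" and i: "i < length ns" and j: "j < ns ! i"
  shows "Mf_rcomp k Q (sum_list ns) m (sum_list (take i ns) + j) (Mf_lcomp k Q M ns p fs) q
    = Mf_lcomp k Q M (ns[i := ns ! i + m - 1]) p (fs[i := Mf_rcomp k Q (ns ! i) m j (fs ! i) q])"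
proof -
  note lf = elems_MfD(1)[OF fs]
  let ?ns = "ns[i := ns ! i + m - 1]" and ?f = "Mf_rcomp k Q (ns ! i) m j (fs ! i) q" and ?c = "sum_list (take i ns) + j"
  have s: "sum_list ?ns = sum_list ns + m - 1" using sum_list_update_Suc[OF i j] .
  have c: "?c < sum_list ns" using sum_list_take_Suc_le[OF i] j by simp
  show ?thesis
    unfolding Mf_rcomp_eq[of "sum_list ns"] Mf_lcomp_eq[of ?ns] s
  proof (rule make_family_cong)
    fix ds assume ds: "ds \<in> dt (sum_list ns + m - 1)"
    then have "ds \<in> dt (sum_list ?ns)" by (simp only: s)
    then obtain dss where dss: "ds = concat dss" "map length dss = ?ns" "length dss = length ?ns"
      "\<And>a. a < length ?ns \<Longrightarrow> dss ! a \<in> dt (?ns ! a)" by (rule dt_blocksE) blast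
    have id: "i < length dss" using i dss(3) by simp
    have di: "dss ! i \<in> dt (ns ! i + m - 1)" using dss(4)[of i] i by simp
    have "j + m \<le> length (dss ! i)" using dt_length[OF di] j by simp
    then obtain A B C where A: "dss ! i = A @ B @ C" "length A = j" "length B = m" by (rule three_blocks)
    let ?D = "graft j m q (dss ! i)"
    have D: "?D = A @ Node (0, q) B # C" unfolding A(1) by (rule graft_append) (simp_all add: A)
    have lt: "length (concat (take i dss)) = sum_list (take i ns)"
      using length_concat_take[OF dss(2), of i] by simp
    have "ds = (concat (take i dss) @ A) @ B @ C @ concat (drop (Suc i) dss)"
      unfolding dss(1) using concat_nth_split[OF id] A(1) by simp
    then have "graft ?c m q ds = (concat (take i dss) @ A) @ Node (0, q) B # C @ concat (drop (Suc i) dss)"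
      using graft_append[of ?c "concat (take i dss) @ A" m B q "C @ concat (drop (Suc i) dss)"] lt A by simp
    then have g: "graft ?c m q ds = concat (dss[i := ?D])"
      using concat_nth_split[of i "dss[i := ?D]"] id D by simp
    have lD: "length ?D = ns ! i" using length_graft[OF dt_length[OF di] j] .
    have m: "map length (dss[i := ?D]) = ns" using dss(2) lD i by (simp add: map_update)
    have N: "map nleaves (dss[i := ?D]) = map nleaves dss"
      using id by (simp add: map_update nleaves_graft) (metis list_update_id length_map nth_map)
    have gd: "concat (dss[i := ?D]) \<in> dt (sum_list ns)" using graft_in_dtrees[OF ds c q] by (simp only: g)
    have "family_value (Mf_lcomp k Q M ns p fs) (graft ?c m q ds)
        = lc (map nleaves dss) p (map2 family_value fs (dss[i := ?D]))"
      unfolding g using family_value_Mf_lcomp[OF gd m] by (simp only: N)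
    also have "map2 family_value fs (dss[i := ?D]) = (map2 family_value fs dss)[i := family_value (fs ! i) ?D]"
      using map2_update[of fs dss i family_value "fs ! i" ?D] lf dss(3) id by simp
    also have "\<dots> = map2 family_value (fs[i := ?f]) dss"
      using map2_update[of fs dss i family_value ?f "dss ! i"] lf dss(3) id
      by (simp add: family_value_Mf_rcomp[OF di])
    also have "lc (map nleaves dss) p \<dots> = lcomp_family ?ns p (map family_value (fs[i := ?f])) ds"
      unfolding dss(1) lcomp_family_concat[OF dss(2)] map2_apply ..
    finally show "family_value (Mf_lcomp k Q M ns p fs) (graft ?c m q ds)
        = lcomp_family ?ns p (map family_value (fs[i := ?f])) ds" .
  qed
qed

theorem is_bimodule_Mf: "is_bimodule k P Q (Mf k Q M)"
  unfolding is_bimodule_def right_module_axioms_def left_module_axioms_def mspace_Mf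
  by (intro conjI allI ballI impI; (elim conjE)?;
      (rule symmetric_sequence_Mf continuous_Mf_rcomp Mf_rcomp_unit Mf_rcomp_assoc Mf_rcomp_commute Mf_rcomp_act
        continuous_Mf_lcomp Mf_lcomp_unit Mf_lcomp_assoc Mf_lcomp_permute Mf_lcomp_act Mf_rcomp_lcomp; assumption))

end

section \<open>The canonical map\<close>

lemma block_index:
  fixes ns :: "nat list"
  assumes "j < sum_list ns"
  obtains a r where "a < length ns" "r < ns ! a" "j = sum_list (take a ns) + r"
  using assms
proof (induction ns arbitrary: j thesis)
  case (Cons n ns)
  show ?case
  proof (cases "j < n")
    case True
    then show ?thesis using Cons.prems(1)[of 0 j] by simp
  next
    case False
    then have "j - n < sum_list ns" using Cons.prems(2) by simp
    from Cons.IH[OF _ this] obtain a r where "a < length ns" "r < ns ! a" "j - n = sum_list (take a ns) + r" by blast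
    then show ?thesis using Cons.prems(1)[of "Suc a" r] False by simp
  qed
qed simp

lemma concat_block_index:
  assumes "map length zss = ns" "a < length zss" "r < length (zss ! a)" "j = sum_list (take a ns) + r"
  shows "concat zss ! j = zss ! a ! r"
    and "take j (concat zss) = concat (take a zss) @ take r (zss ! a)"
    and "(concat zss)[j := v] = concat (zss[a := (zss ! a)[r := v]])"
proof -
  have l: "length (concat (take a zss)) = sum_list (take a ns)" using assms(1) by (rule length_concat_take)
  show "concat zss ! j = zss ! a ! r" "take j (concat zss) = concat (take a zss) @ take r (zss ! a)"
    using assms(3,4) l by (simp_all add: concat_nth_split[OF assms(2)] nth_append)
  show "(concat zss)[j := v] = concat (zss[a := (zss ! a)[r := v]])"
    using assms(2-4) l concat_nth_split[of a "zss[a := (zss ! a)[r := v]]"]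
    by (simp add: concat_nth_split[OF assms(2)] list_update_append)
qed

lemma split_at_replicate: "split_at ns (replicate (sum_list ns) u) = map (\<lambda>n. replicate n u) ns"
  by (induction ns) (simp_all add: replicate_add)

context bimodule_families
begin

text \<open>The compatibility of left operations with one right composition is extended to
  composites with all inputs filled. Filling input \<open>j\<close> of the whole fills input
  \<open>r\<close> of the block \<open>a\<close> containing it.\<close>

lemma plug_lc:
  assumes p: "p \<in> Pt (length ns)" and xs: "elems M ns xs" and ys: "fits ys" "length ys = sum_list ns"
  shows "plug circ 0 (lc ns p xs) ys
    = lc (map (\<lambda>z. sum_list (map fst z)) (split_at ns ys)) p (map2 (plug circ 0) xs (split_at ns ys))"
  (is "_ = lc (?N (split_at ns ys)) p (?V (split_at ns ys))")
proof (induction ys rule: fill_induct[where u = "ounit Q"])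
  case base
  have lx: "length xs = length ns" "\<And>a. a < length ns \<Longrightarrow> xs ! a \<in> Mt (ns ! a)" using xs by (auto simp: elems_iff)
  let ?R = "map (\<lambda>n. replicate n (1, ounit Q)) ns"
  have "?N ?R = ns" by (intro nth_equalityI) (simp_all add: sum_list_replicate)
  moreover have "?V ?R = xs" using lx by (intro nth_equalityI) (simp_all add: plug_units[of _ 0, simplified])
  moreover have "plug circ 0 (lc ns p xs) (replicate (sum_list ns) (1, ounit Q)) = lc ns p xs"
    using plug_units[of _ 0] lc_closed[OF p xs] by simp
  ultimately show ?case by (simp only: ys(2) split_at_replicate)
next
  case (fill zs j l y)
  have lx: "length xs = length ns" "\<And>a. a < length ns \<Longrightarrow> xs ! a \<in> Mt (ns ! a)" using xs by (auto simp: elems_iff)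
  have f: "fits zs" using fits_filled[OF ys(1) fill(5)] .
  have y: "y \<in> Qt l" using fits_nth[OF ys(1)] fill by blast
  obtain zss where z: "concat zss = zs" "map length zss = ns" using exists_blocks[of zs ns] fill(1) ys(2) by metis
  have lz: "length zss = length ns" "\<And>a. a < length ns \<Longrightarrow> length (zss ! a) = ns ! a"
    using z(2) by auto
  have sz: "split_at ns zs = zss" using split_at_concat[OF z(2)] z(1) by simp
  obtain a r where a: "a < length ns" "r < ns ! a" "j = sum_list (take a ns) + r"
    using block_index[of j ns] fill(2) ys(2) by metis
  have a': "a < length zss" "r < length (zss ! a)" using a lz by simp_all
  note ci = concat_block_index[OF z(2) a' a(3), unfolded z(1)]
  have zr: "zss ! a ! r = (1, ounit Q)" using ci(1) fill(3) by simp
  let ?z = "(zss ! a)[r := (l, y)]"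
  have "map length (zss[a := ?z]) = ns" using z(2) a' by (simp add: map_update) (metis list_update_id length_map nth_map)
  then have sz': "split_at ns (zs[j := (l, y)]) = zss[a := ?z]" using split_at_concat ci(3) by metis
  have fa: "fits (zss ! b)" if "b < length ns" for b
  proof -
    have "zss ! b \<in> set zss" using that lz by simp
    then show ?thesis using f unfolding z(1)[symmetric] fits_def set_concat by blast
  qed
  have el: "elems M (?N zss) (?V zss)"
    unfolding elems_iff
  proof (intro conjI allI impI)
    fix b assume "b < length (?V zss)"
    then show "?V zss ! b \<in> Mt (?N zss ! b)"
      using plug_closed[OF fa, of b "xs ! b" 0] lx lz by simp
  qed (use lx lz in simp)
  define s where "s = sum_list (map fst (take r (zss ! a)))"
  have sN: "s < ?N zss ! a"
    using sum_list_take_Suc_le[of r "map fst (zss ! a)"] a' zr by (simp add: s_def take_map)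
  have S: "sum_list (map fst zs) = sum_list (?N zss)"
    unfolding z(1)[symmetric] by (simp add: map_concat sum_list_concat o_def)
  have T: "sum_list (map fst (take j zs)) = sum_list (take a (?N zss)) + s"
    by (simp add: ci(2) map_concat sum_list_concat o_def s_def take_map)
  have "plug circ 0 (lc ns p xs) (zs[j := (l, y)])
      = circ (sum_list (?N zss)) l (sum_list (take a (?N zss)) + s) (lc (?N zss) p (?V zss)) y"
    using plug_fill[OF f, of "lc ns p xs" 0 j y l] lc_closed[OF p xs] fill(1,2,3,6) ys(2) y by (simp add: S T sz)
  also have "\<dots> = lc ((?N zss)[a := ?N zss ! a + l - 1]) p ((?V zss)[a := circ (?N zss ! a) l s (?V zss ! a) y])"
    using p y el a(1) lz sN by (intro circ_lc) simp_all
  also have "(?N zss)[a := ?N zss ! a + l - 1] = ?N (zss[a := ?z])"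
  proof -
    have "sum_list (map fst ?z) = ?N zss ! a + l - 1"
      using sum_list_update_Suc[of r "map fst (zss ! a)" 0 l] a' zr by (simp add: map_update)
    then show ?thesis by (simp add: map_update)
  qed
  also have "(?V zss)[a := circ (?N zss ! a) l s (?V zss ! a) y] = ?V (zss[a := ?z])"
  proof -
    have "plug circ 0 (xs ! a) ?z = circ (?N zss ! a) l s (?V zss ! a) y"
      using plug_fill[OF fa[OF a(1)], of "xs ! a" 0 r y l] a a' lx lz zr y by (simp add: s_def)
    then show ?thesis using map2_update[of xs zss a "plug circ 0" "xs ! a" ?z] a(1) lx lz by simp
  qed
  finally show ?case by (simp only: sz')
qed

lemma mcomposite_lc:
  assumes p: "p \<in> Pt (length ns)" and xs: "elems M ns xs" and ds: "concat dss \<in> dt (sum_list ns)" "map length dss = ns"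
  shows "mcomposite M Q (lc ns p xs) (concat dss) = lc (map nleaves dss) p (map2 (mcomposite M Q) xs dss)"
proof -
  let ?c = "map (comps Q) dss"
  have c: "concat ?c = comps Q (concat dss)" "map length ?c = ns" using ds(2) by (simp_all add: map_concat o_def)
  have "fits (comps Q (concat dss))" using fits_comps ds(1) unfolding dtrees_iff by blast
  from plug_lc[OF p xs this] have "plug circ 0 (lc ns p xs) (comps Q (concat dss))
      = lc (map (\<lambda>z. sum_list (map fst z)) ?c) p (map2 (plug circ 0) xs ?c)"
    using dt_length[OF ds(1)] split_at_concat[OF c(2)] by (simp add: c(1))
  moreover have "map (\<lambda>z. sum_list (map fst z)) ?c = map nleaves dss"
    by (simp add: nleaves_def o_def)
  moreover have "map2 (plug circ 0) xs ?c = map2 (mcomposite M Q) xs dss"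
    by (simp add: mcomposite_def zip_map2 case_prod_unfold o_def)
  ultimately have "plug circ 0 (lc ns p xs) (comps Q (concat dss))
      = lc (map nleaves dss) p (map2 (mcomposite M Q) xs dss)" by (simp only:)
  then show ?thesis unfolding mcomposite_def[of M Q "lc ns p xs"] .
qed

end

context family_module
begin

text \<open>Composites read only the operad labels, and for these the four conditions express the
  left unit law, equivariance, associativity and the decomposition of a composite along a
  cut.\<close>

lemma is_family_mcomposite:
  assumes x: "x \<in> Mt n"
  shows "is_family n (mcomposite M Q x)"
proof -
  have wf: "wf_tree Q 0 ds" "x \<in> Mt (length ds)" if "ds \<in> dt n" for ds
    using that x by (auto simp: dtrees_iff)
  have "typed_family n (mcomposite M Q x)"
    using mcomposite_closed wf unfolding typed_family_def by blast
  moreover have "unit_invariant n (mcomposite M Q x)"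
    unfolding unit_invariant_def
  proof (intro allI impI)
    fix ds ds' s t d assume ds: "ds \<in> dt n" and r: "replaces (Node (t, ounit Q) [d]) d s ds ds'"
    obtain lo where "wf_branch Q lo (Node (t, ounit Q) [d])" using replaces_wf_branch[OF r wf(1)[OF ds]] by blast
    then have "wf_branch Q lo d" by (rule wf_branch_unit)
    then show "mcomposite M Q x ds = mcomposite M Q x ds'"
      using ocomposite_unit by (intro mcomposite_cong_replaces[OF r]) simp_all
  qed
  moreover have "symmetric_family n (mcomposite M Q x)"
    unfolding symmetric_family_def
  proof (intro allI impI)
    fix ds ds' s t q es \<sigma> assume ds: "ds \<in> dt n" and \<sigma>: "\<sigma> permutes {..<length es}"
      and r: "replaces (Node (t, q) es) (Node (t, oact Q (length es) \<sigma> q) (permute_list \<sigma> es)) s ds ds'"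
    show "mcomposite M Q x ds' = mact M (nleaves ds) (shift_perm s (block_perm \<sigma> (map leaves es))) (mcomposite M Q x ds)"
    proof (rule replaces_ocomposite_act[OF r wf(1)[OF ds] _ _ _ wf(2)[OF ds]])
      show "block_perm \<sigma> (map leaves es) permutes {..<leaves (Node (t, q) es)}"
        using block_perm_leaves[OF \<sigma>] by simp
      show "ocomposite Q (Node (t, oact Q (length es) \<sigma> q) (permute_list \<sigma> es))
          = oact Q (leaves (Node (t, q) es)) (block_perm \<sigma> (map leaves es)) (ocomposite Q (Node (t, q) es))"
        if "wf_branch Q lo (Node (t, q) es)" for lo
        using ocomposite_permute[OF that \<sigma>] by simp
    qed (use \<sigma> in \<open>simp add: nleaves_permute_list\<close>)
  qed
  moreover have "contraction_invariant n (mcomposite M Q x)"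
    unfolding contraction_invariant_def
  proof (intro allI impI)
    fix ds ds' s t q q' es es' j assume ds: "ds \<in> dt n" and j: "j < length es" "es ! j = Node (t, q') es'"
      and r: "replaces (Node (t, q) es)
          (Node (t, ocomp Q (length es) (length es') j q q') (take j es @ es' @ drop (Suc j) es)) s ds ds'"
    obtain lo where "wf_branch Q lo (Node (t, q) es)" using replaces_wf_branch[OF r wf(1)[OF ds]] by blast
    from ocomposite_contract[OF this j] show "mcomposite M Q x ds = mcomposite M Q x ds'"
      by (rule mcomposite_cong_replaces[OF r leaves_contract[OF j, symmetric]])
  qed
  moreover have "top_compatible n (mcomposite M Q x)"
    unfolding top_compatible_def
    using replaces_mcomposite_circ wf by blast
  ultimately show ?thesis by (simp add: is_family_def)
qed

lemma continuous_eta: "continuous_map (mspace M n) (Mfs n) (eta k Q M n)"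
proof -
  have "continuous_map (mspace M n) (Mfs n) (\<lambda>x. make_family k Q n (mcomposite M Q x))"
  proof (rule continuous_map_into_Mf_space[OF kspace])
    fix K :: "'k topology" and g assume K: "test_space K" and g: "continuous_map K (mspace M n) g"
    show "continuous_family K n (\<lambda>z. mcomposite M Q (g z))"
    proof (rule continuous_familyI)
      fix L :: "'k topology" and \<alpha> es z0
      assume L: "test_space L" and \<alpha>: "continuous_map L K \<alpha>" and es: "\<forall>e\<in>set es. plot_branch Q L e" and len: "length es = n"
      have "continuous_map L (mspace M (length es)) (g \<circ> \<alpha>)" using continuous_map_compose[OF \<alpha> g] len by simp
      from continuous_mcomposite[OF L es this, of z0]
      show "continuous_map L (mspace M (nleaves (map (\<lambda>e. e z0) es))) (\<lambda>z. mcomposite M Q (g (\<alpha> z)) (map (\<lambda>e. e z) es))"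
        by simp
    qed
    show "is_family n (mcomposite M Q (g z))" if "z \<in> topspace K" for z
      using is_family_mcomposite g that by (auto simp: continuous_map_def Pi_iff)
  qed
  then show ?thesis by (simp add: eta_def[abs_def])
qed

lemma family_value_eta: "ds \<in> dt n \<Longrightarrow> family_value (eta k Q M n x) ds = mcomposite M Q x ds"
  unfolding eta_def by (rule family_value_make_family)

lemma eta_act:
  assumes x: "x \<in> Mt n" and \<sigma>: "\<sigma> permutes {..<n}"
  shows "eta k Q M n (mact M n \<sigma> x) = Mf_act k Q M n \<sigma> (eta k Q M n x)"
  unfolding Mf_act_eq eta_def[of k Q M n "mact M n \<sigma> x"]
proof (rule make_family_cong)
  fix ds assume "ds \<in> dt n"
  then obtain ds0 where ds0: "ds0 \<in> dt n" "length ds0 = n" "ds = permute_list \<sigma> ds0" using \<sigma> by (rule dt_permuteE)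
  have "wf_tree Q 0 ds0" using ds0(1) by (simp add: dtrees_iff)
  from mcomposite_permute[OF this, of x \<sigma>]
  show "mcomposite M Q (mact M n \<sigma> x) ds = act_family \<sigma> (family_value (eta k Q M n x)) ds"
    using x \<sigma> ds0(2) act_family_permute[of \<sigma> ds0] by (simp add: ds0(3) family_value_eta[OF ds0(1)])
qed

lemma eta_circ:
  assumes x: "x \<in> Mt n" and q: "q \<in> Qt m" and i: "i < n"
  shows "eta k Q M (n + m - 1) (circ n m i x q) = Mf_rcomp k Q n m i (eta k Q M n x) q"
  unfolding Mf_rcomp_eq eta_def[of k Q M "n + m - 1"]
proof (rule make_family_cong)
  fix ds assume ds: "ds \<in> dt (n + m - 1)"
  then have "wf_tree Q 0 ds" by (simp add: dtrees_iff)
  from mcomposite_circ[OF this x q i dt_length[OF ds], of 0]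
  show "mcomposite M Q (circ n m i x q) ds = family_value (eta k Q M n x) (graft i m q ds)"
    unfolding family_value_eta[OF graft_in_dtrees[OF ds i q]] unfolding graft_def .
qed

end

context bimodule_families
begin

lemma eta_lc:
  assumes p: "p \<in> Pt (length ns)" and xs: "elems M ns xs"
  shows "eta k Q M (sum_list ns) (lc ns p xs) = Mf_lcomp k Q M ns p (map2 (eta k Q M) ns xs)"
  unfolding Mf_lcomp_eq eta_def[of k Q M "sum_list ns"]
proof (rule make_family_cong)
  fix ds assume ds: "ds \<in> dt (sum_list ns)"
  then obtain dss where dss: "ds = concat dss" "map length dss = ns" "length dss = length ns"
    "\<And>a. a < length ns \<Longrightarrow> dss ! a \<in> dt (ns ! a)" by (rule dt_blocksE) blast
  have lx: "length xs = length ns" using xs by (simp add: elems_iff)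
  have "map2 family_value (map2 (eta k Q M) ns xs) dss = map2 (mcomposite M Q) xs dss"
    using lx dss(3,4) by (intro nth_equalityI) (simp_all add: family_value_eta)
  then show "mcomposite M Q (lc ns p xs) ds = lcomp_family ns p (map family_value (map2 (eta k Q M) ns xs)) ds"
    unfolding dss(1) lcomp_family_concat[OF dss(2)] map2_apply
    using mcomposite_lc[OF p xs _ dss(2)] ds dss(1) by simp
qed

lemma bimodule_map_eta: "bimodule_map P Q M (Mf k Q M) (eta k Q M)"
  unfolding bimodule_map_def mspace_Mf
  by (intro conjI allI ballI impI; (elim conjE)?; (rule continuous_eta eta_act eta_circ eta_lc; assumption))

end

subsection \<open>The homotopy\<close>

definition raise :: "real \<Rightarrow> (real \<times> 'q) ptree \<Rightarrow> (real \<times> 'q) ptree" where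
  "raise s = map_ptree (\<lambda>a. (max s (fst a), snd a))"

lemma raise_simps [simp]:
  "raise s Leaf = Leaf" "raise s (Node (t, q) es) = Node (max s t, q) (map (raise s) es)"
  by (simp_all add: raise_def)

lemma leaves_map_ptree: "leaves (map_ptree f d) = leaves d"
  by (induction d) (simp_all add: nleaves_def o_def cong: map_cong)

lemma nleaves_map_raise: "nleaves (map (raise s) ds) = nleaves ds"
  by (simp add: nleaves_def o_def raise_def leaves_map_ptree)

lemma ocomposite_raise: "ocomposite Q (raise s d) = ocomposite Q d"
proof (induction d)
  case (Node a es)
  have "comps Q (map (raise s) es) = comps Q es"
    using Node by (simp add: raise_def leaves_map_ptree)
  then show ?case by (cases a) (simp only: raise_simps ocomposite.simps snd_conv)
qed simp

lemma mcomposite_raise: "mcomposite M Q x (map (raise s) ds) = mcomposite M Q x ds"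
proof -
  have "comps Q (map (raise s) ds) = comps Q ds"
    by (simp add: ocomposite_raise) (simp add: raise_def leaves_map_ptree)
  then show ?thesis by (simp only: mcomposite_def)
qed

lemma wf_branch_raise:
  assumes "s \<le> 1"
  shows "wf_branch Q lo d \<Longrightarrow> wf_branch Q (max s lo) (raise s d)"
proof (induction d arbitrary: lo)
  case (Node a es)
  obtain t q where a: "a = (t, q)" by force
  then show ?case using Node assms by auto
qed simp

lemma raise_0: "wf_branch Q lo d \<Longrightarrow> 0 \<le> lo \<Longrightarrow> raise 0 d = d"
proof (induction d arbitrary: lo)
  case (Node a es)
  obtain t q where a: "a = (t, q)" by force
  have "raise 0 e = e" if "e \<in> set es" for e using Node.IH[OF that, of t] Node.prems that a by auto
  then show ?case using Node.prems a by (simp add: map_idI max_def)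
qed simp

lemma raise_1: "wf_branch Q lo d \<Longrightarrow> \<forall>a\<in>set_ptree (raise 1 d). fst a = 1"
proof (induction d arbitrary: lo)
  case (Node a es)
  obtain t q where a: "a = (t, q)" by force
  then show ?case using Node by fastforce
qed simp

lemma replaces_map_raise:
  "replaces b b' s ds ds' \<Longrightarrow> replaces (raise u b) (raise u b') s (map (raise u) ds) (map (raise u) ds')"
proof (induction rule: replaces.induct)
  case (here i ds)
  from replaces.here[of i "map (raise u) ds" "raise u b" "raise u b'"] here show ?case
    by (simp add: map_update take_map nleaves_map_raise)
next
  case (above i ds a es s es')
  obtain t q where a: "a = (t, q)" by force
  from replaces.above[of i "map (raise u) ds" "(max u t, q)" "map (raise u) es" "raise u b" "raise u b'" s "map (raise u) es'"] above a
  show ?case by (simp add: map_update take_map nleaves_map_raise)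
qed

lemma plot_branch_raise:
  assumes "continuous_map K euclideanreal s"
  shows "plot_branch Q K e \<Longrightarrow> plot_branch Q K (\<lambda>z. raise (s z) (e z))"
proof (induction rule: plot_branch.induct)
  case Leaf
  then show ?case by (simp add: plot_branch.Leaf)
next
  case (Node t es q)
  let ?es = "map (\<lambda>e z. raise (s z) (e z)) es"
  have "plot_branch Q K (\<lambda>z. Node (max (s z) (t z), q z) (map (\<lambda>e. e z) ?es))"
    using Node assms by (intro plot_branch.Node continuous_map_real_max) auto
  then show ?case by (simp add: o_def)
qed

context family_module
begin

lemma raise_in_dt:
  assumes "ds \<in> dt n" "s \<le> 1"
  shows "map (raise s) ds \<in> dt n"
proof -
  have "wf_branch Q 0 (raise s d)" if "d \<in> set ds" for d
    using assms that wf_branch_raise[OF assms(2), of Q 0 d] by (auto simp: dtrees_iff intro: wf_branch_mono)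
  then show ?thesis using assms by (simp add: dtrees_iff)
qed

text \<open>Raising commutes with replacing a branch and keeps leaf counts and composites, so each
  condition at \<open>ds\<close> becomes the same condition at the raised tree. The bound on
  \<open>u\<close> keeps numbers equal to 1 in place, as the top condition requires.\<close>

lemma is_family_raise:
  assumes F: "is_family n F" and u: "u \<le> 1"
  shows "is_family n (\<lambda>ds. F (map (raise u) ds))"
proof -
  have fam: "typed_family n F" "unit_invariant n F" "symmetric_family n F" "contraction_invariant n F" "top_compatible n F"
    using F by (simp_all add: is_family_def)
  note g = raise_in_dt[OF _ u]
  have "typed_family n (\<lambda>ds. F (map (raise u) ds))"
    using fam(1) g nleaves_map_raise unfolding typed_family_def by metis
  moreover have "unit_invariant n (\<lambda>ds. F (map (raise u) ds))"
    unfolding unit_invariant_def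
  proof (intro allI impI)
    fix ds ds' s t d assume ds: "ds \<in> dt n" and r: "replaces (Node (t, ounit Q) [d]) d s ds ds'"
    from replaces_map_raise[OF r, of u] show "F (map (raise u) ds) = F (map (raise u) ds')"
      using fam(2)[unfolded unit_invariant_def] g[OF ds] by (simp only: raise_simps list.map)
  qed
  moreover have "symmetric_family n (\<lambda>ds. F (map (raise u) ds))"
    unfolding symmetric_family_def
  proof (intro allI impI)
    fix ds ds' s t q es \<sigma> assume ds: "ds \<in> dt n" and \<sigma>: "\<sigma> permutes {..<length es}"
      and r: "replaces (Node (t, q) es) (Node (t, oact Q (length es) \<sigma> q) (permute_list \<sigma> es)) s ds ds'"
    let ?es = "map (raise u) es"
    have "replaces (Node (max u t, q) ?es) (Node (max u t, oact Q (length ?es) \<sigma> q) (permute_list \<sigma> ?es)) s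
        (map (raise u) ds) (map (raise u) ds')"
      using replaces_map_raise[OF r, of u] \<sigma> by (simp add: permute_list_map)
    from fam(3)[unfolded symmetric_family_def, rule_format, OF g[OF ds] _ this] \<sigma>
    have "F (map (raise u) ds') = mact M (nleaves ds) (shift_perm s (block_perm \<sigma> (map leaves ?es))) (F (map (raise u) ds))"
      by (simp add: nleaves_map_raise)
    moreover have "map leaves ?es = map leaves es" by (simp add: raise_def leaves_map_ptree)
    ultimately show "F (map (raise u) ds') = mact M (nleaves ds) (shift_perm s (block_perm \<sigma> (map leaves es))) (F (map (raise u) ds))"
      by (simp only:)
  qed
  moreover have "contraction_invariant n (\<lambda>ds. F (map (raise u) ds))"
    unfolding contraction_invariant_def
  proof (intro allI impI)
    fix ds ds' s t q q' es es' j assume ds: "ds \<in> dt n" and j: "j < length es" "es ! j = Node (t, q') es'"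
      and r: "replaces (Node (t, q) es)
          (Node (t, ocomp Q (length es) (length es') j q q') (take j es @ es' @ drop (Suc j) es)) s ds ds'"
    let ?es = "map (raise u) es" and ?es' = "map (raise u) es'"
    have "replaces (Node (max u t, q) ?es)
        (Node (max u t, ocomp Q (length ?es) (length ?es') j q q') (take j ?es @ ?es' @ drop (Suc j) ?es)) s
        (map (raise u) ds) (map (raise u) ds')"
      using replaces_map_raise[OF r, of u] by (simp add: take_map drop_map)
    moreover have "j < length ?es" "?es ! j = Node (max u t, q') ?es'" using j by simp_all
    ultimately show "F (map (raise u) ds) = F (map (raise u) ds')"
      using fam(4)[unfolded contraction_invariant_def] g[OF ds] by blast
  qed
  moreover have "top_compatible n (\<lambda>ds. F (map (raise u) ds))"
    unfolding top_compatible_def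
  proof (intro allI impI)
    fix ds ds' s b assume ds: "ds \<in> dt n" and b: "\<forall>a\<in>set_ptree b. fst a = 1" "b \<noteq> Leaf" and r: "replaces b Leaf s ds ds'"
    have "\<forall>a\<in>set_ptree (raise u b). fst a = 1" using b(1) u by (auto simp: raise_def ptree.set_map)
    moreover have "raise u b \<noteq> Leaf" using b(2) by (cases b) (auto simp: raise_def)
    moreover have "replaces (raise u b) Leaf s (map (raise u) ds) (map (raise u) ds')"
      using replaces_map_raise[OF r, of u] by simp
    ultimately have "F (map (raise u) ds) = circ (nleaves (map (raise u) ds')) (leaves (raise u b)) s
        (F (map (raise u) ds')) (ocomposite Q (raise u b))"
      using fam(5)[unfolded top_compatible_def] g[OF ds] by blast
    then show "F (map (raise u) ds) = circ (nleaves ds') (leaves b) s (F (map (raise u) ds')) (ocomposite Q b)"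
      by (simp only: nleaves_map_raise ocomposite_raise) (simp only: raise_def leaves_map_ptree)
  qed
  ultimately show ?thesis by (simp add: is_family_def)
qed

lemma continuous_family_raise:
  assumes F: "continuous_family K n F" and u: "continuous_map K (top_of_set {0..1}) u"
  shows "continuous_family K n (\<lambda>z ds. F z (map (raise (u z)) ds))"
proof (rule continuous_familyI)
  fix L :: "'k topology" and \<alpha> es z0
  assume L: "test_space L" and \<alpha>: "continuous_map L K \<alpha>" and es: "\<forall>e\<in>set es. plot_branch Q L e"
     and d: "\<forall>z\<in>topspace L. map (\<lambda>e. e z) es \<in> dt n"
  have u': "continuous_map L (top_of_set {0..1}) (u \<circ> \<alpha>)" using continuous_map_compose[OF \<alpha> u] .
  then have uL: "continuous_map L euclideanreal (u \<circ> \<alpha>)" "\<And>z. z \<in> topspace L \<Longrightarrow> u (\<alpha> z) \<le> 1"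
    by (auto simp: continuous_map_in_subtopology)
  let ?es = "map (\<lambda>e z. raise ((u \<circ> \<alpha>) z) (e z)) es"
  have es': "\<forall>e\<in>set ?es. plot_branch Q L e" using es plot_branch_raise[OF uL(1)] by auto
  have m: "map (\<lambda>e. e z) ?es = map (raise (u (\<alpha> z))) (map (\<lambda>e. e z) es)" for z by simp
  have d': "\<forall>z\<in>topspace L. map (\<lambda>e. e z) ?es \<in> dt n"
    unfolding m using d uL(2) raise_in_dt by blast
  show "continuous_map L (mspace M (nleaves (map (\<lambda>e. e z0) es))) (\<lambda>z. F (\<alpha> z) (map (raise (u (\<alpha> z))) (map (\<lambda>e. e z) es)))"
    using continuous_familyD[OF F L \<alpha> es' d', of z0] unfolding m nleaves_map_raise .
qed

definition corolla_value :: "nat \<Rightarrow> ('q, 'm) family \<Rightarrow> 'm" where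
  "corolla_value n f = family_value f (replicate n Leaf)"

definition raise_family :: "nat \<Rightarrow> real \<Rightarrow> ('q, 'm) family \<Rightarrow> ('q, 'm) family" where
  "raise_family n u f = make_family k Q n (\<lambda>ds. family_value f (map (raise u) ds))"

lemma corolla_in_dt: "replicate n Leaf \<in> dt n"
  by (simp add: dtrees_iff)

lemma nleaves_replicate_Leaf: "nleaves (replicate n Leaf) = n"
  by (induction n) simp_all

lemma mcomposite_corolla: "x \<in> Mt n \<Longrightarrow> mcomposite M Q x (replicate n Leaf) = x"
  using plug_units[of x 0 n] by (simp add: mcomposite_def)

lemma corolla_value_eta: "x \<in> Mt n \<Longrightarrow> corolla_value n (eta k Q M n x) = x"
  by (simp add: corolla_value_def family_value_eta corolla_in_dt mcomposite_corolla)

lemma continuous_corolla_value: "continuous_map (Mfs n) (mspace M n) (corolla_value n)"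
proof (rule continuous_map_from_kspace[OF is_kspace_Mf_space])
  fix K :: "'k topology" and g assume K: "test_space K" and g: "continuous_map K (Mfs n) g"
  let ?es = "replicate n (\<lambda>_ :: 'k. Leaf :: (real \<times> 'q) ptree)"
  have "\<forall>e\<in>set ?es. plot_branch Q K e" by (auto intro: plot_branch.Leaf)
  from continuous_familyD[OF continuous_family_Mf_space[OF K g] K continuous_map_id[unfolded id_def] this]
  show "continuous_map K (mspace M n) (corolla_value n \<circ> g)"
    by (simp add: corolla_in_dt nleaves_replicate_Leaf corolla_value_def o_def)
qed

text \<open>The top condition moves the branches into the module one root edge at a time.\<close>

lemma family_all_ones:
  assumes F: "is_family n F" and ds: "ds \<in> dt n" and ones: "\<forall>d\<in>set ds. \<forall>a\<in>set_ptree d. fst a = 1"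
  shows "F ds = mcomposite M Q (F (replicate n Leaf)) ds"
proof -
  have len: "length ds = n" using dt_length[OF ds] .
  let ?x = "F (replicate n Leaf)"
  have x: "?x \<in> Mt n"
    using F corolla_in_dt[of n] by (auto simp: is_family_def typed_family_def nleaves_replicate_Leaf)
  have "F (take j ds @ replicate (n - j) Leaf) = mcomposite M Q ?x (take j ds @ replicate (n - j) Leaf)"
    if "j \<le> n" for j
    using that
  proof (induction j)
    case 0
    then show ?case by (simp add: mcomposite_corolla[OF x])
  next
    case (Suc j)
    let ?d0 = "take j ds @ replicate (n - j) Leaf" and ?d1 = "take (Suc j) ds @ replicate (n - Suc j) Leaf"
    have j: "j < n" using Suc.prems by simp
    have nj: "n - j = Suc (n - Suc j)" using j by simp
    have d1: "?d1 \<in> dt n" using ds len j by (auto simp: dtrees_iff dest: in_set_takeD)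
    have dj: "?d1 ! j = ds ! j" using j len by (simp add: nth_append)
    have up: "?d1[j := Leaf] = ?d0"
      using j len nj by (simp add: take_Suc_conv_app_nth list_update_append)
    have r: "replaces (ds ! j) Leaf (nleaves (take j ?d1)) ?d1 ?d0"
      using replaces.here[of j ?d1 "ds ! j" Leaf] dj j len up by simp
    show ?case
    \<comment> \<open>A root edge that is itself a leaf leaves the tree unchanged; the top condition
      concerns the other case.\<close>
    proof (cases "ds ! j = Leaf")
      case True
      then have "?d1 = ?d0" using up dj by (metis list_update_id)
      then show ?thesis using Suc by simp
    next
      case False
      have o: "\<forall>a\<in>set_ptree (ds ! j). fst a = 1" using ones nth_mem[of j ds] j unfolding len by blast
      have "F ?d1 = circ (nleaves ?d0) (leaves (ds ! j)) (nleaves (take j ?d1)) (F ?d0) (ocomposite Q (ds ! j))"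
        using F d1 o False r unfolding is_family_def top_compatible_def by blast
      also have "\<dots> = mcomposite M Q ?x ?d1"
        using replaces_mcomposite_circ[OF r, of 0 ?x] d1 x Suc by (simp add: dtrees_iff)
      finally show ?thesis .
    qed
  qed
  from this[of n] show ?thesis using len by simp
qed

lemma raise_family_0: "f \<in> topspace (Mfs n) \<Longrightarrow> raise_family n 0 f = f"
proof -
  assume f: "f \<in> topspace (Mfs n)"
  have "raise_family n 0 f = make_family k Q n (family_value f)"
    unfolding raise_family_def
  proof (rule make_family_cong)
    fix ds assume "ds \<in> dt n"
    then have "map (raise 0) ds = ds" using raise_0[of Q 0] by (auto simp: dtrees_iff intro: map_idI)
    then show "family_value f (map (raise 0) ds) = family_value f ds" by simp
  qed
  then show ?thesis using Mf_space_family(2)[OF f] by simp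
qed

lemma raise_family_1: "f \<in> topspace (Mfs n) \<Longrightarrow> raise_family n 1 f = eta k Q M n (corolla_value n f)"
  unfolding raise_family_def eta_def corolla_value_def
proof (rule make_family_cong)
  fix ds assume f: "f \<in> topspace (Mfs n)" and ds: "ds \<in> dt n"
  have "\<forall>d\<in>set (map (raise 1) ds). \<forall>a\<in>set_ptree d. fst a = 1"
    using ds raise_1[of Q 0] by (auto simp: dtrees_iff)
  from family_all_ones[OF Mf_space_family(1)[OF f] raise_in_dt[OF ds] this]
  show "family_value f (map (raise 1) ds) = mcomposite M Q (family_value f (replicate n Leaf)) ds"
    by (simp add: mcomposite_raise)
qed

lemma raise_family_eta:
  assumes "u \<le> 1"
  shows "raise_family n u (eta k Q M n x) = eta k Q M n x"
  unfolding raise_family_def eta_def[of k Q M n x, symmetric]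
proof -
  have "make_family k Q n (\<lambda>ds. family_value (eta k Q M n x) (map (raise u) ds)) = make_family k Q n (mcomposite M Q x)"
    by (rule make_family_cong) (simp add: family_value_eta raise_in_dt assms mcomposite_raise)
  then show "make_family k Q n (\<lambda>ds. family_value (eta k Q M n x) (map (raise u) ds)) = eta k Q M n x"
    by (simp add: eta_def)
qed

lemma continuous_raise_family:
  assumes K: "test_space (K :: 'k topology)" and u: "continuous_map K (top_of_set {0..1}) u"
    and g: "continuous_map K (Mfs n) g"
  shows "continuous_map K (Mfs n) (\<lambda>z. raise_family n (u z) (g z))"
  unfolding raise_family_def
proof (rule continuous_map_make_family[OF K])
  show "continuous_family K n (\<lambda>z ds. family_value (g z) (map (raise (u z)) ds))"
    by (rule continuous_family_raise[OF continuous_family_Mf_space[OF K g] u])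
  fix z assume z: "z \<in> topspace K"
  have "g z \<in> topspace (Mfs n)" "u z \<le> 1"
    using z g u by (auto simp: continuous_map_def Pi_iff)
  then show "is_family n (\<lambda>ds. family_value (g z) (map (raise (u z)) ds))"
    using is_family_raise[OF Mf_space_family(1)] by blast
qed

end

subsection \<open>Weak equivalence from a deformation\<close>

lemma path_component_of_map:
  assumes "continuous_map X Y \<phi>" "path_component_of X x x'"
  shows "path_component_of Y (\<phi> x) (\<phi> x')"
  using assms unfolding path_component_of_def pathin_def
  by (metis comp_apply continuous_map_compose)

lemma path_component_of_set_eq_iff:
  "x \<in> topspace X \<Longrightarrow> path_component_of_set X x = path_component_of_set X x' \<longleftrightarrow> path_component_of X x x'"
  by (metis mem_Collect_eq path_component_of_equiv path_component_of_refl)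

lemma nloop_class_eq:
  assumes f: "f \<in> nloops n X x"
    and fg: "homotopic_with (\<lambda>h. \<forall>u\<in>cube_bd n. h u = x) (cube n) X f g"
  shows "nloop_class n X x f = nloop_class n X x g"
  using fg unfolding nloop_class_def by (blast intro: homotopic_with_trans homotopic_with_symD)

lemma nloop_class_self: "f \<in> nloops n X x \<Longrightarrow> f \<in> nloop_class n X x f"
  by (simp add: nloop_class_def nloops_def)

lemma homotopic_with_boundary_cong:
  assumes "homotopic_with (\<lambda>h. \<forall>u\<in>cube_bd n. h u = x) (cube n) X f g"
    and "\<And>u. u \<in> topspace (cube n) \<Longrightarrow> f' u = f u" "\<And>u. u \<in> topspace (cube n) \<Longrightarrow> g' u = g u"
  shows "homotopic_with (\<lambda>h. \<forall>u\<in>cube_bd n. h u = x) (cube n) X f' g'"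
  by (rule homotopic_with_eq[OF assms]) (auto simp: cube_bd_def)

lemma nloop_compose: "f \<in> nloops n X x \<Longrightarrow> continuous_map X Y \<phi> \<Longrightarrow> \<phi> \<circ> f \<in> nloops n Y (\<phi> x)"
  by (auto simp: nloops_def intro: continuous_map_compose)

lemma nloop_class_compose:
  assumes "f \<in> nloops n X x" "g \<in> nloop_class n X x f" "continuous_map X Y \<phi>"
  shows "nloop_class n Y (\<phi> x) (\<phi> \<circ> g) = nloop_class n Y (\<phi> x) (\<phi> \<circ> f)"
proof (rule sym, rule nloop_class_eq[OF nloop_compose[OF assms(1,3)]])
  have "homotopic_with (\<lambda>h. \<forall>u\<in>cube_bd n. h u = x) (cube n) X f g"
    using assms(2) by (simp add: nloop_class_def)
  then show "homotopic_with (\<lambda>h. \<forall>u\<in>cube_bd n. h u = \<phi> x) (cube n) Y (\<phi> \<circ> f) (\<phi> \<circ> g)"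
    by (rule homotopic_with_compose_continuous_map_left[OF _ assms(3)]) simp
qed

text \<open>The induced map on homotopy groups is written as a union over representatives; all its
  members coincide, so it is the class of any one composite.\<close>

lemma Union_nloop_class_compose:
  assumes "f \<in> nloops n X x" "continuous_map X Y \<phi>"
  shows "(\<Union>g\<in>nloop_class n X x f. nloop_class n Y (\<phi> x) (\<phi> \<circ> g)) = nloop_class n Y (\<phi> x) (\<phi> \<circ> f)"
  using nloop_class_compose[OF assms(1) _ assms(2)] nloop_class_self[OF assms(1)] by blast

text \<open>The deformation is assumed continuous on test maps, which suffices because paths and
  homotopies of loops live on the interval and on cylinders over cubes. Injectivity comes from the
  retraction \<psi>. For surjectivity a loop \<open>g\<close> is deformed to
  \<open>\<phi> \<circ> (\<psi> \<circ> g)\<close>; the boundary of the cube goes to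
  \<open>\<phi> x\<close>, where the deformation is stationary, so the base point is kept.\<close>

lemma weak_homotopy_equivalence_deformation:
  fixes e :: "real \<Rightarrow> 'k" and H :: "real \<Rightarrow> 'b \<Rightarrow> 'b"
  assumes e: "inj e" and \<phi>: "continuous_map X Y \<phi>" and \<psi>: "continuous_map Y X \<psi>"
    and \<psi>\<phi>: "\<And>x. x \<in> topspace X \<Longrightarrow> \<psi> (\<phi> x) = x"
    and H: "\<And>(K :: 'k topology) a g. test_space K \<Longrightarrow> continuous_map K (top_of_set {0..1}) a \<Longrightarrow>
      continuous_map K Y g \<Longrightarrow> continuous_map K Y (\<lambda>z. H (a z) (g z))"
    and H0: "\<And>y. y \<in> topspace Y \<Longrightarrow> H 0 y = y"
    and H1: "\<And>y. y \<in> topspace Y \<Longrightarrow> H 1 y = \<phi> (\<psi> y)"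
    and H\<phi>: "\<And>s x. 0 \<le> s \<Longrightarrow> s \<le> 1 \<Longrightarrow> x \<in> topspace X \<Longrightarrow> H s (\<phi> x) = \<phi> x"
  shows "weak_homotopy_equivalence X Y \<phi>"
proof -
  note ks = is_kspace_cube_homotopy[OF e, where k = "TYPE('k)"]
  have HZ: "continuous_map Z Y (\<lambda>z. H (a z) (g z))"
    if "is_kspace TYPE('k) Z" "continuous_map Z (top_of_set {0..1}) a" "continuous_map Z Y g" for Z :: "'z topology" and a g
  proof (rule continuous_map_from_kspace[OF that(1)])
    fix K :: "'k topology" and h assume h: "test_space K" "continuous_map K Z h"
    show "continuous_map K Y ((\<lambda>z. H (a z) (g z)) \<circ> h)"
      using H[OF h(1) continuous_map_compose[OF h(2) that(2)] continuous_map_compose[OF h(2) that(3)]]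
      by (simp add: o_def)
  qed
  have \<phi>X: "\<phi> x \<in> topspace Y" if "x \<in> topspace X" for x using \<phi> that by (auto simp: continuous_map_def Pi_iff)
  have \<psi>Y: "\<psi> y \<in> topspace X" if "y \<in> topspace Y" for y using \<psi> that by (auto simp: continuous_map_def Pi_iff)
  have pc: "path_component_of Y y (\<phi> (\<psi> y))" if y: "y \<in> topspace Y" for y
    unfolding path_component_of_def
  proof (intro exI conjI)
    have "continuous_map (top_of_set {0..1}) Y (\<lambda>s. H ((\<lambda>s. s) s) ((\<lambda>_. y) s))"
      using y by (intro HZ[OF ks(2)]) simp_all
    then show "pathin Y (\<lambda>s. H s y)" by (simp add: pathin_def)
  qed (simp_all add: H0 H1 y)
  have comp: "(\<Union>x'\<in>path_component_of_set X x. path_component_of_set Y (\<phi> x')) = path_component_of_set Y (\<phi> x)"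
    if x: "x \<in> topspace X" for x
  proof -
    have "path_component_of_set Y (\<phi> x') = path_component_of_set Y (\<phi> x)" if "path_component_of X x x'" for x'
      using path_component_of_map[OF \<phi> that] by (metis path_component_of_equiv)
    moreover have "x \<in> path_component_of_set X x" using x by (simp add: path_component_of_refl)
    ultimately show ?thesis by blast
  qed
  have components: "bij_betw (\<lambda>C. \<Union>x\<in>C. path_component_of_set Y (\<phi> x)) (path_components_of X) (path_components_of Y)"
    unfolding bij_betw_def path_components_of_def
  proof (rule conjI[OF inj_onI subset_antisym])
    fix C C'
    assume "C \<in> path_component_of_set X ` topspace X" "C' \<in> path_component_of_set X ` topspace X"
      and eq: "(\<Union>x\<in>C. path_component_of_set Y (\<phi> x)) = (\<Union>x\<in>C'. path_component_of_set Y (\<phi> x))"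
    then obtain x x' where x: "x \<in> topspace X" "C = path_component_of_set X x"
        "x' \<in> topspace X" "C' = path_component_of_set X x'" by blast
    have "path_component_of_set Y (\<phi> x) = path_component_of_set Y (\<phi> x')" using eq comp x by metis
    then have "path_component_of Y (\<phi> x) (\<phi> x')"
      using path_component_of_set_eq_iff[OF \<phi>X[OF x(1)]] by blast
    from path_component_of_map[OF \<psi> this] have "path_component_of X x x'" using \<psi>\<phi> x by simp
    then show "C = C'" using path_component_of_set_eq_iff[OF x(1)] x by blast
  next
    show "(\<lambda>C. \<Union>x\<in>C. path_component_of_set Y (\<phi> x)) ` path_component_of_set X ` topspace X
        \<subseteq> path_component_of_set Y ` topspace Y"
      using comp \<phi>X by (auto simp: image_iff) blast
    show "path_component_of_set Y ` topspace Y
        \<subseteq> (\<lambda>C. \<Union>x\<in>C. path_component_of_set Y (\<phi> x)) ` path_component_of_set X ` topspace X"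
    proof
      fix D assume "D \<in> path_component_of_set Y ` topspace Y"
      then obtain y where y: "y \<in> topspace Y" "D = path_component_of_set Y y" by blast
      have "D = path_component_of_set Y (\<phi> (\<psi> y))"
        using path_component_of_set_eq_iff[OF y(1)] pc[OF y(1)] y(2) by blast
      then have "D = (\<Union>x\<in>path_component_of_set X (\<psi> y). path_component_of_set Y (\<phi> x))"
        using comp[OF \<psi>Y[OF y(1)]] by simp
      then show "D \<in> (\<lambda>C. \<Union>x\<in>C. path_component_of_set Y (\<phi> x)) ` path_component_of_set X ` topspace X"
        using \<psi>Y[OF y(1)] by blast
    qed
  qed
  have groups: "bij_betw (\<lambda>c. \<Union>f\<in>c. nloop_class n Y (\<phi> x) (\<phi> \<circ> f)) (homotopy_group n X x) (homotopy_group n Y (\<phi> x))"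
    if x: "x \<in> topspace X" for n x
    unfolding bij_betw_def homotopy_group_def
  proof (rule conjI[OF inj_onI subset_antisym])
    fix c c'
    assume "c \<in> nloop_class n X x ` nloops n X x" "c' \<in> nloop_class n X x ` nloops n X x"
      and eq: "(\<Union>f\<in>c. nloop_class n Y (\<phi> x) (\<phi> \<circ> f)) = (\<Union>f\<in>c'. nloop_class n Y (\<phi> x) (\<phi> \<circ> f))"
    then obtain f g where f: "f \<in> nloops n X x" "c = nloop_class n X x f" and g: "g \<in> nloops n X x" "c' = nloop_class n X x g"
      by blast
    have "nloop_class n Y (\<phi> x) (\<phi> \<circ> f) = nloop_class n Y (\<phi> x) (\<phi> \<circ> g)"
      using eq Union_nloop_class_compose[OF f(1) \<phi>] Union_nloop_class_compose[OF g(1) \<phi>] f(2) g(2) by simp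
    then have "\<phi> \<circ> g \<in> nloop_class n Y (\<phi> x) (\<phi> \<circ> f)" using nloop_class_self[OF nloop_compose[OF g(1) \<phi>]] by simp
    then have "homotopic_with (\<lambda>h. \<forall>u\<in>cube_bd n. h u = \<phi> x) (cube n) Y (\<phi> \<circ> f) (\<phi> \<circ> g)"
      by (simp add: nloop_class_def)
    then have "homotopic_with (\<lambda>h. \<forall>u\<in>cube_bd n. h u = x) (cube n) X (\<psi> \<circ> (\<phi> \<circ> f)) (\<psi> \<circ> (\<phi> \<circ> g))"
      by (rule homotopic_with_compose_continuous_map_left[OF _ \<psi>]) (simp add: \<psi>\<phi> x)
    \<comment> \<open>\<open>\<psi> \<circ> \<phi>\<close> is the identity on points of
      \<open>X\<close> only, so the loops agree on the cube but perhaps not outside it.\<close>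
    then have "homotopic_with (\<lambda>h. \<forall>u\<in>cube_bd n. h u = x) (cube n) X f g"
    proof (rule homotopic_with_boundary_cong)
      fix u assume "u \<in> topspace (cube n)"
      then have "f u \<in> topspace X" "g u \<in> topspace X" using f(1) g(1) by (auto simp: nloops_def continuous_map_def Pi_iff)
      then show "f u = (\<psi> \<circ> (\<phi> \<circ> f)) u" "g u = (\<psi> \<circ> (\<phi> \<circ> g)) u" by (simp_all add: \<psi>\<phi>)
    qed
    then show "c = c'" using nloop_class_eq[OF f(1)] f(2) g(2) by simp
  next
    show "(\<lambda>c. \<Union>f\<in>c. nloop_class n Y (\<phi> x) (\<phi> \<circ> f)) ` nloop_class n X x ` nloops n X x
        \<subseteq> nloop_class n Y (\<phi> x) ` nloops n Y (\<phi> x)"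
      using Union_nloop_class_compose[OF _ \<phi>] nloop_compose[OF _ \<phi>] by fastforce
    show "nloop_class n Y (\<phi> x) ` nloops n Y (\<phi> x)
        \<subseteq> (\<lambda>c. \<Union>f\<in>c. nloop_class n Y (\<phi> x) (\<phi> \<circ> f)) ` nloop_class n X x ` nloops n X x"
    proof
      fix d assume "d \<in> nloop_class n Y (\<phi> x) ` nloops n Y (\<phi> x)"
      then obtain g where g: "g \<in> nloops n Y (\<phi> x)" "d = nloop_class n Y (\<phi> x) g" by blast
      have gc: "continuous_map (cube n) Y g" "\<And>u. u \<in> cube_bd n \<Longrightarrow> g u = \<phi> x" using g(1) by (auto simp: nloops_def)
      have gY: "g u \<in> topspace Y" if "u \<in> topspace (cube n)" for u
        using gc(1) that by (auto simp: continuous_map_def Pi_iff)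
      have \<psi>g: "\<psi> \<circ> g \<in> nloops n X x" using nloop_compose[OF g(1) \<psi>] \<psi>\<phi>[OF x] by simp
      have "homotopic_with (\<lambda>h. \<forall>u\<in>cube_bd n. h u = \<phi> x) (cube n) Y g (\<phi> \<circ> (\<psi> \<circ> g))"
      proof (subst homotopic_with)
        show "\<exists>h. continuous_map (prod_topology (top_of_set {0..1}) (cube n)) Y h \<and>
            (\<forall>u\<in>topspace (cube n). h (0, u) = g u) \<and> (\<forall>u\<in>topspace (cube n). h (1, u) = (\<phi> \<circ> (\<psi> \<circ> g)) u) \<and>
            (\<forall>t\<in>{0..1 :: real}. \<forall>u\<in>cube_bd n. h (t, u) = \<phi> x)"
        proof (rule exI[of _ "\<lambda>z. H (fst z) (g (snd z))"], intro conjI ballI)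
          have "continuous_map (prod_topology (top_of_set {0..1}) (cube n)) Y (\<lambda>z. H (fst z) ((g \<circ> snd) z))"
            using gc(1) by (intro HZ ks(3) continuous_map_fst continuous_map_compose[OF continuous_map_snd])
          then show "continuous_map (prod_topology (top_of_set {0..1}) (cube n)) Y (\<lambda>z. H (fst z) (g (snd z)))"
            by (simp add: o_def)
        qed (use gY gc(2) H\<phi> x in \<open>auto simp: H0 H1\<close>)
      qed (auto simp: cube_bd_def)
      then have "d = nloop_class n Y (\<phi> x) (\<phi> \<circ> (\<psi> \<circ> g))" using nloop_class_eq[OF g(1)] g(2) by simp
      also have "\<dots> = (\<Union>f\<in>nloop_class n X x (\<psi> \<circ> g). nloop_class n Y (\<phi> x) (\<phi> \<circ> f))"
        using Union_nloop_class_compose[OF \<psi>g \<phi>] by simp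
      finally show "d \<in> (\<lambda>c. \<Union>f\<in>c. nloop_class n Y (\<phi> x) (\<phi> \<circ> f)) ` nloop_class n X x ` nloops n X x"
        using \<psi>g by blast
    qed
  qed
  show ?thesis
    unfolding weak_homotopy_equivalence_def using \<phi> components groups by blast
qed

lemma (in family_module) weak_homotopy_equivalence_eta:
  "weak_homotopy_equivalence (mspace M n) (Mfs n) (eta k Q M n)"
proof -
  obtain e :: "real \<Rightarrow> 'k" where "inj e" using inj by blast
  then show ?thesis
  proof (rule weak_homotopy_equivalence_deformation[where H = "raise_family n"])
    show "continuous_map K (Mfs n) (\<lambda>z. raise_family n (a z) (g z))"
      if "test_space K" "continuous_map K (top_of_set {0..1}) a" "continuous_map K (Mfs n) g" for K :: "'k topology" and a g
      using that by (rule continuous_raise_family)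
  qed (simp_all add: continuous_eta continuous_corolla_value corolla_value_eta raise_family_0 raise_family_1 raise_family_eta)
qed

theorem proposition3p3:
  fixes P :: "'p operad" and Q :: "'q operad" and M :: "('p, 'q, 'm) bimod"
  assumes "\<exists>e :: real \<Rightarrow> 'k. inj e"
    and "is_operad TYPE('k) P"
    and "is_operad TYPE('k) Q" and "reduced Q"
    and "is_bimodule TYPE('k) P Q M"
  shows "is_bimodule TYPE('k) P Q (Mf TYPE('k) Q M) \<and>
    bimodule_map P Q M (Mf TYPE('k) Q M) (eta TYPE('k) Q M) \<and>
    (\<forall>n. weak_homotopy_equivalence (mspace M n) (mspace (Mf TYPE('k) Q M) n) (eta TYPE('k) Q M n))"
proof -
  interpret bimodule_families "TYPE('k)" Q M P
    using assms by unfold_locales (auto simp: is_bimodule_def)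
  show ?thesis
    using is_bimodule_Mf bimodule_map_eta weak_homotopy_equivalence_eta by simp
qed

end
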